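(* Let $d\ge2$, let $X=(X_1,\dots,X_d)$ be a random vector with components $X_j\in\mathbb{R}^{p_j}$, $p=\sum_{j=1}^dp_j$, and let $X^1,X^2,\dots$ be i.i.d. with the distribution of $X$; for each $n$ put $\mathbf{X}=\{X^1,\dots,X^n\}$. Suppose $\mathrm{E}|X|<\infty$. (i) If $X_1,\dots,X_d$ are mutually independent, then there exist complex-valued Gaussian processes $\zeta(t)$ and $\zeta^\star(t)$, $t\in\mathbb{R}^p$, with mean zero and covariance functions respectively $$R(t,t^0)=\prod_{j=1}^d\phi_{X_j}(t_j-t^0_j)+(d-1)\prod_{j=1}^d\phi_{X_j}(t_j)\overline{\phi_{X_j}(t_j^0)}-\sum_{j=1}^d\phi_{X_j}(t_j-t_j^0)\prod_{\ell\ne j}\phi_{X_\ell}(t_\ell)\overline{\phi_{X_\ell}(t_\ell^0)},$$ $$R^\star(t,t^0)=2R(t,t^0),$$ such that, as $n\to\infty$, in distribution, $$n\mathcal{Q}_n(\mathbf{X})\to\|\zeta(t)\|^2_{w_1}\qquad\text{and}\qquad n\mathcal{Q}^\star_n(\mathbf{X})\to\|\zeta^\star(t)\|^2_{w_1}.$$ (ii) If $X_1,\dots,X_d$ are not mutually independent, then almost surely, as $n\to\infty$, $n\mathcal{Q}_n(\mathbf{X})\to\infty$ and $n\mathcal{Q}_n^\star(\mathbf{X})\to\infty$.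
   Context: Each component $X_j$ is a continuous random vector in $\mathbb{R}^{p_j}$ (its distribution is absolutely continuous with respect to Lebesgue measure). $|\cdot|$ is the Euclidean norm (modulus for complex numbers), $\langle\cdot,\cdot\rangle$ the Euclidean inner product. Write $X^k=(X_1^k,\dots,X_d^k)$ with $X_j^k\in\mathbb{R}^{p_j}$. For fixed $n$, upper indices are taken cyclically: $X_j^{n+k}$ is interpreted as $X_j^k$ for $k>0$. For $t=(t_1,\dots,t_d),\,t^0=(t^0_1,\dots,t^0_d)\in\mathbb{R}^p$ with $t_j,t_j^0\in\mathbb{R}^{p_j}$, define $\phi_{X_j}(t_j)=\mathrm{E}[e^{i\langle t_j,X_j\rangle}]$ and $$\phi_X^n(t)=\frac1n\sum_{k=1}^ne^{i\langle t,X^k\rangle},\quad \phi^n_{\widetilde X}(t)=\prod_{j=1}^d\Big(\frac1n\sum_{k=1}^ne^{i\langle t_j,X_j^k\rangle}\Big),\quad \phi^{n\star}_{\widetilde X}(t)=\frac1n\sum_{k=1}^ne^{i\sum_{j=1}^d\langle t_j,X_j^{k+j-1}\rangle}.$$ The weight function is $w_1(t)=(K_p|t|^{p+1})^{-1}$ with $K_q=\frac{\pi^{(q+1)/2}}{\Gamma((q+1)/2)}$, and $\|\eta(t)\|_{w_1}^2=\int_{\mathbb{R}^p}|\eta(t)|^2w_1(t)\,dt$. Then $\mathcal{Q}_n(\mathbf{X})=\|\phi_X^n-\phi^n_{\widetilde X}\|_{w_1}^2$ and $\mathcal{Q}^\star_n(\mathbf{X})=\|\phi_X^n-\phi^{n\star}_{\widetilde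 X}\|_{w_1}^2$. A complex-valued Gaussian process is one whose real and imaginary parts are jointly Gaussian; the covariance function of a mean-zero process $\zeta$ is $(t,t^0)\mapsto\mathrm{E}[\zeta(t)\overline{\zeta(t^0)}]$. *)

theory Defs
  imports "HOL-Probability.Probability"
begin

text \<open>
  The space \<open>real ^ 'n\<close> plays the role of \<open>\<real>\<^sup>p\<close> with \<open>p = CARD('n)\<close>. Its division into \<open>d\<close>
  components is given by a map \<open>b :: 'n \<Rightarrow> nat\<close> with range \<open>{1..d}\<close>: coordinate \<open>i\<close> belongs to
  component \<open>b i\<close>, and \<open>p\<^sub>j = card (block b j)\<close>. The space of the \<open>j\<close>-th component consists of the
  extensional functions on \<open>block b j\<close>, with the product Lebesgue measure.
\<close>

definition block :: "('n::finite \<Rightarrow> nat) \<Rightarrow> nat \<Rightarrow> 'n set" where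
  "block b j = {i. b i = j}"

definition component :: "('n::finite \<Rightarrow> nat) \<Rightarrow> nat \<Rightarrow> real ^ 'n \<Rightarrow> 'n \<Rightarrow> real" where
  "component b j x = (\<lambda>i\<in>block b j. x $ i)"

definition component_lebesgue :: "('n::finite \<Rightarrow> nat) \<Rightarrow> nat \<Rightarrow> ('n \<Rightarrow> real) measure" where
  "component_lebesgue b j = (\<Pi>\<^sub>M i\<in>block b j. lborel)"

definition component_inner :: "('n::finite \<Rightarrow> nat) \<Rightarrow> nat \<Rightarrow> real ^ 'n \<Rightarrow> real ^ 'n \<Rightarrow> real" where
  "component_inner b j t x = (\<Sum>i\<in>block b j. component b j t i * component b j x i)"

definition components_independent ::
    "'w measure \<Rightarrow> ('n::finite \<Rightarrow> nat) \<Rightarrow> nat \<Rightarrow> ('w \<Rightarrow> real ^ 'n) \<Rightarrow> bool" where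
  "components_independent M b d X \<longleftrightarrow>
     prob_space.indep_vars M (component_lebesgue b) (\<lambda>j \<omega>. component b j (X \<omega>)) {1..d}"

definition component_char ::
    "'w measure \<Rightarrow> ('n::finite \<Rightarrow> nat) \<Rightarrow> ('w \<Rightarrow> real ^ 'n) \<Rightarrow> nat \<Rightarrow> real ^ 'n \<Rightarrow> complex" where
  "component_char M b X j t = (LINT \<omega>|M. iexp (component_inner b j t (X \<omega>)))"

text \<open>
  A sample is a sequence \<open>x\<close> of which only the entries \<open>x 1, \<dots>, x n\<close> are used;
  \<open>cyclic n\<close> reduces an index \<open>k \<ge> 1\<close> modulo \<open>n\<close> to \<open>{1..n}\<close>.
\<close>

definition cyclic :: "nat \<Rightarrow> nat \<Rightarrow> nat" where
  "cyclic n k = (k - 1) mod n + 1"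

definition ecf :: "nat \<Rightarrow> (nat \<Rightarrow> real ^ 'n::finite) \<Rightarrow> real ^ 'n \<Rightarrow> complex" where
  "ecf n x t = (1 / of_nat n) * (\<Sum>k=1..n. iexp (t \<bullet> x k))"

definition ecf_prod ::
    "('n::finite \<Rightarrow> nat) \<Rightarrow> nat \<Rightarrow> nat \<Rightarrow> (nat \<Rightarrow> real ^ 'n) \<Rightarrow> real ^ 'n \<Rightarrow> complex" where
  "ecf_prod b d n x t =
     (\<Prod>j=1..d. (1 / of_nat n) * (\<Sum>k=1..n. iexp (component_inner b j t (x k))))"

definition ecf_star ::
    "('n::finite \<Rightarrow> nat) \<Rightarrow> nat \<Rightarrow> nat \<Rightarrow> (nat \<Rightarrow> real ^ 'n) \<Rightarrow> real ^ 'n \<Rightarrow> complex" where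
  "ecf_star b d n x t =
     (1 / of_nat n) *
     (\<Sum>k=1..n. iexp (\<Sum>j=1..d. component_inner b j t (x (cyclic n (k + j - 1)))))"

definition K_const :: "nat \<Rightarrow> real" where
  "K_const q = pi powr ((real q + 1) / 2) / Gamma ((real q + 1) / 2)"

definition w1 :: "real ^ 'n::finite \<Rightarrow> real" where
  "w1 t = 1 / (K_const CARD('n) * norm t ^ (CARD('n) + 1))"

definition w1_integrable :: "(real ^ 'n::finite \<Rightarrow> complex) \<Rightarrow> bool" where
  "w1_integrable \<eta> \<longleftrightarrow> integrable lborel (\<lambda>t. (cmod (\<eta> t))\<^sup>2 * w1 t)"

definition w1_norm_sq :: "(real ^ 'n::finite \<Rightarrow> complex) \<Rightarrow> real" where
  "w1_norm_sq \<eta> = (LINT t|lborel. (cmod (\<eta> t))\<^sup>2 * w1 t)"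

definition Q ::
    "('n::finite \<Rightarrow> nat) \<Rightarrow> nat \<Rightarrow> nat \<Rightarrow> (nat \<Rightarrow> real ^ 'n) \<Rightarrow> real" where
  "Q b d n x = w1_norm_sq (\<lambda>t. ecf n x t - ecf_prod b d n x t)"

definition Q_star ::
    "('n::finite \<Rightarrow> nat) \<Rightarrow> nat \<Rightarrow> nat \<Rightarrow> (nat \<Rightarrow> real ^ 'n) \<Rightarrow> real" where
  "Q_star b d n x = w1_norm_sq (\<lambda>t. ecf n x t - ecf_star b d n x t)"

definition R_cov ::
    "'w measure \<Rightarrow> ('n::finite \<Rightarrow> nat) \<Rightarrow> nat \<Rightarrow> ('w \<Rightarrow> real ^ 'n) \<Rightarrow>
     real ^ 'n \<Rightarrow> real ^ 'n \<Rightarrow> complex" where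
  "R_cov M b d X t t0 =
     (let \<phi> = component_char M b X in
        (\<Prod>j=1..d. \<phi> j (t - t0))
        + (of_nat d - 1) * (\<Prod>j=1..d. \<phi> j t * cnj (\<phi> j t0))
        - (\<Sum>j=1..d. \<phi> j (t - t0) * (\<Prod>l\<in>{1..d} - {j}. \<phi> l t * cnj (\<phi> l t0))))"

text \<open>Constants count as (degenerate) Gaussian variables.\<close>

definition gaussian_rv :: "'w measure \<Rightarrow> ('w \<Rightarrow> real) \<Rightarrow> bool" where
  "gaussian_rv M Y \<longleftrightarrow> Y \<in> borel_measurable M \<and>
     (\<exists>\<mu>. (AE \<omega> in M. Y \<omega> = \<mu>) \<or> (\<exists>\<sigma>>0. distributed M lborel Y (normal_density \<mu> \<sigma>)))"

text \<open>Joint Gaussianity means that all finite real linear combinations are Gaussian.\<close>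

definition complex_gaussian_process :: "'w measure \<Rightarrow> ('i \<Rightarrow> 'w \<Rightarrow> complex) \<Rightarrow> bool" where
  "complex_gaussian_process M \<zeta> \<longleftrightarrow>
     (\<forall>F \<alpha> \<beta>. finite F \<longrightarrow>
        gaussian_rv M (\<lambda>\<omega>. \<Sum>t\<in>F. \<alpha> t * Re (\<zeta> t \<omega>) + \<beta> t * Im (\<zeta> t \<omega>)))"

text \<open>
  Joint measurability and almost sure finiteness of the weighted norm are what makes
  \<open>w1_norm_sq (\<lambda>t. \<zeta> t \<omega>)\<close> a genuine random variable in \<open>\<omega>\<close>; without the latter
  the Bochner integral would silently be \<open>0\<close>.
\<close>

definition centered_gaussian_with_cov ::
    "'w measure \<Rightarrow> (real ^ 'n::finite \<Rightarrow> 'w \<Rightarrow> complex) \<Rightarrow>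
     (real ^ 'n \<Rightarrow> real ^ 'n \<Rightarrow> complex) \<Rightarrow> bool" where
  "centered_gaussian_with_cov M \<zeta> C \<longleftrightarrow>
     complex_gaussian_process M \<zeta> \<and>
     (\<forall>t. (LINT \<omega>|M. \<zeta> t \<omega>) = 0) \<and>
     (\<forall>t t0. (LINT \<omega>|M. \<zeta> t \<omega> * cnj (\<zeta> t0 \<omega>)) = C t t0) \<and>
     (\<lambda>(t, \<omega>). \<zeta> t \<omega>) \<in> borel_measurable (lborel \<Otimes>\<^sub>M M) \<and>
     (AE \<omega> in M. w1_integrable (\<lambda>t. \<zeta> t \<omega>))"

definition converges_in_distribution ::
    "'w measure \<Rightarrow> (nat \<Rightarrow> 'w \<Rightarrow> real) \<Rightarrow> 'v measure \<Rightarrow> ('v \<Rightarrow> real) \<Rightarrow> bool" where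
  "converges_in_distribution M Y N Z \<longleftrightarrow>
     weak_conv_m (\<lambda>n. distr M borel (Y n)) (distr N borel Z)"

end

theory Submission
  imports Defs "HOL-Probability.Probability"
begin

text \<open>
  (i) Under independence, replace \<open>iexp (t \<bullet> x)\<close> by its Hoeffding projection \<open>feature t x\<close>, which
  is orthogonal to all functions of one component; its covariance is exactly \<open>R\<close>. Because of this
  orthogonality, the summands \<open>feature t (X\<^sup>k) - c * feature t (X\<^sup>k\<^sup>\<star>)\<close>, where \<open>X\<^sup>k\<^sup>\<star>\<close> is the cyclically
  shifted copy of \<open>X\<^sup>k\<close>, are uncorrelated, so that normalised sums have covariance \<open>(1 + c\<^sup>2) R\<close>,
  and blocks separated by gaps of length \<open>d\<close> are independent, so that they are asymptotically normal.
  The limiting process is a series of independent Gaussians over an orthonormalised dense sequence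
  of features. Since \<open>exp (- r\<^sup>2 / 2)\<close> is the mean of \<open>iexp (g * r)\<close> for a standard normal \<open>g\<close>, the
  Laplace transform of a finite weighted sum of squares is a mean of characteristic functions of linear
  combinations, so the univariate limit theorem gives its convergence. Second-moment bounds of
  order \<open>min 1 |t|\<^sup>2\<close>, integrable against \<open>w1\<close>, extend this to the integral over \<open>t\<close>, and Laplace
  transforms determine weak convergence of nonnegative variables.

  (ii) For fixed \<open>t\<close> the strong law for \<open>d\<close>-dependent sequences makes the integrands converge to
  \<open>\<bar>\<psi> t\<bar>\<^sup>2\<close>, where \<open>\<psi>\<close> is the joint characteristic function minus the product of the component
  ones. By Fubini and Fatou \<open>liminf Q\<^sub>n \<ge> \<parallel>\<psi>\<parallel>\<^sup>2\<close>, which is positive as \<open>\<psi>\<close> is continuous and not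
  identically zero.
\<close>

subsection \<open>The weight function\<close>

text \<open>The singularity of \<open>w1\<close> at the origin shapes the estimates. Second moments
  of order |t| are not integrable against it, and a first moment of X gives the variance of each
  component character only that order. The feature and the linearisation error of the product of
  empirical characteristic functions are both remainders of a product after first-order expansion,
  so each of their terms contains deviations of two different components. Independence then
  multiplies two factors of order |t| into |t|^2. Weak convergence in a function space, with its
  tightness questions, is avoided since the statistics are quadratic: L2 bounds uniform in n allow t
  to be discretised, which leaves finitely many squares. The limit is the isonormal process over the
  features, so covariance and L2 modulus of continuity are transported from them. Uniqueness of
  characteristic functions in several dimensions enters twice: vectors assembled from unshared
  blocks are independent copies of X, and a factorising characteristic function means independent
  components.\<close>

lemma dyadic_bracket:
  fixes r :: real
  assumes "r \<ge> 1"
  obtains k :: nat where "2 ^ k \<le> r" "r < 2 ^ (k + 1)"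
proof -
  obtain m :: nat where m: "r < 2 ^ m"
    using real_arch_pow[of 2 r] by auto
  define n where "n = (LEAST m :: nat. r < 2 ^ m)"
  have n: "r < 2 ^ n"
    unfolding n_def using m by (rule LeastI)
  have "n \<noteq> 0" using n assms by (cases n) auto
  then obtain k where k: "n = Suc k" by (cases n) auto
  have "\<not> r < 2 ^ k"
    using not_less_Least[of k "\<lambda>m. r < 2 ^ m"] k unfolding n_def by auto
  then show ?thesis using n k that[of k] by auto
qed

text \<open>Dyadic shells. For \<open>2 ^ k \<le> norm t < 2 ^ (k + 1)\<close> the integrand is at
  most \<open>?c k\<close>; on the shells inside the unit ball the factor \<open>1 / 4 ^ k\<close>
  of the numerator compensates the power in the denominator, which gives \<open>?c' k\<close>.
  Against the volume of the enclosing ball either kind contributes of order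
  \<open>(1 / 2) ^ k\<close>. Enlarging shells to balls leaves only ball volumes to compute.\<close>

lemma integrable_truncated_power:
  "integrable lborel (\<lambda>t::'a::euclidean_space. min 1 ((norm t)\<^sup>2) / norm t ^ (DIM('a) + 1))"
proof -
  let ?p = "DIM('a)"
  let ?f = "\<lambda>t::'a. min 1 ((norm t)\<^sup>2) / norm t ^ (?p + 1)"
  let ?c = "\<lambda>k::nat. 1 / (2::real) ^ (k * (?p + 1))"
  let ?c' = "\<lambda>k::nat. (1 / 4 ^ k) * (2::real) ^ ((k + 1) * (?p + 1))"
  let ?V = "unit_ball_vol (real ?p)"
  let ?S = "\<lambda>k (t::'a). ennreal (?c k) * indicator (cball 0 (2 ^ (k + 1))) t
      + ennreal (?c' k) * indicator (cball 0 (1 / 2 ^ k)) t"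
  have cball_borel [measurable]: "cball (0::'a) r \<in> sets borel" for r
    by simp
  have V0: "?V \<ge> 0" by simp
  have le: "ennreal (?f t) \<le> (\<Sum>k. ?S k t)" for t :: 'a
  proof -
    have *: "ennreal (?f t) \<le> ?S k t \<Longrightarrow> ?thesis" for k
      using sum_le_suminf[of "\<lambda>k. ?S k t" "{k}"] by (auto intro: order_trans)
    consider "t = 0" | "norm t \<ge> 1" | "t \<noteq> 0" "norm t < 1" by linarith
    then show ?thesis
    proof cases
      case 2
      then obtain k where k: "2 ^ k \<le> norm t" "norm t < 2 ^ (k + 1)"
        using dyadic_bracket by blast
      have "?f t \<le> ?c k"
      proof (rule frac_le)
        show "(2::real) ^ (k * (?p + 1)) \<le> norm t ^ (?p + 1)"
          unfolding power_mult by (rule power_mono) (use k in auto)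
      qed auto
      then have "ennreal (?f t) \<le> ?S k t"
        using k by (auto intro!: add_increasing2 ennreal_leI)
      then show ?thesis by (rule *)
    next
      case 3
      then have "1 / norm t \<ge> 1" by auto
      then obtain k where k: "2 ^ k \<le> 1 / norm t" "1 / norm t < 2 ^ (k + 1)"
        using dyadic_bracket by blast
      have n: "norm t \<le> 1 / 2 ^ k" using k(1) 3 by (simp add: field_simps)
      have n': "1 / norm t ^ (?p + 1) \<le> 2 ^ ((k + 1) * (?p + 1))"
      proof -
        have "(1 / norm t) ^ (?p + 1) \<le> (2 ^ (k + 1)) ^ (?p + 1)"
          by (rule power_mono) (use k in auto)
        then show ?thesis by (simp only: power_one_over power_mult)
      qed
      have "(norm t)\<^sup>2 \<le> (1 / 2 ^ k)\<^sup>2"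
        by (rule power_mono) (use n in auto)
      also have "\<dots> = 1 / 4 ^ k"
        by (metis (no_types, opaque_lifting) num_double numeral_times_numeral power2_eq_square
            power_mult_distrib power_one_over)
      finally have n2: "min 1 ((norm t)\<^sup>2) \<le> 1 / 4 ^ k" by linarith
      have "?f t = min 1 ((norm t)\<^sup>2) * (1 / norm t ^ (?p + 1))" by simp
      also have "\<dots> \<le> ?c' k" by (rule mult_mono[OF n2 n']) auto
      finally have "ennreal (?f t) \<le> ?S k t"
        using n by (auto intro!: add_increasing ennreal_leI)
      then show ?thesis by (rule *)
    qed auto
  qed
  have "(\<integral>\<^sup>+t. ennreal (?f t) \<partial>lborel) \<le> (\<integral>\<^sup>+t. (\<Sum>k. ?S k t) \<partial>lborel)"
    by (intro nn_integral_mono le)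
  also have "\<dots> = (\<Sum>k. \<integral>\<^sup>+t. ?S k t \<partial>lborel)"
    by (rule nn_integral_suminf) measurable
  \<comment> \<open>The factor 3 is 1 from the outer shell plus 2 from the inner shell.\<close>
  also have "\<dots> = (\<Sum>k. ennreal (?V * 2 ^ ?p * 3 * (1 / 2) ^ k))"
  proof (rule suminf_cong)
    fix k
    have "(\<integral>\<^sup>+t. ?S k t \<partial>lborel)
        = ennreal (?c k) * ennreal (?V * (2 ^ (k + 1)) ^ ?p)
          + ennreal (?c' k) * ennreal (?V * (1 / 2 ^ k) ^ ?p)"
      by (subst nn_integral_add) (measurable, auto simp: nn_integral_cmult_indicator emeasure_cball)
    also have "\<dots> = ennreal (?c k * (?V * (2 ^ (k + 1)) ^ ?p) + ?c' k * (?V * (1 / 2 ^ k) ^ ?p))"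
      using V0 by (simp add: ennreal_mult[symmetric] del: ennreal_plus add: ennreal_plus[symmetric])
    also have "?c k * (?V * (2 ^ (k + 1)) ^ ?p) = ?V * 2 ^ ?p * (1 / 2) ^ k"
      by (simp add: power_mult[symmetric] power_add power_one_over field_simps power_mult_distrib)
    also have "?c' k * (?V * (1 / 2 ^ k) ^ ?p) = ?V * 2 ^ (?p + 1) * (1 / 2) ^ k"
    proof -
      have "(4::real) ^ k = 2 ^ k * 2 ^ k" by (simp flip: power_mult_distrib)
      then show ?thesis
        by (simp add: power_mult[symmetric] power_add power_one_over field_simps power_mult_distrib)
    qed
    also have "?V * 2 ^ ?p * (1 / 2) ^ k + ?V * 2 ^ (?p + 1) * (1 / 2) ^ k
       = ?V * 2 ^ ?p * 3 * (1 / 2) ^ k" by (simp add: algebra_simps)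
    finally show "(\<integral>\<^sup>+t. ?S k t \<partial>lborel) = ennreal (?V * 2 ^ ?p * 3 * (1 / 2) ^ k)"
      .
  qed
  also have "\<dots> < \<infinity>"
  proof -
    have "summable (\<lambda>k. ?V * 2 ^ ?p * 3 * (1 / 2) ^ k)"
      by (intro summable_mult summable_geometric) auto
    then have "(\<Sum>k. ennreal (?V * 2 ^ ?p * 3 * (1 / 2) ^ k)) \<noteq> top"
      using V0 by (intro ennreal_suminf_neq_top) auto
    then show ?thesis by (simp add: less_top)
  qed
  finally show ?thesis
    by (intro integrableI_nonneg) auto
qed

text \<open>The common shape of the second-moment bounds in t: quadratic at the origin to absorb the
  singularity of \<open>w1\<close>, bounded at infinity, where \<open>w1\<close> is integrable by
  itself.\<close>

definition trunc_sq :: "'a::real_normed_vector \<Rightarrow> real" where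
  "trunc_sq t = min 1 ((norm t)\<^sup>2)"

lemma trunc_sq_nonneg [simp]: "trunc_sq t \<ge> 0"
  and trunc_sq_le_1: "trunc_sq t \<le> 1"
  and trunc_sq_zero [simp]: "trunc_sq 0 = 0"
  by (auto simp: trunc_sq_def)

lemma trunc_sq_measurable [measurable]: "trunc_sq \<in> borel_measurable borel"
  unfolding trunc_sq_def by measurable

lemma K_const_pos: "K_const q > 0"
  unfolding K_const_def by (intro divide_pos_pos) (auto intro: Gamma_real_pos)

lemma w1_nonneg [simp]: "w1 t \<ge> 0"
  unfolding w1_def using K_const_pos[of "CARD('a)"] by simp

lemma w1_measurable [measurable]: "w1 \<in> borel_measurable borel"
  unfolding w1_def by measurable

lemma integrable_trunc_sq_w1: "integrable lborel (\<lambda>t::real ^ 'n::finite. trunc_sq t * w1 t)"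
proof -
  have "integrable lborel (\<lambda>t::real ^ 'n. (1 / K_const CARD('n)) *
      (min 1 ((norm t)\<^sup>2) / norm t ^ (DIM(real ^ 'n) + 1)))"
    by (rule integrable_mult_right[OF integrable_truncated_power])
  then show ?thesis by (simp add: trunc_sq_def w1_def field_simps)
qed

subsection \<open>Uniqueness of characteristic functions\<close>

lemma integrable_bounded:
  fixes f :: "'a \<Rightarrow> 'b::{banach, second_countable_topology}"
  assumes "finite_measure M" "f \<in> borel_measurable M" "\<And>x. norm (f x) \<le> C"
  shows "integrable M f"
  using finite_measure.integrable_const_bound[OF assms(1), of f C] assms by auto

lemma power_le_fact_mult_exp:
  fixes x :: real
  assumes "x \<ge> 0"
  shows "x ^ n \<le> fact n * exp x"
proof -
  have "(\<Sum>i\<in>{n}. x ^ i /\<^sub>R fact i) \<le> exp x"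
    unfolding exp_def using summable_exp_generic by (rule sum_le_suminf) (use assms in auto)
  then show ?thesis by (simp add: field_simps)
qed

text \<open>Comparison with the integrand just treated: off the unit ball the kernel is at most a
  constant times \<open>1 / norm y ^ ?p\<close>, by the inequality between a power and the
  exponential at half the squared norm.\<close>

lemma integrable_gaussian_kernel:
  "integrable lborel (\<lambda>y::'a::euclidean_space. exp (- (norm y)\<^sup>2 / 2))"
proof -
  let ?p = "DIM('a) + 1"
  let ?K = "2 ^ ?p * fact ?p :: real"
  have "integrable lborel (\<lambda>y::'a. indicator (cball 0 1) y + ?K * (min 1 ((norm y)\<^sup>2) / norm y ^ ?p))"
    by (intro Bochner_Integration.integrable_add integrable_mult_right integrable_truncated_power
        integrable_real_indicator) (auto simp: emeasure_cball)
  then show ?thesis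
  proof (rule Bochner_Integration.integrable_bound, simp, intro AE_I2)
    fix y :: 'a
    have "exp (- (norm y)\<^sup>2 / 2) \<le> indicator (cball 0 1) y + ?K * (min 1 ((norm y)\<^sup>2) / norm y ^ ?p)"
    proof (cases "norm y \<le> 1")
      case True
      then show ?thesis by (auto simp: indicator_def intro!: add_increasing2)
    next
      case False
      then have y1: "norm y \<ge> 1" by simp
      have "norm y ^ ?p \<le> ((norm y)\<^sup>2) ^ ?p"
        by (rule power_mono) (use self_le_power[OF y1, of 2] in auto)
      also have "\<dots> = 2 ^ ?p * ((norm y)\<^sup>2 / 2) ^ ?p" by (simp add: power_divide)
      also have "\<dots> \<le> 2 ^ ?p * (fact ?p * exp ((norm y)\<^sup>2 / 2))"
        by (intro mult_left_mono power_le_fact_mult_exp) auto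
      finally have "norm y ^ ?p \<le> ?K * exp ((norm y)\<^sup>2 / 2)" by (simp only: mult_ac)
      moreover have "norm y ^ ?p > 0" by (rule zero_less_power) (use y1 in linarith)
      ultimately have "exp (- (norm y)\<^sup>2 / 2) \<le> ?K * (1 / norm y ^ ?p)"
        by (simp add: exp_minus field_simps)
      moreover have "min 1 ((norm y)\<^sup>2) = 1" using one_le_power[OF y1, of 2] by (intro min_absorb1)
      ultimately show ?thesis by (auto intro: add_increasing)
    qed
    moreover have "0 \<le> indicator (cball 0 1) y + ?K * (min 1 ((norm y)\<^sup>2) / norm y ^ ?p)"
      by auto
    ultimately show "norm (exp (- (norm y)\<^sup>2 / 2)) \<le> norm (indicator (cball 0 1) y + ?K * (min 1 ((norm y)\<^sup>2) / norm y ^ ?p))"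
      by (simp only: real_norm_def abs_of_nonneg exp_ge_zero)
  qed
qed

lemma std_normal_iexp: "(\<integral>x. iexp (s * x) \<partial>std_normal_distribution) = complex_of_real (exp (- (s\<^sup>2) / 2))"
  using fun_cong[OF char_std_normal_distribution, of s] by (simp add: char_def)

text \<open>Under \<open>gauss_basis\<close> this is the standard Gaussian vector. It is kept as a
  function on the product space so that the product rule for integrals applies coordinate by
  coordinate.\<close>

definition gauss_dir :: "('a::euclidean_space \<Rightarrow> real) \<Rightarrow> 'a" where
  "gauss_dir w = (\<Sum>b\<in>Basis. w b *\<^sub>R b)"

abbreviation gauss_basis :: "('a::euclidean_space \<Rightarrow> real) measure" where
  "gauss_basis \<equiv> \<Pi>\<^sub>M b\<in>Basis. std_normal_distribution"

lemma prob_space_std_normal: "prob_space std_normal_distribution"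
  using real_dist_normal_dist by (simp add: real_distribution_def)

lemma prob_space_gauss_basis: "prob_space gauss_basis"
  by (rule prob_space_PiM) (rule prob_space_std_normal)

lemma gauss_dir_measurable [measurable]: "gauss_dir \<in> measurable gauss_basis borel"
  unfolding gauss_dir_def by measurable

text \<open>Read from right to left, it writes the Gaussian kernel as a mean of characters; this is
  the door through which equality of characteristic functions enters.\<close>

lemma gauss_basis_iexp:
  "(\<integral>w. iexp (x \<bullet> gauss_dir w) \<partial>gauss_basis) = complex_of_real (exp (- (norm x)\<^sup>2 / 2))"
proof -
  interpret product_prob_space "\<lambda>b::'a. std_normal_distribution" Basis
    by (intro product_prob_spaceI prob_space_std_normal)
  have "(\<integral>w. iexp (x \<bullet> gauss_dir w) \<partial>gauss_basis)
      = (\<integral>w. (\<Prod>b\<in>Basis. iexp ((x \<bullet> b) * w b)) \<partial>gauss_basis)"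
    by (simp add: gauss_dir_def inner_sum_right sum_distrib_left exp_sum mult_ac)
  also have "\<dots> = (\<Prod>b\<in>Basis. \<integral>y. iexp ((x \<bullet> b) * y) \<partial>std_normal_distribution)"
  proof (rule product_integral_prod)
    show "integrable std_normal_distribution (\<lambda>y. iexp ((x \<bullet> b) * y))" for b
      by (rule integrable_bounded[where C=1])
         (use prob_space_std_normal in \<open>auto simp: prob_space_def\<close>)
  qed simp
  also have "\<dots> = (\<Prod>b\<in>Basis. complex_of_real (exp (- ((x \<bullet> b)\<^sup>2) / 2)))"
    by (simp only: std_normal_iexp)
  also have "\<dots> = complex_of_real (exp (\<Sum>b\<in>Basis. - ((x \<bullet> b)\<^sup>2) / 2))"
    by (simp add: exp_sum)
  also have "(\<Sum>b\<in>Basis. - ((x \<bullet> b)\<^sup>2) / 2) = - (norm x)\<^sup>2 / 2"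
    unfolding norm_eq_sqrt_inner euclidean_inner[of x x]
    by (simp add: sum_nonneg power2_eq_square sum_divide_distrib sum_negf)
  finally show ?thesis .
qed

text \<open>The two laws are compared by Gaussian smoothing: the smoothed laws agree at every width,
  and the width then tends to 0.\<close>

locale same_char =
  fixes \<mu> \<nu> :: "'a::euclidean_space measure"
  assumes \<mu>: "prob_space \<mu>" and \<nu>: "prob_space \<nu>"
    and sets_\<mu>: "sets \<mu> = sets borel" and sets_\<nu>: "sets \<nu> = sets borel"
    and same_char: "\<And>t. (\<integral>x. iexp (t \<bullet> x) \<partial>\<mu>) = (\<integral>x. iexp (t \<bullet> x) \<partial>\<nu>)"
begin

text \<open>Fubini after expanding the kernel into characters. On the right the measure occurs only
  through its characteristic function, evaluated at random multiples of a Gaussian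
  direction.\<close>

lemma gaussian_smoothing_char:
  assumes \<rho>: "prob_space \<rho>" and [measurable_cong]: "sets \<rho> = sets borel"
  shows "complex_of_real (\<integral>x. exp (- (norm (c *\<^sub>R (x - a)))\<^sup>2 / 2) \<partial>\<rho>)
    = (\<integral>w. iexp (- c * (a \<bullet> gauss_dir w)) * (\<integral>x. iexp ((c *\<^sub>R gauss_dir w) \<bullet> (x::'a)) \<partial>\<rho>) \<partial>gauss_basis)"
proof -
  interpret \<rho>: prob_space \<rho> by fact
  interpret \<gamma>: prob_space "gauss_basis :: ('a \<Rightarrow> real) measure" by (rule prob_space_gauss_basis)
  interpret P: pair_prob_space \<rho> "gauss_basis :: ('a \<Rightarrow> real) measure" ..
  have "complex_of_real (\<integral>x. exp (- (norm (c *\<^sub>R (x - a)))\<^sup>2 / 2) \<partial>\<rho>)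
      = (\<integral>x. (\<integral>w. iexp ((c *\<^sub>R (x - a)) \<bullet> gauss_dir w) \<partial>gauss_basis) \<partial>\<rho>)"
    by (simp only: gauss_basis_iexp integral_complex_of_real)
  also have "\<dots> = (\<integral>w. (\<integral>x. iexp ((c *\<^sub>R (x - a)) \<bullet> gauss_dir w) \<partial>\<rho>) \<partial>gauss_basis)"
    by (rule P.Fubini_integral[symmetric], rule integrable_bounded[where C=1])
       (auto simp: P.finite_measure_axioms)
  also have "\<dots> = (\<integral>w. iexp (- c * (a \<bullet> gauss_dir w)) * (\<integral>x. iexp ((c *\<^sub>R gauss_dir w) \<bullet> x) \<partial>\<rho>) \<partial>gauss_basis)"
  proof (rule Bochner_Integration.integral_cong[OF refl])
    fix w :: "'a \<Rightarrow> real"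
    have "iexp ((c *\<^sub>R (x - a)) \<bullet> gauss_dir w)
        = iexp (- c * (a \<bullet> gauss_dir w)) * iexp ((c *\<^sub>R gauss_dir w) \<bullet> x)" for x
      by (simp add: exp_add[symmetric] inner_diff_left algebra_simps inner_commute[of x])
    then show "(\<integral>x. iexp ((c *\<^sub>R (x - a)) \<bullet> gauss_dir w) \<partial>\<rho>)
       = iexp (- c * (a \<bullet> gauss_dir w)) * (\<integral>x. iexp ((c *\<^sub>R gauss_dir w) \<bullet> x) \<partial>\<rho>)" by simp
  qed
  finally show ?thesis .
qed

lemma gaussian_smoothing_eq:
  "(\<integral>x. exp (- (norm (c *\<^sub>R (x - a)))\<^sup>2 / 2) \<partial>\<mu>) = (\<integral>x. exp (- (norm (c *\<^sub>R (x - a)))\<^sup>2 / 2) \<partial>\<nu>)"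
proof -
  have "complex_of_real (\<integral>x. exp (- (norm (c *\<^sub>R (x - a)))\<^sup>2 / 2) \<partial>\<mu>)
      = complex_of_real (\<integral>x. exp (- (norm (c *\<^sub>R (x - a)))\<^sup>2 / 2) \<partial>\<nu>)"
    by (simp only: gaussian_smoothing_char[OF \<mu> sets_\<mu>] gaussian_smoothing_char[OF \<nu> sets_\<nu>] same_char)
  then show ?thesis by (simp only: of_real_eq_iff)
qed

lemma lborel_rescale:
  fixes h :: "'a \<Rightarrow> real"
  assumes [measurable]: "h \<in> borel_measurable borel" and "s > 0"
  shows "(\<integral>a. h a \<partial>lborel) = s ^ DIM('a) * (\<integral>y. h (x + s *\<^sub>R y) \<partial>lborel)"
    and "integrable lborel (\<lambda>y. h (x + s *\<^sub>R y)) \<longleftrightarrow> integrable lborel h"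
proof -
  have *: "lborel = density (distr lborel borel (\<lambda>y::'a. x + s *\<^sub>R y)) (\<lambda>_. ennreal (s ^ DIM('a)))"
    using lborel_affine[of s x] assms(2) by simp
  show "(\<integral>a. h a \<partial>lborel) = s ^ DIM('a) * (\<integral>y. h (x + s *\<^sub>R y) \<partial>lborel)"
    using arg_cong[OF *, of "\<lambda>M. integral\<^sup>L M h"] assms(2)
    by (simp add: integral_density integral_distr)
  show "integrable lborel (\<lambda>y. h (x + s *\<^sub>R y)) \<longleftrightarrow> integrable lborel h"
    using arg_cong[OF *, of "\<lambda>M. integrable M h"] assms(2)
    by (simp add: integrable_density integrable_distr_eq)
qed

text \<open>Fubini turns the smoothed integral of f into an integral of f against
  \<open>\<integral>x. ?k x a \<partial>\<rho>\<close>, which is the same for both laws. The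
  substitution a = x + s y moves the width s out of the kernel and into the argument of f, ready for
  s to tend to 0.\<close>

lemma smoothed_integral_eq:
  fixes f :: "'a \<Rightarrow> real"
  assumes f[measurable]: "f \<in> borel_measurable borel" and bd: "\<And>x. \<bar>f x\<bar> \<le> C" and s: "s > 0"
  shows "(\<integral>x. (\<integral>y. f (x + s *\<^sub>R y) * exp (- (norm y)\<^sup>2 / 2) \<partial>lborel) \<partial>\<mu>)
       = (\<integral>x. (\<integral>y. f (x + s *\<^sub>R y) * exp (- (norm y)\<^sup>2 / 2) \<partial>lborel) \<partial>\<nu>)"
proof -
  let ?k = "\<lambda>x a::'a. exp (- (norm ((1 / s) *\<^sub>R (x - a)))\<^sup>2 / 2)"
  have k: "?k x (x + s *\<^sub>R y) = exp (- (norm y)\<^sup>2 / 2)" for x y :: 'a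
    using s by simp
  have k_meas: "?k x \<in> borel_measurable borel" for x by measurable
  have resc: "(\<integral>a. f a * ?k x a \<partial>lborel)
      = s ^ DIM('a) * (\<integral>y. f (x + s *\<^sub>R y) * exp (- (norm y)\<^sup>2 / 2) \<partial>lborel)" for x
    using lborel_rescale(1)[of "\<lambda>a. f a * ?k x a" s x, unfolded k] s by measurable
  have int_k: "integrable lborel (?k x)" for x
    using lborel_rescale(2)[OF k_meas s, of x x, unfolded k] integrable_gaussian_kernel by blast
  have norm_k: "(\<integral>a. ?k x a \<partial>lborel) = s ^ DIM('a) * (\<integral>y. exp (- (norm (y::'a))\<^sup>2 / 2) \<partial>lborel)" for x
    by (rule lborel_rescale(1)[OF k_meas s, of x x, unfolded k])
  have swap: "(\<integral>x. (\<integral>a. f a * ?k x a \<partial>lborel) \<partial>\<rho>) = (\<integral>a. f a * (\<integral>x. ?k x a \<partial>\<rho>) \<partial>lborel)"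
    if \<rho>: "prob_space \<rho>" and [measurable_cong]: "sets \<rho> = sets borel" for \<rho>
  proof -
    interpret \<rho>: prob_space \<rho> by fact
    interpret P: pair_sigma_finite \<rho> "lborel :: 'a measure" ..
    have int: "integrable lborel (\<lambda>a. f a * ?k x a)" for x
      by (rule Bochner_Integration.integrable_bound[OF integrable_mult_right[OF int_k[of x], of C]])
         (use bd in \<open>auto simp: abs_mult intro!: mult_right_mono order_trans[OF bd]\<close>)
    have "(\<integral>x. (\<integral>a. f a * ?k x a \<partial>lborel) \<partial>\<rho>) = (\<integral>a. (\<integral>x. f a * ?k x a \<partial>\<rho>) \<partial>lborel)"
    proof (rule P.Fubini_integral[symmetric], rule P.Fubini_integrable)
      show "AE x in \<rho>. integrable lborel (\<lambda>y. case (x, y) of (x, a) \<Rightarrow> f a * ?k x a)"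
        using int by simp
      have "\<bar>\<integral>a. norm (f a * ?k x a) \<partial>lborel\<bar> \<le> C * (s ^ DIM('a) * (\<integral>y. exp (- (norm (y::'a))\<^sup>2 / 2) \<partial>lborel))" for x
      proof -
        have "(\<integral>a. norm (f a * ?k x a) \<partial>lborel) \<le> (\<integral>a. C * ?k x a \<partial>lborel)"
          by (rule integral_mono[OF integrable_norm[OF int] integrable_mult_right[OF int_k]])
             (use bd in \<open>auto simp: abs_mult\<close>)
        then show ?thesis by (simp only: integral_mult_right_zero norm_k) (simp add: integral_nonneg_AE)
      qed
      then show "integrable \<rho> (\<lambda>x. \<integral>y. norm (case (x, y) of (x, a) \<Rightarrow> f a * ?k x a) \<partial>lborel)"
        by (intro integrable_bounded[OF \<rho>.finite_measure_axioms]) auto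
    qed measurable
    then show ?thesis by simp
  qed
  have "(\<integral>x. (\<integral>a. f a * ?k x a \<partial>lborel) \<partial>\<mu>) = (\<integral>x. (\<integral>a. f a * ?k x a \<partial>lborel) \<partial>\<nu>)"
    by (simp only: swap[OF \<mu> sets_\<mu>] swap[OF \<nu> sets_\<nu>] gaussian_smoothing_eq)
  then show ?thesis using s by (simp only: resc) simp
qed

lemma integral_continuous_eq:
  fixes f :: "'a \<Rightarrow> real"
  assumes cont: "continuous_on UNIV f" and bd: "\<And>x. \<bar>f x\<bar> \<le> C"
  shows "(\<integral>x. f x \<partial>\<mu>) = (\<integral>x. f x \<partial>\<nu>)"
proof -
  let ?K = "\<integral>y. exp (- (norm (y::'a))\<^sup>2 / 2) \<partial>lborel"
  let ?H = "\<lambda>n x. \<integral>y. f (x + (1 / real (Suc n)) *\<^sub>R y) * exp (- (norm y)\<^sup>2 / 2) \<partial>lborel"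
  have f[measurable]: "f \<in> borel_measurable borel"
    by (rule borel_measurable_continuous_onI[OF cont])
  have dom: "integrable lborel (\<lambda>y::'a. C * exp (- (norm y)\<^sup>2 / 2))"
    by (intro integrable_mult_right integrable_gaussian_kernel)
  have conv: "(\<lambda>n. \<integral>x. ?H n x \<partial>\<rho>) \<longlonglongrightarrow> (\<integral>x. f x * ?K \<partial>\<rho>)"
    if \<rho>: "prob_space \<rho>" and [measurable_cong]: "sets \<rho> = sets borel" for \<rho>
  proof (rule integral_dominated_convergence[where w="\<lambda>_. C * ?K"])
    interpret \<rho>: prob_space \<rho> by fact
    show "integrable \<rho> (\<lambda>_. C * ?K)" by simp
    show "AE x in \<rho>. (\<lambda>n. ?H n x) \<longlonglongrightarrow> f x * ?K"
    proof (rule AE_I2)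
      fix x
      have "(\<lambda>n. ?H n x) \<longlonglongrightarrow> (\<integral>y. f x * exp (- (norm (y::'a))\<^sup>2 / 2) \<partial>lborel)"
      proof (rule integral_dominated_convergence[OF _ _ dom])
        show "AE y in lborel. (\<lambda>n. f (x + (1 / real (Suc n)) *\<^sub>R y) * exp (- (norm y)\<^sup>2 / 2))
            \<longlonglongrightarrow> f x * exp (- (norm y)\<^sup>2 / 2)"
        proof (rule AE_I2)
          fix y :: 'a
          have "(\<lambda>n. x + (1 / real (Suc n)) *\<^sub>R y) \<longlonglongrightarrow> x + 0 *\<^sub>R y"
            by (intro tendsto_intros LIMSEQ_Suc[OF lim_1_over_n])
          then have "(\<lambda>n. f (x + (1 / real (Suc n)) *\<^sub>R y)) \<longlonglongrightarrow> f x"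
            using cont by (intro isCont_tendsto_compose[of x f])
              (auto simp: continuous_on_eq_continuous_at simp del: of_nat_Suc)
          then show "(\<lambda>n. f (x + (1 / real (Suc n)) *\<^sub>R y) * exp (- (norm y)\<^sup>2 / 2))
            \<longlonglongrightarrow> f x * exp (- (norm y)\<^sup>2 / 2)" by (intro tendsto_intros)
        qed
        show "AE y in lborel. norm (f (x + (1 / real (Suc n)) *\<^sub>R y) * exp (- (norm y)\<^sup>2 / 2))
            \<le> C * exp (- (norm y)\<^sup>2 / 2)" for n
          by (intro AE_I2) (use bd in \<open>auto simp: abs_mult\<close>)
      qed auto
      then show "(\<lambda>n. ?H n x) \<longlonglongrightarrow> f x * ?K" by simp
    qed
    show "AE x in \<rho>. norm (?H n x) \<le> C * ?K" for n
    proof (rule AE_I2)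
      fix x
      have "norm (?H n x) \<le> (\<integral>y. C * exp (- (norm (y::'a))\<^sup>2 / 2) \<partial>lborel)"
        by (rule Bochner_Integration.integral_norm_bound_integral[OF _ dom])
           (use bd in \<open>auto simp: abs_mult intro!: Bochner_Integration.integrable_bound[OF dom] AE_I2
             order_trans[OF bd abs_ge_self]\<close>)
      then show "norm (?H n x) \<le> C * ?K" by simp
    qed
  qed auto
  have "(\<integral>x. ?H n x \<partial>\<mu>) = (\<integral>x. ?H n x \<partial>\<nu>)" for n
    by (rule smoothed_integral_eq[OF f bd]) simp
  then have "(\<lambda>n. \<integral>x. ?H n x \<partial>\<mu>) \<longlonglongrightarrow> (\<integral>x. f x * ?K \<partial>\<nu>)"
    using conv[OF \<nu> sets_\<nu>] by (simp only:)
  then have "(\<integral>x. f x * ?K \<partial>\<mu>) = (\<integral>x. f x * ?K \<partial>\<nu>)"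
    by (rule LIMSEQ_unique[OF conv[OF \<mu> sets_\<mu>]])
  \<comment> \<open>The kernel is not normalised, so its total mass has to be divided out of the
    limit identity.\<close>
  moreover have "?K \<noteq> 0"
  proof
    assume "?K = 0"
    then have "AE y in lborel. exp (- (norm (y::'a))\<^sup>2 / 2) = 0"
      using integral_nonneg_eq_0_iff_AE[OF integrable_gaussian_kernel[where 'a='a]] by auto
    then have "AE y in (lborel :: 'a measure). False" by simp
    then show False using AE_iff_measurable[of UNIV "lborel :: 'a measure" "\<lambda>_. False"] by auto
  qed
  ultimately show ?thesis by simp
qed

text \<open>Closed sets form a generator stable under intersection, and the indicator of a nonempty
  closed set is the pointwise limit of the continuous functions \<open>f n\<close>, which fall from
  1 to 0 within distance 1/n of the set.\<close>

lemma measures_eq: "\<mu> = \<nu>"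
proof (rule measure_eqI_generator_eq[where E="Collect closed" and \<Omega>=UNIV and A="\<lambda>_. UNIV"])
  interpret \<mu>: prob_space \<mu> by (rule \<mu>)
  interpret \<nu>: prob_space \<nu> by (rule \<nu>)
  show "Int_stable (Collect (closed :: 'a set \<Rightarrow> bool))" by (auto simp: Int_stable_def)
  show "sets \<mu> = sigma_sets UNIV (Collect closed)" "sets \<nu> = sigma_sets UNIV (Collect closed)"
    using sets_\<mu> sets_\<nu> by (simp_all add: borel_eq_closed)
  show "emeasure \<mu> UNIV \<noteq> \<infinity>" by simp
  fix S :: "'a set" assume "S \<in> Collect closed"
  then have S: "closed S" by simp
  show "emeasure \<mu> S = emeasure \<nu> S"
  proof (cases "S = {}")
    case False
    define f where "f n x = max 0 (1 - real n * infdist x S)" for n and x :: 'a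
    have f_cont: "continuous_on UNIV (f n)" for n
      unfolding f_def by (intro continuous_intros)
    have f_bd: "\<bar>f n x\<bar> \<le> 1" for n x
      unfolding f_def using infdist_nonneg[of x S] by (auto simp: max_def)
    have f_lim: "(\<lambda>n. f n x) \<longlonglongrightarrow> indicator S x" for x
    proof (cases "x \<in> S")
      case True
      then show ?thesis by (simp add: f_def)
    next
      case x: False
      then have pos: "infdist x S > 0"
        using in_closed_iff_infdist_zero[OF S False, of x] infdist_nonneg[of x S] by linarith
      obtain n0 :: nat where n0: "1 < real n0 * infdist x S"
        using reals_Archimedean3[OF pos] by blast
      have "f n x = 0" if "n \<ge> n0" for n
      proof -
        have "real n0 * infdist x S \<le> real n * infdist x S"
          using that pos by (intro mult_right_mono) auto
        with n0 show ?thesis by (simp add: f_def)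
      qed
      then have "eventually (\<lambda>n. f n x = 0) sequentially"
        by (auto simp: eventually_sequentially)
      then show ?thesis using x by (simp add: tendsto_eventually)
    qed
    have lim: "(\<lambda>n. \<integral>x. f n x \<partial>\<rho>) \<longlonglongrightarrow> measure \<rho> S"
      if \<rho>: "prob_space \<rho>" and [measurable_cong, simp]: "sets \<rho> = sets borel" for \<rho>
    proof -
      interpret \<rho>: prob_space \<rho> by fact
      have [measurable]: "f n \<in> borel_measurable borel" for n
        by (rule borel_measurable_continuous_onI[OF f_cont])
      have [measurable]: "S \<in> sets borel" using S by simp
      have "(\<lambda>n. \<integral>x. f n x \<partial>\<rho>) \<longlonglongrightarrow> (\<integral>x. indicator S x \<partial>\<rho>)"
        by (rule integral_dominated_convergence[where w="\<lambda>_. 1"])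
           (auto intro: f_lim f_bd)
      then show ?thesis using S by simp
    qed
    have "(\<lambda>n. \<integral>x. f n x \<partial>\<mu>) \<longlonglongrightarrow> measure \<nu> S"
      unfolding integral_continuous_eq[OF f_cont f_bd] by (rule lim[OF \<nu> sets_\<nu>])
    then have "measure \<mu> S = measure \<nu> S"
      by (rule LIMSEQ_unique[OF lim[OF \<mu> sets_\<mu>]])
    then show ?thesis by (simp add: \<mu>.emeasure_eq_measure \<nu>.emeasure_eq_measure)
  qed simp
qed auto

end

theorem measure_eqI_char:
  fixes \<mu> \<nu> :: "'a::euclidean_space measure"
  assumes "prob_space \<mu>" "prob_space \<nu>" "sets \<mu> = sets borel" "sets \<nu> = sets borel"
    and "\<And>t. (\<integral>x. iexp (t \<bullet> x) \<partial>\<mu>) = (\<integral>x. iexp (t \<bullet> x) \<partial>\<nu>)"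
  shows "\<mu> = \<nu>"
  by (rule same_char.measures_eq, rule same_char.intro) (fact assms)+

section \<open>Real random variables bounded at every point\<close>

definition bounded_rv :: "'w measure \<Rightarrow> ('w \<Rightarrow> real) \<Rightarrow> bool" where
  "bounded_rv M f \<longleftrightarrow> f \<in> borel_measurable M \<and> (\<exists>C. \<forall>x. \<bar>f x\<bar> \<le> C)"

lemma bounded_rvI: "f \<in> borel_measurable M \<Longrightarrow> (\<And>x. \<bar>f x\<bar> \<le> C) \<Longrightarrow> bounded_rv M f"
  unfolding bounded_rv_def by blast

lemma bounded_rv_measurable: "bounded_rv M f \<Longrightarrow> f \<in> borel_measurable M"
  by (simp add: bounded_rv_def)

lemma bounded_rv_const [simp]: "bounded_rv M (\<lambda>_. c)"
  by (auto simp: bounded_rv_def)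

lemma bounded_rv_add [intro]:
  assumes "bounded_rv M f" "bounded_rv M g"
  shows "bounded_rv M (\<lambda>x. f x + g x)"
proof -
  obtain C D where "\<And>x. \<bar>f x\<bar> \<le> C" "\<And>x. \<bar>g x\<bar> \<le> D"
    using assms by (auto simp: bounded_rv_def)
  then show ?thesis
    using assms by (intro bounded_rvI[where C="C + D"])
      (auto simp: bounded_rv_def intro!: order_trans[OF abs_triangle_ineq] add_mono)
qed

lemma bounded_rv_mult [intro]:
  assumes "bounded_rv M f" "bounded_rv M g"
  shows "bounded_rv M (\<lambda>x. f x * g x)"
proof -
  obtain C D where *: "\<And>x. \<bar>f x\<bar> \<le> C" "\<And>x. \<bar>g x\<bar> \<le> D"
    using assms by (auto simp: bounded_rv_def)
  have "C \<ge> 0" using *(1) abs_ge_zero order_trans by blast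
  then show ?thesis
    using assms * by (intro bounded_rvI[where C="C * D"])
      (auto simp: bounded_rv_def abs_mult intro!: mult_mono)
qed

lemma bounded_rv_diff [intro]:
  assumes "bounded_rv M f" "bounded_rv M g"
  shows "bounded_rv M (\<lambda>x. f x - g x)"
  using bounded_rv_add[OF assms(1) bounded_rv_mult[OF bounded_rv_const[of M "-1"] assms(2)]] by simp

lemma bounded_rv_sum [intro]:
  assumes "\<And>i. i \<in> I \<Longrightarrow> bounded_rv M (f i)"
  shows "bounded_rv M (\<lambda>x. \<Sum>i\<in>I. f i x)"
  using assms by (induction I rule: infinite_finite_induct) auto

text \<open>The bound is required everywhere rather than almost everywhere: such functions can be
  composed with any random vector and multiplied freely, and every product remains
  integrable.\<close>

lemma (in finite_measure) integrable_bounded_rv: "bounded_rv M f \<Longrightarrow> integrable M f"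
proof -
  assume f: "bounded_rv M f"
  then obtain C where "\<And>x. norm (f x) \<le> C" by (auto simp: bounded_rv_def)
  with f show "integrable M f"
    by (intro integrable_bounded[OF finite_measure_axioms]) (auto simp: bounded_rv_def)
qed

subsection \<open>Gram--Schmidt orthonormalisation of bounded random variables\<close>

definition ip :: "'w measure \<Rightarrow> ('w \<Rightarrow> real) \<Rightarrow> ('w \<Rightarrow> real) \<Rightarrow> real" where
  "ip M f g = (\<integral>x. f x * g x \<partial>M)"

text \<open>Linearly dependent generators are allowed: if the residual \<open>r\<close> has norm 0,
  division by \<open>sqrt 0\<close> yields the zero function. Hence the elements are orthogonal and
  each either has norm 1 or is identically zero.\<close>

function gram_schmidt :: "'w measure \<Rightarrow> (nat \<Rightarrow> 'w \<Rightarrow> real) \<Rightarrow> nat \<Rightarrow> 'w \<Rightarrow> real" where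
  "gram_schmidt M v n =
     (let r = (\<lambda>x. v n x - (\<Sum>i<n. ip M (v n) (gram_schmidt M v i) * gram_schmidt M v i x))
      in (\<lambda>x. r x / sqrt (ip M r r)))"
  by auto
termination
  by (relation "inv_image less_than (\<lambda>(M, v, n). n)") auto

declare gram_schmidt.simps [simp del]

lemma ip_commute: "ip M f g = ip M g f"
  by (simp add: ip_def mult.commute)

context prob_space
begin

lemma ip_add: "bounded_rv M f \<Longrightarrow> bounded_rv M g \<Longrightarrow> bounded_rv M h \<Longrightarrow>
    ip M (\<lambda>x. f x + g x) h = ip M f h + ip M g h"
  unfolding ip_def
  by (subst Bochner_Integration.integral_add[symmetric])
     (auto intro!: integrable_bounded_rv simp: algebra_simps)

lemma ip_cmult: "ip M (\<lambda>x. c * f x) h = c * ip M f h"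
  unfolding ip_def by (simp add: mult.assoc)

lemma ip_diff: "bounded_rv M f \<Longrightarrow> bounded_rv M g \<Longrightarrow> bounded_rv M h \<Longrightarrow>
    ip M (\<lambda>x. f x - g x) h = ip M f h - ip M g h"
  unfolding ip_def
  by (subst Bochner_Integration.integral_diff[symmetric])
     (auto intro!: integrable_bounded_rv simp: algebra_simps)

lemma ip_sum: "(\<And>i. i \<in> I \<Longrightarrow> bounded_rv M (f i)) \<Longrightarrow> bounded_rv M h \<Longrightarrow>
    ip M (\<lambda>x. \<Sum>i\<in>I. f i x) h = (\<Sum>i\<in>I. ip M (f i) h)"
proof (induction I rule: infinite_finite_induct)
  case (insert i I)
  then show ?case by (simp add: ip_add bounded_rv_sum)
qed (simp_all add: ip_def)

lemma ip_self_nonneg: "ip M f f \<ge> 0"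
  unfolding ip_def by (rule integral_nonneg_AE) auto

context
  fixes v :: "nat \<Rightarrow> 'a \<Rightarrow> real"
  assumes v: "\<And>n. bounded_rv M (v n)"
begin

abbreviation "gs \<equiv> gram_schmidt M v"

definition gs_proj :: "nat \<Rightarrow> ('a \<Rightarrow> real) \<Rightarrow> 'a \<Rightarrow> real" where
  "gs_proj n h = (\<lambda>x. \<Sum>i<n. ip M h (gs i) * gs i x)"

definition gs_res :: "nat \<Rightarrow> ('a \<Rightarrow> real) \<Rightarrow> 'a \<Rightarrow> real" where
  "gs_res n h = (\<lambda>x. h x - gs_proj n h x)"

lemma gs_eq: "gs n = (\<lambda>x. gs_res n (v n) x / sqrt (ip M (gs_res n (v n)) (gs_res n (v n))))"
  by (subst gram_schmidt.simps) (simp add: gs_res_def gs_proj_def Let_def)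

lemma gs_bounded [simp]: "bounded_rv M (gs n)"
proof (induction n rule: less_induct)
  case (less n)
  have "bounded_rv M (gs_res n (v n))"
    unfolding gs_res_def gs_proj_def
    by (intro bounded_rv_diff bounded_rv_sum bounded_rv_mult bounded_rv_const v less) auto
  from bounded_rv_mult[OF bounded_rv_const this,
      of "1 / sqrt (ip M (gs_res n (v n)) (gs_res n (v n)))"]
  show ?case by (subst gs_eq) simp
qed

lemma gs_proj_bounded [simp]: "bounded_rv M (gs_proj n h)"
  unfolding gs_proj_def by (intro bounded_rv_sum bounded_rv_mult bounded_rv_const gs_bounded)

lemma gs_res_bounded [simp]: "bounded_rv M h \<Longrightarrow> bounded_rv M (gs_res n h)"
  unfolding gs_res_def by (intro bounded_rv_diff gs_proj_bounded)

lemma gs_orthonormal_aux: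
  "(\<forall>i<n. ip M (gs n) (gs i) = 0) \<and> (ip M (gs n) (gs n) = 1 \<or> gs n = (\<lambda>_. 0))"
proof (induction n rule: less_induct)
  case (less n)
  let ?r = "gs_res n (v n)"
  have r: "bounded_rv M ?r" by (simp add: v)
  have gs: "gs n = (\<lambda>x. (1 / sqrt (ip M ?r ?r)) * ?r x)" by (subst gs_eq) simp
  have orth: "ip M ?r (gs j) = 0" if "j < n" for j
  proof -
    have off: "ip M (gs i) (gs j) = 0" if "i < n" "i \<noteq> j" for i
      using less[OF \<open>i < n\<close>] less[OF \<open>j < n\<close>] that ip_commute by (metis linorder_neqE_nat)
    have "ip M (gs_proj n (v n)) (gs j) = (\<Sum>i<n. ip M (v n) (gs i) * ip M (gs i) (gs j))"
      unfolding gs_proj_def by (subst ip_sum) (auto simp: ip_cmult intro!: bounded_rv_mult)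
    also have "\<dots> = (\<Sum>i<n. if i = j then ip M (v n) (gs j) * ip M (gs j) (gs j) else 0)"
      by (rule sum.cong) (auto simp: off)
    also have "\<dots> = ip M (v n) (gs j) * ip M (gs j) (gs j)" using that by simp
    also have "\<dots> = ip M (v n) (gs j)"
      using less[OF that] by (auto simp: ip_def)
    finally show ?thesis
      unfolding gs_res_def by (subst ip_diff) (auto simp: v)
  qed
  show ?case
  proof (intro conjI allI impI)
    fix i assume "i < n"
    then show "ip M (gs n) (gs i) = 0" unfolding gs ip_cmult by (simp add: orth)
  next
    show "ip M (gs n) (gs n) = 1 \<or> gs n = (\<lambda>_. 0)"
    proof (cases "ip M ?r ?r = 0")
      case True
      then have "gs n = (\<lambda>_. 0)" by (subst gs) simp
      then show ?thesis by blast
    next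
      case False
      have "ip M (gs n) (gs n) = (1 / sqrt (ip M ?r ?r)) * ((1 / sqrt (ip M ?r ?r)) * ip M ?r ?r)"
        unfolding gs ip_cmult by (subst ip_commute, subst ip_cmult) simp
      also have "\<dots> = 1" using False ip_self_nonneg[of ?r] by (simp add: field_simps)
      finally show ?thesis by blast
    qed
  qed
qed

lemma gs_orthogonal: "i \<noteq> j \<Longrightarrow> ip M (gs i) (gs j) = 0"
  using gs_orthonormal_aux ip_commute by (metis linorder_neqE_nat)

text \<open>True for vanishing elements as well, which spares the projection formulas a case
  distinction.\<close>

lemma ip_gs_self: "ip M h (gs i) * ip M (gs i) (gs i) = ip M h (gs i)"
  using gs_orthonormal_aux[of i] by (auto simp: ip_def)

lemma ip_gs_res_gs:
  assumes h: "bounded_rv M h"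
  shows "ip M (gs_res n h) (gs j) = (if j < n then 0 else ip M h (gs j))"
proof -
  have "ip M (gs_proj n h) (gs j) = (\<Sum>i<n. ip M h (gs i) * ip M (gs i) (gs j))"
    unfolding gs_proj_def by (subst ip_sum) (auto simp: ip_cmult intro!: bounded_rv_mult)
  also have "\<dots> = (\<Sum>i<n. if i = j then ip M h (gs j) * ip M (gs j) (gs j) else 0)"
    by (rule sum.cong) (auto simp: gs_orthogonal)
  also have "\<dots> = (if j < n then ip M h (gs j) else 0)" by (simp add: ip_gs_self)
  finally show ?thesis unfolding gs_res_def using h by (subst ip_diff) auto
qed

text \<open>Pythagoras: the residual is orthogonal to the projection, so its squared norm is that of
  h less the sum of squared coefficients.\<close>

lemma ip_gs_res:
  assumes h: "bounded_rv M h"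
  shows "ip M (gs_res n h) (gs_res n h) = ip M h h - (\<Sum>i<n. (ip M h (gs i))\<^sup>2)"
proof -
  have "ip M (gs_proj n h) (gs_res n h) = (\<Sum>i<n. ip M h (gs i) * ip M (gs_res n h) (gs i))"
    unfolding gs_proj_def by (subst ip_sum) (auto simp: ip_cmult h ip_commute[of M "gs _" "gs_res n h"]
        intro!: bounded_rv_mult)
  also have "\<dots> = 0" by (simp add: ip_gs_res_gs h)
  finally have "ip M (gs_res n h) (gs_res n h) = ip M h (gs_res n h)"
    using h by (subst gs_res_def, subst ip_diff) auto
  also have "\<dots> = ip M h h - ip M (gs_proj n h) h"
    using h by (subst ip_commute, subst gs_res_def, subst ip_diff) auto
  also have "ip M (gs_proj n h) h = (\<Sum>i<n. (ip M h (gs i))\<^sup>2)"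
    unfolding gs_proj_def
    by (subst ip_sum) (auto simp: h ip_cmult ip_commute[of M "gs _" h] power2_eq_square
        intro!: bounded_rv_mult)
  finally show ?thesis .
qed

text \<open>The k-th element is the normalised residual of \<open>v k\<close>, so the squared
  coefficient of \<open>v k\<close> there equals the squared norm of that residual. Bessel's
  inequality is therefore exhausted after k + 1 terms.\<close>

lemma ip_gs_res_gen:
  assumes "n > k"
  shows "ip M (gs_res n (v k)) (gs_res n (v k)) = 0"
proof -
  let ?r = "gs_res k (v k)"
  have "ip M (v k) (gs k) = ip M ?r (gs k)" by (simp add: ip_gs_res_gs v)
  also have "\<dots> = ip M ?r ?r / sqrt (ip M ?r ?r)"
    by (subst gs_eq, subst ip_commute) (use ip_cmult[of "1 / sqrt (ip M ?r ?r)" ?r ?r] in simp)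
  finally have "(ip M (v k) (gs k))\<^sup>2 = ip M ?r ?r"
    using ip_self_nonneg[of ?r] by (simp add: real_div_sqrt)
  moreover have "(\<Sum>i<n. (ip M (v k) (gs i))\<^sup>2) \<ge> (\<Sum>i<Suc k. (ip M (v k) (gs i))\<^sup>2)"
    using assms by (intro sum_mono2) auto
  ultimately have "ip M (gs_res n (v k)) (gs_res n (v k)) \<le> 0"
    using ip_gs_res[OF v, of k k] ip_gs_res[OF v, of n k] by simp
  then show ?thesis using ip_self_nonneg[of "gs_res n (v k)"] by simp
qed

lemma ip_add_self_le:
  assumes "bounded_rv M f" "bounded_rv M g"
  shows "ip M (\<lambda>x. f x + g x) (\<lambda>x. f x + g x) \<le> 2 * ip M f f + 2 * ip M g g"
proof -
  have int: "integrable M (\<lambda>x. f x * f x)" "integrable M (\<lambda>x. g x * g x)"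
      "integrable M (\<lambda>x. (f x + g x) * (f x + g x))"
    using assms by (auto intro!: integrable_bounded_rv)
  have "(\<integral>x. (f x + g x) * (f x + g x) \<partial>M) \<le> (\<integral>x. 2 * (f x * f x) + 2 * (g x * g x) \<partial>M)"
  proof (rule integral_mono)
    fix x
    have "0 \<le> (f x - g x) * (f x - g x)" by simp
    then show "(f x + g x) * (f x + g x) \<le> 2 * (f x * f x) + 2 * (g x * g x)"
      by (simp add: algebra_simps)
  qed (use int in auto)
  then show ?thesis unfolding ip_def using int by simp
qed

lemma gs_res_add:
  assumes "bounded_rv M f" "bounded_rv M g"
  shows "gs_res n (\<lambda>x. f x + g x) = (\<lambda>x. gs_res n f x + gs_res n g x)"
  unfolding gs_res_def gs_proj_def using assms
  by (simp add: ip_add distrib_right sum.distrib algebra_simps)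

lemma gs_res_cmult: "gs_res n (\<lambda>x. c * f x) = (\<lambda>x. c * gs_res n f x)"
  unfolding gs_res_def gs_proj_def
  by (simp add: ip_cmult right_diff_distrib sum_distrib_left mult.assoc)

text \<open>Membership in the L2 closure of the span of the orthonormal system, phrased by residuals
  because Parseval's identity is then a rearrangement.\<close>

definition gs_dense :: "('a \<Rightarrow> real) \<Rightarrow> bool" where
  "gs_dense h \<longleftrightarrow> bounded_rv M h \<and> (\<lambda>n. ip M (gs_res n h) (gs_res n h)) \<longlonglongrightarrow> 0"

lemma gs_dense_add: assumes "gs_dense f" "gs_dense g" shows "gs_dense (\<lambda>x. f x + g x)"
proof -
  have fg: "bounded_rv M f" "bounded_rv M g" using assms by (auto simp: gs_dense_def)
  let ?X = "\<lambda>n. ip M (gs_res n (\<lambda>x. f x + g x)) (gs_res n (\<lambda>x. f x + g x))"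
  let ?B = "\<lambda>n. 2 * ip M (gs_res n f) (gs_res n f) + 2 * ip M (gs_res n g) (gs_res n g)"
  have "?B \<longlonglongrightarrow> 2 * 0 + 2 * 0"
    using assms by (intro tendsto_intros) (simp_all add: gs_dense_def)
  then have B: "?B \<longlonglongrightarrow> 0" by simp
  have up: "?X n \<le> ?B n" for n
    unfolding gs_res_add[OF fg] by (rule ip_add_self_le) (simp_all add: fg)
  have "?X \<longlonglongrightarrow> 0"
    by (rule tendsto_sandwich[OF always_eventually always_eventually tendsto_const B])
       (intro allI ip_self_nonneg up)+
  then show ?thesis using fg by (auto simp: gs_dense_def)
qed

lemma gs_dense_cmult: assumes "gs_dense f" shows "gs_dense (\<lambda>x. c * f x)"
proof -
  have "(\<lambda>n. c * (c * ip M (gs_res n f) (gs_res n f))) \<longlonglongrightarrow> c * (c * 0)"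
    using assms by (intro tendsto_intros) (auto simp: gs_dense_def)
  moreover have "ip M (\<lambda>x. c * g x) (\<lambda>x. c * g x) = c * (c * ip M g g)" for g
    by (subst ip_cmult, subst ip_commute, subst ip_cmult) simp
  ultimately show ?thesis using assms by (auto simp: gs_dense_def gs_res_cmult)
qed

lemma gs_dense_sum:
  "(\<And>i. i \<in> I \<Longrightarrow> gs_dense (f i)) \<Longrightarrow> gs_dense (\<lambda>x. \<Sum>i\<in>I. f i x)"
proof (induction I rule: infinite_finite_induct)
  case (insert i I)
  then show ?case by (simp add: gs_dense_add)
qed (simp_all add: gs_dense_def gs_res_def gs_proj_def ip_def)

text \<open>Taking residuals is linear, does not increase the norm, and annihilates
  \<open>v k\<close> once n exceeds k. So it suffices that the generators themselves, without linear
  combinations, come arbitrarily close to h.\<close>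

lemma gs_denseI:
  assumes h: "bounded_rv M h"
    and approx: "\<And>e. e > 0 \<Longrightarrow> \<exists>k. ip M (\<lambda>x. h x - v k x) (\<lambda>x. h x - v k x) < e"
  shows "gs_dense h"
  unfolding gs_dense_def
proof (intro conjI h LIMSEQ_I)
  fix e :: real assume "e > 0"
  then obtain k where k: "ip M (\<lambda>x. h x - v k x) (\<lambda>x. h x - v k x) < e / 2"
    using approx[of "e / 2"] by auto
  have "norm (ip M (gs_res n h) (gs_res n h) - 0) < e" if "n \<ge> Suc k" for n
  proof -
    let ?d = "\<lambda>x. h x - v k x"
    have d: "bounded_rv M ?d" using h v by auto
    have h': "gs_res n h = (\<lambda>x. gs_res n ?d x + gs_res n (v k) x)"
      using gs_res_add[OF d v, of n k] by simp
    have "ip M (gs_res n h) (gs_res n h)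
        \<le> 2 * ip M (gs_res n ?d) (gs_res n ?d) + 2 * ip M (gs_res n (v k)) (gs_res n (v k))"
      unfolding h' by (rule ip_add_self_le) (use d v in auto)
    also have "\<dots> = 2 * ip M (gs_res n ?d) (gs_res n ?d)"
      using that by (simp add: ip_gs_res_gen)
    also have "\<dots> \<le> 2 * ip M ?d ?d" by (simp add: ip_gs_res d sum_nonneg)
    finally show ?thesis using k ip_self_nonneg[of "gs_res n h"] by simp
  qed
  then show "\<exists>no. \<forall>n\<ge>no. norm (ip M (gs_res n h) (gs_res n h) - 0) < e" by blast
qed

lemma gs_parseval_sq:
  assumes "gs_dense h"
  shows "(\<lambda>i. (ip M h (gs i))\<^sup>2) sums ip M h h"
proof -
  have "(\<lambda>n. ip M h h - ip M (gs_res n h) (gs_res n h)) \<longlonglongrightarrow> ip M h h - 0"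
    using assms by (intro tendsto_intros) (auto simp: gs_dense_def)
  then show ?thesis using assms by (simp add: sums_def ip_gs_res gs_dense_def)
qed

text \<open>Polarisation of the identity for squares, applied to f, g and f + g.\<close>

lemma gs_parseval:
  assumes "gs_dense f" "gs_dense g"
  shows "(\<lambda>i. ip M f (gs i) * ip M g (gs i)) sums ip M f g"
proof -
  have fg: "bounded_rv M f" "bounded_rv M g" using assms by (auto simp: gs_dense_def)
  have "(\<lambda>i. ((ip M (\<lambda>x. f x + g x) (gs i))\<^sup>2 - (ip M f (gs i))\<^sup>2 - (ip M g (gs i))\<^sup>2) / 2) sums
      ((ip M (\<lambda>x. f x + g x) (\<lambda>x. f x + g x) - ip M f f - ip M g g) / 2)"
    by (intro sums_divide sums_diff gs_parseval_sq gs_dense_add assms)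
  moreover have "ip M (\<lambda>x. f x + g x) (\<lambda>x. f x + g x) = ip M f f + ip M g g + 2 * ip M f g"
  proof -
    have "ip M h (\<lambda>x. f x + g x) = ip M f h + ip M g h" if "bounded_rv M h" for h
      by (subst ip_commute) (rule ip_add[OF fg that])
    then show ?thesis
      using ip_add[OF fg bounded_rv_add[OF fg]] fg ip_commute[of M g f] by simp
  qed
  ultimately show ?thesis using fg by (simp add: ip_add power2_sum)
qed

end
end

subsection \<open>Gaussian series\<close>

abbreviation gauss_seq :: "(nat \<Rightarrow> real) measure" where
  "gauss_seq \<equiv> \<Pi>\<^sub>M i\<in>UNIV. std_normal_distribution"

lemma prob_space_gauss_seq: "prob_space gauss_seq"
  by (rule prob_space_PiM) (rule prob_space_std_normal)

lemma gauss_seq_coord_measurable [measurable]: "(\<lambda>w. w i) \<in> borel_measurable gauss_seq"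
  by (rule measurable_compose[OF measurable_component_singleton[of i UNIV "\<lambda>_. std_normal_distribution"]]) auto

text \<open>The integrand depends only on the coordinates in J, and restriction to J maps the
  infinite product to the finite one.\<close>

lemma gauss_seq_prod:
  fixes f :: "nat \<Rightarrow> real \<Rightarrow> 'b::{real_normed_field, banach, second_countable_topology}"
  assumes J: "finite J" and f: "\<And>i. i \<in> J \<Longrightarrow> integrable std_normal_distribution (f i)"
  shows "integrable gauss_seq (\<lambda>w. \<Prod>i\<in>J. f i (w i))"
    and "(\<integral>w. (\<Prod>i\<in>J. f i (w i)) \<partial>gauss_seq) = (\<Prod>i\<in>J. \<integral>x. f i x \<partial>std_normal_distribution)"
proof -
  interpret product_prob_space "\<lambda>_::nat. std_normal_distribution" UNIV
    by (intro product_prob_spaceI prob_space_std_normal)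
  have D: "distr gauss_seq (PiM J (\<lambda>_. std_normal_distribution)) (\<lambda>x. restrict x J)
      = PiM J (\<lambda>_. std_normal_distribution)"
    by (rule distr_PiM_restrict_finite) (use J in auto)
  have m: "(\<lambda>x. restrict x J) \<in> measurable gauss_seq (PiM J (\<lambda>_. std_normal_distribution))"
    by (rule measurable_restrict_subset) simp
  have int: "integrable (PiM J (\<lambda>_. std_normal_distribution)) (\<lambda>w. \<Prod>i\<in>J. f i (w i))"
    by (rule product_integrable_prod[OF J f])
  then have int': "integrable (distr gauss_seq (PiM J (\<lambda>_. std_normal_distribution)) (\<lambda>x. restrict x J))
      (\<lambda>w. \<Prod>i\<in>J. f i (w i))" by (simp only: D)
  have eq: "(\<lambda>w. \<Prod>i\<in>J. f i (restrict w J i)) = (\<lambda>w. \<Prod>i\<in>J. f i (w i))"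
    by (intro ext prod.cong) auto
  show "integrable gauss_seq (\<lambda>w. \<Prod>i\<in>J. f i (w i))"
    using integrable_distr[OF m int'] by (simp only: eq)
  have "(\<integral>w. (\<Prod>i\<in>J. f i (w i)) \<partial>gauss_seq)
      = (\<integral>w. (\<Prod>i\<in>J. f i (w i)) \<partial>distr gauss_seq (PiM J (\<lambda>_. std_normal_distribution)) (\<lambda>x. restrict x J))"
    by (subst integral_distr[OF m]) (use int in \<open>auto simp only: eq borel_measurable_integrable\<close>)
  also have "\<dots> = (\<Prod>i\<in>J. \<integral>x. f i x \<partial>std_normal_distribution)"
    unfolding D by (rule product_integral_prod[OF J f])
  finally show "(\<integral>w. (\<Prod>i\<in>J. f i (w i)) \<partial>gauss_seq) = (\<Prod>i\<in>J. \<integral>x. f i x \<partial>std_normal_distribution)" .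
qed

lemma gauss_seq_iexp:
  "(\<integral>w. iexp (\<Sum>i<n. a i * w i) \<partial>gauss_seq) = complex_of_real (exp (- (\<Sum>i<n. (a i)\<^sup>2) / 2))"
proof -
  have "(\<integral>w. iexp (\<Sum>i<n. a i * w i) \<partial>gauss_seq) = (\<integral>w. (\<Prod>i<n. iexp (a i * w i)) \<partial>gauss_seq)"
    by (simp add: sum_distrib_left exp_sum)
  also have "\<dots> = (\<Prod>i<n. \<integral>x. iexp (a i * x) \<partial>std_normal_distribution)"
  proof (rule gauss_seq_prod(2))
    show "integrable std_normal_distribution (\<lambda>y. iexp (a i * y))" for i
      by (rule integrable_bounded[where C=1])
         (use prob_space_std_normal in \<open>auto simp: prob_space_def\<close>)
  qed simp
  also have "\<dots> = complex_of_real (\<Prod>i<n. exp (- (a i)\<^sup>2 / 2))"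
    by (simp only: std_normal_iexp of_real_prod)
  also have "(\<Prod>i<n. exp (- (a i)\<^sup>2 / 2)) = exp (- (\<Sum>i<n. (a i)\<^sup>2) / 2)"
    by (simp add: exp_sum[symmetric] sum_divide_distrib sum_negf)
  finally show ?thesis .
qed

lemma std_normal_moments:
  "integrable std_normal_distribution (\<lambda>x. x)" "(\<integral>x. x \<partial>std_normal_distribution) = 0"
  "integrable std_normal_distribution (\<lambda>x. x * x)" "(\<integral>x. x * x \<partial>std_normal_distribution) = 1"
  using integrable_std_normal_distribution_moment[of 1] integrable_std_normal_distribution_moment[of 2]
    integral_std_normal_distribution_moment_odd[of 1] std_normal_distribution_even_moments[of 1]
  by (simp_all add: power2_eq_square)

lemma gauss_seq_coord:
  "integrable gauss_seq (\<lambda>w. w i)" "(\<integral>w. w i \<partial>gauss_seq) = 0"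
  "integrable gauss_seq (\<lambda>w. w i * w j)" "(\<integral>w. w i * w j \<partial>gauss_seq) = (if i = j then 1 else 0)"
proof -
  show "integrable gauss_seq (\<lambda>w. w i)" "(\<integral>w. w i \<partial>gauss_seq) = 0"
    using gauss_seq_prod[of "{i}" "\<lambda>_ x. x"] by (simp_all add: std_normal_moments)
  show "integrable gauss_seq (\<lambda>w. w i * w j)" "(\<integral>w. w i * w j \<partial>gauss_seq) = (if i = j then 1 else 0)"
    using gauss_seq_prod[of "{i, j}" "\<lambda>_ x. x"] gauss_seq_prod[of "{i}" "\<lambda>_ x. x * x"]
    by (cases "i = j"; simp add: std_normal_moments)+
qed

definition gsum :: "(nat \<Rightarrow> complex) \<Rightarrow> nat \<Rightarrow> (nat \<Rightarrow> real) \<Rightarrow> complex" where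
  "gsum a n w = (\<Sum>i<n. a i * complex_of_real (w i))"

lemma gsum_measurable [measurable]: "gsum a n \<in> borel_measurable gauss_seq"
  unfolding gsum_def by measurable

lemma gauss_lincomb_cov:
  fixes a b :: "nat \<Rightarrow> complex"
  assumes "finite I"
  shows "integrable gauss_seq (\<lambda>w. (\<Sum>i\<in>I. a i * complex_of_real (w i)) * cnj (\<Sum>i\<in>I. b i * complex_of_real (w i)))"
    and "(\<integral>w. (\<Sum>i\<in>I. a i * complex_of_real (w i)) * cnj (\<Sum>i\<in>I. b i * complex_of_real (w i)) \<partial>gauss_seq)
      = (\<Sum>i\<in>I. a i * cnj (b i))"
proof -
  have eq: "(\<Sum>i\<in>I. a i * complex_of_real (w i)) * cnj (\<Sum>i\<in>I. b i * complex_of_real (w i))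
      = (\<Sum>i\<in>I. \<Sum>j\<in>I. (a i * cnj (b j)) * complex_of_real (w i * w j))" for w :: "nat \<Rightarrow> real"
    by (simp add: sum_product mult_ac)
  have int: "integrable gauss_seq (\<lambda>w. (a i * cnj (b j)) * complex_of_real (w i * w j))" for i j
    using gauss_seq_coord(3)[of i j]
    by (intro integrable_mult_right integrable_of_real)
  show "integrable gauss_seq (\<lambda>w. (\<Sum>i\<in>I. a i * complex_of_real (w i)) * cnj (\<Sum>i\<in>I. b i * complex_of_real (w i)))"
    unfolding eq by (intro Bochner_Integration.integrable_sum int)
  have "(\<integral>w. (\<Sum>i\<in>I. a i * complex_of_real (w i)) * cnj (\<Sum>i\<in>I. b i * complex_of_real (w i)) \<partial>gauss_seq)
     = (\<Sum>i\<in>I. \<Sum>j\<in>I. (a i * cnj (b j)) * complex_of_real (\<integral>w. w i * w j \<partial>gauss_seq))"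
    unfolding eq using int
    by (simp only: Bochner_Integration.integral_sum Bochner_Integration.integrable_sum
        integral_mult_right_zero integral_complex_of_real)
  also have "\<dots> = (\<Sum>i\<in>I. \<Sum>j\<in>I. if i = j then a i * cnj (b j) else 0)"
    by (intro sum.cong) (auto simp: gauss_seq_coord)
  also have "\<dots> = (\<Sum>i\<in>I. a i * cnj (b i))" using assms by simp
  finally show "(\<integral>w. (\<Sum>i\<in>I. a i * complex_of_real (w i)) * cnj (\<Sum>i\<in>I. b i * complex_of_real (w i)) \<partial>gauss_seq)
      = (\<Sum>i\<in>I. a i * cnj (b i))" .
qed

lemma gauss_lincomb_norm:
  assumes "finite I"
  shows "(\<integral>\<^sup>+w. ennreal ((cmod (\<Sum>i\<in>I. a i * complex_of_real (w i)))\<^sup>2) \<partial>gauss_seq) = ennreal (\<Sum>i\<in>I. (cmod (a i))\<^sup>2)"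
proof -
  let ?S = "\<lambda>w::nat \<Rightarrow> real. \<Sum>i\<in>I. a i * complex_of_real (w i)"
  have int: "complex_integrable gauss_seq (\<lambda>w. complex_of_real ((cmod (?S w))\<^sup>2))"
    and eq: "(\<integral>w. complex_of_real ((cmod (?S w))\<^sup>2) \<partial>gauss_seq) = complex_of_real (\<Sum>i\<in>I. (cmod (a i))\<^sup>2)"
    using gauss_lincomb_cov[OF assms, of a a]
    by (simp_all only: complex_norm_square[symmetric] of_real_power[symmetric] of_real_sum)
  from int have int': "integrable gauss_seq (\<lambda>w. (cmod (?S w))\<^sup>2)"
    using integrable_Re[OF int] by simp
  have "(\<integral>w. (cmod (?S w))\<^sup>2 \<partial>gauss_seq) = (\<Sum>i\<in>I. (cmod (a i))\<^sup>2)"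
    using eq by (simp only: integral_complex_of_real of_real_eq_iff)
  with int' show ?thesis by (simp add: nn_integral_eq_integral)
qed

lemma gsum_diff_norm:
  assumes "m \<le> n"
  shows "(\<integral>\<^sup>+w. ennreal ((cmod (gsum a n w - gsum a m w))\<^sup>2) \<partial>gauss_seq) = ennreal ((\<Sum>i<n. (cmod (a i))\<^sup>2) - (\<Sum>i<m. (cmod (a i))\<^sup>2))"
proof -
  have *: "sum f {..<n} - sum f {..<m} = sum f {m..<n}" for f :: "nat \<Rightarrow> 'b::ab_group_add"
    using sum_diff_nat_ivl[of 0 m n f] assms by (simp add: lessThan_atLeast0)
  show ?thesis unfolding gsum_def * by (rule gauss_lincomb_norm) simp
qed

definition tail :: "(nat \<Rightarrow> complex) \<Rightarrow> nat \<Rightarrow> real" where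
  "tail a n = (\<Sum>i. (cmod (a i))\<^sup>2) - (\<Sum>i<n. (cmod (a i))\<^sup>2)"

lemma tail_nonneg: "summable (\<lambda>i. (cmod (a i))\<^sup>2) \<Longrightarrow> tail a n \<ge> 0"
  unfolding tail_def using sum_le_suminf[of "\<lambda>i. (cmod (a i))\<^sup>2" "{..<n}"] by simp

lemma tail_tendsto:
  assumes "summable (\<lambda>i. (cmod (a i))\<^sup>2)"
  shows "tail a \<longlonglongrightarrow> 0"
proof -
  have "(\<lambda>n. (\<Sum>i. (cmod (a i))\<^sup>2) - (\<Sum>i<n. (cmod (a i))\<^sup>2)) \<longlonglongrightarrow> (\<Sum>i. (cmod (a i))\<^sup>2) - (\<Sum>i. (cmod (a i))\<^sup>2)"
    by (intro tendsto_intros summable_LIMSEQ assms)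
  then show ?thesis by (simp add: tail_def[abs_def])
qed

lemma gsum_diff_le:
  assumes s: "summable (\<lambda>i. (cmod (a i))\<^sup>2)"
  shows "(\<integral>\<^sup>+w. ennreal ((cmod (gsum a n w - gsum a m w))\<^sup>2) \<partial>gauss_seq) \<le> ennreal (tail a n + tail a m)"
proof -
  have *: "(\<integral>\<^sup>+w. ennreal ((cmod (gsum a n w - gsum a m w))\<^sup>2) \<partial>gauss_seq) \<le> ennreal (tail a n + tail a m)"
    if "m \<le> n" for n m
    unfolding gsum_diff_norm[OF that]
    by (rule ennreal_leI) (use tail_nonneg[OF s, of n] in \<open>simp add: tail_def\<close>)
  show ?thesis
    using *[of n m] *[of m n] by (cases "m \<le> n") (auto simp: norm_minus_commute add.commute)
qed

text \<open>Partial sums of a Gaussian series with square-summable coefficients are controlled here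
  in L2; along indices whose tail is at most \<open>(1 / 8) ^ k\<close> they converge almost surely.
  The least such index is a measurable function of the coefficients, so the limit is jointly
  measurable when the coefficients depend on a parameter.\<close>

definition tail_index :: "(nat \<Rightarrow> complex) \<Rightarrow> nat \<Rightarrow> nat" where
  "tail_index a k = (LEAST n. tail a n \<le> (1 / 8) ^ k)"

lemma tail_index:
  assumes "summable (\<lambda>i. (cmod (a i))\<^sup>2)"
  shows "tail a (tail_index a k) \<le> (1 / 8) ^ k"
proof -
  have "eventually (\<lambda>n. tail a n < (1 / 8) ^ k) sequentially"
    using tail_tendsto[OF assms] by (rule order_tendstoD) simp
  then obtain n where "tail a n \<le> (1 / 8) ^ k"
    by (auto simp: eventually_sequentially dest: less_imp_le)
  then show ?thesis unfolding tail_index_def by (rule LeastI)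
qed

definition gseries :: "(nat \<Rightarrow> complex) \<Rightarrow> (nat \<Rightarrow> real) \<Rightarrow> complex" where
  "gseries a w = lim (\<lambda>k. gsum a (tail_index a k) w)"

lemma gseries_measurable [measurable]: "gseries a \<in> borel_measurable gauss_seq"
  unfolding gseries_def by measurable

text \<open>The number of summands depends on t through \<open>tail_index\<close>, but takes
  countably many values and is measurable in t; composing along it keeps each stage, hence the
  limit, jointly measurable.\<close>

lemma gseries_joint_measurable:
  assumes [measurable]: "\<And>i. (\<lambda>t. a t i) \<in> borel_measurable T"
  shows "(\<lambda>(t, w). gseries (a t) w) \<in> borel_measurable (T \<Otimes>\<^sub>M gauss_seq)"
proof -
  have idx: "(\<lambda>t. tail_index (a t) k) \<in> measurable T (count_space UNIV)" for k
    unfolding tail_index_def tail_def by measurable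
  have "(\<lambda>x. gsum (a (fst x)) (tail_index (a (fst x)) k) (snd x)) \<in> borel_measurable (T \<Otimes>\<^sub>M gauss_seq)" for k
  proof (rule measurable_compose_countable[where f="\<lambda>n x. gsum (a (fst x)) n (snd x)"])
    show "(\<lambda>x. gsum (a (fst x)) n (snd x)) \<in> borel_measurable (T \<Otimes>\<^sub>M gauss_seq)" for n
      unfolding gsum_def by measurable
    show "(\<lambda>x. tail_index (a (fst x)) k) \<in> measurable (T \<Otimes>\<^sub>M gauss_seq) (count_space UNIV)"
      by (rule measurable_compose[OF measurable_fst idx])
  qed
  then show ?thesis
    unfolding gseries_def case_prod_unfold by measurable
qed

text \<open>The increments along \<open>tail_index\<close> have absolute means at most
  \<open>3 * (1 / 2) ^ k\<close>. Hence the sum of their absolute values has finite mean and is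
  finite almost surely.\<close>

lemma gsum_AE_convergent:
  assumes s: "summable (\<lambda>i. (cmod (a i))\<^sup>2)"
  shows "AE w in gauss_seq. convergent (\<lambda>k. gsum a (tail_index a k) w)"
proof -
  let ?S = "\<lambda>k. gsum a (tail_index a k)"
  interpret prob_space gauss_seq by (rule prob_space_gauss_seq)
  have bound: "(\<integral>\<^sup>+w. ennreal (cmod (?S (Suc k) w - ?S k w)) \<partial>gauss_seq) \<le> ennreal (3 * (1 / 2) ^ k)" for k
  proof -
    \<comment> \<open>Weighted arithmetic-geometric mean inequality. The weight \<open>2 ^ k\<close>
      balances the two sides: the squared increments are of order \<open>(1 / 8) ^ k\<close>, and
      both summands end up at most of order \<open>(1 / 2) ^ k\<close>.\<close>
    have "cmod z \<le> (1 / 2) ^ k + 2 ^ k * (cmod z)\<^sup>2" for z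
    proof -
      have "0 \<le> (2 ^ k * cmod z - 1)\<^sup>2" by simp
      also have "\<dots> = (2 ^ k * cmod z)\<^sup>2 - 2 * (2 ^ k * cmod z) + 1"
        by (simp add: power2_diff)
      finally have "2 * (2 ^ k * cmod z) \<le> 2 ^ k * (2 ^ k * (cmod z)\<^sup>2) + 1"
        by (simp add: power2_eq_square mult_ac)
      moreover have "2 ^ k * cmod z \<ge> 0" by simp
      ultimately have "2 ^ k * cmod z \<le> 2 ^ k * (2 ^ k * (cmod z)\<^sup>2) + 1" by linarith
      then have "2 ^ k * cmod z \<le> 2 ^ k * ((1 / 2) ^ k + 2 ^ k * (cmod z)\<^sup>2)"
        by (simp add: distrib_left power_one_over)
      then show ?thesis by simp
    qed
    then have "(\<integral>\<^sup>+w. ennreal (cmod (?S (Suc k) w - ?S k w)) \<partial>gauss_seq)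
        \<le> (\<integral>\<^sup>+w. (ennreal ((1 / 2) ^ k) + ennreal (2 ^ k) * ennreal ((cmod (?S (Suc k) w - ?S k w))\<^sup>2)) \<partial>gauss_seq)"
      by (intro nn_integral_mono) (simp add: ennreal_mult[symmetric] ennreal_plus[symmetric] ennreal_leI del: ennreal_plus)
    also have "\<dots> = ennreal ((1 / 2) ^ k) + ennreal (2 ^ k) * (\<integral>\<^sup>+w. ennreal ((cmod (?S (Suc k) w - ?S k w))\<^sup>2) \<partial>gauss_seq)"
      by (subst nn_integral_add) (auto simp: nn_integral_cmult emeasure_space_1)
    also have "\<dots> \<le> ennreal ((1 / 2) ^ k) + ennreal (2 ^ k) * ennreal (2 * (1 / 8) ^ k)"
    proof (intro add_left_mono mult_left_mono order_trans[OF gsum_diff_le[OF s]] ennreal_leI)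
      have "(1 / 8) ^ Suc k \<le> (1 / 8 :: real) ^ k" by simp
      then show "tail a (tail_index a (Suc k)) + tail a (tail_index a k) \<le> 2 * (1 / 8) ^ k"
        using tail_index[OF s, of "Suc k"] tail_index[OF s, of k] by linarith
    qed auto
    also have "\<dots> = ennreal ((1 / 2) ^ k + 2 ^ k * (2 * (1 / 8) ^ k))"
      by (simp add: ennreal_mult[symmetric] ennreal_plus[symmetric] del: ennreal_plus)
    also have "\<dots> \<le> ennreal (3 * (1 / 2) ^ k)"
    proof (rule ennreal_leI)
      have "(2::real) ^ k * (1 / 8) ^ k = (1 / 4) ^ k" by (simp flip: power_mult_distrib)
      moreover have "(1 / 4 :: real) ^ k \<le> (1 / 2) ^ k" by (rule power_mono) auto
      ultimately show "(1 / 2) ^ k + 2 ^ k * (2 * (1 / 8) ^ k) \<le> 3 * (1 / 2 :: real) ^ k"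
        by (simp add: mult.left_commute)
    qed
    finally show ?thesis .
  qed
  have "(\<integral>\<^sup>+w. (\<Sum>k. ennreal (cmod (?S (Suc k) w - ?S k w))) \<partial>gauss_seq)
      = (\<Sum>k. \<integral>\<^sup>+w. ennreal (cmod (?S (Suc k) w - ?S k w)) \<partial>gauss_seq)"
    by (rule nn_integral_suminf) auto
  also have "\<dots> \<le> (\<Sum>k. ennreal (3 * (1 / 2) ^ k))"
    by (intro suminf_le bound summableI)
  also have "\<dots> < \<infinity>"
    by (simp add: less_top[symmetric], rule ennreal_suminf_neq_top) (auto intro!: summable_mult summable_geometric)
  finally have "AE w in gauss_seq. (\<Sum>k. ennreal (cmod (?S (Suc k) w - ?S k w))) \<noteq> \<infinity>"
    by (intro nn_integral_PInf_AE) auto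
  then show ?thesis
  proof eventually_elim
    case (elim w)
    have "summable (\<lambda>k. cmod (?S (Suc k) w - ?S k w))"
      by (rule summable_suminf_not_top) (use elim in auto)
    then have "summable (\<lambda>k. ?S (Suc k) w - ?S k w)" by (rule summable_norm_cancel)
    then have "convergent (\<lambda>n. \<Sum>k<n. (?S (Suc k) w - ?S k w))"
      by (simp add: summable_iff_convergent)
    then have "convergent (\<lambda>n. ?S n w - ?S 0 w)"
      by (simp only: sum_lessThan_telescope[of "\<lambda>k. ?S k w"])
    then show ?case using convergent_add[OF _ convergent_const[of "?S 0 w"]] by fastforce
  qed
qed

text \<open>Fatou along the subsequence: the squared distance between two partial sums is at most
  the sum of their tails, and the tail at \<open>tail_index\<close> vanishes in the limit.\<close>

lemma gseries_approx:
  assumes s: "summable (\<lambda>i. (cmod (a i))\<^sup>2)"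
  shows "(\<integral>\<^sup>+w. ennreal ((cmod (gseries a w - gsum a n w))\<^sup>2) \<partial>gauss_seq) \<le> ennreal (tail a n)"
proof -
  let ?S = "\<lambda>k. gsum a (tail_index a k)"
  have "(\<integral>\<^sup>+w. ennreal ((cmod (gseries a w - gsum a n w))\<^sup>2) \<partial>gauss_seq)
      = (\<integral>\<^sup>+w. liminf (\<lambda>k. ennreal ((cmod (?S k w - gsum a n w))\<^sup>2)) \<partial>gauss_seq)"
  proof (rule nn_integral_cong_AE)
    show "AE w in gauss_seq. ennreal ((cmod (gseries a w - gsum a n w))\<^sup>2)
        = liminf (\<lambda>k. ennreal ((cmod (?S k w - gsum a n w))\<^sup>2))"
      using gsum_AE_convergent[OF s]
    proof eventually_elim
      case (elim w)
      then have "(\<lambda>k. ?S k w) \<longlonglongrightarrow> gseries a w"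
        by (simp add: gseries_def convergent_LIMSEQ_iff)
      then have "(\<lambda>k. ennreal ((cmod (?S k w - gsum a n w))\<^sup>2)) \<longlonglongrightarrow> ennreal ((cmod (gseries a w - gsum a n w))\<^sup>2)"
        by (intro tendsto_ennrealI tendsto_intros)
      then show ?case by (rule lim_imp_Liminf[OF sequentially_bot, symmetric])
    qed
  qed
  also have "\<dots> \<le> liminf (\<lambda>k. \<integral>\<^sup>+w. ennreal ((cmod (?S k w - gsum a n w))\<^sup>2) \<partial>gauss_seq)"
    by (rule nn_integral_liminf) auto
  also have "\<dots> \<le> liminf (\<lambda>k. ennreal ((1 / 8) ^ k + tail a n))"
    by (intro Liminf_mono always_eventually allI order_trans[OF gsum_diff_le[OF s]] ennreal_leI
        add_right_mono tail_index s)
  also have "\<dots> = ennreal (0 + tail a n)"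
    by (intro lim_imp_Liminf tendsto_ennrealI tendsto_intros) auto
  finally show ?thesis by simp
qed

subsection \<open>Second-moment estimates\<close>

lemma integral_mult_le_sqrt:
  fixes f g :: "'a \<Rightarrow> real"
  assumes [measurable]: "f \<in> borel_measurable M" "g \<in> borel_measurable M"
    and f: "integrable M (\<lambda>x. (f x)\<^sup>2)" and g: "integrable M (\<lambda>x. (g x)\<^sup>2)"
  shows "integrable M (\<lambda>x. f x * g x)"
    and "(\<integral>x. \<bar>f x * g x\<bar> \<partial>M) \<le> sqrt (\<integral>x. (f x)\<^sup>2 \<partial>M) * sqrt (\<integral>x. (g x)\<^sup>2 \<partial>M)"
proof -
  let ?a = "\<integral>x. (f x)\<^sup>2 \<partial>M" and ?b = "\<integral>x. (g x)\<^sup>2 \<partial>M"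
  have ab: "?a \<ge> 0" "?b \<ge> 0" by (auto intro: integral_nonneg_AE)
  show int: "integrable M (\<lambda>x. f x * g x)"
  proof (rule Bochner_Integration.integrable_bound[OF Bochner_Integration.integrable_add[OF f g]], simp, intro AE_I2)
    fix x
    have "0 \<le> (\<bar>f x\<bar> - \<bar>g x\<bar>)\<^sup>2" by simp
    also have "\<dots> = (f x)\<^sup>2 + (g x)\<^sup>2 - 2 * (\<bar>f x\<bar> * \<bar>g x\<bar>)" by (simp add: power2_diff)
    finally have "2 * (\<bar>f x\<bar> * \<bar>g x\<bar>) \<le> (f x)\<^sup>2 + (g x)\<^sup>2" by simp
    moreover have "\<bar>f x\<bar> * \<bar>g x\<bar> \<ge> 0" by simp
    ultimately have "\<bar>f x\<bar> * \<bar>g x\<bar> \<le> (f x)\<^sup>2 + (g x)\<^sup>2" by linarith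
    then show "norm (f x * g x) \<le> norm ((f x)\<^sup>2 + (g x)\<^sup>2)"
      by (simp add: abs_mult)
  qed
  have "(\<integral>\<^sup>+x. ennreal \<bar>f x\<bar> * ennreal \<bar>g x\<bar> \<partial>M)\<^sup>2
      \<le> (\<integral>\<^sup>+x. (ennreal \<bar>f x\<bar>)\<^sup>2 \<partial>M) * (\<integral>\<^sup>+x. (ennreal \<bar>g x\<bar>)\<^sup>2 \<partial>M)"
    by (rule Cauchy_Schwarz_nn_integral) auto
  also have "(\<integral>\<^sup>+x. (ennreal \<bar>f x\<bar>)\<^sup>2 \<partial>M) = ennreal ?a"
    using f by (simp add: ennreal_power nn_integral_eq_integral)
  also have "(\<integral>\<^sup>+x. (ennreal \<bar>g x\<bar>)\<^sup>2 \<partial>M) = ennreal ?b"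
    using g by (simp add: ennreal_power nn_integral_eq_integral)
  also have "(\<integral>\<^sup>+x. ennreal \<bar>f x\<bar> * ennreal \<bar>g x\<bar> \<partial>M) = ennreal (\<integral>x. \<bar>f x * g x\<bar> \<partial>M)"
    using integrable_abs[OF int]
    by (subst nn_integral_eq_integral[symmetric]) (auto simp: abs_mult ennreal_mult)
  finally have "(\<integral>x. \<bar>f x * g x\<bar> \<partial>M)\<^sup>2 \<le> ?a * ?b"
    using ab by (simp add: ennreal_power ennreal_mult[symmetric] integral_nonneg_AE)
  then have "(\<integral>x. \<bar>f x * g x\<bar> \<partial>M) \<le> sqrt (?a * ?b)"
    by (rule real_le_rsqrt)
  then show "(\<integral>x. \<bar>f x * g x\<bar> \<partial>M) \<le> sqrt ?a * sqrt ?b"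
    by (simp add: real_sqrt_mult)
qed

section \<open>Square-integrable complex functions\<close>

lemma cnj_borel_measurable [measurable]: "cnj \<in> borel_measurable borel"
  by (intro borel_measurable_continuous_onI continuous_intros)

definition sq_integrable :: "'a measure \<Rightarrow> ('a \<Rightarrow> complex) \<Rightarrow> bool" where
  "sq_integrable M f \<longleftrightarrow> f \<in> borel_measurable M \<and> integrable M (\<lambda>x. (cmod (f x))\<^sup>2)"

definition sq_norm :: "'a measure \<Rightarrow> ('a \<Rightarrow> complex) \<Rightarrow> real" where
  "sq_norm M f = (\<integral>x. (cmod (f x))\<^sup>2 \<partial>M)"

lemma sq_norm_nonneg [simp]: "sq_norm M f \<ge> 0"
  unfolding sq_norm_def by (auto intro: integral_nonneg_AE)

lemma sq_integrableD:
  assumes "sq_integrable M f"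
  shows "f \<in> borel_measurable M" "integrable M (\<lambda>x. (cmod (f x))\<^sup>2)"
  using assms by (auto simp: sq_integrable_def)

lemma cmod_add_sq_le: "(cmod (a + b))\<^sup>2 \<le> 2 * (cmod a)\<^sup>2 + 2 * (cmod b)\<^sup>2"
proof -
  have "(cmod (a + b))\<^sup>2 \<le> (cmod a + cmod b)\<^sup>2"
    by (rule power_mono[OF norm_triangle_ineq]) simp
  also have "\<dots> \<le> 2 * (cmod a)\<^sup>2 + 2 * (cmod b)\<^sup>2"
    using zero_le_power2[of "cmod a - cmod b"] by (simp add: power2_sum power2_diff)
  finally show ?thesis .
qed

lemma sq_integrable_add:
  assumes f: "sq_integrable M f" and g: "sq_integrable M g"
  shows "sq_integrable M (\<lambda>x. f x + g x)"
    and "sq_norm M (\<lambda>x. f x + g x) \<le> 2 * sq_norm M f + 2 * sq_norm M g"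
proof -
  note [measurable] = sq_integrableD(1)[OF f] sq_integrableD(1)[OF g]
  have dom: "integrable M (\<lambda>x. 2 * (cmod (f x))\<^sup>2 + 2 * (cmod (g x))\<^sup>2)"
    using sq_integrableD(2)[OF f] sq_integrableD(2)[OF g] by auto
  have int: "integrable M (\<lambda>x. (cmod (f x + g x))\<^sup>2)"
    by (rule Bochner_Integration.integrable_bound[OF dom]) (use cmod_add_sq_le in auto)
  then show "sq_integrable M (\<lambda>x. f x + g x)" by (simp add: sq_integrable_def)
  have "sq_norm M (\<lambda>x. f x + g x) \<le> (\<integral>x. 2 * (cmod (f x))\<^sup>2 + 2 * (cmod (g x))\<^sup>2 \<partial>M)"
    unfolding sq_norm_def by (rule integral_mono[OF int dom cmod_add_sq_le])
  then show "sq_norm M (\<lambda>x. f x + g x) \<le> 2 * sq_norm M f + 2 * sq_norm M g"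
    using sq_integrableD(2)[OF f] sq_integrableD(2)[OF g] by (simp add: sq_norm_def)
qed

lemma sq_integrable_cmult:
  assumes "sq_integrable M f"
  shows "sq_integrable M (\<lambda>x. c * f x)" "sq_norm M (\<lambda>x. c * f x) = (cmod c)\<^sup>2 * sq_norm M f"
  using assms by (auto simp: sq_integrable_def sq_norm_def norm_mult power_mult_distrib)

lemma sq_integrable_diff:
  assumes f: "sq_integrable M f" and g: "sq_integrable M g"
  shows "sq_integrable M (\<lambda>x. f x - g x)"
    and "sq_norm M (\<lambda>x. f x - g x) \<le> 2 * sq_norm M f + 2 * sq_norm M g"
  using sq_integrable_add[OF f sq_integrable_cmult(1)[OF g, of "-1"]]
    sq_integrable_cmult(2)[OF g, of "-1"] by simp_all

lemma sq_integrable_mult: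
  assumes f: "sq_integrable M f" and g: "sq_integrable M g"
  shows "complex_integrable M (\<lambda>x. f x * cnj (g x))"
    and "(\<integral>x. cmod (f x) * cmod (g x) \<partial>M) \<le> sqrt (sq_norm M f) * sqrt (sq_norm M g)"
    and "integrable M (\<lambda>x. cmod (f x) * cmod (g x))"
    and "cmod (\<integral>x. f x * cnj (g x) \<partial>M) \<le> sqrt (sq_norm M f) * sqrt (sq_norm M g)"
proof -
  note [measurable] = sq_integrableD(1)[OF f] sq_integrableD(1)[OF g]
  note * = integral_mult_le_sqrt[of "\<lambda>x. cmod (f x)" M "\<lambda>x. cmod (g x)"]
  show int: "integrable M (\<lambda>x. cmod (f x) * cmod (g x))"
    by (rule *(1)) (use sq_integrableD(2)[OF f] sq_integrableD(2)[OF g] in auto)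
  show le: "(\<integral>x. cmod (f x) * cmod (g x) \<partial>M) \<le> sqrt (sq_norm M f) * sqrt (sq_norm M g)"
    using *(2) sq_integrableD(2)[OF f] sq_integrableD(2)[OF g] by (simp add: sq_norm_def)
  show int2: "complex_integrable M (\<lambda>x. f x * cnj (g x))"
    by (rule Bochner_Integration.integrable_bound[OF int]) (auto simp: norm_mult)
  have "cmod (\<integral>x. f x * cnj (g x) \<partial>M) \<le> (\<integral>x. cmod (f x * cnj (g x)) \<partial>M)"
    by (rule integral_norm_bound)
  with le show "cmod (\<integral>x. f x * cnj (g x) \<partial>M) \<le> sqrt (sq_norm M f) * sqrt (sq_norm M g)"
    by (simp add: norm_mult)
qed

lemma (in prob_space) sq_integrable_integrable:
  assumes f: "sq_integrable M f"
  shows "complex_integrable M f" "expectation (\<lambda>x. cmod (f x)) \<le> sqrt (sq_norm M f)"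
proof -
  have one: "sq_integrable M (\<lambda>_. 1)" "sq_norm M (\<lambda>_. 1) = 1"
    by (auto simp: sq_integrable_def sq_norm_def prob_space)
  show "complex_integrable M f" "expectation (\<lambda>x. cmod (f x)) \<le> sqrt (sq_norm M f)"
    using sq_integrable_mult[OF f one(1)] one(2) by simp_all
qed

lemma (in prob_space) sq_integrable_bounded:
  assumes "f \<in> borel_measurable M" "\<And>x. cmod (f x) \<le> C"
  shows "sq_integrable M f"
proof -
  have "integrable M (\<lambda>x. (cmod (f x))\<^sup>2)"
    by (rule integrable_bounded[OF finite_measure_axioms, where C="C\<^sup>2"])
       (use assms in \<open>auto intro!: power_mono\<close>)
  then show ?thesis using assms by (simp add: sq_integrable_def)
qed

lemma sq_norm_minus_commute: "sq_norm M (\<lambda>x. f x - g x) = sq_norm M (\<lambda>x. g x - f x)"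
  unfolding sq_norm_def by (simp add: norm_minus_commute)

text \<open>Expresses distances through covariances, so that a process with the covariances of the
  features also has their L2 distances.\<close>

lemma sq_norm_diff_cov:
  assumes f: "sq_integrable M f" and g: "sq_integrable M g"
  shows "sq_norm M (\<lambda>x. f x - g x) =
    Re ((\<integral>x. f x * cnj (f x) \<partial>M) + (\<integral>x. g x * cnj (g x) \<partial>M) - (\<integral>x. f x * cnj (g x) \<partial>M) - (\<integral>x. g x * cnj (f x) \<partial>M))"
proof -
  note i = sq_integrable_mult(1)[OF f f] sq_integrable_mult(1)[OF g g]
    sq_integrable_mult(1)[OF f g] sq_integrable_mult(1)[OF g f]
  have "complex_of_real (sq_norm M (\<lambda>x. f x - g x)) = (\<integral>x. complex_of_real ((cmod (f x - g x))\<^sup>2) \<partial>M)"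
    unfolding sq_norm_def by (simp only: integral_complex_of_real)
  also have "\<dots> = (\<integral>x. f x * cnj (f x) + g x * cnj (g x) - f x * cnj (g x) - g x * cnj (f x) \<partial>M)"
    by (rule Bochner_Integration.integral_cong[OF refl])
       (simp only: complex_norm_square, simp add: algebra_simps)
  also have "\<dots> = (\<integral>x. f x * cnj (f x) \<partial>M) + (\<integral>x. g x * cnj (g x) \<partial>M) - (\<integral>x. f x * cnj (g x) \<partial>M) - (\<integral>x. g x * cnj (f x) \<partial>M)"
    using i by simp
  finally show ?thesis by (metis Re_complex_of_real)
qed

lemma sq_norm_cov: "complex_of_real (sq_norm M f) = (\<integral>x. f x * cnj (f x) \<partial>M)"
  unfolding sq_norm_def complex_norm_square[symmetric]
  by (simp only: integral_complex_of_real of_real_power[symmetric])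

lemma sq_norm_cov_tendsto:
  assumes f: "sq_integrable M f" and g: "sq_integrable M g"
    and F: "\<And>n. sq_integrable M (F n)" and G: "\<And>n. sq_integrable M (G n)"
    and fF: "(\<lambda>n. sq_norm M (\<lambda>x. F n x - f x)) \<longlonglongrightarrow> 0"
    and gG: "(\<lambda>n. sq_norm M (\<lambda>x. G n x - g x)) \<longlonglongrightarrow> 0"
  shows "(\<lambda>n. \<integral>x. F n x * cnj (G n x) \<partial>M) \<longlonglongrightarrow> (\<integral>x. f x * cnj (g x) \<partial>M)"
proof (rule Lim_null[THEN iffD2], rule Lim_null_comparison)
  let ?a = "\<lambda>n. sqrt (sq_norm M (\<lambda>x. F n x - f x))" and ?b = "\<lambda>n. sqrt (sq_norm M (\<lambda>x. G n x - g x))"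
  show "(\<lambda>n. ?a n * ?b n + ?a n * sqrt (sq_norm M g) + sqrt (sq_norm M f) * ?b n) \<longlonglongrightarrow> 0"
    by (rule tendsto_eq_intros fF gG refl | simp)+
  show "\<forall>\<^sub>F n in sequentially. norm ((\<integral>x. F n x * cnj (G n x) \<partial>M) - (\<integral>x. f x * cnj (g x) \<partial>M))
      \<le> ?a n * ?b n + ?a n * sqrt (sq_norm M g) + sqrt (sq_norm M f) * ?b n"
  proof (rule always_eventually, rule allI)
    fix n
    note D = sq_integrable_diff(1)[OF F[of n] f] and E = sq_integrable_diff(1)[OF G[of n] g]
    have "(\<integral>x. F n x * cnj (G n x) \<partial>M) - (\<integral>x. f x * cnj (g x) \<partial>M)
        = (\<integral>x. F n x * cnj (G n x) - f x * cnj (g x) \<partial>M)"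
      using sq_integrable_mult(1)[OF F[of n] G[of n]] sq_integrable_mult(1)[OF f g] by simp
    also have "\<dots> = (\<integral>x. (F n x - f x) * cnj (G n x - g x) + (F n x - f x) * cnj (g x) + f x * cnj (G n x - g x) \<partial>M)"
      by (rule Bochner_Integration.integral_cong) (auto simp: algebra_simps)
    also have "\<dots> = (\<integral>x. (F n x - f x) * cnj (G n x - g x) \<partial>M) + (\<integral>x. (F n x - f x) * cnj (g x) \<partial>M)
        + (\<integral>x. f x * cnj (G n x - g x) \<partial>M)"
      by (subst Bochner_Integration.integral_add[OF Bochner_Integration.integrable_add];
          (subst Bochner_Integration.integral_add)?;
          intro sq_integrable_mult(1) D E g f refl)
    finally show "norm ((\<integral>x. F n x * cnj (G n x) \<partial>M) - (\<integral>x. f x * cnj (g x) \<partial>M))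
      \<le> ?a n * ?b n + ?a n * sqrt (sq_norm M g) + sqrt (sq_norm M f) * ?b n"
      using sq_integrable_mult(4)[OF D E] sq_integrable_mult(4)[OF D g] sq_integrable_mult(4)[OF f E]
      by (smt (verit) norm_triangle_ineq)
  qed
qed

subsection \<open>The Gaussian process of a bounded feature map\<close>

lemma norm_iexp_diff_le: "norm (iexp a - iexp b) \<le> \<bar>a - b\<bar>"
proof -
  have "iexp a - iexp b = iexp b * (iexp (a - b) - 1)"
    by (simp add: right_diff_distrib exp_add[symmetric] algebra_simps)
  then have "norm (iexp a - iexp b) = norm (iexp (a - b) - 1)" by (simp add: norm_mult)
  also have "\<dots> \<le> \<bar>a - b\<bar>" using iexp_approx1[of "a - b" 0] by simp
  finally show ?thesis .
qed

lemma (in prob_space) integrable_iexp_rv: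
  "Y \<in> borel_measurable M \<Longrightarrow> complex_integrable M (\<lambda>x. iexp (Y x))"
  by (rule integrable_bounded[OF finite_measure_axioms, where C=1]) auto

text \<open>Characters are Lipschitz with constant 1. This is the device by which L1-small
  perturbations are removed from characteristic functions.\<close>

lemma (in prob_space) expectation_iexp_diff_le:
  assumes [measurable]: "Y \<in> borel_measurable M" "Z \<in> borel_measurable M"
    and int: "integrable M (\<lambda>x. \<bar>Y x - Z x\<bar>)"
  shows "norm ((\<integral>x. iexp (Y x) \<partial>M) - (\<integral>x. iexp (Z x) \<partial>M)) \<le> (\<integral>x. \<bar>Y x - Z x\<bar> \<partial>M)"
proof -
  have "(\<integral>x. iexp (Y x) \<partial>M) - (\<integral>x. iexp (Z x) \<partial>M) = (\<integral>x. iexp (Y x) - iexp (Z x) \<partial>M)"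
    by (simp add: integrable_iexp_rv)
  also have "norm \<dots> \<le> (\<integral>x. \<bar>Y x - Z x\<bar> \<partial>M)"
    by (rule order_trans[OF integral_norm_bound integral_mono[OF _ int norm_iexp_diff_le]])
       (intro integrable_norm Bochner_Integration.integrable_diff integrable_iexp_rv assms)
  finally show ?thesis .
qed

lemma char_normal:
  assumes "\<sigma> > 0"
  shows "char (density lborel (normal_density 0 \<sigma>)) u = complex_of_real (exp (- (u\<^sup>2 * \<sigma>\<^sup>2) / 2))"
proof -
  interpret prob_space std_normal_distribution by (rule prob_space_std_normal)
  have "distributed std_normal_distribution lborel (\<lambda>x. x) std_normal_density"
    by (simp add: distributed_def distr_id2[of _ lborel] distr_id2)
  from normal_density_affine[OF this _ less_imp_neq[OF assms, symmetric], of 0] assms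
  have D: "distr std_normal_distribution lborel (\<lambda>x. \<sigma> * x) = density lborel (normal_density 0 \<sigma>)"
    by (simp add: distributed_def)
  have "char (density lborel (normal_density 0 \<sigma>)) u
      = (\<integral>x. iexp (u * (\<sigma> * x)) \<partial>std_normal_distribution)"
    unfolding char_def D[symmetric] by (subst integral_distr) auto
  also have "\<dots> = (\<integral>x. iexp ((u * \<sigma>) * x) \<partial>std_normal_distribution)" by (simp add: mult.assoc)
  also have "\<dots> = complex_of_real (exp (- ((u * \<sigma>)\<^sup>2) / 2))" by (rule std_normal_iexp)
  finally show ?thesis by (simp add: power_mult_distrib)
qed

lemma (in prob_space) gaussian_rvI_char:
  assumes [measurable]: "Y \<in> borel_measurable M" and s: "s \<ge> 0"
    and char: "\<And>u. (\<integral>x. iexp (u * Y x) \<partial>M) = complex_of_real (exp (- (u\<^sup>2 * s) / 2))"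
  shows "gaussian_rv M Y"
proof -
  have D: "real_distribution (distr M borel Y)" by simp
  have cY: "char (distr M borel Y) u = complex_of_real (exp (- (u\<^sup>2 * s) / 2))" for u
    unfolding char_def by (subst integral_distr) (simp_all only: char, measurable)
  show ?thesis
  proof (cases "s = 0")
    \<comment> \<open>With variance 0 the law is the point mass at 0, the degenerate case that
      \<open>gaussian_rv\<close> admits.\<close>
    case True
    have "real_distribution (return borel (0::real))"
      by (auto simp: real_distribution_def real_distribution_axioms_def prob_space_return)
    moreover have "char (distr M borel Y) = char (return borel 0)"
      unfolding cY[abs_def] char_def using True by (auto simp: integral_return)
    ultimately have eq: "distr M borel Y = return borel 0"
      using Levy_uniqueness[OF D] by blast
    have "AE y in distr M borel Y. y = 0"
      unfolding eq by (subst AE_return) auto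
    then have "AE x in M. Y x = 0" by (subst (asm) AE_distr_iff) auto
    then show ?thesis by (auto simp: gaussian_rv_def)
  next
    case False
    define \<sigma> where "\<sigma> = sqrt s"
    have \<sigma>: "\<sigma> > 0" "\<sigma>\<^sup>2 = s" using False s by (auto simp: \<sigma>_def)
    have "real_distribution (density lborel (normal_density 0 \<sigma>))"
      using prob_space_normal_density[OF \<sigma>(1)]
      by (auto simp: real_distribution_def real_distribution_axioms_def)
    moreover have "char (distr M borel Y) = char (density lborel (normal_density 0 \<sigma>))"
      by (rule ext) (simp add: cY char_normal[OF \<sigma>(1)] \<sigma>(2))
    ultimately have "distr M borel Y = density lborel (normal_density 0 \<sigma>)"
      using Levy_uniqueness[OF D] by blast
    moreover have "distr M lborel Y = distr M borel Y" by (rule distr_cong) auto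
    ultimately have "distributed M lborel Y (normal_density 0 \<sigma>)"
      by (simp add: distributed_def)
    with \<sigma>(1) show ?thesis unfolding gaussian_rv_def by auto
  qed
qed

lemma sq_integrable_nn:
  assumes [measurable]: "f \<in> borel_measurable M"
    and le: "(\<integral>\<^sup>+x. ennreal ((cmod (f x))\<^sup>2) \<partial>M) \<le> ennreal c" and c: "c \<ge> 0"
  shows "sq_integrable M f" "sq_norm M f \<le> c"
proof -
  have int: "integrable M (\<lambda>x. (cmod (f x))\<^sup>2)"
    by (rule integrableI_nonneg) (use le in \<open>auto intro: order_le_less_trans\<close>)
  then show "sq_integrable M f" by (simp add: sq_integrable_def)
  have "ennreal (sq_norm M f) \<le> ennreal c"
    using le int by (simp add: sq_norm_def nn_integral_eq_integral)
  then show "sq_norm M f \<le> c" using c by simp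
qed

lemma cmod_sq_eq: "(cmod z)\<^sup>2 = Re z * Re z + Im z * Im z"
  unfolding cmod_power2 by (simp add: power2_eq_square)

text \<open>The real linear combinations by which \<open>complex_gaussian_process\<close> tests
  joint Gaussianity. In the manner of Cramer and Wold, their characteristic functions carry all
  finite-dimensional laws.\<close>

definition rcomb :: "'t set \<Rightarrow> ('t \<Rightarrow> real) \<Rightarrow> ('t \<Rightarrow> real) \<Rightarrow> ('t \<Rightarrow> 'b \<Rightarrow> complex) \<Rightarrow> 'b \<Rightarrow> real" where
  "rcomb F \<alpha> \<beta> Z x = (\<Sum>t\<in>F. \<alpha> t * Re (Z t x) + \<beta> t * Im (Z t x))"

text \<open>The setting of an isonormal Gaussian process over a bounded family in L2(M): sending the
  orthonormal elements to the coordinates of \<open>gauss_seq\<close> is isometric on the closed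
  span of the features. The sequence q makes this span separable, and joint measurability passes to
  the coefficients and hence to the process.\<close>

locale feature_process = prob_space M for M :: "'a measure" +
  fixes T :: "'t measure" and \<Gamma> :: "'t \<Rightarrow> 'a \<Rightarrow> complex" and q :: "nat \<Rightarrow> 't" and C :: real
  assumes joint: "(\<lambda>(t, x). \<Gamma> t x) \<in> borel_measurable (T \<Otimes>\<^sub>M M)"
    and space_T: "space T = UNIV"
    and bound: "\<And>t x. cmod (\<Gamma> t x) \<le> C"
    and dense: "\<And>t e. e > 0 \<Longrightarrow> \<exists>k. sq_norm M (\<lambda>x. \<Gamma> t x - \<Gamma> (q k) x) < e"
begin

lemma feature_measurable [measurable]: "\<Gamma> t \<in> borel_measurable M"
  using measurable_compose[OF measurable_Pair1'[of t T M] joint] by (simp add: space_T)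

lemma feature_sq_integrable: "sq_integrable M (\<Gamma> t)"
  by (rule sq_integrable_bounded[OF feature_measurable bound])

lemma bounded_Re: "bounded_rv M (\<lambda>x. Re (\<Gamma> t x))" and bounded_Im: "bounded_rv M (\<lambda>x. Im (\<Gamma> t x))"
  by (rule bounded_rvI[where C=C];
      auto intro: order_trans[OF abs_Re_le_cmod bound] order_trans[OF abs_Im_le_cmod bound])+

text \<open>Real and imaginary parts alternate in a single real sequence. The joint law of both
  parts is prescribed, not merely the Hermitian covariance, so they must be expanded in one real
  orthonormal system with shared Gaussian coordinates.\<close>

definition gen :: "nat \<Rightarrow> 'a \<Rightarrow> real" where
  "gen n x = (if even n then Re (\<Gamma> (q (n div 2)) x) else Im (\<Gamma> (q (n div 2)) x))"

lemma gen_bounded: "bounded_rv M (gen n)"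
proof (cases "even n")
  case True
  then have "gen n = (\<lambda>x. Re (\<Gamma> (q (n div 2)) x))" by (auto simp: gen_def)
  then show ?thesis using bounded_Re by simp
next
  case False
  then have "gen n = (\<lambda>x. Im (\<Gamma> (q (n div 2)) x))" by (auto simp: gen_def)
  then show ?thesis using bounded_Im by simp
qed

lemmas basis_bounded = gs_bounded[of gen, OF gen_bounded]

lemma dense_Re: "gs_dense gen (\<lambda>x. Re (\<Gamma> t x))" and dense_Im: "gs_dense gen (\<lambda>x. Im (\<Gamma> t x))"
proof -
  have int: "integrable M (\<lambda>x. (cmod (\<Gamma> t x - \<Gamma> s x))\<^sup>2)" for s
    using sq_integrable_diff(1)[OF feature_sq_integrable feature_sq_integrable]
    by (auto simp: sq_integrable_def)
  have int': "integrable M (\<lambda>x. (Re (\<Gamma> t x) - Re (\<Gamma> s x)) * (Re (\<Gamma> t x) - Re (\<Gamma> s x)))"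
      "integrable M (\<lambda>x. (Im (\<Gamma> t x) - Im (\<Gamma> s x)) * (Im (\<Gamma> t x) - Im (\<Gamma> s x)))" for s
    using bounded_Re bounded_Im by (auto intro!: integrable_bounded_rv bounded_rv_mult bounded_rv_diff)
  have le: "\<exists>k. ip M (\<lambda>x. Re (\<Gamma> t x) - gen k x) (\<lambda>x. Re (\<Gamma> t x) - gen k x) < e"
      "\<exists>k. ip M (\<lambda>x. Im (\<Gamma> t x) - gen k x) (\<lambda>x. Im (\<Gamma> t x) - gen k x) < e"
    if e: "e > 0" for e
  proof -
    obtain k where k: "sq_norm M (\<lambda>x. \<Gamma> t x - \<Gamma> (q k) x) < e" using dense[OF e] by blast
    have "ip M (\<lambda>x. Re (\<Gamma> t x) - gen (2 * k) x) (\<lambda>x. Re (\<Gamma> t x) - gen (2 * k) x)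
        \<le> sq_norm M (\<lambda>x. \<Gamma> t x - \<Gamma> (q k) x)"
      unfolding ip_def sq_norm_def gen_def
      using integral_mono[OF int'(1)[of "q k"] int[of "q k"]] by (simp add: cmod_sq_eq)
    with k show "\<exists>k. ip M (\<lambda>x. Re (\<Gamma> t x) - gen k x) (\<lambda>x. Re (\<Gamma> t x) - gen k x) < e"
      by (intro exI[of _ "2 * k"]) linarith
    have "ip M (\<lambda>x. Im (\<Gamma> t x) - gen (2 * k + 1) x) (\<lambda>x. Im (\<Gamma> t x) - gen (2 * k + 1) x)
        \<le> sq_norm M (\<lambda>x. \<Gamma> t x - \<Gamma> (q k) x)"
      unfolding ip_def sq_norm_def gen_def
      using integral_mono[OF int'(2)[of "q k"] int[of "q k"]] by (simp add: cmod_sq_eq)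
    with k show "\<exists>k. ip M (\<lambda>x. Im (\<Gamma> t x) - gen k x) (\<lambda>x. Im (\<Gamma> t x) - gen k x) < e"
      by (intro exI[of _ "2 * k + 1"]) linarith
  qed
  show "gs_dense gen (\<lambda>x. Re (\<Gamma> t x))"
    by (rule gs_denseI[OF gen_bounded bounded_Re le(1)])
  show "gs_dense gen (\<lambda>x. Im (\<Gamma> t x))"
    by (rule gs_denseI[OF gen_bounded bounded_Im le(2)])
qed

definition coef :: "'t \<Rightarrow> nat \<Rightarrow> complex" where
  "coef t i = Complex (ip M (\<lambda>x. Re (\<Gamma> t x)) (gram_schmidt M gen i)) (ip M (\<lambda>x. Im (\<Gamma> t x)) (gram_schmidt M gen i))"

lemma coef_measurable [measurable]: "(\<lambda>t. coef t i) \<in> borel_measurable T"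
proof -
  note [measurable] = joint bounded_rv_measurable[OF basis_bounded]
  have [measurable]: "(\<lambda>t. ip M (\<lambda>x. Re (\<Gamma> t x)) (gram_schmidt M gen i)) \<in> borel_measurable T"
      "(\<lambda>t. ip M (\<lambda>x. Im (\<Gamma> t x)) (gram_schmidt M gen i)) \<in> borel_measurable T"
    unfolding ip_def by (rule borel_measurable_lebesgue_integral, measurable)+
  show ?thesis unfolding coef_def Complex_eq by measurable
qed

lemma coef_norm_sums: "(\<lambda>i. (cmod (coef t i))\<^sup>2) sums sq_norm M (\<Gamma> t)"
proof -
  have "(\<lambda>i. (ip M (\<lambda>x. Re (\<Gamma> t x)) (gram_schmidt M gen i))\<^sup>2 + (ip M (\<lambda>x. Im (\<Gamma> t x)) (gram_schmidt M gen i))\<^sup>2)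
     sums (ip M (\<lambda>x. Re (\<Gamma> t x)) (\<lambda>x. Re (\<Gamma> t x)) + ip M (\<lambda>x. Im (\<Gamma> t x)) (\<lambda>x. Im (\<Gamma> t x)))"
    by (intro sums_add gs_parseval_sq gen_bounded dense_Re dense_Im)
  moreover have "ip M (\<lambda>x. Re (\<Gamma> t x)) (\<lambda>x. Re (\<Gamma> t x)) + ip M (\<lambda>x. Im (\<Gamma> t x)) (\<lambda>x. Im (\<Gamma> t x)) = sq_norm M (\<Gamma> t)"
    unfolding ip_def sq_norm_def cmod_sq_eq
    by (rule Bochner_Integration.integral_add[symmetric])
       (intro integrable_bounded_rv bounded_rv_mult bounded_Re bounded_Im)+
  ultimately show ?thesis by (simp add: coef_def cmod_power2)
qed

lemmas coef_summable = sums_summable[OF coef_norm_sums]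

lemma coef_cov_sums: "(\<lambda>i. coef t i * cnj (coef s i)) sums (\<integral>x. \<Gamma> t x * cnj (\<Gamma> s x) \<partial>M)"
proof -
  note b = gs_parseval[OF gen_bounded]
  let ?g = "gram_schmidt M gen"
  let ?R = "\<lambda>t x. Re (\<Gamma> t x)" and ?I = "\<lambda>t x. Im (\<Gamma> t x)"
  have int: "complex_integrable M (\<lambda>x. \<Gamma> t x * cnj (\<Gamma> s x))"
    by (rule sq_integrable_mult(1)[OF feature_sq_integrable feature_sq_integrable])
  have i: "integrable M (\<lambda>x. ?R t x * ?R s x)" "integrable M (\<lambda>x. ?I t x * ?I s x)"
     "integrable M (\<lambda>x. ?I t x * ?R s x)" "integrable M (\<lambda>x. ?R t x * ?I s x)"
    by (intro integrable_bounded_rv bounded_rv_mult bounded_Re bounded_Im)+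
  have "(\<lambda>i. ip M (?R t) (?g i) * ip M (?R s) (?g i) + ip M (?I t) (?g i) * ip M (?I s) (?g i))
      sums (ip M (?R t) (?R s) + ip M (?I t) (?I s))"
    by (intro sums_add b dense_Re dense_Im)
  moreover have "ip M (?R t) (?R s) + ip M (?I t) (?I s) = Re (\<integral>x. \<Gamma> t x * cnj (\<Gamma> s x) \<partial>M)"
    unfolding ip_def using i int by (simp flip: integral_Re Bochner_Integration.integral_add)
  moreover have "(\<lambda>i. ip M (?I t) (?g i) * ip M (?R s) (?g i) - ip M (?R t) (?g i) * ip M (?I s) (?g i))
      sums (ip M (?I t) (?R s) - ip M (?R t) (?I s))"
    by (intro sums_diff b dense_Re dense_Im)
  moreover have "ip M (?I t) (?R s) - ip M (?R t) (?I s) = Im (\<integral>x. \<Gamma> t x * cnj (\<Gamma> s x) \<partial>M)"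
    unfolding ip_def using i int by (simp flip: integral_Im Bochner_Integration.integral_diff)
  ultimately show ?thesis by (simp add: sums_complex_iff coef_def)
qed

definition gp :: "'t \<Rightarrow> (nat \<Rightarrow> real) \<Rightarrow> complex" where
  "gp t = gseries (coef t)"

lemma gp_measurable [measurable]: "gp t \<in> borel_measurable gauss_seq"
  unfolding gp_def by measurable

lemma gp_joint_measurable: "(\<lambda>(t, w). gp t w) \<in> borel_measurable (T \<Otimes>\<^sub>M gauss_seq)"
  unfolding gp_def by (rule gseries_joint_measurable) measurable

lemma gsum_sq_integrable: "sq_integrable gauss_seq (gsum a n)"
proof (rule sq_integrable_nn(1))
  show "(\<integral>\<^sup>+x. ennreal ((cmod (gsum a n x))\<^sup>2) \<partial>gauss_seq) \<le> ennreal (\<Sum>i<n. (cmod (a i))\<^sup>2)"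
    using gsum_diff_norm[of 0 n a] by (simp add: gsum_def)
qed (auto intro: sum_nonneg)

lemma gp_approx:
  "sq_integrable gauss_seq (\<lambda>w. gp t w - gsum (coef t) n w)"
  "sq_norm gauss_seq (\<lambda>w. gp t w - gsum (coef t) n w) \<le> tail (coef t) n"
  unfolding gp_def
  by (rule sq_integrable_nn[OF _ gseries_approx[OF coef_summable] tail_nonneg[OF coef_summable]];
      measurable)+

lemma gp_sq_integrable: "sq_integrable gauss_seq (gp t)"
  using gp_approx(1)[of t 0] by (simp add: gsum_def)

lemma gp_approx_tendsto: "(\<lambda>n. sq_norm gauss_seq (\<lambda>w. gsum (coef t) n w - gp t w)) \<longlonglongrightarrow> 0"
  by (subst sq_norm_minus_commute)
     (rule tendsto_sandwich[OF always_eventually always_eventually tendsto_const tail_tendsto[OF coef_summable]],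
       auto intro: gp_approx)

lemma gp_cov: "(\<integral>w. gp t w * cnj (gp s w) \<partial>gauss_seq) = (\<integral>x. \<Gamma> t x * cnj (\<Gamma> s x) \<partial>M)"
proof (rule LIMSEQ_unique)
  show "(\<lambda>n. \<integral>w. gsum (coef t) n w * cnj (gsum (coef s) n w) \<partial>gauss_seq)
      \<longlonglongrightarrow> (\<integral>w. gp t w * cnj (gp s w) \<partial>gauss_seq)"
    by (rule sq_norm_cov_tendsto; rule gp_sq_integrable gsum_sq_integrable gp_approx_tendsto)
  have "(\<integral>w. gsum (coef t) n w * cnj (gsum (coef s) n w) \<partial>gauss_seq) = (\<Sum>i<n. coef t i * cnj (coef s i))" for n
    unfolding gsum_def by (rule gauss_lincomb_cov(2)) simp
  then show "(\<lambda>n. \<integral>w. gsum (coef t) n w * cnj (gsum (coef s) n w) \<partial>gauss_seq)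
      \<longlonglongrightarrow> (\<integral>x. \<Gamma> t x * cnj (\<Gamma> s x) \<partial>M)"
    using coef_cov_sums[of t s] by (simp add: sums_def)
qed

lemma gp_sq_norm: "sq_norm gauss_seq (gp t) = sq_norm M (\<Gamma> t)"
  using gp_cov[of t t] by (simp add: sq_norm_cov[symmetric])

lemma gp_sq_norm_diff: "sq_norm gauss_seq (\<lambda>w. gp t w - gp s w) = sq_norm M (\<lambda>x. \<Gamma> t x - \<Gamma> s x)"
  by (simp only: sq_norm_diff_cov[OF gp_sq_integrable gp_sq_integrable]
      sq_norm_diff_cov[OF feature_sq_integrable feature_sq_integrable] gp_cov)

lemma gp_approx_abs:
  "integrable gauss_seq (\<lambda>w. cmod (gp t w - gsum (coef t) n w))"
  "(\<integral>w. cmod (gp t w - gsum (coef t) n w) \<partial>gauss_seq) \<le> sqrt (tail (coef t) n)"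
proof -
  interpret N: prob_space gauss_seq by (rule prob_space_gauss_seq)
  note * = N.sq_integrable_integrable[OF gp_approx(1)[of t n]]
  show "integrable gauss_seq (\<lambda>w. cmod (gp t w - gsum (coef t) n w))"
    by (rule integrable_norm[OF *(1)])
  show "(\<integral>w. cmod (gp t w - gsum (coef t) n w) \<partial>gauss_seq) \<le> sqrt (tail (coef t) n)"
    using *(2) gp_approx(2)[of t n] by (meson order_trans real_sqrt_le_iff)
qed

lemma sqrt_tail_tendsto: "(\<lambda>n. sqrt (tail (coef t) n)) \<longlonglongrightarrow> 0"
  using tendsto_real_sqrt[OF tail_tendsto[OF coef_summable]] by simp

lemma gp_mean: "(\<integral>w. gp t w \<partial>gauss_seq) = 0"
proof -
  interpret N: prob_space gauss_seq by (rule prob_space_gauss_seq)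
  have "(\<integral>w. gsum (coef t) n w \<partial>gauss_seq) = 0" for n
    unfolding gsum_def using gauss_seq_coord(1,2) by simp
  then have eq: "(\<integral>w. gp t w \<partial>gauss_seq) = (\<integral>w. gp t w - gsum (coef t) n w \<partial>gauss_seq)" for n
    using N.sq_integrable_integrable(1)[OF gp_sq_integrable] N.sq_integrable_integrable(1)[OF gsum_sq_integrable]
    by simp
  have "norm (\<integral>w. gp t w \<partial>gauss_seq) \<le> sqrt (tail (coef t) n)" for n
    unfolding eq[of n] by (rule order_trans[OF integral_norm_bound gp_approx_abs(2)])
  then have "norm (\<integral>w. gp t w \<partial>gauss_seq) \<le> 0"
    by (intro LIMSEQ_le_const[OF sqrt_tail_tendsto[of t]]) auto
  then show ?thesis by simp
qed

text \<open>A real combination of the truncated series is a Gaussian sum whose coefficients are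
  those of the same combination of features. Parseval turns the limiting variance into the second
  moment of that combination, which is the form in which the central limit theorem supplies
  it.\<close>

lemma gp_char:
  assumes F: "finite F"
  shows "(\<integral>w. iexp (rcomb F \<alpha> \<beta> gp w) \<partial>gauss_seq)
    = complex_of_real (exp (- (\<integral>x. (rcomb F \<alpha> \<beta> \<Gamma> x)\<^sup>2 \<partial>M) / 2))"
proof -
  interpret N: prob_space gauss_seq by (rule prob_space_gauss_seq)
  let ?g = "gram_schmidt M gen"
  let ?h = "\<lambda>x. \<Sum>t\<in>F. \<alpha> t * Re (\<Gamma> t x) + \<beta> t * Im (\<Gamma> t x)"
  let ?Y = "\<lambda>n. rcomb F \<alpha> \<beta> (\<lambda>t. gsum (coef t) n)"
  define c where "c i = ip M ?h (?g i)" for i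
  have c: "c i = (\<Sum>t\<in>F. \<alpha> t * Re (coef t i) + \<beta> t * Im (coef t i))" for i
    unfolding c_def coef_def
    by (subst ip_sum)
       (simp_all add: ip_add ip_cmult bounded_rv_add bounded_rv_mult bounded_Re bounded_Im basis_bounded)
  have hd: "gs_dense gen ?h"
    by (intro gs_dense_sum gs_dense_add gs_dense_cmult gen_bounded dense_Re dense_Im)
  have Y: "?Y n w = (\<Sum>i<n. c i * w i)" for n w
  proof -
    have "?Y n w = (\<Sum>t\<in>F. \<Sum>i<n. (\<alpha> t * Re (coef t i) + \<beta> t * Im (coef t i)) * w i)"
      unfolding rcomb_def gsum_def
      by (intro sum.cong refl) (simp add: sum_distrib_left sum.distrib algebra_simps)
    also have "\<dots> = (\<Sum>i<n. c i * w i)"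
      unfolding c by (subst sum.swap) (simp add: sum_distrib_right)
    finally show ?thesis .
  qed
  have lim1: "(\<lambda>n. \<integral>w. iexp (?Y n w) \<partial>gauss_seq) \<longlonglongrightarrow> complex_of_real (exp (- ip M ?h ?h / 2))"
    unfolding Y gauss_seq_iexp
    by (intro tendsto_intros)
       (use gs_parseval_sq[OF gen_bounded hd] in \<open>auto simp: sums_def c_def\<close>)
  have meas: "rcomb F \<alpha> \<beta> gp \<in> borel_measurable gauss_seq" "?Y n \<in> borel_measurable gauss_seq" for n
    unfolding rcomb_def by measurable
  have diff: "norm ((\<integral>w. iexp (?Y n w) \<partial>gauss_seq) - (\<integral>w. iexp (rcomb F \<alpha> \<beta> gp w) \<partial>gauss_seq))
     \<le> (\<Sum>t\<in>F. (\<bar>\<alpha> t\<bar> + \<bar>\<beta> t\<bar>) * sqrt (tail (coef t) n))" for n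
  proof -
    have pt: "\<bar>?Y n w - rcomb F \<alpha> \<beta> gp w\<bar> \<le> (\<Sum>t\<in>F. (\<bar>\<alpha> t\<bar> + \<bar>\<beta> t\<bar>) * cmod (gp t w - gsum (coef t) n w))" for w
    proof -
      have eq: "?Y n w - rcomb F \<alpha> \<beta> gp w
          = (\<Sum>t\<in>F. \<alpha> t * - Re (gp t w - gsum (coef t) n w) + \<beta> t * - Im (gp t w - gsum (coef t) n w))"
        unfolding rcomb_def sum_subtractf[symmetric] by (intro sum.cong refl) (simp add: algebra_simps)
      show ?thesis
        unfolding eq
      proof (intro order_trans[OF sum_abs] sum_mono)
        fix t
        let ?z = "gp t w - gsum (coef t) n w"
        have "\<bar>\<alpha> t * - Re ?z + \<beta> t * - Im ?z\<bar> \<le> \<bar>\<alpha> t\<bar> * \<bar>Re ?z\<bar> + \<bar>\<beta> t\<bar> * \<bar>Im ?z\<bar>"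
          by (rule order_trans[OF abs_triangle_ineq]) (simp only: abs_mult abs_minus_cancel order_refl)
        also have "\<dots> \<le> \<bar>\<alpha> t\<bar> * cmod ?z + \<bar>\<beta> t\<bar> * cmod ?z"
          by (intro add_mono mult_left_mono abs_Re_le_cmod abs_Im_le_cmod) auto
        finally show "\<bar>\<alpha> t * - Re ?z + \<beta> t * - Im ?z\<bar> \<le> (\<bar>\<alpha> t\<bar> + \<bar>\<beta> t\<bar>) * cmod ?z"
          by (simp add: distrib_right)
      qed
    qed
    have intb: "integrable gauss_seq (\<lambda>w. \<Sum>t\<in>F. (\<bar>\<alpha> t\<bar> + \<bar>\<beta> t\<bar>) * cmod (gp t w - gsum (coef t) n w))"
      by (intro Bochner_Integration.integrable_sum integrable_mult_right gp_approx_abs(1))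
    have inta: "integrable gauss_seq (\<lambda>w. \<bar>?Y n w - rcomb F \<alpha> \<beta> gp w\<bar>)"
      by (rule Bochner_Integration.integrable_bound[OF intb])
         (use pt meas in \<open>auto intro: order_trans[OF _ abs_ge_self]\<close>)
    have "norm ((\<integral>w. iexp (?Y n w) \<partial>gauss_seq) - (\<integral>w. iexp (rcomb F \<alpha> \<beta> gp w) \<partial>gauss_seq))
       \<le> (\<integral>w. \<bar>?Y n w - rcomb F \<alpha> \<beta> gp w\<bar> \<partial>gauss_seq)"
      by (rule N.expectation_iexp_diff_le[OF meas(2) meas(1) inta])
    also have "\<dots> \<le> (\<integral>w. (\<Sum>t\<in>F. (\<bar>\<alpha> t\<bar> + \<bar>\<beta> t\<bar>) * cmod (gp t w - gsum (coef t) n w)) \<partial>gauss_seq)"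
      by (rule integral_mono[OF inta intb pt])
    also have "\<dots> = (\<Sum>t\<in>F. (\<bar>\<alpha> t\<bar> + \<bar>\<beta> t\<bar>) * (\<integral>w. cmod (gp t w - gsum (coef t) n w) \<partial>gauss_seq))"
      using gp_approx_abs(1) by simp
    also have "\<dots> \<le> (\<Sum>t\<in>F. (\<bar>\<alpha> t\<bar> + \<bar>\<beta> t\<bar>) * sqrt (tail (coef t) n))"
      by (intro sum_mono mult_left_mono gp_approx_abs(2)) auto
    finally show ?thesis .
  qed
  have "(\<lambda>n. \<Sum>t\<in>F. (\<bar>\<alpha> t\<bar> + \<bar>\<beta> t\<bar>) * sqrt (tail (coef t) n)) \<longlonglongrightarrow> (\<Sum>t\<in>F. (\<bar>\<alpha> t\<bar> + \<bar>\<beta> t\<bar>) * 0)"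
    by (intro tendsto_intros sqrt_tail_tendsto)
  then have null: "(\<lambda>n. \<Sum>t\<in>F. (\<bar>\<alpha> t\<bar> + \<bar>\<beta> t\<bar>) * sqrt (tail (coef t) n)) \<longlonglongrightarrow> 0"
    by simp
  have "(\<lambda>n. \<integral>w. iexp (?Y n w) \<partial>gauss_seq) \<longlonglongrightarrow> (\<integral>w. iexp (rcomb F \<alpha> \<beta> gp w) \<partial>gauss_seq)"
    by (rule Lim_null[THEN iffD2], rule Lim_null_comparison[OF _ null], rule always_eventually, rule allI, rule diff)
  from LIMSEQ_unique[OF this lim1] show ?thesis
    by (simp add: ip_def power2_eq_square rcomb_def)
qed

lemma rcomb_scale: "rcomb F (\<lambda>t. u * \<alpha> t) (\<lambda>t. u * \<beta> t) Z x = u * rcomb F \<alpha> \<beta> Z x"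
  unfolding rcomb_def sum_distrib_left by (intro sum.cong refl) (simp add: algebra_simps)

lemma gp_gaussian: "complex_gaussian_process gauss_seq (\<lambda>t w. complex_of_real c * gp t w)"
  unfolding complex_gaussian_process_def
proof (intro allI impI)
  fix F :: "'t set" and \<alpha> \<beta> :: "'t \<Rightarrow> real" assume F: "finite F"
  interpret N: prob_space gauss_seq by (rule prob_space_gauss_seq)
  let ?Y = "\<lambda>w. \<Sum>t\<in>F. \<alpha> t * Re (complex_of_real c * gp t w) + \<beta> t * Im (complex_of_real c * gp t w)"
  have Y: "?Y w = c * rcomb F \<alpha> \<beta> gp w" for w
    unfolding rcomb_def sum_distrib_left by (intro sum.cong refl) (simp add: algebra_simps)
  show "gaussian_rv gauss_seq ?Y"
  proof (rule N.gaussian_rvI_char)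
    show "?Y \<in> borel_measurable gauss_seq" by measurable
    show "c\<^sup>2 * (\<integral>x. (rcomb F \<alpha> \<beta> \<Gamma> x)\<^sup>2 \<partial>M) \<ge> 0"
      by (intro mult_nonneg_nonneg integral_nonneg_AE) auto
    fix u
    have "(\<integral>w. iexp (u * ?Y w) \<partial>gauss_seq)
        = (\<integral>w. iexp (rcomb F (\<lambda>t. (u * c) * \<alpha> t) (\<lambda>t. (u * c) * \<beta> t) gp w) \<partial>gauss_seq)"
      unfolding Y rcomb_scale by (simp only: mult.assoc)
    also have "\<dots> = complex_of_real (exp (- (\<integral>x. ((u * c) * rcomb F \<alpha> \<beta> \<Gamma> x)\<^sup>2 \<partial>M) / 2))"
      by (subst gp_char[OF F]) (simp only: rcomb_scale)
    finally show "(\<integral>w. iexp (u * ?Y w) \<partial>gauss_seq)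
        = complex_of_real (exp (- (u\<^sup>2 * (c\<^sup>2 * (\<integral>x. (rcomb F \<alpha> \<beta> \<Gamma> x)\<^sup>2 \<partial>M))) / 2))"
      by (simp only: power_mult_distrib integral_mult_right_zero mult.assoc)
  qed
qed

end

subsection \<open>Laplace transforms of quadratic functionals\<close>

text \<open>Interpolates between a characteristic function (A empty) and the Laplace transform of a
  weighted sum of squares (A = F and \<alpha> = 0), so that the passage from one to the other can be
  an induction on A.\<close>

definition mixed_transform ::
  "'a measure \<Rightarrow> 'i set \<Rightarrow> ('i \<Rightarrow> real) \<Rightarrow> ('i \<Rightarrow> 'a \<Rightarrow> real) \<Rightarrow> 'i set \<Rightarrow> ('i \<Rightarrow> real) \<Rightarrow> complex" where
  "mixed_transform M F c \<rho> A \<alpha> =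
     (\<integral>x. complex_of_real (exp (- (\<Sum>i\<in>A. c i * (\<rho> i x)\<^sup>2))) * iexp (\<Sum>i\<in>F. \<alpha> i * \<rho> i x) \<partial>M)"

lemma norm_mixed_integrand:
  assumes "\<And>i. i \<in> A \<Longrightarrow> c i \<ge> 0"
  shows "norm (complex_of_real (exp (- (\<Sum>i\<in>A. c i * (\<rho> i x)\<^sup>2))) * iexp y) \<le> 1"
proof -
  have "(\<Sum>i\<in>A. c i * (\<rho> i x)\<^sup>2) \<ge> 0" using assms by (intro sum_nonneg) auto
  then show ?thesis by (simp add: norm_mult)
qed

lemma (in prob_space) norm_mixed_transform:
  assumes "\<And>i. i \<in> A \<Longrightarrow> c i \<ge> 0"
  shows "norm (mixed_transform M F c \<rho> A \<alpha>) \<le> 1"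
proof -
  have "norm (mixed_transform M F c \<rho> A \<alpha>) \<le> (\<integral>x. norm (complex_of_real (exp (- (\<Sum>i\<in>A. c i * (\<rho> i x)\<^sup>2))) * iexp (\<Sum>i\<in>F. \<alpha> i * \<rho> i x)) \<partial>M)"
    unfolding mixed_transform_def by (rule integral_norm_bound)
  also have "\<dots> \<le> 1"
  proof (rule order_trans[OF integral_mono'[of _ "\<lambda>_. 1"]])
    show "norm (complex_of_real (exp (- (\<Sum>i\<in>A. c i * (\<rho> i x)\<^sup>2))) * iexp (\<Sum>i\<in>F. \<alpha> i * \<rho> i x)) \<le> 1" for x
      by (rule norm_mixed_integrand) (rule assms)
  qed (auto simp: prob_space)
  finally show ?thesis .
qed

lemma mixed_transform_measurable:
  assumes M: "prob_space M" and F: "finite F" and y: "y \<in> F"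
    and [measurable]: "\<And>i. i \<in> F \<Longrightarrow> \<rho> i \<in> borel_measurable M" and A: "A \<subseteq> F"
  shows "(\<lambda>g. mixed_transform M F c \<rho> A (\<alpha>(y := \<alpha> y + k * g))) \<in> borel_measurable borel"
proof -
  interpret prob_space M by fact
  have [measurable]: "i \<in> A \<Longrightarrow> \<rho> i \<in> borel_measurable M" for i using A by auto
  show ?thesis
    unfolding mixed_transform_def fun_upd_def by measurable
qed

text \<open>A factor exp(-c r^2) is the mean of exp(i sqrt(2 c) r g) over a standard normal g. The
  square at y thus becomes a random shift of the linear coefficient \<open>\<alpha> y\<close>, and
  Fubini takes the mean over g outside.\<close>

lemma mixed_transform_insert:
  assumes M: "prob_space M" and F: "finite F" and y: "y \<in> F"
    and meas[measurable]: "\<And>i. i \<in> F \<Longrightarrow> \<rho> i \<in> borel_measurable M" and A: "A \<subseteq> F" "y \<notin> A"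
    and c: "\<And>i. i \<in> F \<Longrightarrow> c i \<ge> 0"
  shows "mixed_transform M F c \<rho> (insert y A) \<alpha>
     = (\<integral>g. mixed_transform M F c \<rho> A (\<alpha>(y := \<alpha> y + sqrt (2 * c y) * g)) \<partial>std_normal_distribution)"
proof -
  interpret M: prob_space M by fact
  interpret \<gamma>: prob_space std_normal_distribution by (rule prob_space_std_normal)
  interpret P: pair_prob_space M std_normal_distribution ..
  have [measurable]: "i \<in> A \<Longrightarrow> \<rho> i \<in> borel_measurable M" for i using A by auto
  have [measurable]: "\<rho> y \<in> borel_measurable M" using y by simp
  have finA: "finite A" using A F finite_subset by blast
  let ?E = "\<lambda>x. complex_of_real (exp (- (\<Sum>i\<in>A. c i * (\<rho> i x)\<^sup>2)))"
  let ?\<alpha> = "\<lambda>g. \<alpha>(y := \<alpha> y + sqrt (2 * c y) * g)"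
  have lin: "(\<Sum>i\<in>F. ?\<alpha> g i * \<rho> i x) = (\<Sum>i\<in>F. \<alpha> i * \<rho> i x) + (sqrt (2 * c y) * \<rho> y x) * g" for g x
  proof -
    have "(\<Sum>i\<in>F. ?\<alpha> g i * \<rho> i x) = (\<Sum>i\<in>F. \<alpha> i * \<rho> i x + (if i = y then (sqrt (2 * c y) * \<rho> y x) * g else 0))"
      by (rule sum.cong) (auto simp: algebra_simps)
    then show ?thesis using F y by (simp add: sum.distrib)
  qed
  have ins: "complex_of_real (exp (- (\<Sum>i\<in>insert y A. c i * (\<rho> i x)\<^sup>2))) * iexp (\<Sum>i\<in>F. \<alpha> i * \<rho> i x)
      = (\<integral>g. ?E x * iexp (\<Sum>i\<in>F. ?\<alpha> g i * \<rho> i x) \<partial>std_normal_distribution)" for x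
  proof -
    have "(\<integral>g. ?E x * iexp (\<Sum>i\<in>F. ?\<alpha> g i * \<rho> i x) \<partial>std_normal_distribution)
        = ?E x * iexp (\<Sum>i\<in>F. \<alpha> i * \<rho> i x) * (\<integral>g. iexp ((sqrt (2 * c y) * \<rho> y x) * g) \<partial>std_normal_distribution)"
      unfolding lin by (simp add: exp_add distrib_left mult.assoc)
    also have "(\<integral>g. iexp ((sqrt (2 * c y) * \<rho> y x) * g) \<partial>std_normal_distribution)
        = complex_of_real (exp (- (c y * (\<rho> y x)\<^sup>2)))"
      unfolding std_normal_iexp using c[OF y] by (simp add: power_mult_distrib)
    finally have "(\<integral>g. ?E x * iexp (\<Sum>i\<in>F. ?\<alpha> g i * \<rho> i x) \<partial>std_normal_distribution)
        = complex_of_real (exp (- (\<Sum>i\<in>A. c i * (\<rho> i x)\<^sup>2)) * exp (- (c y * (\<rho> y x)\<^sup>2))) * iexp (\<Sum>i\<in>F. \<alpha> i * \<rho> i x)"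
      by simp
    also have "exp (- (\<Sum>i\<in>A. c i * (\<rho> i x)\<^sup>2)) * exp (- (c y * (\<rho> y x)\<^sup>2))
       = exp (- (\<Sum>i\<in>insert y A. c i * (\<rho> i x)\<^sup>2))"
      using finA A(2) by (simp add: exp_add[symmetric])
    finally show ?thesis by simp
  qed
  have "mixed_transform M F c \<rho> (insert y A) \<alpha>
      = (\<integral>x. (\<integral>g. ?E x * iexp (\<Sum>i\<in>F. ?\<alpha> g i * \<rho> i x) \<partial>std_normal_distribution) \<partial>M)"
    unfolding mixed_transform_def ins ..
  also have "\<dots> = (\<integral>g. (\<integral>x. ?E x * iexp (\<Sum>i\<in>F. ?\<alpha> g i * \<rho> i x) \<partial>M) \<partial>std_normal_distribution)"
  proof (rule P.Fubini_integral[symmetric], rule integrable_bounded[OF P.finite_measure_axioms])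
    show "(\<lambda>(x, g). ?E x * iexp (\<Sum>i\<in>F. ?\<alpha> g i * \<rho> i x)) \<in> borel_measurable (M \<Otimes>\<^sub>M std_normal_distribution)"
      unfolding lin by measurable
    show "norm (case z of (x, g) \<Rightarrow> ?E x * iexp (\<Sum>i\<in>F. ?\<alpha> g i * \<rho> i x)) \<le> 1" for z
      unfolding case_prod_unfold by (rule norm_mixed_integrand) (use c A in auto)
  qed
  finally show ?thesis unfolding mixed_transform_def .
qed

text \<open>The Gaussian identity behind \<open>mixed_transform_insert\<close> removes one square at a time, so that
  convergence of univariate characteristic functions suffices.\<close>

lemma mixed_transform_tendsto:
  assumes M: "prob_space M" and N: "prob_space N" and F: "finite F"
    and \<rho>: "\<And>n i. i \<in> F \<Longrightarrow> \<rho> n i \<in> borel_measurable M"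
    and \<rho>': "\<And>i. i \<in> F \<Longrightarrow> \<rho>' i \<in> borel_measurable N"
    and c: "\<And>i. i \<in> F \<Longrightarrow> c i \<ge> 0"
    and char: "\<And>\<alpha>. (\<lambda>n. \<integral>x. iexp (\<Sum>i\<in>F. \<alpha> i * \<rho> n i x) \<partial>M) \<longlonglongrightarrow> (\<integral>x. iexp (\<Sum>i\<in>F. \<alpha> i * \<rho>' i x) \<partial>N)"
    and A: "A \<subseteq> F"
  shows "(\<lambda>n. mixed_transform M F c (\<rho> n) A \<alpha>) \<longlonglongrightarrow> mixed_transform N F c \<rho>' A \<alpha>"
proof -
  have "finite A" using A F finite_subset by blast
  then show ?thesis using A
  proof (induction A arbitrary: \<alpha> rule: finite_induct)
    case empty
    then show ?case using char by (simp add: mixed_transform_def)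
  next
    case (insert y A)
    then have y: "y \<in> F" "A \<subseteq> F" "y \<notin> A" by auto
    interpret M: prob_space M by fact
    interpret \<gamma>: prob_space std_normal_distribution by (rule prob_space_std_normal)
    let ?G = "\<lambda>g. \<alpha>(y := \<alpha> y + sqrt (2 * c y) * g)"
    have eq: "mixed_transform M F c (\<rho> n) (insert y A) \<alpha>
        = (\<integral>g. mixed_transform M F c (\<rho> n) A (?G g) \<partial>std_normal_distribution)" for n
      by (rule mixed_transform_insert[OF M F y(1) _ y(2,3) c]) (rule \<rho>)
    have eq': "mixed_transform N F c \<rho>' (insert y A) \<alpha>
        = (\<integral>g. mixed_transform N F c \<rho>' A (?G g) \<partial>std_normal_distribution)"
      by (rule mixed_transform_insert[OF N F y(1) _ y(2,3) c]) (rule \<rho>')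
    show ?case
      unfolding eq eq'
    proof (rule integral_dominated_convergence[where w="\<lambda>_. 1"])
      show "AE g in std_normal_distribution. (\<lambda>n. mixed_transform M F c (\<rho> n) A (\<alpha>(y := \<alpha> y + sqrt (2 * c y) * g)))
          \<longlonglongrightarrow> mixed_transform N F c \<rho>' A (\<alpha>(y := \<alpha> y + sqrt (2 * c y) * g))"
        using insert.IH[OF y(2)] by (intro AE_I2)
      show "AE g in std_normal_distribution. norm (mixed_transform M F c (\<rho> n) A (\<alpha>(y := \<alpha> y + sqrt (2 * c y) * g))) \<le> 1" for n
        by (intro AE_I2 M.norm_mixed_transform c) (use y in auto)
      show "(\<lambda>g. mixed_transform N F c \<rho>' A (\<alpha>(y := \<alpha> y + sqrt (2 * c y) * g))) \<in> borel_measurable std_normal_distribution"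
        using mixed_transform_measurable[OF N F y(1) \<rho>' y(2)] by simp
      show "(\<lambda>g. mixed_transform M F c (\<rho> n) A (\<alpha>(y := \<alpha> y + sqrt (2 * c y) * g))) \<in> borel_measurable std_normal_distribution" for n
        using mixed_transform_measurable[OF M F y(1) \<rho> y(2)] by simp
    qed simp
  qed
qed

text \<open>Each complex value is split into two real coordinates, indexed by a boolean and carrying
  the same weight, so that the squared modulus becomes a sum of two squares.\<close>

lemma laplace_fdd_tendsto:
  fixes \<xi> :: "nat \<Rightarrow> 't \<Rightarrow> 'a \<Rightarrow> complex" and \<zeta> :: "'t \<Rightarrow> 'b \<Rightarrow> complex"
  assumes M: "prob_space M" and N: "prob_space N" and F: "finite F"
    and \<xi>[measurable]: "\<And>n t. \<xi> n t \<in> borel_measurable M" and \<zeta>[measurable]: "\<And>t. \<zeta> t \<in> borel_measurable N"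
    and c: "\<And>t. c t \<ge> 0"
    and char: "\<And>\<alpha> \<beta>. (\<lambda>n. \<integral>x. iexp (rcomb F \<alpha> \<beta> (\<xi> n) x) \<partial>M) \<longlonglongrightarrow> (\<integral>x. iexp (rcomb F \<alpha> \<beta> \<zeta> x) \<partial>N)"
  shows "(\<lambda>n. \<integral>x. exp (- (\<Sum>t\<in>F. c t * (cmod (\<xi> n t x))\<^sup>2)) \<partial>M)
    \<longlonglongrightarrow> (\<integral>x. exp (- (\<Sum>t\<in>F. c t * (cmod (\<zeta> t x))\<^sup>2)) \<partial>N)"
proof -
  let ?F = "F \<times> (UNIV :: bool set)"
  let ?c = "\<lambda>i :: 't \<times> bool. c (fst i)"
  have sum_F: "(\<Sum>i\<in>?F. f i) = (\<Sum>t\<in>F. f (t, True) + f (t, False))" for f :: "'t \<times> bool \<Rightarrow> real"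
    by (simp add: sum.cartesian_product[symmetric] UNIV_bool add.commute sum.cartesian_product')
  have sq: "(\<Sum>i\<in>?F. ?c i * (if snd i then Re (Z (fst i) x) else Im (Z (fst i) x))\<^sup>2) = (\<Sum>t\<in>F. c t * (cmod (Z t x))\<^sup>2)"
    for Z :: "'t \<Rightarrow> 'z \<Rightarrow> complex" and x
    unfolding sum_F by (simp add: cmod_power2 distrib_left)
  have lin: "(\<Sum>i\<in>?F. \<alpha> i * (if snd i then Re (Z (fst i) x) else Im (Z (fst i) x)))
      = rcomb F (\<lambda>t. \<alpha> (t, True)) (\<lambda>t. \<alpha> (t, False)) Z x"
    for Z :: "'t \<Rightarrow> 'z \<Rightarrow> complex" and x \<alpha>
    unfolding sum_F rcomb_def by simp
  have "(\<lambda>n. mixed_transform M ?F ?c (\<lambda>i x. if snd i then Re (\<xi> n (fst i) x) else Im (\<xi> n (fst i) x)) ?F (\<lambda>_. 0))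
    \<longlonglongrightarrow> mixed_transform N ?F ?c (\<lambda>i x. if snd i then Re (\<zeta> (fst i) x) else Im (\<zeta> (fst i) x)) ?F (\<lambda>_. 0)"
    by (rule mixed_transform_tendsto[OF M N])
       (use F c char in \<open>auto simp: lin\<close>)
  then have "(\<lambda>n. complex_of_real (\<integral>x. exp (- (\<Sum>t\<in>F. c t * (cmod (\<xi> n t x))\<^sup>2)) \<partial>M))
    \<longlonglongrightarrow> complex_of_real (\<integral>x. exp (- (\<Sum>t\<in>F. c t * (cmod (\<zeta> t x))\<^sup>2)) \<partial>N)"
    unfolding mixed_transform_def sq by (simp flip: integral_complex_of_real)
  then show ?thesis by (simp only: tendsto_of_real_iff)
qed

lemma cmod_sq_diff_le: "\<bar>(cmod a)\<^sup>2 - (cmod b)\<^sup>2\<bar> \<le> cmod (a - b) * (cmod a + cmod b)"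
proof -
  have "\<bar>(cmod a)\<^sup>2 - (cmod b)\<^sup>2\<bar> = \<bar>cmod a - cmod b\<bar> * (cmod a + cmod b)"
    by (simp add: power2_eq_square square_diff_square_factored abs_mult mult.commute)
  also have "\<dots> \<le> cmod (a - b) * (cmod a + cmod b)"
    by (intro mult_right_mono norm_triangle_ineq3) auto
  finally show ?thesis .
qed

lemma sq_norm_sq_diff_le:
  assumes f: "sq_integrable M f" and g: "sq_integrable M g"
  shows "integrable M (\<lambda>x. \<bar>(cmod (f x))\<^sup>2 - (cmod (g x))\<^sup>2\<bar>)"
    and "(\<integral>x. \<bar>(cmod (f x))\<^sup>2 - (cmod (g x))\<^sup>2\<bar> \<partial>M)
      \<le> sqrt (sq_norm M (\<lambda>x. f x - g x)) * sqrt (2 * sq_norm M f + 2 * sq_norm M g)"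
proof -
  note [measurable] = sq_integrableD(1)[OF f] sq_integrableD(1)[OF g]
  have f': "sq_integrable M (\<lambda>x. complex_of_real (cmod (f x)))" "sq_norm M (\<lambda>x. complex_of_real (cmod (f x))) = sq_norm M f"
    and g': "sq_integrable M (\<lambda>x. complex_of_real (cmod (g x)))" "sq_norm M (\<lambda>x. complex_of_real (cmod (g x))) = sq_norm M g"
    using sq_integrableD(2)[OF f] sq_integrableD(2)[OF g] by (auto simp: sq_integrable_def sq_norm_def)
  note D = sq_integrable_diff(1)[OF f g]
  have cm: "cmod (complex_of_real (cmod a) + complex_of_real (cmod b)) = cmod a + cmod b" for a b
    unfolding of_real_add[symmetric] by (simp only: norm_of_real) simp
  have int: "integrable M (\<lambda>x. cmod (f x - g x) * (cmod (f x) + cmod (g x)))"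
    using sq_integrable_mult(3)[OF D sq_integrable_add(1)[OF f'(1) g'(1)]] by (simp only: cm)
  show int2: "integrable M (\<lambda>x. \<bar>(cmod (f x))\<^sup>2 - (cmod (g x))\<^sup>2\<bar>)"
    using sq_integrableD(2)[OF f] sq_integrableD(2)[OF g] by auto
  have "(\<integral>x. \<bar>(cmod (f x))\<^sup>2 - (cmod (g x))\<^sup>2\<bar> \<partial>M) \<le> (\<integral>x. cmod (f x - g x) * (cmod (f x) + cmod (g x)) \<partial>M)"
    by (rule integral_mono[OF int2 int cmod_sq_diff_le])
  also have "\<dots> \<le> sqrt (sq_norm M (\<lambda>x. f x - g x)) * sqrt (sq_norm M (\<lambda>x. complex_of_real (cmod (f x)) + complex_of_real (cmod (g x))))"
    using sq_integrable_mult(2)[OF D sq_integrable_add(1)[OF f'(1) g'(1)]] by (simp only: cm)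
  also have "\<dots> \<le> sqrt (sq_norm M (\<lambda>x. f x - g x)) * sqrt (2 * sq_norm M f + 2 * sq_norm M g)"
    using sq_integrable_add(2)[OF f'(1) g'(1)] f'(2) g'(2)
    by (intro mult_left_mono) auto
  finally show "(\<integral>x. \<bar>(cmod (f x))\<^sup>2 - (cmod (g x))\<^sup>2\<bar> \<partial>M)
      \<le> sqrt (sq_norm M (\<lambda>x. f x - g x)) * sqrt (2 * sq_norm M f + 2 * sq_norm M g)" .
qed

lemma tendsto_by_approximation:
  fixes A :: "nat \<Rightarrow> 'a::real_normed_vector"
  assumes near: "\<And>i. eventually (\<lambda>n. norm (A n - B i n) \<le> e i) sequentially"
    and near': "\<And>i. norm (A' - B' i) \<le> e i"
    and B: "\<And>i. B i \<longlonglongrightarrow> B' i" and e: "e \<longlonglongrightarrow> (0::real)"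
  shows "A \<longlonglongrightarrow> A'"
proof (rule tendstoI)
  fix r :: real assume r: "r > 0"
  then have "eventually (\<lambda>i. e i < r / 3) sequentially"
    using e by (intro order_tendstoD(2)[of e 0]) auto
  then obtain i where i: "e i < r / 3" by (auto simp: eventually_sequentially)
  have "eventually (\<lambda>n. dist (B i n) (B' i) < r / 3) sequentially"
    using B[of i] r by (intro tendstoD) auto
  with near[of i] show "eventually (\<lambda>n. dist (A n) A' < r) sequentially"
  proof eventually_elim
    case (elim n)
    have "norm (A n - A') \<le> norm (A n - B i n) + norm (B i n - B' i) + norm (B' i - A')"
      using norm_triangle_ineq[of "A n - B i n" "B i n - B' i"]
        norm_triangle_ineq[of "A n - B' i" "B' i - A'"] by simp
    then show ?case
      using elim near'[of i] i by (simp add: dist_norm norm_minus_commute[of "B' i"])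
  qed
qed

lemma exp_minus_diff_le:
  fixes a b :: real
  assumes "a \<ge> 0" "b \<ge> 0"
  shows "\<bar>exp (- a) - exp (- b)\<bar> \<le> \<bar>a - b\<bar>"
proof -
  have *: "\<bar>exp (- a) - exp (- b)\<bar> \<le> \<bar>a - b\<bar>" if "0 \<le> a" "a \<le> b" for a b :: real
  proof -
    have e: "1 - exp (- (b - a)) \<le> b - a"
      using exp_ge_add_one_self[of "- (b - a)"] by linarith
    have "exp (- a) - exp (- b) = exp (- a) * (1 - exp (- (b - a)))"
      by (simp add: right_diff_distrib exp_add[symmetric])
    also have "\<dots> \<le> 1 * (b - a)"
      using that e by (intro mult_mono) auto
    finally show ?thesis using that by simp
  qed
  show ?thesis using *[of a b] *[of b a] assms by (cases "a \<le> b") (auto simp: abs_minus_commute)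
qed

section \<open>Weighted L2 norms of random functions\<close>

definition weighted_norm :: "('t::euclidean_space \<Rightarrow> real) \<Rightarrow> ('t \<Rightarrow> complex) \<Rightarrow> real" where
  "weighted_norm w f = (\<integral>t. (cmod (f t))\<^sup>2 * w t \<partial>lborel)"

lemma weighted_norm_nonneg: "(\<And>t. w t \<ge> 0) \<Longrightarrow> weighted_norm w f \<ge> 0"
  unfolding weighted_norm_def by (rule integral_nonneg_AE) auto

lemma weighted_norm_measurable:
  assumes M: "sigma_finite_measure M" and Z[measurable]: "(\<lambda>(t, x). Z t x) \<in> borel_measurable (lborel \<Otimes>\<^sub>M M)"
    and w[measurable]: "w \<in> borel_measurable borel"
  shows "(\<lambda>x. weighted_norm w (\<lambda>t. Z t x)) \<in> borel_measurable M"
proof -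
  have "(\<lambda>(x, t). (cmod (Z t x))\<^sup>2 * w t) \<in> borel_measurable (M \<Otimes>\<^sub>M lborel)"
    by measurable
  then show ?thesis unfolding weighted_norm_def by (rule lborel.borel_measurable_lebesgue_integral)
qed

text \<open>Tonelli, with V as a bound on the second moments. It guards against the default value 0
  that \<open>weighted_norm\<close> takes when the integrand is not integrable.\<close>

lemma weighted_norm_AE_finite:
  fixes Z :: "'t::euclidean_space \<Rightarrow> 'a \<Rightarrow> complex"
  assumes P: "prob_space P" and Z[measurable]: "(\<lambda>(t, x). Z t x) \<in> borel_measurable (lborel \<Otimes>\<^sub>M P)"
    and w[measurable]: "w \<in> borel_measurable borel" and w0: "\<And>t. w t \<ge> 0"
    and Zi: "\<And>t. sq_integrable P (Z t)" and V: "\<And>t. sq_norm P (Z t) \<le> V t"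
    and int: "integrable lborel (\<lambda>t. V t * w t)"
  shows "AE x in P. integrable lborel (\<lambda>t. (cmod (Z t x))\<^sup>2 * w t)"
proof -
  interpret P: prob_space P by fact
  interpret Q: pair_sigma_finite "lborel :: 't measure" P ..
  have m[measurable]: "(\<lambda>(t, x). (cmod (Z t x))\<^sup>2 * w t) \<in> borel_measurable (lborel \<Otimes>\<^sub>M P)" by measurable
  have "(\<integral>\<^sup>+x. (\<integral>\<^sup>+t. ennreal ((cmod (Z t x))\<^sup>2 * w t) \<partial>lborel) \<partial>P)
      = (\<integral>\<^sup>+t. (\<integral>\<^sup>+x. ennreal ((cmod (Z t x))\<^sup>2 * w t) \<partial>P) \<partial>lborel)"
    by (rule Q.Fubini') measurable
  also have "\<dots> \<le> (\<integral>\<^sup>+t. ennreal (V t * w t) \<partial>lborel)"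
  proof (rule nn_integral_mono)
    fix t
    have "(\<integral>\<^sup>+x. ennreal ((cmod (Z t x))\<^sup>2 * w t) \<partial>P) = ennreal (sq_norm P (Z t) * w t)"
      unfolding sq_norm_def using sq_integrableD(2)[OF Zi[of t]] w0[of t]
      by (subst nn_integral_eq_integral) auto
    also have "\<dots> \<le> ennreal (V t * w t)"
      by (intro ennreal_leI mult_right_mono V w0)
    finally show "(\<integral>\<^sup>+x. ennreal ((cmod (Z t x))\<^sup>2 * w t) \<partial>P) \<le> ennreal (V t * w t)" .
  qed
  also have "\<dots> < \<infinity>"
  proof -
    have "V t * w t \<ge> 0" for t using order_trans[OF sq_norm_nonneg V] w0 by auto
    then show ?thesis using int by (simp add: nn_integral_eq_integral)
  qed
  finally have "AE x in P. (\<integral>\<^sup>+t. ennreal ((cmod (Z t x))\<^sup>2 * w t) \<partial>lborel) \<noteq> \<infinity>"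
    by (intro nn_integral_PInf_AE) auto
  moreover have "AE x in P. (\<lambda>t. (cmod (Z t x))\<^sup>2 * w t) \<in> borel_measurable lborel"
  proof (rule AE_I2)
    fix x assume "x \<in> space P"
    then show "(\<lambda>t. (cmod (Z t x))\<^sup>2 * w t) \<in> borel_measurable lborel"
      using measurable_compose[OF measurable_Pair2'[of x P lborel] m] by simp
  qed
  ultimately show ?thesis
  proof eventually_elim
    case (elim x)
    then show ?case using w0 by (intro integrableI_nonneg) (auto simp: less_top)
  qed
qed

text \<open>For fixed t, Cauchy-Schwarz bounds the mean of the difference of the squared moduli by
  \<open>sqrt (D t) * sqrt (2 * V t + 2 * V' t)\<close>. Tonelli integrates this over t, and exp(-x)
  is Lipschitz with constant 1 for nonnegative x. The two processes have to live on the same space,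
  but no information on their laws beyond second moments enters.\<close>

lemma laplace_weighted_norm_compare:
  fixes Z Z' :: "'t::euclidean_space \<Rightarrow> 'a \<Rightarrow> complex"
  assumes P: "prob_space P" and Z[measurable]: "(\<lambda>(t, x). Z t x) \<in> borel_measurable (lborel \<Otimes>\<^sub>M P)"
    and Z'[measurable]: "(\<lambda>(t, x). Z' t x) \<in> borel_measurable (lborel \<Otimes>\<^sub>M P)"
    and w[measurable]: "w \<in> borel_measurable borel" and w0: "\<And>t. w t \<ge> 0"
    and Zi: "\<And>t. sq_integrable P (Z t)" and V: "\<And>t. sq_norm P (Z t) \<le> V t"
    and int: "integrable lborel (\<lambda>t. V t * w t)"
    and Z'i: "\<And>t. sq_integrable P (Z' t)" and V': "\<And>t. sq_norm P (Z' t) \<le> V' t"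
    and int': "integrable lborel (\<lambda>t. V' t * w t)"
    and D: "\<And>t. sq_norm P (\<lambda>x. Z t x - Z' t x) \<le> D t"
    and Dint: "integrable lborel (\<lambda>t. sqrt (D t) * sqrt (2 * V t + 2 * V' t) * w t)"
    and s: "s \<ge> 0"
  shows "\<bar>(\<integral>x. exp (- (s * weighted_norm w (\<lambda>t. Z t x))) \<partial>P) - (\<integral>x. exp (- (s * weighted_norm w (\<lambda>t. Z' t x))) \<partial>P)\<bar>
    \<le> s * (\<integral>t. sqrt (D t) * sqrt (2 * V t + 2 * V' t) * w t \<partial>lborel)"
proof -
  interpret P: prob_space P by fact
  interpret Q: pair_sigma_finite "lborel :: 't measure" P ..
  let ?J = "\<lambda>x. weighted_norm w (\<lambda>t. Z t x)" and ?J' = "\<lambda>x. weighted_norm w (\<lambda>t. Z' t x)"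
  let ?d = "\<lambda>t x. \<bar>(cmod (Z t x))\<^sup>2 - (cmod (Z' t x))\<^sup>2\<bar>"
  let ?\<delta> = "\<lambda>t. sqrt (D t) * sqrt (2 * V t + 2 * V' t)"
  have \<delta>0: "?\<delta> t \<ge> 0" for t
    using order_trans[OF sq_norm_nonneg V[of t]] order_trans[OF sq_norm_nonneg V'[of t]]
      order_trans[OF sq_norm_nonneg D[of t]] by auto
  have [measurable]: "?J \<in> borel_measurable P" "?J' \<in> borel_measurable P"
    by (intro weighted_norm_measurable P.sigma_finite_measure_axioms Z Z' w)+
  have "(\<integral>\<^sup>+x. ennreal \<bar>?J x - ?J' x\<bar> \<partial>P) \<le> (\<integral>\<^sup>+x. (\<integral>\<^sup>+t. ennreal (?d t x * w t) \<partial>lborel) \<partial>P)"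
  proof (rule nn_integral_mono_AE)
    show "AE x in P. ennreal \<bar>?J x - ?J' x\<bar> \<le> (\<integral>\<^sup>+t. ennreal (?d t x * w t) \<partial>lborel)"
      using weighted_norm_AE_finite[OF P Z w w0 Zi V int] weighted_norm_AE_finite[OF P Z' w w0 Z'i V' int']
    proof eventually_elim
      case (elim x)
      have intd: "integrable lborel (\<lambda>t. (cmod (Z t x))\<^sup>2 * w t - (cmod (Z' t x))\<^sup>2 * w t)"
        using elim by auto
      have "\<bar>?J x - ?J' x\<bar> = \<bar>\<integral>t. (cmod (Z t x))\<^sup>2 * w t - (cmod (Z' t x))\<^sup>2 * w t \<partial>lborel\<bar>"
        unfolding weighted_norm_def using elim by simp
      also have "\<dots> \<le> (\<integral>t. \<bar>(cmod (Z t x))\<^sup>2 * w t - (cmod (Z' t x))\<^sup>2 * w t\<bar> \<partial>lborel)"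
        by (rule integral_abs_bound)
      finally have "ennreal \<bar>?J x - ?J' x\<bar> \<le> ennreal (\<integral>t. \<bar>(cmod (Z t x))\<^sup>2 * w t - (cmod (Z' t x))\<^sup>2 * w t\<bar> \<partial>lborel)"
        by (rule ennreal_leI)
      also have "\<dots> = (\<integral>\<^sup>+t. ennreal \<bar>(cmod (Z t x))\<^sup>2 * w t - (cmod (Z' t x))\<^sup>2 * w t\<bar> \<partial>lborel)"
        by (rule nn_integral_eq_integral[symmetric]) (use intd in auto)
      also have "\<dots> = (\<integral>\<^sup>+t. ennreal (?d t x * w t) \<partial>lborel)"
        by (intro nn_integral_cong) (use w0 in \<open>simp add: left_diff_distrib[symmetric] abs_mult\<close>)
      finally show ?case .
    qed
  qed
  also have "\<dots> = (\<integral>\<^sup>+t. (\<integral>\<^sup>+x. ennreal (?d t x * w t) \<partial>P) \<partial>lborel)"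
    by (rule Q.Fubini') measurable
  also have "\<dots> \<le> (\<integral>\<^sup>+t. ennreal (?\<delta> t * w t) \<partial>lborel)"
  proof (rule nn_integral_mono)
    fix t
    note * = sq_norm_sq_diff_le[OF Zi[of t] Z'i[of t]]
    have "(\<integral>\<^sup>+x. ennreal (?d t x * w t) \<partial>P) = ennreal ((\<integral>x. ?d t x \<partial>P) * w t)"
      using *(1) w0[of t] by (subst nn_integral_eq_integral) auto
    also have "\<dots> \<le> ennreal (?\<delta> t * w t)"
    proof (intro ennreal_leI mult_right_mono w0 order_trans[OF *(2)] mult_mono)
      show "sqrt (sq_norm P (\<lambda>x. Z t x - Z' t x)) \<le> sqrt (D t)" using D by simp
      show "sqrt (2 * sq_norm P (Z t) + 2 * sq_norm P (Z' t)) \<le> sqrt (2 * V t + 2 * V' t)"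
        using V[of t] V'[of t] by simp
      show "0 \<le> sqrt (D t)" using order_trans[OF sq_norm_nonneg D[of t]] by simp
    qed auto
    finally show "(\<integral>\<^sup>+x. ennreal (?d t x * w t) \<partial>P) \<le> ennreal (?\<delta> t * w t)" .
  qed
  also have "\<dots> = ennreal (\<integral>t. ?\<delta> t * w t \<partial>lborel)"
    by (rule nn_integral_eq_integral[OF Dint]) (use \<delta>0 w0 in auto)
  finally have le: "(\<integral>\<^sup>+x. ennreal \<bar>?J x - ?J' x\<bar> \<partial>P) \<le> ennreal (\<integral>t. ?\<delta> t * w t \<partial>lborel)" .
  have int_d: "integrable P (\<lambda>x. \<bar>?J x - ?J' x\<bar>)"
    by (rule integrableI_nonneg) (use le in \<open>auto intro: order_le_less_trans\<close>)
  have \<delta>w: "(\<integral>t. ?\<delta> t * w t \<partial>lborel) \<ge> 0" using \<delta>0 w0 by (intro integral_nonneg_AE) auto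
  have E: "(\<integral>x. \<bar>?J x - ?J' x\<bar> \<partial>P) \<le> (\<integral>t. ?\<delta> t * w t \<partial>lborel)"
    using le int_d \<delta>w by (simp add: nn_integral_eq_integral)
  have J0: "s * weighted_norm w f \<ge> 0" for f using s weighted_norm_nonneg[of w f, OF w0] by simp
  have inte: "integrable P (\<lambda>x. exp (- (s * ?J x)))" "integrable P (\<lambda>x. exp (- (s * ?J' x)))"
    by (rule integrable_bounded[OF P.finite_measure_axioms, where C=1]; use J0 in simp)+
  have "\<bar>(\<integral>x. exp (- (s * ?J x)) \<partial>P) - (\<integral>x. exp (- (s * ?J' x)) \<partial>P)\<bar>
      = \<bar>\<integral>x. exp (- (s * ?J x)) - exp (- (s * ?J' x)) \<partial>P\<bar>" using inte by simp
  also have "\<dots> \<le> (\<integral>x. \<bar>exp (- (s * ?J x)) - exp (- (s * ?J' x))\<bar> \<partial>P)" by (rule integral_abs_bound)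
  also have "\<dots> \<le> (\<integral>x. s * \<bar>?J x - ?J' x\<bar> \<partial>P)"
  proof (rule integral_mono)
    fix x
    have "\<bar>exp (- (s * ?J x)) - exp (- (s * ?J' x))\<bar> \<le> \<bar>s * ?J x - s * ?J' x\<bar>"
      by (rule exp_minus_diff_le[OF J0 J0])
    then show "\<bar>exp (- (s * ?J x)) - exp (- (s * ?J' x))\<bar> \<le> s * \<bar>?J x - ?J' x\<bar>"
      using s by (simp add: right_diff_distrib[symmetric] abs_mult)
  qed (use int_d inte in auto)
  also have "\<dots> \<le> s * (\<integral>t. ?\<delta> t * w t \<partial>lborel)" using E s by (simp add: mult_left_mono)
  finally show ?thesis .
qed

text \<open>On the preimage of y \<noteq> 0 the bound on q forces norm t to be at least half of norm
  y, so this preimage has finite mass under w. The preimage of 0 may have infinite mass, which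
  \<open>f 0 = 0\<close> makes harmless; its weight is set to 0.\<close>

lemma weighted_norm_simple:
  fixes q :: "'t::euclidean_space \<Rightarrow> 't"
  assumes q: "simple_function lborel q" and q2: "\<And>t. norm (q t) \<le> 2 * norm t"
    and w[measurable]: "w \<in> borel_measurable borel" and w0: "\<And>t. w t \<ge> 0"
    and int: "integrable lborel (\<lambda>t. trunc_sq t * w t)" and f0: "f 0 = 0"
  shows "weighted_norm w (\<lambda>t. f (q t))
    = (\<Sum>y\<in>range q. (if y = 0 then 0 else \<integral>t. indicator (q -` {y}) t * w t \<partial>lborel) * (cmod (f y))\<^sup>2)"
proof -
  have fin: "finite (range q)" using simple_functionD(1)[OF q] by simp
  have [measurable]: "q -` {y} \<in> sets borel" for y
    using simple_functionD(2)[OF q, of "{y}"] by simp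
  have ind: "integrable lborel (\<lambda>t. indicator (q -` {y}) t * w t)" if "y \<noteq> 0" for y
  proof (rule Bochner_Integration.integrable_bound[OF integrable_mult_right[OF int, of "4 / trunc_sq y"]])
    have pos: "trunc_sq y > 0" using that by (simp add: trunc_sq_def)
    show "AE t in lborel. norm (indicator (q -` {y}) t * w t) \<le> norm (4 / trunc_sq y * (trunc_sq t * w t))"
    proof (rule AE_I2)
      fix t
      show "norm (indicator (q -` {y}) t * w t) \<le> norm (4 / trunc_sq y * (trunc_sq t * w t))"
      proof (cases "q t = y")
        case True
        have "(norm y)\<^sup>2 \<le> (2 * norm t)\<^sup>2" by (rule power_mono) (use q2[of t] True in auto)
        then have "trunc_sq y \<le> 4 * trunc_sq t" by (auto simp: trunc_sq_def power_mult_distrib min_def)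
        then have "1 \<le> 4 / trunc_sq y * trunc_sq t" using pos by (simp add: field_simps)
        then have "1 * w t \<le> 4 / trunc_sq y * trunc_sq t * w t" by (intro mult_right_mono w0)
        then show ?thesis using True w0[of t] by (simp add: abs_mult mult.assoc)
      qed simp
    qed
  qed simp
  have "(cmod (f (q t)))\<^sup>2 * w t = (\<Sum>y\<in>range q. (if y = 0 then 0 else indicator (q -` {y}) t * w t) * (cmod (f y))\<^sup>2)" for t
  proof -
    have "(\<Sum>y\<in>range q. (if y = 0 then 0 else indicator (q -` {y}) t * w t) * (cmod (f y))\<^sup>2)
        = (\<Sum>y\<in>range q. if y = q t then (cmod (f (q t)))\<^sup>2 * w t else 0)"
      by (rule sum.cong) (auto simp: f0)
    then show ?thesis using fin by simp
  qed
  then have "weighted_norm w (\<lambda>t. f (q t))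
      = (\<integral>t. (\<Sum>y\<in>range q. (if y = 0 then 0 else indicator (q -` {y}) t * w t) * (cmod (f y))\<^sup>2) \<partial>lborel)"
    by (simp add: weighted_norm_def)
  also have "\<dots> = (\<Sum>y\<in>range q. \<integral>t. (if y = 0 then 0 else indicator (q -` {y}) t * w t) * (cmod (f y))\<^sup>2 \<partial>lborel)"
  proof (rule Bochner_Integration.integral_sum)
    show "integrable lborel (\<lambda>t. (if y = 0 then 0 else indicator (q -` {y}) t * w t) * (cmod (f y))\<^sup>2)" for y
      using ind[of y] by (cases "y = 0") simp_all
  qed
  also have "\<dots> = (\<Sum>y\<in>range q. (if y = 0 then 0 else \<integral>t. indicator (q -` {y}) t * w t \<partial>lborel) * (cmod (f y))\<^sup>2)"
  proof (intro sum.cong refl)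
    fix y
    show "(\<integral>t. (if y = 0 then 0 else indicator (q -` {y}) t * w t) * (cmod (f y))\<^sup>2 \<partial>lborel)
      = (if y = 0 then 0 else \<integral>t. indicator (q -` {y}) t * w t \<partial>lborel) * (cmod (f y))\<^sup>2"
      by (cases "y = 0") simp_all
  qed
  finally show ?thesis .
qed

text \<open>The parameter t is replaced by a simple function of t, whereupon the norm is a finite
  weighted sum of squares and finite-dimensional convergence applies. The error of the replacement
  is bounded through the common modulus \<kappa>, uniformly in n and also for the limit, and
  vanishes by dominated convergence as the simple functions refine.\<close>

theorem laplace_weighted_norm_tendsto:
  fixes \<xi> :: "nat \<Rightarrow> 't::euclidean_space \<Rightarrow> 'a \<Rightarrow> complex" and \<zeta> :: "'t \<Rightarrow> 'b \<Rightarrow> complex"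
  assumes M: "prob_space M" and N: "prob_space N"
    and \<xi>m: "\<And>n. (\<lambda>(t, x). \<xi> n t x) \<in> borel_measurable (lborel \<Otimes>\<^sub>M M)"
    and \<zeta>m: "(\<lambda>(t, x). \<zeta> t x) \<in> borel_measurable (lborel \<Otimes>\<^sub>M N)"
    and w[measurable]: "w \<in> borel_measurable borel" and w0: "\<And>t. w t \<ge> 0"
    and int: "integrable lborel (\<lambda>t. trunc_sq t * w t)"
    and \<xi>i: "\<And>n t. sq_integrable M (\<xi> n t)" and \<zeta>i: "\<And>t. sq_integrable N (\<zeta> t)"
    and \<xi>V: "\<And>n t. sq_norm M (\<xi> n t) \<le> C * trunc_sq t" and \<zeta>V: "\<And>t. sq_norm N (\<zeta> t) \<le> C * trunc_sq t"
    and \<xi>\<kappa>: "\<And>n s t. sq_norm M (\<lambda>x. \<xi> n t x - \<xi> n s x) \<le> \<kappa> t s"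
    and \<zeta>\<kappa>: "\<And>s t. sq_norm N (\<lambda>x. \<zeta> t x - \<zeta> s x) \<le> \<kappa> t s"
    and \<kappa>m[measurable]: "(\<lambda>(t, s). \<kappa> t s) \<in> borel_measurable (borel \<Otimes>\<^sub>M borel)"
    and \<kappa>: "\<And>t r. r \<longlonglongrightarrow> t \<Longrightarrow> (\<lambda>i. \<kappa> t (r i)) \<longlonglongrightarrow> 0"
    and \<xi>0: "\<And>n x. \<xi> n 0 x = 0" and \<zeta>0: "\<And>x. \<zeta> 0 x = 0"
    and char: "\<And>F \<alpha> \<beta>. finite F \<Longrightarrow>
       (\<lambda>n. \<integral>x. iexp (rcomb F \<alpha> \<beta> (\<xi> n) x) \<partial>M) \<longlonglongrightarrow> (\<integral>x. iexp (rcomb F \<alpha> \<beta> \<zeta> x) \<partial>N)"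
    and s: "s \<ge> 0"
  shows "(\<lambda>n. \<integral>x. exp (- (s * weighted_norm w (\<lambda>t. \<xi> n t x))) \<partial>M)
     \<longlonglongrightarrow> (\<integral>x. exp (- (s * weighted_norm w (\<lambda>t. \<zeta> t x))) \<partial>N)"
proof -
  have C0: "C * trunc_sq t \<ge> 0" for t :: 't
    using order_trans[OF sq_norm_nonneg \<zeta>V[of t]] .
  \<comment> \<open>The base point 0 of the approximation gives
    \<open>norm (q i t) \<le> 2 * norm t\<close>; hence the rounded parameter loses at most a factor
    4 in \<open>trunc_sq\<close>, and the origin is never mapped away from itself.\<close>
  obtain q where q: "\<And>i. simple_function lborel (q i)" "\<And>t. (\<lambda>i. q i t) \<longlonglongrightarrow> t"
      "\<And>i t. norm (q i t) \<le> 2 * norm (t :: 't)"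
    using borel_measurable_implies_sequence_metric[of "\<lambda>t::'t. t" lborel 0] by auto
  have qm[measurable]: "q i \<in> borel_measurable borel" for i
    using borel_measurable_simple_function[OF q(1)] by simp
  have trunc_q: "trunc_sq (q i t) \<le> 4 * trunc_sq t" for i t
  proof -
    have "(norm (q i t))\<^sup>2 \<le> (2 * norm t)\<^sup>2" by (rule power_mono) (use q(3) in auto)
    then show ?thesis by (auto simp: trunc_sq_def power_mult_distrib min_def)
  qed
  let ?V = "\<lambda>t::'t. C * trunc_sq t" and ?V' = "\<lambda>t::'t. 4 * (C * trunc_sq t)"
  \<comment> \<open>The modulus makes this small as i grows; the cap by the trivial bound on the
    difference supplies an integrable majorant, which \<kappa> alone does not.\<close>
  define D where "D i t = min (max 0 (\<kappa> t (q i t))) (2 * ?V t + 2 * ?V' t)" for i and t :: 't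
  have D0: "D i t \<ge> 0" for i t using C0[of t] by (auto simp: D_def)
  have Dm[measurable]: "D i \<in> borel_measurable borel" for i unfolding D_def by measurable
  let ?\<delta> = "\<lambda>i t. sqrt (D i t) * sqrt (2 * ?V t + 2 * ?V' t) * w t"
  have C_trunc_q: "C * trunc_sq (q i t) \<le> ?V' t" for i t
  proof (cases "C \<ge> 0")
    case True
    then show ?thesis using mult_left_mono[OF trunc_q[of i t] True] by simp
  next
    case False
    then have "C * trunc_sq (q i t) \<le> 0" by (intro mult_nonpos_nonneg) auto
    then show ?thesis using C0[of t] by linarith
  qed
  have Vint: "integrable lborel (\<lambda>t. ?V t * w t)" "integrable lborel (\<lambda>t. ?V' t * w t)"
    using integrable_mult_right[OF int, of C] integrable_mult_right[OF int, of "4 * C"]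
    by (simp_all add: mult.assoc)
  have \<delta>_le: "norm (?\<delta> i t) \<le> (2 * ?V t + 2 * ?V' t) * w t" for i t
  proof -
    have "sqrt (D i t) \<le> sqrt (2 * ?V t + 2 * ?V' t)" by (simp add: D_def)
    then have "sqrt (D i t) * sqrt (2 * ?V t + 2 * ?V' t) \<le> sqrt (2 * ?V t + 2 * ?V' t) * sqrt (2 * ?V t + 2 * ?V' t)"
      using C0[of t] by (intro mult_right_mono) auto
    also have "\<dots> = 2 * ?V t + 2 * ?V' t" using C0[of t] by (intro real_sqrt_mult_self[THEN trans]) auto
    finally have "?\<delta> i t \<le> (2 * ?V t + 2 * ?V' t) * w t" by (intro mult_right_mono w0)
    moreover have "?\<delta> i t \<ge> 0" using D0 C0[of t] w0[of t] by auto
    ultimately show ?thesis by simp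
  qed
  have dom: "integrable lborel (\<lambda>t. (2 * ?V t + 2 * ?V' t) * w t)"
    using integrable_mult_right[OF Vint(1), of 10] by (simp add: algebra_simps)
  have \<delta>int: "integrable lborel (?\<delta> i)" for i
    by (rule Bochner_Integration.integrable_bound[OF dom])
       (use \<delta>_le in \<open>auto intro: order_trans[OF _ abs_ge_self]\<close>)
  have \<delta>lim: "(\<lambda>i. \<integral>t. ?\<delta> i t \<partial>lborel) \<longlonglongrightarrow> (\<integral>t. 0 \<partial>(lborel :: 't measure))"
  proof (rule integral_dominated_convergence[OF _ _ dom])
    show "AE t in lborel. (\<lambda>i. ?\<delta> i t) \<longlonglongrightarrow> 0"
    proof (rule AE_I2)
      fix t
      have "(\<lambda>i. max 0 (\<kappa> t (q i t))) \<longlonglongrightarrow> max 0 0"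
        by (intro tendsto_max tendsto_const \<kappa> q(2))
      then have "(\<lambda>i. D i t) \<longlonglongrightarrow> min 0 (2 * ?V t + 2 * ?V' t)"
        unfolding D_def by (intro tendsto_min tendsto_const) simp
      then have "(\<lambda>i. D i t) \<longlonglongrightarrow> 0" using C0[of t] by (simp add: min_absorb1)
      then have "(\<lambda>i. ?\<delta> i t) \<longlonglongrightarrow> sqrt 0 * sqrt (2 * ?V t + 2 * ?V' t) * w t"
        by (intro tendsto_intros)
      then show "(\<lambda>i. ?\<delta> i t) \<longlonglongrightarrow> 0" by simp
    qed
    show "AE t in lborel. norm (?\<delta> i t) \<le> (2 * ?V t + 2 * ?V' t) * w t" for i
      using \<delta>_le by auto
  qed auto
  have near: "norm ((\<integral>x. exp (- (s * weighted_norm w (\<lambda>t. Z t x))) \<partial>P) - (\<integral>x. exp (- (s * weighted_norm w (\<lambda>t. Z (q i t) x))) \<partial>P))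
      \<le> s * (\<integral>t. ?\<delta> i t \<partial>lborel)"
    if P: "prob_space P" and Zm[measurable]: "(\<lambda>(t, x). Z t x) \<in> borel_measurable (lborel \<Otimes>\<^sub>M P)"
      and Zi: "\<And>t. sq_integrable P (Z t)" and ZV: "\<And>t. sq_norm P (Z t) \<le> C * trunc_sq t"
      and Z\<kappa>: "\<And>s t. sq_norm P (\<lambda>x. Z t x - Z s x) \<le> \<kappa> t s"
    for P :: "'z measure" and Z :: "'t \<Rightarrow> 'z \<Rightarrow> complex" and i
    unfolding real_norm_def
  proof (rule laplace_weighted_norm_compare[OF P Zm _ w w0 Zi ZV Vint(1) Zi _ Vint(2) _ \<delta>int s])
    have "(\<lambda>z. (q i (fst z), snd z)) \<in> measurable (lborel \<Otimes>\<^sub>M P) (lborel \<Otimes>\<^sub>M P)"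
      by measurable
    from measurable_compose[OF this Zm]
    show "(\<lambda>(t, x). Z (q i t) x) \<in> borel_measurable (lborel \<Otimes>\<^sub>M P)" by (simp add: case_prod_unfold)
    show V': "sq_norm P (Z (q i t)) \<le> ?V' t" for t
      by (rule order_trans[OF ZV C_trunc_q])
    show "sq_norm P (\<lambda>x. Z t x - Z (q i t) x) \<le> D i t" for t
      unfolding D_def
    proof (rule min.boundedI)
      show "sq_norm P (\<lambda>x. Z t x - Z (q i t) x) \<le> max 0 (\<kappa> t (q i t))"
        using Z\<kappa>[of t "q i t"] by simp
      show "sq_norm P (\<lambda>x. Z t x - Z (q i t) x) \<le> 2 * ?V t + 2 * ?V' t"
        using sq_integrable_diff(2)[OF Zi[of t] Zi[of "q i t"]] ZV[of t] V'[of t] by linarith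
    qed
  qed
  show ?thesis
  proof (rule tendsto_by_approximation)
    show "\<forall>\<^sub>F n in sequentially. norm ((\<integral>x. exp (- (s * weighted_norm w (\<lambda>t. \<xi> n t x))) \<partial>M)
        - (\<integral>x. exp (- (s * weighted_norm w (\<lambda>t. \<xi> n (q i t) x))) \<partial>M)) \<le> s * (\<integral>t. ?\<delta> i t \<partial>lborel)" for i
      by (intro always_eventually allI near[OF M \<xi>m \<xi>i \<xi>V \<xi>\<kappa>])
    show "norm ((\<integral>x. exp (- (s * weighted_norm w (\<lambda>t. \<zeta> t x))) \<partial>N)
        - (\<integral>x. exp (- (s * weighted_norm w (\<lambda>t. \<zeta> (q i t) x))) \<partial>N)) \<le> s * (\<integral>t. ?\<delta> i t \<partial>lborel)" for i
      by (rule near[OF N \<zeta>m \<zeta>i \<zeta>V \<zeta>\<kappa>])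
    show "(\<lambda>i. s * (\<integral>t. ?\<delta> i t \<partial>lborel)) \<longlonglongrightarrow> 0"
      using tendsto_mult_right_zero[OF \<delta>lim[simplified]] by simp
    fix i
    define c where "c y = (if y = 0 then 0 else \<integral>t. indicator (q i -` {y}) t * w t \<partial>lborel)" for y
    have c0: "s * c y \<ge> 0" for y
      using s w0 by (auto simp: c_def intro!: mult_nonneg_nonneg integral_nonneg_AE)
    have fin: "finite (range (q i))" using simple_functionD(1)[OF q(1)[of i]] by simp
    have S: "s * weighted_norm w (\<lambda>t. Z (q i t) x) = (\<Sum>y\<in>range (q i). (s * c y) * (cmod (Z y x))\<^sup>2)"
      if "Z 0 x = 0" for Z :: "'t \<Rightarrow> 'z \<Rightarrow> complex" and x
      using weighted_norm_simple[OF q(1)[of i] q(3) w w0 int, of "\<lambda>t. Z t x"] that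
      by (simp add: sum_distrib_left mult.assoc c_def)
    have S\<xi>: "s * weighted_norm w (\<lambda>t. \<xi> n (q i t) x) = (\<Sum>y\<in>range (q i). (s * c y) * (cmod (\<xi> n y x))\<^sup>2)" for n x
      by (rule S) (rule \<xi>0)
    have S\<zeta>: "s * weighted_norm w (\<lambda>t. \<zeta> (q i t) x) = (\<Sum>y\<in>range (q i). (s * c y) * (cmod (\<zeta> y x))\<^sup>2)" for x
      by (rule S) (rule \<zeta>0)
    have "(\<lambda>n. \<integral>x. exp (- (\<Sum>y\<in>range (q i). (s * c y) * (cmod (\<xi> n y x))\<^sup>2)) \<partial>M)
        \<longlonglongrightarrow> (\<integral>x. exp (- (\<Sum>y\<in>range (q i). (s * c y) * (cmod (\<zeta> y x))\<^sup>2)) \<partial>N)"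
      by (rule laplace_fdd_tendsto[OF M N fin])
         (intro sq_integrableD(1) \<xi>i \<zeta>i c0 char fin)+
    then show "(\<lambda>n. \<integral>x. exp (- (s * weighted_norm w (\<lambda>t. \<xi> n (q i t) x))) \<partial>M)
        \<longlonglongrightarrow> (\<integral>x. exp (- (s * weighted_norm w (\<lambda>t. \<zeta> (q i t) x))) \<partial>N)"
      by (simp only: S\<xi> S\<zeta>)
  qed
qed

subsection \<open>Components and samples\<close>

lemma borel_measurable_vec_nth [measurable]: "(\<lambda>x::real ^ 'n::finite. x $ i) \<in> borel_measurable borel"
  by (intro borel_measurable_continuous_onI continuous_intros)

lemma borel_measurable_vec_lambda:
  fixes f :: "'n::finite \<Rightarrow> 'a \<Rightarrow> real"
  assumes [measurable]: "\<And>i. f i \<in> borel_measurable M"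
  shows "(\<lambda>x. \<chi> i. f i x) \<in> borel_measurable M"
proof (subst borel_measurable_euclidean_space, rule ballI)
  fix e :: "real ^ 'n" assume "e \<in> Basis"
  then obtain i where "e = axis i 1" by (auto simp: Basis_vec_def)
  then show "(\<lambda>x. (\<chi> i. f i x) \<bullet> e) \<in> borel_measurable M" by (simp add: inner_axis)
qed

lemma component_inner_eq: "component_inner b j t x = (\<Sum>i\<in>block b j. t $ i * x $ i)"
  unfolding component_inner_def component_def by (intro sum.cong) auto

lemma component_inner_measurable [measurable]:
  "(\<lambda>p. component_inner b j (fst p) (snd p)) \<in> borel_measurable (borel \<Otimes>\<^sub>M borel)"
  unfolding component_inner_eq by measurable

lemma component_inner_measurable' [measurable (raw)]:
  assumes "f \<in> borel_measurable M" "g \<in> borel_measurable M"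
  shows "(\<lambda>x. component_inner b j (f x) (g x)) \<in> borel_measurable M"
  using measurable_compose[OF measurable_Pair[OF assms] component_inner_measurable] by simp

lemma component_measurable [measurable]: "component b j \<in> measurable borel (component_lebesgue b j)"
  unfolding component_def component_lebesgue_def by (rule measurable_restrict) simp

lemma component_inner_component:
  "component b j x = component b j y \<Longrightarrow> component_inner b j t x = component_inner b j t y"
  unfolding component_inner_def by simp

lemma component_inner_diff: "component_inner b j (t - s) x = component_inner b j t x - component_inner b j s x"
  unfolding component_inner_eq by (simp add: left_diff_distrib sum_subtractf)

lemma component_inner_minus: "component_inner b j (- t) x = - component_inner b j t x"
  unfolding component_inner_eq by (simp add: sum_negf)

lemma component_inner_zero [simp]: "component_inner b j 0 x = 0"
  unfolding component_inner_eq by simp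

lemma sum_component_inner:
  assumes "range b = {1..d}"
  shows "(\<Sum>j=1..d. component_inner b j t x) = t \<bullet> x"
proof -
  have "(\<Sum>j\<in>{1..d}. \<Sum>i\<in>{i\<in>UNIV. b i = j}. t $ i * x $ i) = (\<Sum>i\<in>UNIV. t $ i * x $ i)"
    by (rule sum.group) (use assms in auto)
  then show ?thesis by (simp add: component_inner_eq block_def inner_vec_def)
qed

lemma abs_component_inner_le: "\<bar>component_inner b j t x\<bar> \<le> norm t * norm x"
proof -
  let ?u = "(\<chi> i. if b i = j then t $ i else 0) :: real ^ 'a"
  have "component_inner b j t x = ?u \<bullet> x"
    unfolding component_inner_eq block_def inner_vec_def
    by (simp add: sum.If_cases if_distrib[of "\<lambda>z. z * _"] Int_def cong: if_cong)
  also have "\<bar>\<dots>\<bar> \<le> norm ?u * norm x" by (rule Cauchy_Schwarz_ineq2)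
  also have "\<dots> \<le> norm t * norm x"
    by (intro mult_right_mono norm_le_componentwise_cart) auto
  finally show ?thesis .
qed

text \<open>Assembles a vector whose block j comes from vector number \<open>r j\<close>. A constant
  r returns a sample vector; r j = \<open>cyclic n (k + j - 1)\<close> gives the shifted vector
  behind \<open>ecf_star\<close>.\<close>

definition mix :: "('n::finite \<Rightarrow> nat) \<Rightarrow> (nat \<Rightarrow> nat) \<Rightarrow> (nat \<Rightarrow> real ^ 'n) \<Rightarrow> real ^ 'n" where
  "mix b r x = (\<chi> i. x (r (b i)) $ i)"

lemma component_mix: "component b j (mix b r x) = component b j (x (r j))"
  unfolding component_def mix_def by (auto simp: block_def restrict_def)

lemma component_inner_mix: "component_inner b j t (mix b r x) = component_inner b j t (x (r j))"
  by (rule component_inner_component[OF component_mix])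

lemma mix_const [simp]: "mix b (\<lambda>_. k) x = x k"
  by (simp add: mix_def)

lemma (in prob_space) indep_vars_reindex:
  assumes inj: "inj_on \<rho> P" and ind: "indep_vars M' X (\<rho> ` P)"
  shows "indep_vars (\<lambda>p. M' (\<rho> p)) (\<lambda>p. X (\<rho> p)) P"
proof -
  let ?F = "\<lambda>i. {X i -` A \<inter> space M | A. A \<in> sets (M' i)}"
  have sets: "indep_sets ?F (\<rho> ` P)" and rv: "\<And>p. p \<in> P \<Longrightarrow> random_variable (M' (\<rho> p)) (X (\<rho> p))"
    using ind by (auto simp: indep_vars_def2)
  have "indep_sets (\<lambda>p. ?F (\<rho> p)) P"
  proof (rule indep_setsI)
    show "?F (\<rho> i) \<subseteq> events" if "i \<in> P" for i
      using rv[OF that] by (auto intro: measurable_sets)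
    fix A J assume J: "J \<noteq> {}" "J \<subseteq> P" "finite J" and A: "\<forall>j\<in>J. A j \<in> ?F (\<rho> j)"
    have injJ: "inj_on \<rho> J" using inj J(2) by (rule inj_on_subset)
    let ?A = "\<lambda>i. A (inv_into J \<rho> i)"
    have "prob (\<Inter>i\<in>\<rho> ` J. ?A i) = (\<Prod>i\<in>\<rho> ` J. prob (?A i))"
    proof (rule indep_setsD[OF sets])
      show "\<rho> ` J \<subseteq> \<rho> ` P" "\<rho> ` J \<noteq> {}" "finite (\<rho> ` J)" using J by auto
      show "\<forall>j\<in>\<rho> ` J. ?A j \<in> ?F j" using A injJ by (auto simp: inv_into_f_f)
    qed
    then show "prob (\<Inter>j\<in>J. A j) = (\<Prod>j\<in>J. prob (A j))"
      using injJ by (simp add: prod.reindex inv_into_f_f)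
  qed
  then show ?thesis using rv by (auto simp: indep_vars_def2)
qed

section \<open>Sample expectations and component characteristic functions\<close>

locale sample = prob_space M for M :: "'w measure" +
  fixes X :: "'w \<Rightarrow> real ^ 'n::finite" and Xs :: "nat \<Rightarrow> 'w \<Rightarrow> real ^ 'n"
    and b :: "'n \<Rightarrow> nat" and d :: nat
  assumes range_b: "range b = {1..d}"
    and X_measurable [measurable]: "X \<in> borel_measurable M"
    and Xs_indep: "indep_vars (\<lambda>_. borel) Xs {1..}"
    and Xs_law: "\<And>k. k \<ge> 1 \<Longrightarrow> distr M borel (Xs k) = distr M borel X"
begin

lemma d_pos: "d \<ge> 1"
  using range_b rangeI[of b undefined] by (auto simp del: rangeI)

lemma Xs_measurable [measurable]: "k \<ge> 1 \<Longrightarrow> Xs k \<in> borel_measurable M"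
  using Xs_indep by (auto simp: indep_vars_def)

lemma expectation_Xs:
  fixes f :: "real ^ 'n \<Rightarrow> 'b::{banach, second_countable_topology}"
  assumes "k \<ge> 1" and [measurable]: "f \<in> borel_measurable borel"
  shows "(\<integral>\<omega>. f (Xs k \<omega>) \<partial>M) = (\<integral>\<omega>. f (X \<omega>) \<partial>M)"
proof -
  have [measurable]: "Xs k \<in> borel_measurable M" using assms by simp
  have "(\<integral>\<omega>. f (Xs k \<omega>) \<partial>M) = (\<integral>x. f x \<partial>distr M borel (Xs k))"
    by (simp add: integral_distr)
  also have "\<dots> = (\<integral>\<omega>. f (X \<omega>) \<partial>M)"
    unfolding Xs_law[OF assms(1)] by (simp add: integral_distr)
  finally show ?thesis .
qed

lemma expectation_prod_Xs:
  fixes g :: "'p \<Rightarrow> real ^ 'n \<Rightarrow> complex"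
  assumes P: "finite P" and inj: "inj_on \<rho> P" and \<rho>: "\<And>p. p \<in> P \<Longrightarrow> \<rho> p \<ge> 1"
    and g: "\<And>p. p \<in> P \<Longrightarrow> g p \<in> borel_measurable borel" and bd: "\<And>p x. p \<in> P \<Longrightarrow> norm (g p x) \<le> C p"
  shows "(\<integral>\<omega>. (\<Prod>p\<in>P. g p (Xs (\<rho> p) \<omega>)) \<partial>M) = (\<Prod>p\<in>P. \<integral>\<omega>. g p (X \<omega>) \<partial>M)"
proof -
  have "indep_vars (\<lambda>_. borel) Xs (\<rho> ` P)"
    by (rule indep_vars_subset[OF Xs_indep]) (use \<rho> in auto)
  from indep_vars_reindex[OF inj this]
  have ind: "indep_vars (\<lambda>_. borel) (\<lambda>p \<omega>. g p (Xs (\<rho> p) \<omega>)) P"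
    by (rule indep_vars_compose2) (use g in auto)
  have int: "integrable M (\<lambda>\<omega>. g p (Xs (\<rho> p) \<omega>))" if p: "p \<in> P" for p
  proof -
    have [measurable]: "g p \<in> borel_measurable borel" "Xs (\<rho> p) \<in> borel_measurable M"
      using g \<rho> p by auto
    show ?thesis
      by (rule integrable_bounded[OF finite_measure_axioms _ bd[OF p]]) measurable
  qed
  have "(\<integral>\<omega>. (\<Prod>p\<in>P. g p (Xs (\<rho> p) \<omega>)) \<partial>M) = (\<Prod>p\<in>P. \<integral>\<omega>. g p (Xs (\<rho> p) \<omega>) \<partial>M)"
    by (rule indep_vars_lebesgue_integral[OF P ind int])
  also have "\<dots> = (\<Prod>p\<in>P. \<integral>\<omega>. g p (X \<omega>) \<partial>M)"
    by (intro prod.cong refl expectation_Xs) (use \<rho> g in auto)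
  finally show ?thesis .
qed

abbreviation "\<phi> \<equiv> component_char M b X"

definition ch :: "nat \<Rightarrow> real ^ 'n \<Rightarrow> real ^ 'n \<Rightarrow> complex" where
  "ch j t x = iexp (component_inner b j t x)"

lemma ch_measurable [measurable]: "ch j t \<in> borel_measurable borel"
  unfolding ch_def by measurable

lemma norm_ch [simp]: "cmod (ch j t x) = 1"
  unfolding ch_def by simp

lemma component_char_eq: "\<phi> j t = (\<integral>\<omega>. ch j t (X \<omega>) \<partial>M)"
  unfolding component_char_def ch_def ..

lemma prod_ch: "(\<Prod>j=1..d. ch j t x) = iexp (t \<bullet> x)"
proof -
  have "(\<Prod>j=1..d. ch j t x) = exp (\<Sum>j=1..d. \<i> * complex_of_real (component_inner b j t x))"
    unfolding ch_def by (rule exp_sum[symmetric]) simp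
  also have "\<dots> = iexp (\<Sum>j=1..d. component_inner b j t x)"
    by (simp only: sum_distrib_left of_real_sum)
  finally show ?thesis by (simp only: sum_component_inner[OF range_b])
qed

lemma prod_ch_mix: "iexp (t \<bullet> mix b r x) = (\<Prod>j=1..d. ch j t (x (r j)))"
  unfolding prod_ch[symmetric] by (simp add: ch_def component_inner_mix)

lemma ch_minus: "ch j (- t) x = cnj (ch j t x)"
  unfolding ch_def by (simp add: component_inner_minus exp_cnj)

lemma ch_component: "component b j x = component b j y \<Longrightarrow> ch j t x = ch j t y"
  using component_inner_component[of b j x y t] by (simp only: ch_def)

lemma norm_component_char: "cmod (\<phi> j t) \<le> 1"
proof -
  have "cmod (\<phi> j t) \<le> (\<integral>\<omega>. cmod (ch j t (X \<omega>)) \<partial>M)"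
    unfolding component_char_eq by (rule integral_norm_bound)
  then show ?thesis by (simp add: prob_space)
qed

lemma component_char_cnj: "\<phi> j (- t) = cnj (\<phi> j t)"
  unfolding component_char_eq ch_minus by (simp add: integral_cnj)

lemma mix_Xs_measurable [measurable]:
  assumes "\<And>j. j \<in> {1..d} \<Longrightarrow> r j \<ge> 1"
  shows "(\<lambda>\<omega>. mix b r (\<lambda>k. Xs k \<omega>)) \<in> borel_measurable M"
proof -
  have [measurable]: "Xs (r (b i)) \<in> borel_measurable M" for i
    using assms[of "b i"] rangeI[of b i] unfolding range_b by auto
  show ?thesis unfolding mix_def by (rule borel_measurable_vec_lambda) measurable
qed

lemma char_mix:
  assumes inj: "inj_on r {1..d}" and r: "\<And>j. j \<in> {1..d} \<Longrightarrow> r j \<ge> 1"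
  shows "(\<integral>\<omega>. iexp (t \<bullet> mix b r (\<lambda>k. Xs k \<omega>)) \<partial>M) = (\<Prod>j=1..d. \<phi> j t)"
  unfolding prod_ch_mix component_char_eq
  by (rule expectation_prod_Xs[where C="\<lambda>_. 1"]) (use inj r in auto)

text \<open>A mix over distinct indices draws its blocks from independent vectors, and independence
  of the components is a property of the joint law alone: it says that this law is the product of
  the laws of the components.\<close>

lemma distr_mix_components_independent:
  assumes r: "inj_on r {1..d}" "\<And>j. j \<in> {1..d} \<Longrightarrow> r j \<ge> 1"
    and law: "distr M borel X = distr M borel (\<lambda>\<omega>. mix b r (\<lambda>k. Xs k \<omega>))"
  shows "components_independent M b d X"
proof -
  let ?Y = "\<lambda>\<omega>. mix b r (\<lambda>k. Xs k \<omega>)"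
  have [measurable]: "?Y \<in> borel_measurable M" by (rule mix_Xs_measurable[OF r(2)])
  have "indep_vars (\<lambda>_. borel) Xs (r ` {1..d})"
    by (rule indep_vars_subset[OF Xs_indep]) (use r in auto)
  from indep_vars_reindex[OF r(1) this]
  have "indep_vars (component_lebesgue b) (\<lambda>j \<omega>. component b j (Xs (r j) \<omega>)) {1..d}"
    by (rule indep_vars_compose2) measurable
  then have indY: "indep_vars (component_lebesgue b) (\<lambda>j \<omega>. component b j (?Y \<omega>)) {1..d}"
    by (simp only: component_mix)
  have ne: "{1..d} \<noteq> {}" using d_pos by auto
  let ?f = "\<lambda>x. \<lambda>j\<in>{1..d}. component b j (x :: real ^ 'n)"
  let ?P = "PiM {1..d} (component_lebesgue b)"
  have f[measurable]: "?f \<in> measurable borel ?P" by (rule measurable_restrict) measurable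
  have tr: "distr M ?P (\<lambda>\<omega>. ?f (Z \<omega>)) = distr (distr M borel Z) ?P ?f"
      "distr M (component_lebesgue b j) (\<lambda>\<omega>. component b j (Z \<omega>)) = distr (distr M borel Z) (component_lebesgue b j) (component b j)"
    if [measurable]: "Z \<in> borel_measurable M" for Z j
    by (simp_all add: distr_distr comp_def)
  have "distr M ?P (\<lambda>\<omega>. ?f (?Y \<omega>)) = PiM {1..d} (\<lambda>j. distr M (component_lebesgue b j) (\<lambda>\<omega>. component b j (?Y \<omega>)))"
    using indY indep_vars_iff_distr_eq_PiM[OF ne, of "\<lambda>j \<omega>. component b j (?Y \<omega>)" "component_lebesgue b"]
    by simp
  then have "distr M ?P (\<lambda>\<omega>. ?f (X \<omega>)) = PiM {1..d} (\<lambda>j. distr M (component_lebesgue b j) (\<lambda>\<omega>. component b j (X \<omega>)))"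
    unfolding tr[OF \<open>?Y \<in> borel_measurable M\<close>] tr[OF X_measurable] law .
  then show ?thesis
    unfolding components_independent_def
    by (subst indep_vars_iff_distr_eq_PiM[OF ne]) auto
qed

text \<open>The factorised function is the characteristic function of the mix with r j = j, so by
  uniqueness X has the law of that mix.\<close>

lemma char_factorizes_imp_independent:
  assumes "\<And>t. (\<integral>\<omega>. iexp (t \<bullet> X \<omega>) \<partial>M) = (\<Prod>j=1..d. \<phi> j t)"
  shows "components_independent M b d X"
proof (rule distr_mix_components_independent[of "\<lambda>j. j"])
  have [measurable]: "(\<lambda>\<omega>. mix b (\<lambda>j. j) (\<lambda>k. Xs k \<omega>)) \<in> borel_measurable M"
    by (rule mix_Xs_measurable) auto
  show "distr M borel X = distr M borel (\<lambda>\<omega>. mix b (\<lambda>j. j) (\<lambda>k. Xs k \<omega>))"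
  proof (rule measure_eqI_char)
    fix t :: "real ^ 'n"
    show "(\<integral>x. iexp (t \<bullet> x) \<partial>distr M borel X) = (\<integral>x. iexp (t \<bullet> x) \<partial>distr M borel (\<lambda>\<omega>. mix b (\<lambda>j. j) (\<lambda>k. Xs k \<omega>)))"
      using assms[of t] char_mix[of "\<lambda>j. j" t] by (simp add: integral_distr)
  qed (simp_all add: prob_space_distr)
qed auto

end

section \<open>Arithmetic of cyclic indices\<close>

lemma cyclic_ge_1: "cyclic n k \<ge> 1"
  by (simp add: cyclic_def)

lemma cyclic_id: "1 \<le> k \<Longrightarrow> k \<le> n \<Longrightarrow> cyclic n k = k"
  by (simp add: cyclic_def)

lemma cyclic_inj:
  assumes "cyclic n k = cyclic n l" "1 \<le> k" "1 \<le> l" "k < l + n" "l < k + n"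
  shows "k = l"
proof -
  have *: "k = l" if "(k - 1) mod n = (l - 1) mod n" "1 \<le> k" "k \<le> l" "l < k + n" for k l :: nat
  proof -
    have "n dvd (l - 1) - (k - 1)"
      using that mod_eq_dvd_iff_nat[of "k - 1" "l - 1" n] by (simp add: eq_commute)
    then have "n dvd l - k" using that by simp
    moreover have "l - k < n" using that by linarith
    ultimately have "l - k = 0" by (metis dvd_imp_le not_less neq0_conv)
    then show ?thesis using that by simp
  qed
  have "(k - 1) mod n = (l - 1) mod n" using assms(1) by (simp add: cyclic_def)
  then show ?thesis using *[of k l] *[of l k] assms by (cases "k \<le> l") auto
qed

section \<open>Samples with independent components\<close>

locale independent_sample = sample M X Xs b d
  for M :: "'w measure" and X :: "'w \<Rightarrow> real ^ 'n::finite" and Xs b d +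
  assumes components_indep: "components_independent M b d X"
begin

definition comp_fun :: "nat \<Rightarrow> (real ^ 'n \<Rightarrow> 'c) \<Rightarrow> bool" where
  "comp_fun j f \<longleftrightarrow> (\<forall>x y. component b j x = component b j y \<longrightarrow> f x = f y)"

lemma expectation_prod_components:
  fixes f :: "nat \<Rightarrow> real ^ 'n \<Rightarrow> complex"
  assumes f[measurable]: "\<And>j. f j \<in> borel_measurable borel" and bd: "\<And>j x. norm (f j x) \<le> C"
    and comp: "\<And>j. j \<in> {1..d} \<Longrightarrow> comp_fun j (f j)"
  shows "(\<integral>\<omega>. (\<Prod>j=1..d. f j (X \<omega>)) \<partial>M) = (\<Prod>j=1..d. \<integral>\<omega>. f j (X \<omega>) \<partial>M)"
proof -
  \<comment> \<open>Independence is stated for the block functions, so each \<open>f j\<close> has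
    to be written as a function of its block. Padding a block with zeros gives a vector that
    \<open>f j\<close> does not distinguish from the original one.\<close>
  define emb where "emb j z = (\<chi> i. if b i = j then z i else 0)" for j and z :: "'n \<Rightarrow> real"
  have emb_m[measurable]: "emb j \<in> measurable (component_lebesgue b j) borel" for j
    unfolding emb_def
  proof (rule borel_measurable_vec_lambda)
    fix i
    show "(\<lambda>z. if b i = j then z i else 0) \<in> borel_measurable (component_lebesgue b j)"
      using measurable_component_singleton[of i "block b j" "\<lambda>_. lborel :: real measure"]
      unfolding component_lebesgue_def by (cases "b i = j") (simp_all add: block_def)
  qed
  have "component b j (emb j (component b j x)) = component b j x" for j x
    unfolding component_def emb_def by (auto simp: block_def restrict_def)
  then have f_emb: "f j (emb j (component b j x)) = f j x" if "j \<in> {1..d}" for j x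
    using comp[OF that] unfolding comp_fun_def by blast
  have "indep_vars (\<lambda>_. borel) (\<lambda>j \<omega>. f j (emb j (component b j (X \<omega>)))) {1..d}"
    using components_indep unfolding components_independent_def
    by (rule indep_vars_compose2) measurable
  then have ind: "indep_vars (\<lambda>_. borel) (\<lambda>j \<omega>. f j (X \<omega>)) {1..d}"
    by (rule indep_vars_cong[THEN iffD1, rotated -1]) (auto simp: f_emb)
  show ?thesis
  proof (rule indep_vars_lebesgue_integral[OF _ ind])
    show "integrable M (\<lambda>\<omega>. f j (X \<omega>))" for j
      by (rule integrable_bounded[OF finite_measure_axioms _ bd]) measurable
  qed simp
qed

lemma comp_fun_ch: "comp_fun j (ch j t)"
  unfolding comp_fun_def using ch_component by blast

lemma comp_fun_const: "comp_fun j (\<lambda>_. c)"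
  by (simp add: comp_fun_def)

lemma comp_fun_mult: "comp_fun j f \<Longrightarrow> comp_fun j g \<Longrightarrow> comp_fun j (\<lambda>x. f x * g x)"
  unfolding comp_fun_def by metis

lemma char_X: "(\<integral>\<omega>. iexp (t \<bullet> X \<omega>) \<partial>M) = (\<Prod>j=1..d. \<phi> j t)"
  unfolding prod_ch[symmetric] component_char_eq
  by (rule expectation_prod_components[where C=1]) (auto simp: comp_fun_ch)

text \<open>Each block of each sample vector is used at most once, because
  \<open>r j \<noteq> r' j\<close>; the factors are grouped by sample vector and split first over
  the vectors, then over the components of one vector. Neither r nor r' has to be injective, so
  constant maps, that is, sample vectors themselves, are covered.\<close>

lemma char_pair:
  assumes r: "\<And>j. j \<in> {1..d} \<Longrightarrow> r j \<ge> 1" and r': "\<And>j. j \<in> {1..d} \<Longrightarrow> r' j \<ge> 1"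
    and ne: "\<And>j. j \<in> {1..d} \<Longrightarrow> r j \<noteq> r' j"
  shows "(\<integral>\<omega>. iexp (t \<bullet> mix b r (\<lambda>k. Xs k \<omega>)) * iexp (s \<bullet> mix b r' (\<lambda>k. Xs k \<omega>)) \<partial>M)
    = (\<Prod>j=1..d. \<phi> j t) * (\<Prod>j=1..d. \<phi> j s)"
proof -
  define K where "K = r ` {1..d} \<union> r' ` {1..d}"
  have K: "finite K" "\<And>m. m \<in> K \<Longrightarrow> m \<ge> 1" "\<And>j. j \<in> {1..d} \<Longrightarrow> r j \<in> K" "\<And>j. j \<in> {1..d} \<Longrightarrow> r' j \<in> K"
    using r r' by (auto simp: K_def)
  define f where "f j m x = (if m = r j then ch j t x else 1) * (if m = r' j then ch j s x else 1)" for j m x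
  have f_m[measurable]: "f j m \<in> borel_measurable borel" for j m unfolding f_def by measurable
  have f_1: "norm (f j m x) \<le> 1" for j m x unfolding f_def by (auto simp: norm_mult)
  have prod_K: "(\<Prod>m\<in>K. (if m = r j then u m else 1) * (if m = r' j then v m else 1)) = u (r j) * v (r' j)"
    if "j \<in> {1..d}" for j and u v :: "nat \<Rightarrow> complex"
    using K that by (simp add: prod.distrib)
  have "iexp (t \<bullet> mix b r (\<lambda>k. Xs k \<omega>)) * iexp (s \<bullet> mix b r' (\<lambda>k. Xs k \<omega>))
     = (\<Prod>m\<in>K. \<Prod>j=1..d. f j m (Xs m \<omega>))" for \<omega>
  proof -
    have "(\<Prod>m\<in>K. \<Prod>j=1..d. f j m (Xs m \<omega>)) = (\<Prod>j=1..d. \<Prod>m\<in>K. f j m (Xs m \<omega>))"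
      by (rule prod.swap)
    also have "\<dots> = (\<Prod>j=1..d. ch j t (Xs (r j) \<omega>) * ch j s (Xs (r' j) \<omega>))"
      unfolding f_def by (intro prod.cong refl prod_K)
    finally show ?thesis by (simp add: prod_ch_mix prod.distrib)
  qed
  then have "(\<integral>\<omega>. iexp (t \<bullet> mix b r (\<lambda>k. Xs k \<omega>)) * iexp (s \<bullet> mix b r' (\<lambda>k. Xs k \<omega>)) \<partial>M)
      = (\<integral>\<omega>. (\<Prod>m\<in>K. \<Prod>j=1..d. f j m (Xs m \<omega>)) \<partial>M)" by simp
  also have "\<dots> = (\<Prod>m\<in>K. \<integral>\<omega>. (\<Prod>j=1..d. f j m (X \<omega>)) \<partial>M)"
    by (rule expectation_prod_Xs[where \<rho>="\<lambda>m. m" and C="\<lambda>_. 1"])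
       (use K in \<open>auto simp: prod_norm[symmetric] intro!: prod_le_1 f_1\<close>)
  also have "\<dots> = (\<Prod>m\<in>K. \<Prod>j=1..d. \<integral>\<omega>. f j m (X \<omega>) \<partial>M)"
  proof (intro prod.cong refl expectation_prod_components[OF f_m f_1])
    have "comp_fun j (\<lambda>x. if Q then ch j u x else 1)" for j u Q
      by (cases Q) (simp_all add: comp_fun_ch comp_fun_const)
    then show "comp_fun j (f j m)" for j m
      unfolding f_def by (intro comp_fun_mult)
  qed
  also have "\<dots> = (\<Prod>m\<in>K. \<Prod>j=1..d. (if m = r j then \<phi> j t else 1) * (if m = r' j then \<phi> j s else 1))"
  proof (intro prod.cong refl)
    fix m j assume "j \<in> {1..d}"
    then show "(\<integral>\<omega>. f j m (X \<omega>) \<partial>M) = (if m = r j then \<phi> j t else 1) * (if m = r' j then \<phi> j s else 1)"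
      using ne[of j] by (auto simp: f_def component_char_eq prob_space)
  qed
  also have "\<dots> = (\<Prod>j=1..d. \<Prod>m\<in>K. (if m = r j then \<phi> j t else 1) * (if m = r' j then \<phi> j s else 1))"
    by (rule prod.swap)
  also have "\<dots> = (\<Prod>j=1..d. \<phi> j t * \<phi> j s)"
    by (intro prod.cong refl prod_K)
  finally show ?thesis by (simp add: prod.distrib)
qed

abbreviation law :: "(real ^ 'n) measure" where "law \<equiv> distr M borel X"

lemma prob_space_law: "prob_space law"
  by (rule prob_space_distr) measurable

text \<open>By uniqueness of characteristic functions on the product space. Two mixes may share
  sample vectors as long as they share no block; the second-moment computations for the increments
  rest on this independence.\<close>

lemma pair_law:
  assumes r: "\<And>j. j \<in> {1..d} \<Longrightarrow> r j \<ge> 1" and r': "\<And>j. j \<in> {1..d} \<Longrightarrow> r' j \<ge> 1"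
    and ne: "\<And>j. j \<in> {1..d} \<Longrightarrow> r j \<noteq> r' j"
  shows "distr M borel (\<lambda>\<omega>. (mix b r (\<lambda>k. Xs k \<omega>), mix b r' (\<lambda>k. Xs k \<omega>))) = law \<Otimes>\<^sub>M law"
proof (rule measure_eqI_char)
  interpret L: prob_space law by (rule prob_space_law)
  interpret P: pair_prob_space law law ..
  have [measurable]: "(\<lambda>\<omega>. mix b r (\<lambda>k. Xs k \<omega>)) \<in> borel_measurable M"
     "(\<lambda>\<omega>. mix b r' (\<lambda>k. Xs k \<omega>)) \<in> borel_measurable M"
    using mix_Xs_measurable r r' by auto
  show "prob_space (distr M borel (\<lambda>\<omega>. (mix b r (\<lambda>k. Xs k \<omega>), mix b r' (\<lambda>k. Xs k \<omega>))))"
    by (rule prob_space_distr) measurable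
  show "prob_space (law \<Otimes>\<^sub>M law)" by (rule P.prob_space_axioms)
  show sets: "sets (law \<Otimes>\<^sub>M law) = sets borel"
    by (subst sets_pair_measure_cong[of law borel law borel]) (simp_all only: borel_prod sets_distr)
  fix u :: "(real ^ 'n) \<times> (real ^ 'n)"
  obtain t s where u: "u = (t, s)" by (cases u)
  have "(\<integral>z. iexp (u \<bullet> z) \<partial>(law \<Otimes>\<^sub>M law)) = (\<integral>x. (\<integral>y. iexp (t \<bullet> x) * iexp (s \<bullet> y) \<partial>law) \<partial>law)"
  proof -
    have [measurable]: "(\<lambda>z. iexp (u \<bullet> z)) \<in> borel_measurable (law \<Otimes>\<^sub>M law)"
      unfolding measurable_cong_sets[OF sets refl] by measurable
    have "integrable (law \<Otimes>\<^sub>M law) (\<lambda>z. iexp (u \<bullet> z))"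
      by (rule integrable_bounded[OF P.finite_measure_axioms, where C=1]) simp_all
    from P.integral_fst'[OF this] show ?thesis
      by (simp add: u distrib_left exp_add)
  qed
  also have "\<dots> = (\<Prod>j=1..d. \<phi> j t) * (\<Prod>j=1..d. \<phi> j s)"
    by (simp add: integral_distr char_X)
  finally show "(\<integral>x. iexp (u \<bullet> x) \<partial>distr M borel (\<lambda>\<omega>. (mix b r (\<lambda>k. Xs k \<omega>), mix b r' (\<lambda>k. Xs k \<omega>))))
      = (\<integral>z. iexp (u \<bullet> z) \<partial>(law \<Otimes>\<^sub>M law))"
    using char_pair[OF r r' ne, where t=t and s=s] by (simp add: integral_distr u distrib_left exp_add)
qed auto

lemma expectation_pair:
  fixes h :: "real ^ 'n \<Rightarrow> real ^ 'n \<Rightarrow> real"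
  assumes r: "\<And>j. j \<in> {1..d} \<Longrightarrow> r j \<ge> 1" "\<And>j. j \<in> {1..d} \<Longrightarrow> r' j \<ge> 1" "\<And>j. j \<in> {1..d} \<Longrightarrow> r j \<noteq> r' j"
    and h[measurable]: "(\<lambda>(x, y). h x y) \<in> borel_measurable (borel \<Otimes>\<^sub>M borel)" and bd: "\<And>x y. \<bar>h x y\<bar> \<le> C"
  shows "(\<integral>\<omega>. h (mix b r (\<lambda>k. Xs k \<omega>)) (mix b r' (\<lambda>k. Xs k \<omega>)) \<partial>M) = (\<integral>y. (\<integral>\<omega>. h (X \<omega>) y \<partial>M) \<partial>law)"
proof -
  interpret L: prob_space law by (rule prob_space_law)
  interpret P: pair_prob_space law law ..
  have [measurable]: "(\<lambda>\<omega>. mix b r (\<lambda>k. Xs k \<omega>)) \<in> borel_measurable M"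
     "(\<lambda>\<omega>. mix b r' (\<lambda>k. Xs k \<omega>)) \<in> borel_measurable M"
    using mix_Xs_measurable r by auto
  have h': "(\<lambda>z. h (fst z) (snd z)) \<in> borel_measurable borel"
    using h unfolding borel_prod by (simp add: case_prod_unfold)
  have int: "integrable (law \<Otimes>\<^sub>M law) (\<lambda>(x, y). h x y)"
    by (rule integrable_bounded[OF P.finite_measure_axioms, where C=C]) (use bd in auto)
  have "(\<integral>\<omega>. h (mix b r (\<lambda>k. Xs k \<omega>)) (mix b r' (\<lambda>k. Xs k \<omega>)) \<partial>M)
      = (\<integral>z. h (fst z) (snd z) \<partial>distr M borel (\<lambda>\<omega>. (mix b r (\<lambda>k. Xs k \<omega>), mix b r' (\<lambda>k. Xs k \<omega>))))"
    by (subst integral_distr[OF _ h']) simp_all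
  also have "\<dots> = (\<integral>z. h (fst z) (snd z) \<partial>(law \<Otimes>\<^sub>M law))"
    by (simp only: pair_law[OF r])
  also have "\<dots> = (\<integral>y. (\<integral>x. h x y \<partial>law) \<partial>law)"
    using P.integral_snd[OF int] by (simp add: case_prod_unfold)
  also have "\<dots> = (\<integral>y. (\<integral>\<omega>. h (X \<omega>) y \<partial>M) \<partial>law)"
    by (intro Bochner_Integration.integral_cong refl integral_distr) measurable
  finally show ?thesis .
qed

lemma expectation_mix_mult:
  assumes r: "\<And>j. j \<in> {1..d} \<Longrightarrow> r j \<ge> 1" "\<And>j. j \<in> {1..d} \<Longrightarrow> r' j \<ge> 1" "\<And>j. j \<in> {1..d} \<Longrightarrow> r j \<noteq> r' j"
    and g: "bounded_rv borel g" and h: "bounded_rv borel h"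
  shows "(\<integral>\<omega>. g (mix b r (\<lambda>k. Xs k \<omega>)) * h (mix b r' (\<lambda>k. Xs k \<omega>)) \<partial>M) = (\<integral>\<omega>. g (X \<omega>) \<partial>M) * (\<integral>\<omega>. h (X \<omega>) \<partial>M)"
proof -
  note [measurable] = bounded_rv_measurable[OF g] bounded_rv_measurable[OF h]
  obtain C where C: "\<And>x. \<bar>g x\<bar> \<le> C" using g by (auto simp: bounded_rv_def)
  obtain D where D: "\<And>x. \<bar>h x\<bar> \<le> D" using h by (auto simp: bounded_rv_def)
  have "C \<ge> 0" using order_trans[OF abs_ge_zero C] .
  then have bd: "\<bar>g x * h y\<bar> \<le> C * D" for x y
    unfolding abs_mult by (intro mult_mono C D) auto
  have "(\<integral>\<omega>. g (mix b r (\<lambda>k. Xs k \<omega>)) * h (mix b r' (\<lambda>k. Xs k \<omega>)) \<partial>M) = (\<integral>y. (\<integral>\<omega>. g (X \<omega>) * h y \<partial>M) \<partial>law)"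
    by (rule expectation_pair[OF r _ bd]) measurable
  then show ?thesis by (simp add: integral_distr)
qed

text \<open>The pair formula with the constant function 1 on an arbitrary disjoint mix; r + 1
  differs from r at every block.\<close>

lemma expectation_mix:
  assumes r: "\<And>j. j \<in> {1..d} \<Longrightarrow> r j \<ge> 1" and g: "bounded_rv borel g"
  shows "(\<integral>\<omega>. g (mix b r (\<lambda>k. Xs k \<omega>)) \<partial>M) = (\<integral>\<omega>. g (X \<omega>) \<partial>M)"
  using expectation_mix_mult[of r "\<lambda>j. Suc (r j)" g "\<lambda>_. 1"] r g by (simp add: prob_space)

text \<open>The Hoeffding components of order 0 and 1 vanish: g is orthogonal to all bounded
  functions of a single component, in particular to constants. This is the property of the features
  that the covariance computation of the increments exploits.\<close>

definition degenerate :: "(real ^ 'n \<Rightarrow> real) \<Rightarrow> bool" where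
  "degenerate g \<longleftrightarrow> bounded_rv borel g \<and>
     (\<forall>j\<in>{1..d}. \<forall>f. bounded_rv borel f \<longrightarrow> comp_fun j f \<longrightarrow> (\<integral>\<omega>. g (X \<omega>) * f (X \<omega>) \<partial>M) = 0)"

lemma degenerate_bounded: "degenerate g \<Longrightarrow> bounded_rv borel g"
  by (simp add: degenerate_def)

lemma degenerate_mean: "degenerate g \<Longrightarrow> (\<integral>\<omega>. g (X \<omega>) \<partial>M) = 0"
  using d_pos unfolding degenerate_def by (elim conjE ballE[of _ _ 1]) (auto dest: spec[of _ "\<lambda>_. 1"] simp: comp_fun_const)

lemma bounded_rv_X: "bounded_rv borel g \<Longrightarrow> bounded_rv M (\<lambda>\<omega>. g (X \<omega>))"
  by (auto simp: bounded_rv_def)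

lemma degenerate_add:
  assumes "degenerate f" "degenerate g" shows "degenerate (\<lambda>x. f x + g x)"
  unfolding degenerate_def
proof (intro conjI ballI allI impI)
  show "bounded_rv borel (\<lambda>x. f x + g x)"
    using assms by (intro bounded_rv_add degenerate_bounded)
  fix j h assume j: "j \<in> {1..d}" and h: "bounded_rv borel h" "comp_fun j h"
  have "integrable M (\<lambda>\<omega>. f (X \<omega>) * h (X \<omega>))" "integrable M (\<lambda>\<omega>. g (X \<omega>) * h (X \<omega>))"
    by (intro integrable_bounded_rv bounded_rv_mult bounded_rv_X degenerate_bounded assms h)+
  then show "(\<integral>\<omega>. (f (X \<omega>) + g (X \<omega>)) * h (X \<omega>) \<partial>M) = 0"
    using assms j h by (simp add: distrib_right degenerate_def)
qed

lemma degenerate_cmult: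
  assumes "degenerate g" shows "degenerate (\<lambda>x. c * g x)"
  using assms unfolding degenerate_def by (auto simp: mult.assoc)

lemma degenerate_sum: "(\<And>i. i \<in> I \<Longrightarrow> degenerate (f i)) \<Longrightarrow> degenerate (\<lambda>x. \<Sum>i\<in>I. f i x)"
proof (induction I rule: infinite_finite_induct)
  case (insert i I)
  then show ?case by (simp add: degenerate_add)
qed (simp_all add: degenerate_def)

text \<open>If the two vectors share exactly one block, replacing the shared block of the second by a
  fresh copy gives an independent pair; integrating the first coordinate yields 0 by degeneracy.\<close>

lemma expectation_degenerate_mix:
  assumes k: "k \<ge> 1" and r: "\<And>j. j \<in> {1..d} \<Longrightarrow> r j \<ge> 1" and inj: "inj_on r {1..d}"
    and g: "degenerate g" and h: "bounded_rv borel h"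
  shows "(\<integral>\<omega>. g (Xs k \<omega>) * h (mix b r (\<lambda>k. Xs k \<omega>)) \<partial>M) = 0"
proof (cases "\<exists>j\<in>{1..d}. r j = k")
  case False
  then have ne: "k \<noteq> r j" if "j \<in> {1..d}" for j using that by auto
  have "(\<integral>\<omega>. g (mix b (\<lambda>_. k) (\<lambda>k. Xs k \<omega>)) * h (mix b r (\<lambda>k. Xs k \<omega>)) \<partial>M)
      = (\<integral>\<omega>. g (X \<omega>) \<partial>M) * (\<integral>\<omega>. h (X \<omega>) \<partial>M)"
    by (rule expectation_mix_mult[OF k r ne degenerate_bounded[OF g] h])
  then show ?thesis by (simp add: degenerate_mean[OF g])
next
  case True
  then obtain j0 where j0: "j0 \<in> {1..d}" "r j0 = k" by blast
  \<comment> \<open>Any index other than k would serve as the fresh copy. Disjointness is only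
    required block by block against the constant k, so a clash of \<open>Suc k\<close> with another
    value of r does no harm.\<close>
  define r' where "r' = r(j0 := Suc k)"
  define splice where "splice x y = (\<chi> i. if b i = j0 then x $ i else y $ i)" for x y :: "real ^ 'n"
  have splice_m[measurable]: "(\<lambda>z. splice (fst z) (snd z)) \<in> borel_measurable (borel \<Otimes>\<^sub>M borel)"
    unfolding splice_def
  proof (rule borel_measurable_vec_lambda)
    fix i
    have "(\<lambda>z. (fst z :: real ^ 'n) $ i) \<in> borel_measurable ((borel :: (real ^ 'n) measure) \<Otimes>\<^sub>M (borel :: (real ^ 'n) measure))"
      by (rule measurable_compose[OF measurable_fst borel_measurable_vec_nth])
    moreover have "(\<lambda>z. (snd z :: real ^ 'n) $ i) \<in> borel_measurable ((borel :: (real ^ 'n) measure) \<Otimes>\<^sub>M (borel :: (real ^ 'n) measure))"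
      by (rule measurable_compose[OF measurable_snd borel_measurable_vec_nth])
    ultimately show "(\<lambda>z. if b i = j0 then fst z $ i else snd z $ i)
        \<in> borel_measurable ((borel :: (real ^ 'n) measure) \<Otimes>\<^sub>M (borel :: (real ^ 'n) measure))"
      by (cases "b i = j0") simp_all
  qed
  have mix_eq: "mix b r x = splice (mix b (\<lambda>_. k) x) (mix b r' x)" for x
    by (simp add: mix_def splice_def r'_def vec_eq_iff j0)
  note gb = degenerate_bounded[OF g]
  note [measurable] = bounded_rv_measurable[OF gb] bounded_rv_measurable[OF h]
  obtain C where C: "\<And>x. \<bar>g x\<bar> \<le> C" using gb by (auto simp: bounded_rv_def)
  obtain D where D: "\<And>x. \<bar>h x\<bar> \<le> D" using h by (auto simp: bounded_rv_def)
  have "C \<ge> 0" using order_trans[OF abs_ge_zero C] .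
  then have bd: "\<bar>g x * h (splice x y)\<bar> \<le> C * D" for x y
    unfolding abs_mult by (intro mult_mono C D) auto
  have "(\<integral>\<omega>. g (mix b (\<lambda>_. k) (\<lambda>k. Xs k \<omega>)) * h (splice (mix b (\<lambda>_. k) (\<lambda>k. Xs k \<omega>)) (mix b r' (\<lambda>k. Xs k \<omega>))) \<partial>M)
     = (\<integral>y. (\<integral>\<omega>. g (X \<omega>) * h (splice (X \<omega>) y) \<partial>M) \<partial>law)"
  proof (rule expectation_pair[OF _ _ _ _ bd])
    show "1 \<le> r' j" if "j \<in> {1..d}" for j using r[OF that] by (simp add: r'_def)
    show "k \<noteq> r' j" if "j \<in> {1..d}" for j
      using inj_onD[OF inj, of j j0] that j0 by (auto simp: r'_def)
    have "(\<lambda>z. g (fst z) * h (splice (fst z) (snd z))) \<in> borel_measurable (borel \<Otimes>\<^sub>M borel)"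
      by measurable
    then show "(\<lambda>(x, y). g x * h (splice x y)) \<in> borel_measurable (borel \<Otimes>\<^sub>M borel)"
      by (simp add: case_prod_unfold)
  qed (use k in auto)
  also have "\<dots> = (\<integral>y. 0 \<partial>law)"
  proof (rule Bochner_Integration.integral_cong[OF refl])
    fix y
    have "bounded_rv borel (\<lambda>x. h (splice x y))"
    proof (rule bounded_rvI[OF _ D])
      have "(\<lambda>x. splice x y) \<in> borel_measurable borel"
        using measurable_compose[OF measurable_Pair2'[of y borel borel] splice_m] by simp
      then show "(\<lambda>x. h (splice x y)) \<in> borel_measurable borel" by measurable
    qed
    moreover have "comp_fun j0 (\<lambda>x. h (splice x y))"
      unfolding comp_fun_def
    proof (intro allI impI)
      fix x x' assume eq: "component b j0 x = component b j0 x'"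
      have "x $ i = x' $ i" if "b i = j0" for i
        using fun_cong[OF eq, of i] that by (simp add: component_def block_def)
      then have "splice x y = splice x' y" by (auto simp: splice_def vec_eq_iff)
      then show "h (splice x y) = h (splice x' y)" by simp
    qed
    ultimately show "(\<integral>\<omega>. g (X \<omega>) * h (splice (X \<omega>) y) \<partial>M) = 0"
      using g j0(1) by (auto simp: degenerate_def)
  qed
  finally show ?thesis by (simp add: mix_eq)
qed

end

subsection \<open>A central limit theorem for degenerate functions\<close>

lemma mix_cong: "(\<And>j. j \<in> range b \<Longrightarrow> r j = r' j) \<Longrightarrow> mix b r x = mix b r' x"
  unfolding mix_def by (simp add: vec_eq_iff)

context independent_sample
begin

definition star :: "nat \<Rightarrow> nat \<Rightarrow> 'w \<Rightarrow> real ^ 'n" where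
  "star n k \<omega> = mix b (\<lambda>j. cyclic n (k + j - 1)) (\<lambda>m. Xs m \<omega>)"

lemma star_measurable [measurable]: "star n k \<in> borel_measurable M"
  unfolding star_def[abs_def] by (rule mix_Xs_measurable) (rule cyclic_ge_1)

lemma bounded_rv_compose: "bounded_rv borel g \<Longrightarrow> f \<in> borel_measurable M \<Longrightarrow> bounded_rv M (\<lambda>\<omega>. g (f \<omega>))"
  by (auto simp: bounded_rv_def)

definition increment :: "real \<Rightarrow> (real ^ 'n \<Rightarrow> real) \<Rightarrow> nat \<Rightarrow> nat \<Rightarrow> 'w \<Rightarrow> real" where
  "increment c g n k \<omega> = g (Xs k \<omega>) - c * g (star n k \<omega>)"

definition var :: "(real ^ 'n \<Rightarrow> real) \<Rightarrow> real" where
  "var g = (\<integral>\<omega>. (g (X \<omega>))\<^sup>2 \<partial>M)"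

lemma var_nonneg: "var g \<ge> 0"
  unfolding var_def by (rule integral_nonneg_AE) auto

lemma increment_bounded:
  assumes g: "degenerate g" and k: "k \<ge> 1"
  shows "bounded_rv M (increment c g n k)"
proof -
  have "bounded_rv M (\<lambda>\<omega>. g (Xs k \<omega>))" "bounded_rv M (\<lambda>\<omega>. g (star n k \<omega>))"
    using k by (rule bounded_rv_compose[OF degenerate_bounded[OF g] Xs_measurable])
      (rule bounded_rv_compose[OF degenerate_bounded[OF g] star_measurable])
  then show ?thesis
    unfolding increment_def[abs_def] by (intro bounded_rv_diff bounded_rv_mult bounded_rv_const)
qed

text \<open>Two sample vectors, or two shifted vectors, with different numbers share no block and
  are independent. Since n \<ge> d, a shifted vector takes its blocks from distinct sample vectors,
  so it shares at most one block with any given \<open>Xs k\<close>; degeneracy makes this mixed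
  covariance vanish even for k = l.\<close>

lemma increment_cov:
  assumes g: "degenerate g" and n: "n \<ge> d" and k: "k \<in> {1..n}" and l: "l \<in> {1..n}"
  shows "(\<integral>\<omega>. increment c g n k \<omega> * increment c g n l \<omega> \<partial>M) = (if k = l then (1 + c\<^sup>2) * var g else 0)"
proof -
  note gb = degenerate_bounded[OF g]
  have gg: "bounded_rv borel (\<lambda>x. g x * g x)" using gb by auto
  let ?r = "\<lambda>k j. cyclic n (k + j - 1)"
  have AA: "(\<integral>\<omega>. g (Xs k \<omega>) * g (Xs l \<omega>) \<partial>M) = (if k = l then var g else 0)"
  proof (cases "k = l")
    case True
    then show ?thesis
      using expectation_mix[of "\<lambda>_. k", OF _ gg] k by (simp add: var_def power2_eq_square)
  next
    case False
    then show ?thesis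
      using expectation_mix_mult[of "\<lambda>_. k" "\<lambda>_. l", OF _ _ _ gb gb] k l degenerate_mean[OF g] by simp
  qed
  have BB: "(\<integral>\<omega>. g (star n k \<omega>) * g (star n l \<omega>) \<partial>M) = (if k = l then var g else 0)"
  proof (cases "k = l")
    case True
    then show ?thesis
      using expectation_mix[of "?r k", OF cyclic_ge_1 gg] by (simp add: var_def power2_eq_square star_def)
  next
    case False
    have ne: "?r k j \<noteq> ?r l j" if "j \<in> {1..d}" for j
    proof
      assume "?r k j = ?r l j"
      then have "k + j - 1 = l + j - 1"
        by (rule cyclic_inj) (use k l that in auto)
      with False that show False by auto
    qed
    then show ?thesis
      using expectation_mix_mult[of "?r k" "?r l", OF cyclic_ge_1 cyclic_ge_1 ne gb gb] False degenerate_mean[OF g]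
      by (simp add: star_def)
  qed
  have AB: "(\<integral>\<omega>. g (Xs k \<omega>) * g (star n l \<omega>) \<partial>M) = 0" if "k \<in> {1..n}" "l \<in> {1..n}" for k l
    unfolding star_def
  proof (rule expectation_degenerate_mix[OF _ cyclic_ge_1 _ g gb])
    show "inj_on (?r l) {1..d}"
    proof (rule inj_onI)
      fix j j' assume j: "j \<in> {1..d}" "j' \<in> {1..d}" and eq: "?r l j = ?r l j'"
      from eq have "l + j - 1 = l + j' - 1"
        by (rule cyclic_inj) (use that j n in auto)
      then show "j = j'" using j that by auto
    qed
  qed (use that in auto)
  have int: "integrable M (\<lambda>\<omega>. f (u \<omega>) * f' (u' \<omega>))"
    if "bounded_rv borel f" "bounded_rv borel f'" "u \<in> borel_measurable M" "u' \<in> borel_measurable M" for f f' u u'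
    by (rule integrable_bounded_rv, rule bounded_rv_mult; rule bounded_rv_compose, fact, fact)
  have m: "Xs k \<in> borel_measurable M" "Xs l \<in> borel_measurable M" using k l by auto
  note i = int[OF gb gb m] int[OF gb gb m(1) star_measurable[of n l]]
    int[OF gb gb m(2) star_measurable[of n k]] int[OF gb gb star_measurable[of n k] star_measurable[of n l]]
  have "(\<integral>\<omega>. increment c g n k \<omega> * increment c g n l \<omega> \<partial>M)
      = (\<integral>\<omega>. g (Xs k \<omega>) * g (Xs l \<omega>) - c * (g (Xs k \<omega>) * g (star n l \<omega>))
        - c * (g (Xs l \<omega>) * g (star n k \<omega>)) + c\<^sup>2 * (g (star n k \<omega>) * g (star n l \<omega>)) \<partial>M)"
    unfolding increment_def
    by (intro Bochner_Integration.integral_cong refl) (simp add: algebra_simps power2_eq_square)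
  also have "\<dots> = (\<integral>\<omega>. g (Xs k \<omega>) * g (Xs l \<omega>) \<partial>M) - c * (\<integral>\<omega>. g (Xs k \<omega>) * g (star n l \<omega>) \<partial>M)
        - c * (\<integral>\<omega>. g (Xs l \<omega>) * g (star n k \<omega>) \<partial>M) + c\<^sup>2 * (\<integral>\<omega>. g (star n k \<omega>) * g (star n l \<omega>) \<partial>M)"
    using i by simp
  also have "\<dots> = (if k = l then (1 + c\<^sup>2) * var g else 0)"
    unfolding AA BB AB[OF k l] AB[OF l k] by (simp add: algebra_simps)
  finally show ?thesis .
qed

lemma increment_mean:
  assumes g: "degenerate g" and k: "k \<ge> 1"
  shows "(\<integral>\<omega>. increment c g n k \<omega> \<partial>M) = 0"
proof -
  note gb = degenerate_bounded[OF g]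
  have m: "Xs k \<in> borel_measurable M" using k by auto
  have i: "integrable M (\<lambda>\<omega>. g (Xs k \<omega>))" "integrable M (\<lambda>\<omega>. g (star n k \<omega>))"
    by (rule integrable_bounded_rv, rule bounded_rv_compose[OF gb], rule m star_measurable)+
  then show ?thesis
    using expectation_mix[of "\<lambda>_. k", OF _ gb] expectation_mix[of "\<lambda>j. cyclic n (k + j - 1)", OF cyclic_ge_1 gb] k degenerate_mean[OF g]
    by (simp add: increment_def star_def)
qed

lemma sum_increment_sq:
  assumes g: "degenerate g" and n: "n \<ge> d" and K: "K \<subseteq> {1..n}"
  shows "(\<integral>\<omega>. (\<Sum>k\<in>K. increment c g n k \<omega>)\<^sup>2 \<partial>M) = real (card K) * ((1 + c\<^sup>2) * var g)"
proof -
  have finK: "finite K" using K finite_subset by blast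
  have int: "integrable M (\<lambda>\<omega>. increment c g n k \<omega> * increment c g n l \<omega>)" if "k \<in> K" "l \<in> K" for k l
    using that K by (intro integrable_bounded_rv bounded_rv_mult increment_bounded g) auto
  have "(\<integral>\<omega>. (\<Sum>k\<in>K. increment c g n k \<omega>)\<^sup>2 \<partial>M)
      = (\<integral>\<omega>. (\<Sum>k\<in>K. \<Sum>l\<in>K. increment c g n k \<omega> * increment c g n l \<omega>) \<partial>M)"
    by (simp add: power2_eq_square sum_product)
  also have "\<dots> = (\<Sum>k\<in>K. \<Sum>l\<in>K. \<integral>\<omega>. increment c g n k \<omega> * increment c g n l \<omega> \<partial>M)"
    using int by (subst Bochner_Integration.integral_sum) (auto intro!: sum.cong)
  also have "\<dots> = (\<Sum>k\<in>K. \<Sum>l\<in>K. if k = l then (1 + c\<^sup>2) * var g else 0)"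
    by (intro sum.cong refl increment_cov[OF g n]) (use K in auto)
  also have "\<dots> = (\<Sum>k\<in>K. (1 + c\<^sup>2) * var g)"
    using finK by (intro sum.cong) auto
  finally show ?thesis by simp
qed

lemma expectation_abs_le_sqrt:
  assumes "bounded_rv M f"
  shows "(\<integral>\<omega>. \<bar>f \<omega>\<bar> \<partial>M) \<le> sqrt (\<integral>\<omega>. (f \<omega>)\<^sup>2 \<partial>M)"
proof -
  have "integrable M (\<lambda>x. (f x)\<^sup>2)"
    unfolding power2_eq_square by (intro integrable_bounded_rv bounded_rv_mult assms)
  with integral_mult_le_sqrt(2)[of f M "\<lambda>_. 1"] bounded_rv_measurable[OF assms]
  show ?thesis by (simp add: prob_space)
qed

lemma sum_increment_bounded:
  "degenerate g \<Longrightarrow> K \<subseteq> {1..n} \<Longrightarrow> bounded_rv M (\<lambda>\<omega>. \<Sum>k\<in>K. increment c g n k \<omega>)"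
  by (intro bounded_rv_sum increment_bounded) auto

text \<open>A block has \<open>L + d\<close> indices, but only the first \<open>L\<close> are summed: the shifted copies then
  stay within the block, so that distinct blocks are independent.\<close>

definition block_sum :: "real \<Rightarrow> (real ^ 'n \<Rightarrow> real) \<Rightarrow> nat \<Rightarrow> nat \<Rightarrow> 'w \<Rightarrow> real" where
  "block_sum c g L m \<omega> = (\<Sum>i=1..L. g (Xs (m * (L + d) + i) \<omega>)
     - c * g (mix b (\<lambda>j. m * (L + d) + i + j - 1) (\<lambda>k. Xs k \<omega>)))"

text \<open>The largest index touched by block m is \<open>(m + 1) * (L + d) - 1\<close>, so below n
  the reduction modulo n does nothing. \<open>block_sum\<close> is therefore written without n and
  one sequence of block sums serves all sample sizes.\<close>

lemma block_sum_increment: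
  assumes "(m + 1) * (L + d) \<le> n"
  shows "block_sum c g L m \<omega> = (\<Sum>i=1..L. increment c g n (m * (L + d) + i) \<omega>)"
  unfolding block_sum_def increment_def star_def
proof (intro sum.cong refl)
  fix i assume i: "i \<in> {1..L}"
  have "mix b (\<lambda>j. cyclic n (m * (L + d) + i + j - 1)) (\<lambda>k. Xs k \<omega>) = mix b (\<lambda>j. m * (L + d) + i + j - 1) (\<lambda>k. Xs k \<omega>)"
  proof (rule mix_cong)
    fix j assume "j \<in> range b"
    then have "1 \<le> j" "j \<le> d" unfolding range_b by auto
    then show "cyclic n (m * (L + d) + i + j - 1) = m * (L + d) + i + j - 1"
      using i assms by (intro cyclic_id) auto
  qed
  then show "g (Xs (m * (L + d) + i) \<omega>) - c * g (mix b (\<lambda>j. m * (L + d) + i + j - 1) (\<lambda>k. Xs k \<omega>))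
    = g (Xs (m * (L + d) + i) \<omega>) - c * g (mix b (\<lambda>j. cyclic n (m * (L + d) + i + j - 1)) (\<lambda>k. Xs k \<omega>))"
    by simp
qed

text \<open>Every block sum is the same function \<psi> of a window of \<open>L + d\<close>
  consecutive sample vectors, and the windows of different blocks are disjoint.\<close>

lemma block_sum_iid:
  assumes g: "bounded_rv borel g"
  shows "indep_vars (\<lambda>_. borel) (block_sum c g L) UNIV"
    and "distr M borel (block_sum c g L m) = distr M borel (block_sum c g L 0)"
proof -
  let ?P = "L + d"
  note [measurable] = bounded_rv_measurable[OF g]
  define S where "S = PiM {1..?P} (\<lambda>_. borel :: (real ^ 'n) measure)"
  define \<psi> where "\<psi> y = (\<Sum>i=1..L. g (y i) - c * g (mix b (\<lambda>j. i + j - 1) y))" for y :: "nat \<Rightarrow> real ^ 'n"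
  define Y where "Y m \<omega> = (\<lambda>i\<in>{1..?P}. Xs (m * ?P + i) \<omega>)" for m \<omega>
  have b_range: "1 \<le> b i" "b i \<le> d" for i
    using rangeI[of b i] unfolding range_b by auto
  have \<psi>_m[measurable]: "\<psi> \<in> borel_measurable S"
    unfolding \<psi>_def
  proof (rule borel_measurable_sum)
    fix i assume i: "i \<in> {1..L}"
    have y: "(\<lambda>y. y k) \<in> borel_measurable S" if "k \<in> {1..?P}" for k
      using that unfolding S_def by (rule measurable_component_singleton)
    have "(\<lambda>y. mix b (\<lambda>j. i + j - 1) y) \<in> borel_measurable S"
      unfolding mix_def
    proof (rule borel_measurable_vec_lambda)
      fix i' :: 'n
      have "i + b i' - 1 \<in> {1..?P}" using i b_range[of i'] by auto
      from measurable_compose[OF y[OF this] borel_measurable_vec_nth]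
      show "(\<lambda>y. y (i + b i' - 1) $ i') \<in> borel_measurable S" .
    qed
    moreover have "(\<lambda>y. y i) \<in> borel_measurable S" by (rule y) (use i in auto)
    ultimately show "(\<lambda>y. g (y i) - c * g (mix b (\<lambda>j. i + j - 1) y)) \<in> borel_measurable S"
      by measurable
  qed
  have Z_eq: "block_sum c g L m \<omega> = \<psi> (Y m \<omega>)" for m \<omega>
    unfolding block_sum_def \<psi>_def
  proof (intro sum.cong refl)
    fix i assume i: "i \<in> {1..L}"
    have "mix b (\<lambda>j. i + j - 1) (Y m \<omega>) = mix b (\<lambda>j. m * ?P + i + j - 1) (\<lambda>k. Xs k \<omega>)"
      unfolding mix_def vec_eq_iff
    proof (intro allI)
      fix i'
      have "i + b i' - 1 \<in> {1..?P}" "m * ?P + (i + b i' - 1) = m * ?P + i + b i' - 1"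
        using i b_range[of i'] by auto
      then show "(\<chi> i'. Y m \<omega> (i + b i' - 1) $ i') $ i' = (\<chi> i'. Xs (m * ?P + i + b i' - 1) \<omega> $ i') $ i'"
        by (simp add: Y_def)
    qed
    then show "g (Xs (m * ?P + i) \<omega>) - c * g (mix b (\<lambda>j. m * ?P + i + j - 1) (\<lambda>k. Xs k \<omega>))
        = g (Y m \<omega> i) - c * g (mix b (\<lambda>j. i + j - 1) (Y m \<omega>))"
      using i by (simp add: Y_def)
  qed
  have Y_m[measurable]: "Y m \<in> measurable M S" for m
    unfolding Y_def S_def by (rule measurable_restrict) auto
  define K where "K m = {m * ?P + 1..m * ?P + ?P}" for m
  have disj: "disjoint_family_on K UNIV"
    unfolding disjoint_family_on_def
  proof (intro ballI impI)
    fix m m' :: nat assume "m \<noteq> m'"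
    have "K m \<inter> K m' = {}" if "m < m'" for m m'
    proof -
      have "m * ?P + ?P \<le> m' * ?P" using mult_le_mono1[of "Suc m" m' ?P] that by simp
      then show ?thesis by (auto simp: K_def)
    qed
    then show "K m \<inter> K m' = {}" using \<open>m \<noteq> m'\<close> by (metis inf_commute linorder_neqE_nat)
  qed
  have "indep_vars (\<lambda>m. PiM (K m) (\<lambda>_. borel)) (\<lambda>m \<omega>. restrict (\<lambda>i. Xs i \<omega>) (K m)) UNIV"
    by (rule indep_vars_restrict[OF Xs_indep _ disj]) (auto simp: K_def)
  then have "indep_vars (\<lambda>_. S) (\<lambda>m \<omega>. (\<lambda>i\<in>{1..?P}. restrict (\<lambda>i. Xs i \<omega>) (K m) (m * ?P + i))) UNIV"
  proof (rule indep_vars_compose2)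
    fix m
    show "(\<lambda>z. \<lambda>i\<in>{1..?P}. z (m * ?P + i)) \<in> measurable (PiM (K m) (\<lambda>_. borel)) S"
      unfolding S_def by (rule measurable_restrict, rule measurable_component_singleton) (auto simp: K_def)
  qed
  moreover have "(\<lambda>i\<in>{1..?P}. restrict (\<lambda>i. Xs i \<omega>) (K m) (m * ?P + i)) = Y m \<omega>" for m \<omega>
    unfolding Y_def by (auto simp: K_def restrict_def)
  ultimately have "indep_vars (\<lambda>_. S) Y UNIV" by simp
  then have "indep_vars (\<lambda>_. borel) (\<lambda>m \<omega>. \<psi> (Y m \<omega>)) UNIV"
    by (rule indep_vars_compose2) measurable
  then show "indep_vars (\<lambda>_. borel) (block_sum c g L) UNIV"
    by (simp add: Z_eq[abs_def])
  have ne: "{1..?P} \<noteq> {}" using d_pos by auto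
  have lawY: "distr M S (Y m) = PiM {1..?P} (\<lambda>_. law)" for m
  proof -
    have inj: "inj_on (\<lambda>i. m * ?P + i) {1..?P}" by (auto intro: inj_onI)
    have "indep_vars (\<lambda>_. borel) Xs ((\<lambda>i. m * ?P + i) ` {1..?P})"
      by (rule indep_vars_subset[OF Xs_indep]) auto
    from indep_vars_reindex[OF inj this]
    have "indep_vars (\<lambda>_. borel) (\<lambda>i. Xs (m * ?P + i)) {1..?P}" .
    then have "distr M S (Y m) = PiM {1..?P} (\<lambda>i. distr M borel (Xs (m * ?P + i)))"
      unfolding Y_def S_def
      by (subst (asm) indep_vars_iff_distr_eq_PiM'[OF ne]) auto
    also have "\<dots> = PiM {1..?P} (\<lambda>_. law)"
      by (intro PiM_cong refl Xs_law) auto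
    finally show ?thesis .
  qed
  have "distr M borel (block_sum c g L m) = distr (distr M S (Y m)) borel \<psi>" for m
    by (subst distr_distr) (auto simp: comp_def Z_eq[abs_def])
  then show "distr M borel (block_sum c g L m) = distr M borel (block_sum c g L 0)"
    by (simp only: lawY)
qed


lemma block_index_inj:
  fixes L :: nat
  shows "inj_on (\<lambda>(m, i). m * (L + d) + i) (UNIV \<times> {1..L})"
proof (rule inj_onI, clarify)
  fix m i m' i' assume i: "i \<in> {1..L}" "i' \<in> {1..L}" and eq: "m * (L + d) + i = m' * (L + d) + i'"
  have lt: "i < L + d" "i' < L + d" using i d_pos by auto
  have dv: "(m * P + i) div P = m" if "i < P" for m i P :: nat using that by simp
  have "m = m'" using dv[OF lt(1), of m] dv[OF lt(2), of m'] eq by simp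
  then show "m = m' \<and> i = i'" using eq by simp
qed

lemma block_sum_moments:
  assumes g: "degenerate g"
  shows "(\<integral>\<omega>. block_sum c g L m \<omega> \<partial>M) = 0"
    and "(\<integral>\<omega>. (block_sum c g L m \<omega>)\<^sup>2 \<partial>M) = real L * ((1 + c\<^sup>2) * var g)"
    and "bounded_rv M (block_sum c g L m)"
proof -
  \<comment> \<open>A sample size for which block m is free of wrap-around, so that the moments of
    increments apply; the block sum itself does not depend on it.\<close>
  let ?n = "(m + 1) * (L + d)"
  let ?K = "(\<lambda>i. m * (L + d) + i) ` {1..L}"
  have inj: "inj_on (\<lambda>i. m * (L + d) + i) {1..L}" by (auto intro: inj_onI)
  have K: "?K \<subseteq> {1..?n}" by auto
  have eq: "block_sum c g L m = (\<lambda>\<omega>. \<Sum>k\<in>?K. increment c g ?n k \<omega>)"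
    by (rule ext) (simp only: block_sum_increment[OF order_refl] sum.reindex[OF inj] comp_def)
  show "bounded_rv M (block_sum c g L m)"
    unfolding eq by (rule sum_increment_bounded[OF g K])
  show "(\<integral>\<omega>. (block_sum c g L m \<omega>)\<^sup>2 \<partial>M) = real L * ((1 + c\<^sup>2) * var g)"
    unfolding eq using sum_increment_sq[OF g _ K, of c] by (simp add: card_image[OF inj])
  have "(\<integral>\<omega>. (\<Sum>k\<in>?K. increment c g ?n k \<omega>) \<partial>M) = (\<Sum>k\<in>?K. \<integral>\<omega>. increment c g ?n k \<omega> \<partial>M)"
    by (rule Bochner_Integration.integral_sum, rule integrable_bounded_rv, rule increment_bounded[OF g]) auto
  also have "\<dots> = 0"
    by (rule sum.neutral, rule ballI, rule increment_mean[OF g]) auto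
  finally show "(\<integral>\<omega>. block_sum c g L m \<omega> \<partial>M) = 0" unfolding eq .
qed

text \<open>The classical theorem normalises by the standard deviation of the sum of the
  \<open>n div (L + d)\<close> blocks, while the statistic normalises by \<open>sqrt n\<close>. The
  ratio \<open>a n\<close> of the two tends to \<open>a0\<close>, and the resulting change of the
  frequency is negligible because the normalised sums are bounded in L1.\<close>

lemma block_clt:
  assumes g: "degenerate g" and v: "var g > 0" and L: "L \<ge> 1"
  shows "(\<lambda>n. \<integral>\<omega>. iexp ((\<Sum>m<n div (L + d). block_sum c g L m \<omega>) / sqrt (real n)) \<partial>M)
    \<longlonglongrightarrow> complex_of_real (exp (- (real L / real (L + d) * ((1 + c\<^sup>2) * var g)) / 2))"
proof -
  let ?P = "L + d" and ?Z = "block_sum c g L"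
  define s2 where "s2 = real L * ((1 + c\<^sup>2) * var g)"
  have s2: "s2 > 0" using v L by (auto simp: s2_def intro!: mult_pos_pos add_pos_nonneg)
  define W where "W N \<omega> = (\<Sum>m<N. ?Z m \<omega>) / sqrt (real N * s2)" for N \<omega>
  define a where "a n = sqrt (real (n div ?P) * s2 / real n)" for n
  define a0 where "a0 = sqrt (s2 / real ?P)"
  have Zb: "bounded_rv M (?Z m)" for m by (rule block_sum_moments(3)[OF g])
  have Z2: "(\<integral>\<omega>. (?Z m \<omega>)\<^sup>2 \<partial>M) = s2" for m using block_sum_moments(2)[OF g] by (simp add: s2_def)
  have Wb: "bounded_rv M (W N)" for N
  proof -
    have "bounded_rv M (\<lambda>\<omega>. (1 / sqrt (real N * s2)) * (\<Sum>m<N. ?Z m \<omega>))"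
      by (intro bounded_rv_mult[OF bounded_rv_const] bounded_rv_sum Zb)
    then show ?thesis by (simp add: W_def[abs_def])
  qed
  have [measurable]: "W N \<in> borel_measurable M" for N by (rule bounded_rv_measurable[OF Wb])
  have "weak_conv_m (\<lambda>N. distr M borel (\<lambda>\<omega>. (\<Sum>m<N. ?Z m \<omega>) / sqrt (real N * (sqrt s2)\<^sup>2))) std_normal_distribution"
  proof (rule central_limit_theorem_zero_mean[where \<mu>="distr M borel (?Z 0)"])
    show "indep_vars (\<lambda>_. borel) ?Z UNIV" by (rule block_sum_iid(1)[OF degenerate_bounded[OF g]])
    show "expectation (?Z m) = 0" for m by (rule block_sum_moments(1)[OF g])
    show "0 < sqrt s2" using s2 by simp
    show "integrable M (\<lambda>x. (?Z m x)\<^sup>2)" for m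
      unfolding power2_eq_square by (rule integrable_bounded_rv[OF bounded_rv_mult[OF Zb Zb]])
    show "variance (?Z m) = (sqrt s2)\<^sup>2" for m
      using Z2[of m] s2 by (simp add: block_sum_moments(1)[OF g])
    show "distr M borel (?Z m) = distr M borel (?Z 0)" for m
      by (rule block_sum_iid(2)[OF degenerate_bounded[OF g]])
  qed
  then have "weak_conv_m (\<lambda>N. distr M borel (W N)) std_normal_distribution"
    using s2 by (simp add: W_def[abs_def])
  then have "(\<lambda>N. char (distr M borel (W N)) a0) \<longlonglongrightarrow> char std_normal_distribution a0"
    by (intro levy_continuity1 real_dist_normal_dist) simp_all
  moreover have "char (distr M borel (W N)) a0 = (\<integral>\<omega>. iexp (a0 * W N \<omega>) \<partial>M)" for N
    unfolding char_def by (rule integral_distr) simp_all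
  ultimately have W_lim: "(\<lambda>N. \<integral>\<omega>. iexp (a0 * W N \<omega>) \<partial>M) \<longlonglongrightarrow> complex_of_real (exp (- (a0\<^sup>2) / 2))"
    by (simp only: char_std_normal_distribution)
  have Nlim: "filterlim (\<lambda>n. n div ?P) sequentially sequentially"
    unfolding filterlim_at_top
  proof
    fix N
    show "\<forall>\<^sub>F n in sequentially. N \<le> n div ?P"
      using eventually_ge_at_top[of "N * ?P"]
      by eventually_elim (metis d_pos div_le_mono div_mult_self_is_m le_add2 less_le_trans zero_less_one)
  qed
  have WN_lim: "(\<lambda>n. \<integral>\<omega>. iexp (a0 * W (n div ?P) \<omega>) \<partial>M) \<longlonglongrightarrow> complex_of_real (exp (- (a0\<^sup>2) / 2))"
    using filterlim_compose[OF W_lim Nlim] .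
  have ratio: "(\<lambda>n. real (n div ?P) / real n) \<longlonglongrightarrow> 1 / real ?P"
  proof (rule tendsto_sandwich)
    have P0: "real ?P > 0" using d_pos by simp
    have bounds: "real n / real ?P - 1 \<le> real (n div ?P)" "real (n div ?P) \<le> real n / real ?P" for n
    proof -
      have "real n = real (n div ?P) * real ?P + real (n mod ?P)"
        by (metis div_mult_mod_eq of_nat_add of_nat_mult)
      moreover have "real (n mod ?P) < real ?P" unfolding of_nat_less_iff using d_pos by simp
      ultimately show "real n / real ?P - 1 \<le> real (n div ?P)" "real (n div ?P) \<le> real n / real ?P"
        using P0 by (simp_all add: field_simps)
    qed
    show "\<forall>\<^sub>F n in sequentially. 1 / real ?P - 1 / real n \<le> real (n div ?P) / real n"
      using eventually_gt_at_top[of 0]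
    proof eventually_elim
      case (elim n)
      have "(real n / real ?P - 1) / real n \<le> real (n div ?P) / real n"
        by (rule divide_right_mono[OF bounds(1)]) simp
      then show ?case using elim by (simp add: diff_divide_distrib)
    qed
    show "\<forall>\<^sub>F n in sequentially. real (n div ?P) / real n \<le> 1 / real ?P"
      using eventually_gt_at_top[of 0]
    proof eventually_elim
      case (elim n)
      have "real (n div ?P) / real n \<le> (real n / real ?P) / real n"
        by (rule divide_right_mono[OF bounds(2)]) simp
      then show ?case using elim by simp
    qed
    show "(\<lambda>n. 1 / real ?P - 1 / real n) \<longlonglongrightarrow> 1 / real ?P"
      using tendsto_diff[OF tendsto_const lim_1_over_n, of "1 / real ?P"] by simp
  qed simp
  have "(\<lambda>n. sqrt (s2 * (real (n div ?P) / real n))) \<longlonglongrightarrow> sqrt (s2 * (1 / real ?P))"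
    by (intro tendsto_real_sqrt tendsto_mult tendsto_const ratio)
  then have a_lim: "a \<longlonglongrightarrow> a0" by (simp add: a_def[abs_def] a0_def mult.commute)
  \<comment> \<open>Convergence of characteristic functions is available at the fixed frequency
    \<open>a0\<close> only; this uniform bound lets the moving frequency \<open>a n\<close> be
    exchanged for it.\<close>
  have W_abs: "(\<integral>\<omega>. \<bar>W N \<omega>\<bar> \<partial>M) \<le> 1" for N
  proof -
    have "(\<integral>\<omega>. (W N \<omega>)\<^sup>2 \<partial>M) \<le> 1"
    proof (cases "N = 0")
      case False
      have "(\<integral>\<omega>. (\<Sum>m<N. ?Z m \<omega>)\<^sup>2 \<partial>M) = real N * s2"
      proof -
        have int: "integrable M (\<lambda>\<omega>. ?Z m \<omega> * ?Z m' \<omega>)" for m m'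
          by (rule integrable_bounded_rv[OF bounded_rv_mult[OF Zb Zb]])
        have cov: "(\<integral>\<omega>. ?Z m \<omega> * ?Z m' \<omega> \<partial>M) = (if m = m' then s2 else 0)" for m m'
        proof (cases "m = m'")
          case True
          then show ?thesis using Z2[of m] by (simp add: power2_eq_square)
        next
          case False
          have "indep_vars (\<lambda>_. borel) ?Z {m, m'}"
            by (rule indep_vars_subset[OF block_sum_iid(1)[OF degenerate_bounded[OF g]]]) simp
          from indep_vars_lebesgue_integral[OF _ this integrable_bounded_rv[OF Zb]] False
          show ?thesis by (simp add: block_sum_moments(1)[OF g])
        qed
        have "(\<integral>\<omega>. (\<Sum>m<N. ?Z m \<omega>)\<^sup>2 \<partial>M) = (\<Sum>m<N. \<Sum>m'<N. \<integral>\<omega>. ?Z m \<omega> * ?Z m' \<omega> \<partial>M)"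
          using int by (simp add: power2_eq_square sum_product)
        also have "\<dots> = real N * s2" unfolding cov by simp
        finally show ?thesis .
      qed
      then show ?thesis using False s2 by (simp add: W_def power_divide)
    qed (simp add: W_def)
    then have "sqrt (\<integral>\<omega>. (W N \<omega>)\<^sup>2 \<partial>M) \<le> 1" by simp
    with expectation_abs_le_sqrt[OF Wb, of N] show ?thesis by linarith
  qed
  have eq: "(\<Sum>m<n div ?P. ?Z m \<omega>) / sqrt (real n) = a n * W (n div ?P) \<omega>" for n \<omega>
    using s2 by (cases "n div ?P = 0") (simp_all add: a_def W_def real_sqrt_divide)
  have near: "norm ((\<integral>\<omega>. iexp (a n * W (n div ?P) \<omega>) \<partial>M) - (\<integral>\<omega>. iexp (a0 * W (n div ?P) \<omega>) \<partial>M)) \<le> \<bar>a n - a0\<bar>" for n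
  proof -
    have e: "\<bar>a n * W N \<omega> - a0 * W N \<omega>\<bar> = \<bar>a n - a0\<bar> * \<bar>W N \<omega>\<bar>" for N \<omega>
      by (simp add: left_diff_distrib[symmetric] abs_mult)
    have int: "integrable M (\<lambda>\<omega>. \<bar>W N \<omega>\<bar>)" for N
      by (rule integrable_abs[OF integrable_bounded_rv[OF Wb]])
    have "norm ((\<integral>\<omega>. iexp (a n * W (n div ?P) \<omega>) \<partial>M) - (\<integral>\<omega>. iexp (a0 * W (n div ?P) \<omega>) \<partial>M))
        \<le> (\<integral>\<omega>. \<bar>a n * W (n div ?P) \<omega> - a0 * W (n div ?P) \<omega>\<bar> \<partial>M)"
      by (rule expectation_iexp_diff_le) (simp_all add: e int)
    also have "\<dots> \<le> \<bar>a n - a0\<bar> * 1"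
      unfolding e integral_mult_right_zero by (rule mult_left_mono[OF W_abs]) simp
    finally show ?thesis by simp
  qed
  have "(\<lambda>n. (\<integral>\<omega>. iexp (a n * W (n div ?P) \<omega>) \<partial>M) - (\<integral>\<omega>. iexp (a0 * W (n div ?P) \<omega>) \<partial>M)) \<longlonglongrightarrow> 0"
  proof (rule Lim_null_comparison[OF always_eventually[OF allI[OF near]]])
    show "(\<lambda>n. \<bar>a n - a0\<bar>) \<longlonglongrightarrow> 0"
      using tendsto_rabs_zero[OF Lim_null[THEN iffD1, OF a_lim]] .
  qed
  from tendsto_add[OF this WN_lim]
  have "(\<lambda>n. \<integral>\<omega>. iexp (a n * W (n div ?P) \<omega>) \<partial>M) \<longlonglongrightarrow> complex_of_real (exp (- (a0\<^sup>2) / 2))"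
    by simp
  moreover have "a0\<^sup>2 = real L / real ?P * ((1 + c\<^sup>2) * var g)"
    using s2 by (simp add: a0_def s2_def)
  ultimately show ?thesis unfolding eq by simp
qed

text \<open>Bernstein's blocking. For fixed L the block sums obey the central limit theorem with a
  fraction of the variance; the increments in the gaps, the remainder and the wrapped-around end are
  uncorrelated, so their share is measured by counting them. Letting L grow restores the full
  variance.\<close>

theorem increment_clt:
  assumes g: "degenerate g"
  shows "(\<lambda>n. \<integral>\<omega>. iexp ((\<Sum>k=1..n. increment c g n k \<omega>) / sqrt (real n)) \<partial>M)
    \<longlonglongrightarrow> complex_of_real (exp (- ((1 + c\<^sup>2) * var g) / 2))"
proof -
  let ?V = "(1 + c\<^sup>2) * var g"
  let ?Y = "\<lambda>n \<omega>. (\<Sum>k=1..n. increment c g n k \<omega>) / sqrt (real n)"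
  have V0: "?V \<ge> 0" using var_nonneg by simp
  have rest: "(\<integral>\<omega>. \<bar>(\<Sum>k\<in>K. increment c g n k \<omega>) / sqrt (real n)\<bar> \<partial>M) \<le> sqrt (real (card K) / real n * ?V)"
    if "n \<ge> d" "K \<subseteq> {1..n}" for n K
  proof -
    have "(\<integral>\<omega>. \<bar>\<Sum>k\<in>K. increment c g n k \<omega>\<bar> \<partial>M) \<le> sqrt (real (card K) * ?V)"
      using expectation_abs_le_sqrt[OF sum_increment_bounded[OF g that(2), of c]] sum_increment_sq[OF g that, of c]
      by simp
    then have "(\<integral>\<omega>. \<bar>\<Sum>k\<in>K. increment c g n k \<omega>\<bar> \<partial>M) / sqrt (real n) \<le> sqrt (real (card K) * ?V) / sqrt (real n)"
      by (rule divide_right_mono) simp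
    then show ?thesis by (simp add: abs_divide real_sqrt_divide real_sqrt_mult)
  qed
  have meas: "(\<lambda>\<omega>. (\<Sum>k\<in>K. increment c g n k \<omega>) / sqrt (real n)) \<in> borel_measurable M"
    if "K \<subseteq> {1..n}" for n K
    using bounded_rv_measurable[OF sum_increment_bounded[OF g that, of c]] by measurable
  have intK: "integrable M (\<lambda>\<omega>. \<bar>(\<Sum>k\<in>K. increment c g n k \<omega>) / sqrt (real n)\<bar>)" if "K \<subseteq> {1..n}" for n K
    using integrable_bounded_rv[OF sum_increment_bounded[OF g that, of c]] by simp
  show ?thesis
  proof (cases "var g = 0")
    \<comment> \<open>The central limit theorem for the block sums asks for positive variance; with
      variance 0 the normalised sums vanish in mean.\<close>
    case True
    have "norm ((\<integral>\<omega>. iexp (?Y n \<omega>) \<partial>M) - 1) \<le> 0" if "n \<ge> d" for n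
    proof -
      have "norm ((\<integral>\<omega>. iexp (?Y n \<omega>) \<partial>M) - (\<integral>\<omega>. iexp 0 \<partial>M)) \<le> (\<integral>\<omega>. \<bar>?Y n \<omega> - 0\<bar> \<partial>M)"
        by (rule expectation_iexp_diff_le) (use meas[of "{1..n}" n] intK[of "{1..n}" n] in simp_all)
      also have "\<dots> \<le> 0" using rest[OF that, of "{1..n}"] True by simp
      finally show ?thesis by (simp add: prob_space)
    qed
    then have "(\<integral>\<omega>. iexp (?Y n \<omega>) \<partial>M) = 1" if "n \<ge> d" for n
      using that by (metis norm_le_zero_iff right_minus_eq)
    then have "eventually (\<lambda>n. (\<integral>\<omega>. iexp (?Y n \<omega>) \<partial>M) = 1) sequentially"
      unfolding eventually_sequentially by blast
    then have "(\<lambda>n. \<integral>\<omega>. iexp (?Y n \<omega>) \<partial>M) \<longlonglongrightarrow> 1" by (rule tendsto_eventually)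
    then show ?thesis by (simp only: True mult_zero_right minus_zero div_0 exp_zero of_real_1)
  next
    case False
    then have v: "var g > 0" using var_nonneg[of g] by linarith
    \<comment> \<open>Two errors: the L1 size of the discarded increments, whose fraction is
      eventually at most \<open>2 * real d / real (Suc L + d)\<close>, and the variance missing from
      the Gaussian limit of the blocks. \<open>Suc L\<close> keeps the blocks nonempty.\<close>
    define e where "e L = max (sqrt (2 * real d / real (Suc L + d) * ?V))
       \<bar>exp (- ?V / 2) - exp (- (real (Suc L) / real (Suc L + d) * ?V) / 2)\<bar>" for L
    have rat: "(\<lambda>L. real d / real (Suc L + d)) \<longlonglongrightarrow> 0"
      by (rule tendsto_divide_0[OF tendsto_const])
         (rule filterlim_at_top_imp_at_infinity, rule filterlim_compose[OF filterlim_real_sequentially],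
          rule filterlim_at_top_mono[OF filterlim_ident], simp)
    have rat1: "real (Suc L) / real (Suc L + d) = 1 - real d / real (Suc L + d)" for L
      by (simp add: field_simps)
    show ?thesis
    proof (rule tendsto_by_approximation[where e=e])
      fix L
      let ?P = "Suc L + d"
      let ?B = "\<lambda>n \<omega>. (\<Sum>m<n div ?P. block_sum c g (Suc L) m \<omega>) / sqrt (real n)"
      show "(\<lambda>n. \<integral>\<omega>. iexp (?B n \<omega>) \<partial>M) \<longlonglongrightarrow> complex_of_real (exp (- (real (Suc L) / real (Suc L + d) * ?V) / 2))"
        by (rule block_clt[OF g v]) simp
      have "\<bar>exp (- ?V / 2) - exp (- (real (Suc L) / real (Suc L + d) * ?V) / 2)\<bar> \<le> e L"
        by (simp add: e_def)
      then show "norm (complex_of_real (exp (- ?V / 2)) - complex_of_real (exp (- (real (Suc L) / real (Suc L + d) * ?V) / 2))) \<le> e L"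
        by (simp only: of_real_diff[symmetric] norm_of_real)
      \<comment> \<open>The gaps account for a fraction \<open>real d / real ?P\<close> of the
        indices, the incomplete last block for at most \<open>Suc L\<close> further ones. Once these
        are the smaller share, the factor 2 covers both.\<close>
      have "eventually (\<lambda>n. real (Suc L) / real n < real d / real ?P) sequentially"
      proof (rule order_tendstoD(2))
        show "(\<lambda>n. real (Suc L) / real n) \<longlonglongrightarrow> 0" by (rule lim_const_over_n)
        show "0 < real d / real ?P" using d_pos by simp
      qed
      then show "\<forall>\<^sub>F n in sequentially. norm ((\<integral>\<omega>. iexp (?Y n \<omega>) \<partial>M) - (\<integral>\<omega>. iexp (?B n \<omega>) \<partial>M)) \<le> e L"
        using eventually_ge_at_top[of "max d 1"]
      proof eventually_elim
        case (elim n)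
        then have n: "n \<ge> d" "n > 0" by auto
        let ?N = "n div ?P"
        define Kb where "Kb = (\<lambda>(m, i). m * ?P + i) ` ({..<?N} \<times> {1..Suc L})"
        have inj: "inj_on (\<lambda>(m, i). m * ?P + i) ({..<?N} \<times> {1..Suc L})"
          by (rule inj_on_subset[OF block_index_inj]) auto
        have blk: "(m + 1) * ?P \<le> n" if "m < ?N" for m
        proof -
          have "(m + 1) * ?P \<le> ?N * ?P" using that by (intro mult_right_mono) auto
          also have "\<dots> \<le> n" by (rule div_times_less_eq_dividend)
          finally show ?thesis .
        qed
        have Kb: "Kb \<subseteq> {1..n}"
        proof
          fix k assume "k \<in> Kb"
          then obtain m i where mi: "m < ?N" "1 \<le> i" "i \<le> Suc L" "k = m * ?P + i" unfolding Kb_def by auto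
          then show "k \<in> {1..n}" using blk[OF mi(1)] by auto
        qed
        have cardKb: "card Kb = ?N * Suc L"
          unfolding Kb_def card_image[OF inj] by (simp add: card_cartesian_product)
        have Bsum: "(\<Sum>m<?N. block_sum c g (Suc L) m \<omega>) = (\<Sum>k\<in>Kb. increment c g n k \<omega>)" for \<omega>
        proof -
          have "(\<Sum>m<?N. block_sum c g (Suc L) m \<omega>) = (\<Sum>m<?N. \<Sum>i=1..Suc L. increment c g n (m * ?P + i) \<omega>)"
            by (intro sum.cong refl block_sum_increment) (use blk in auto)
          also have "\<dots> = (\<Sum>(m, i)\<in>{..<?N} \<times> {1..Suc L}. increment c g n (m * ?P + i) \<omega>)"
            by (rule sum.cartesian_product)
          also have "\<dots> = (\<Sum>k\<in>Kb. increment c g n k \<omega>)"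
            unfolding Kb_def by (subst sum.reindex[OF inj]) (simp add: case_prod_unfold)
          finally show ?thesis .
        qed
        let ?K = "{1..n} - Kb"
        have split: "?Y n \<omega> - ?B n \<omega> = (\<Sum>k\<in>?K. increment c g n k \<omega>) / sqrt (real n)" for \<omega>
          unfolding Bsum using sum.subset_diff[OF Kb, of "\<lambda>k. increment c g n k \<omega>"]
          by (simp add: diff_divide_distrib[symmetric])
        have cardK: "real (card ?K) / real n \<le> 2 * real d / real ?P"
        proof -
          have "real n = real ?N * real ?P + real (n mod ?P)"
            by (metis div_mult_mod_eq of_nat_add of_nat_mult)
          moreover have "real (n mod ?P) \<le> real ?P"
            unfolding of_nat_le_iff by (rule less_imp_le, rule mod_less_divisor) simp
          ultimately have N: "real n / real ?P - 1 \<le> real ?N" by (simp add: field_simps)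
          have "real (card ?K) = real n - real ?N * real (Suc L)"
          proof -
            have "card ?K = n - card Kb" using card_Diff_subset[OF finite_subset[OF Kb] Kb] by simp
            moreover have "card Kb \<le> n" using card_mono[OF _ Kb] by simp
            ultimately show ?thesis by (simp only: cardKb of_nat_diff of_nat_mult)
          qed
          also have "\<dots> \<le> real n - (real n / real ?P - 1) * real (Suc L)"
            using mult_right_mono[OF N, of "real (Suc L)"] by simp
          also have "\<dots> = real n * (1 - real (Suc L) / real ?P) + real (Suc L)"
            by (simp add: algebra_simps)
          also have "\<dots> = real n * (real d / real ?P) + real (Suc L)"
            using rat1[of L] by simp
          finally have "real (card ?K) / real n \<le> (real n * (real d / real ?P) + real (Suc L)) / real n"
            by (rule divide_right_mono) simp
          also have "\<dots> = real d / real ?P + real (Suc L) / real n" using n by (simp add: add_divide_distrib)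
          also have "\<dots> \<le> 2 * real d / real ?P" using elim(1) by simp
          finally show ?thesis .
        qed
        have "norm ((\<integral>\<omega>. iexp (?Y n \<omega>) \<partial>M) - (\<integral>\<omega>. iexp (?B n \<omega>) \<partial>M)) \<le> (\<integral>\<omega>. \<bar>?Y n \<omega> - ?B n \<omega>\<bar> \<partial>M)"
        proof (rule expectation_iexp_diff_le)
          show "?Y n \<in> borel_measurable M" by (rule meas) simp
          show "?B n \<in> borel_measurable M" unfolding Bsum by (rule meas[OF Kb])
          show "integrable M (\<lambda>\<omega>. \<bar>?Y n \<omega> - ?B n \<omega>\<bar>)" unfolding split by (rule intK) auto
        qed
        also have "\<dots> \<le> sqrt (real (card ?K) / real n * ?V)"
          unfolding split by (rule rest[OF n(1)]) auto
        also have "\<dots> \<le> sqrt (2 * real d / real ?P * ?V)"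
          by (intro real_sqrt_le_mono mult_right_mono cardK V0)
        also have "\<dots> \<le> e L" by (simp add: e_def)
        finally show ?case .
      qed
    next
      have "(\<lambda>L. sqrt (2 * (real d / real (Suc L + d)) * ?V)) \<longlonglongrightarrow> sqrt (2 * 0 * ?V)"
        by (intro tendsto_intros rat)
      moreover have "(\<lambda>L. \<bar>exp (- ?V / 2) - exp (- ((1 - real d / real (Suc L + d)) * ?V) / 2)\<bar>)
          \<longlonglongrightarrow> \<bar>exp (- ?V / 2) - exp (- ((1 - 0) * ?V) / 2)\<bar>"
        by (intro tendsto_intros rat) simp
      ultimately have "(\<lambda>L. max (sqrt (2 * (real d / real (Suc L + d)) * ?V))
           \<bar>exp (- ?V / 2) - exp (- ((1 - real d / real (Suc L + d)) * ?V) / 2)\<bar>)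
          \<longlonglongrightarrow> max (sqrt (2 * 0 * ?V)) \<bar>exp (- ?V / 2) - exp (- ((1 - 0) * ?V) / 2)\<bar>"
        by (rule tendsto_max)
      then show "e \<longlonglongrightarrow> 0"
        unfolding e_def[abs_def] rat1 by simp
    qed
  qed
qed

end

subsection \<open>The feature map and its covariance\<close>

text \<open>Enlarging the index set multiplies the old remainder by \<open>a m\<close> and adds the
  full difference of the products times the new deviation; that difference is at most the sum of the
  old deviations. So every term of the remainder carries two deviations with different indices, the
  source of the quadratic bounds in t.\<close>

lemma norm_prod_linearization:
  fixes a z :: "'i \<Rightarrow> complex"
  assumes J: "finite J" and a: "\<And>j. j \<in> J \<Longrightarrow> cmod (a j) \<le> 1" and z: "\<And>j. j \<in> J \<Longrightarrow> cmod (z j) \<le> 1"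
  shows "cmod ((\<Prod>j\<in>J. z j) - (\<Prod>j\<in>J. a j) - (\<Sum>j\<in>J. (z j - a j) * (\<Prod>l\<in>J - {j}. a l)))
    \<le> (\<Sum>j\<in>J. \<Sum>l\<in>J - {j}. cmod (z j - a j) * cmod (z l - a l))"
  using J a z
proof (induction J rule: finite_induct)
  case (insert m J)
  let ?u = "\<lambda>j. cmod (z j - a j)"
  let ?D = "(\<Prod>j\<in>J. z j) - (\<Prod>j\<in>J. a j) - (\<Sum>j\<in>J. (z j - a j) * (\<Prod>l\<in>J - {j}. a l))"
  have sub: "insert m J - {j} = insert m (J - {j})" if "j \<in> J" for j using that insert by auto
  have pr: "(\<Prod>l\<in>insert m J - {j}. a l) = a m * (\<Prod>l\<in>J - {j}. a l)" if "j \<in> J" for j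
    using that insert by (simp add: sub)
  have "(\<Sum>j\<in>insert m J. (z j - a j) * (\<Prod>l\<in>insert m J - {j}. a l))
     = (z m - a m) * (\<Prod>l\<in>J. a l) + a m * (\<Sum>j\<in>J. (z j - a j) * (\<Prod>l\<in>J - {j}. a l))"
    using insert by (simp add: pr sum_distrib_left mult_ac)
  then have "(\<Prod>j\<in>insert m J. z j) - (\<Prod>j\<in>insert m J. a j) - (\<Sum>j\<in>insert m J. (z j - a j) * (\<Prod>l\<in>insert m J - {j}. a l))
      = ?D * a m + ((\<Prod>j\<in>J. z j) - (\<Prod>j\<in>J. a j)) * (z m - a m)"
    using insert by (simp add: algebra_simps)
  also have "cmod \<dots> \<le> cmod ?D * cmod (a m) + cmod ((\<Prod>j\<in>J. z j) - (\<Prod>j\<in>J. a j)) * ?u m"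
    by (rule order_trans[OF norm_triangle_ineq]) (simp add: norm_mult)
  also have "\<dots> \<le> cmod ?D * 1 + (\<Sum>j\<in>J. ?u j) * ?u m"
    by (intro add_mono mult_left_mono mult_right_mono norm_prod_diff) (use insert in auto)
  also have "\<dots> \<le> (\<Sum>j\<in>J. \<Sum>l\<in>J - {j}. ?u j * ?u l) + (\<Sum>j\<in>J. ?u j * ?u m)"
    using insert by (simp add: sum_distrib_right)
  also have "\<dots> = (\<Sum>j\<in>J. \<Sum>l\<in>insert m J - {j}. ?u j * ?u l)"
    unfolding sum.distrib[symmetric]
  proof (rule sum.cong[OF refl])
    fix j assume "j \<in> J"
    then show "(\<Sum>l\<in>J - {j}. ?u j * ?u l) + ?u j * ?u m = (\<Sum>l\<in>insert m J - {j}. ?u j * ?u l)"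
      using insert by (simp add: sub)
  qed
  also have "\<dots> \<le> (\<Sum>j\<in>insert m J. \<Sum>l\<in>insert m J - {j}. ?u j * ?u l)"
    using insert by (simp add: sum_nonneg)
  finally show ?case .
qed simp

text \<open>Cauchy-Schwarz over the at most \<open>(card J)^2\<close> ordered pairs. The pairs j
  \<noteq> l are kept apart since the expectation of such a product factorises under
  independence.\<close>

lemma norm_prod_linearization_sq:
  fixes a z :: "'i \<Rightarrow> complex"
  assumes J: "finite J" and a: "\<And>j. j \<in> J \<Longrightarrow> cmod (a j) \<le> 1" and z: "\<And>j. j \<in> J \<Longrightarrow> cmod (z j) \<le> 1"
  shows "(cmod ((\<Prod>j\<in>J. z j) - (\<Prod>j\<in>J. a j) - (\<Sum>j\<in>J. (z j - a j) * (\<Prod>l\<in>J - {j}. a l))))\<^sup>2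
    \<le> (real (card J))\<^sup>2 * (\<Sum>j\<in>J. \<Sum>l\<in>J - {j}. (cmod (z j - a j))\<^sup>2 * (cmod (z l - a l))\<^sup>2)"
proof -
  let ?I = "SIGMA j:J. J - {j}" and ?u = "\<lambda>j. cmod (z j - a j)"
  have sig: "(\<Sum>j\<in>J. \<Sum>l\<in>J - {j}. f j l) = (\<Sum>(j, l)\<in>?I. f j l)" for f :: "'i \<Rightarrow> 'i \<Rightarrow> real"
    using J by (simp add: sum.Sigma)
  have "card ?I \<le> card (J \<times> J)" using J by (intro card_mono) auto
  then have c: "real (card ?I) \<le> (real (card J))\<^sup>2"
    by (simp only: card_cartesian_product power2_eq_square of_nat_mult[symmetric] of_nat_le_iff)
  have "(cmod ((\<Prod>j\<in>J. z j) - (\<Prod>j\<in>J. a j) - (\<Sum>j\<in>J. (z j - a j) * (\<Prod>l\<in>J - {j}. a l))))\<^sup>2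
     \<le> (\<Sum>(j, l)\<in>?I. ?u j * ?u l)\<^sup>2"
    unfolding sig[symmetric] by (rule power_mono[OF norm_prod_linearization[OF J a z]]) auto
  also have "\<dots> \<le> (\<Sum>p\<in>?I. (case p of (j, l) \<Rightarrow> ?u j * ?u l)\<^sup>2) * card ?I"
    by (rule sum_squared_le_sum_of_squares)
  also have "(\<Sum>p\<in>?I. (case p of (j, l) \<Rightarrow> ?u j * ?u l)\<^sup>2) = (\<Sum>j\<in>J. \<Sum>l\<in>J - {j}. (?u j)\<^sup>2 * (?u l)\<^sup>2)"
    unfolding sig by (intro sum.cong) (auto simp: power_mult_distrib)
  also have "\<dots> * real (card ?I) \<le> \<dots> * (real (card J))\<^sup>2"
    by (intro mult_left_mono c sum_nonneg) auto
  finally show ?thesis by (simp add: mult.commute)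
qed

lemma cmod_minus_sq: "(cmod (a - b))\<^sup>2 = (cmod a)\<^sup>2 + (cmod b)\<^sup>2 - 2 * Re (a * cnj b)"
  by (simp add: cmod_sq_eq algebra_simps)

section \<open>Features and the variance of component characters\<close>

context sample
begin

lemma component_char_measurable [measurable]: "\<phi> j \<in> borel_measurable borel"
  unfolding component_char_def by measurable

lemma ch_measurable' [measurable (raw)]:
  assumes "f \<in> borel_measurable N" "g \<in> borel_measurable N"
  shows "(\<lambda>x. ch j (f x) (g x)) \<in> borel_measurable N"
  unfolding ch_def using component_inner_measurable'[OF assms] by measurable

lemma ch_tendsto: "r \<longlonglongrightarrow> t \<Longrightarrow> (\<lambda>i. ch j (r i) x) \<longlonglongrightarrow> ch j t x"
  unfolding ch_def component_inner_eq by (intro tendsto_intros)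

lemma component_char_tendsto: "r \<longlonglongrightarrow> t \<Longrightarrow> (\<lambda>i. \<phi> j (r i)) \<longlonglongrightarrow> \<phi> j t"
  unfolding component_char_eq
  by (rule integral_dominated_convergence[where w="\<lambda>_. 1"]) (auto intro: ch_tendsto)

text \<open>The Hoeffding projection of \<open>iexp (t \<bullet> x)\<close>: under independence, what remains after removing
  the mean and all functions of a single component.\<close>

definition feature :: "real ^ 'n \<Rightarrow> real ^ 'n \<Rightarrow> complex" where
  "feature t x = (\<Prod>j=1..d. ch j t x) - (\<Prod>j=1..d. \<phi> j t)
     - (\<Sum>j=1..d. (ch j t x - \<phi> j t) * (\<Prod>l\<in>{1..d} - {j}. \<phi> l t))"

lemma feature_measurable' [measurable (raw)]:
  assumes [measurable]: "f \<in> borel_measurable N" "g \<in> borel_measurable N"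
  shows "(\<lambda>x. feature (f x) (g x)) \<in> borel_measurable N"
  unfolding feature_def by measurable

lemma feature_tendsto: "r \<longlonglongrightarrow> t \<Longrightarrow> (\<lambda>i. feature (r i) x) \<longlonglongrightarrow> feature t x"
  unfolding feature_def by (intro tendsto_intros ch_tendsto component_char_tendsto)

lemma norm_prod_component_char: "cmod (\<Prod>l\<in>A. \<phi> l t) \<le> 1"
  unfolding prod_norm[symmetric] by (rule prod_le_1) (simp add: norm_component_char)

lemma feature_bound: "cmod (feature t x) \<le> 2 + 2 * real d"
proof -
  have "cmod (\<Sum>j=1..d. (ch j t x - \<phi> j t) * (\<Prod>l\<in>{1..d} - {j}. \<phi> l t)) \<le> (\<Sum>j=1..d. 2 * 1)"
  proof (rule order_trans[OF norm_sum sum_mono])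
    fix j
    have "cmod (ch j t x - \<phi> j t) \<le> 2"
      using norm_triangle_ineq4[of "ch j t x" "\<phi> j t"] norm_component_char[of j t] by simp
    then show "cmod ((ch j t x - \<phi> j t) * (\<Prod>l\<in>{1..d} - {j}. \<phi> l t)) \<le> 2 * 1"
      unfolding norm_mult by (intro mult_mono norm_prod_component_char) auto
  qed
  moreover have "cmod (\<Prod>j=1..d. ch j t x) \<le> 1" by (simp add: prod_norm[symmetric])
  ultimately show ?thesis
    using norm_triangle_ineq4[of "(\<Prod>j=1..d. ch j t x) - (\<Prod>j=1..d. \<phi> j t)" "\<Sum>j=1..d. (ch j t x - \<phi> j t) * (\<Prod>l\<in>{1..d} - {j}. \<phi> l t)"]
      norm_triangle_ineq4[of "\<Prod>j=1..d. ch j t x" "\<Prod>j=1..d. \<phi> j t"] norm_prod_component_char[of t "{1..d}"]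
    unfolding feature_def by (simp del: norm_prod_component_char)
qed

lemma ch_zero [simp]: "ch j 0 x = 1"
  by (simp add: ch_def)

lemma component_char_zero [simp]: "\<phi> j 0 = 1"
  by (simp add: component_char_eq prob_space)

lemma feature_zero [simp]: "feature 0 x = 0"
  by (simp add: feature_def)

definition dev :: "nat \<Rightarrow> real ^ 'n \<Rightarrow> real" where
  "dev j t = (\<integral>\<omega>. (cmod (ch j t (X \<omega>) - \<phi> j t))\<^sup>2 \<partial>M)"

lemma integrable_ch: "complex_integrable M (\<lambda>\<omega>. ch j t (X \<omega>))"
  by (rule integrable_bounded[OF finite_measure_axioms, where C=1]) auto

lemma expectation_minus_sq: "(\<integral>\<omega>. (cmod (ch j t (X \<omega>) - z))\<^sup>2 \<partial>M) = 1 + (cmod z)\<^sup>2 - 2 * Re (\<phi> j t * cnj z)"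
proof -
  have i: "complex_integrable M (\<lambda>\<omega>. ch j t (X \<omega>) * cnj z)"
    by (rule integrable_mult_left[OF integrable_ch])
  have "(\<integral>\<omega>. (cmod (ch j t (X \<omega>) - z))\<^sup>2 \<partial>M) = (\<integral>\<omega>. 1 + (cmod z)\<^sup>2 - 2 * Re (ch j t (X \<omega>) * cnj z) \<partial>M)"
    unfolding cmod_minus_sq by simp
  also have "\<dots> = 1 + (cmod z)\<^sup>2 - 2 * (\<integral>\<omega>. Re (ch j t (X \<omega>) * cnj z) \<partial>M)"
    by (subst Bochner_Integration.integral_diff)
       (auto simp only: prob_space integral_mult_right_zero intro!: integrable_mult_right integrable_Re i, simp_all add: prob_space)
  also have "(\<integral>\<omega>. Re (ch j t (X \<omega>) * cnj z) \<partial>M) = Re (\<phi> j t * cnj z)"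
    unfolding component_char_eq using i by (subst integral_Re) simp_all
  finally show ?thesis .
qed

lemma dev_eq: "dev j t = 1 - (cmod (\<phi> j t))\<^sup>2"
  unfolding dev_def expectation_minus_sq
  by (simp add: cmod_sq_eq)

lemma dev_nonneg: "dev j t \<ge> 0"
  unfolding dev_def by (rule integral_nonneg_AE) auto

text \<open>The variance is at most the second moment about 1, and there
  \<open>(cmod (ch j t x - 1))^2\<close> is bounded by 2 times \<open>norm t * norm x\<close>: one
  factor by 2, the other by the Lipschitz estimate. A first moment of X suffices, at the price of
  only linear decay in t.\<close>

lemma dev_le:
  assumes "integrable M (\<lambda>\<omega>. norm (X \<omega>))"
  shows "dev j t \<le> 1" "dev j t \<le> 2 * norm t * (\<integral>\<omega>. norm (X \<omega>) \<partial>M)"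
proof -
  show "dev j t \<le> 1" by (simp add: dev_eq)
  have "dev j t \<le> 2 - 2 * Re (\<phi> j t)"
  proof -
    have "(Re (\<phi> j t))\<^sup>2 \<le> (cmod (\<phi> j t))\<^sup>2" by (simp add: cmod_power2)
    moreover have "0 \<le> (1 - Re (\<phi> j t))\<^sup>2" by simp
    ultimately show ?thesis unfolding dev_eq by (simp add: power2_diff)
  qed
  also have "\<dots> = (\<integral>\<omega>. (cmod (ch j t (X \<omega>) - 1))\<^sup>2 \<partial>M)"
    unfolding expectation_minus_sq by simp
  also have "\<dots> \<le> (\<integral>\<omega>. 2 * norm t * norm (X \<omega>) \<partial>M)"
  proof (rule integral_mono)
    fix \<omega>
    have "cmod (ch j t (X \<omega>) - 1) \<le> norm t * norm (X \<omega>)"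
      using norm_iexp_diff_le[of "component_inner b j t (X \<omega>)" 0] abs_component_inner_le[of b j t "X \<omega>"]
      by (simp add: ch_def)
    moreover have "cmod (ch j t (X \<omega>) - 1) \<le> 2"
      using norm_triangle_ineq4[of "ch j t (X \<omega>)" 1] by simp
    ultimately have "cmod (ch j t (X \<omega>) - 1) * cmod (ch j t (X \<omega>) - 1) \<le> 2 * (norm t * norm (X \<omega>))"
      by (intro mult_mono) auto
    then show "(cmod (ch j t (X \<omega>) - 1))\<^sup>2 \<le> 2 * norm t * norm (X \<omega>)"
      by (simp add: power2_eq_square mult.assoc)
  next
    have "cmod (ch j t x - 1) \<le> 2" for x using norm_triangle_ineq4[of "ch j t x" 1] by simp
    then have "(cmod (ch j t x - 1))\<^sup>2 \<le> 2\<^sup>2" for x by (intro power_mono) auto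
    then show "integrable M (\<lambda>\<omega>. (cmod (ch j t (X \<omega>) - 1))\<^sup>2)"
      by (intro integrable_bounded[OF finite_measure_axioms, where C="2\<^sup>2"]) auto
    show "integrable M (\<lambda>\<omega>. 2 * norm t * norm (X \<omega>))" using assms by simp
  qed
  also have "\<dots> = 2 * norm t * (\<integral>\<omega>. norm (X \<omega>) \<partial>M)" by simp
  finally show "dev j t \<le> 2 * norm t * (\<integral>\<omega>. norm (X \<omega>) \<partial>M)" .
qed

definition dev_const :: real where
  "dev_const = 1 + (2 * (\<integral>\<omega>. norm (X \<omega>) \<partial>M))\<^sup>2"

lemma dev_const_pos: "dev_const > 0"
  unfolding dev_const_def by (simp add: add_pos_nonneg)

text \<open>Two linear bounds multiply to the square that \<open>trunc_sq\<close> asks for near the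
  origin, and the bound 1 is used elsewhere; \<open>dev_const\<close> dominates the constants of
  both regimes.\<close>

lemma dev_mult_le:
  assumes "integrable M (\<lambda>\<omega>. norm (X \<omega>))"
  shows "dev j t * dev l t \<le> dev_const * trunc_sq t"
proof -
  let ?m = "2 * (\<integral>\<omega>. norm (X \<omega>) \<partial>M)"
  have "dev j t * dev l t \<le> 1 * 1"
    by (intro mult_mono dev_le[OF assms] dev_nonneg) auto
  moreover have "dev j t * dev l t \<le> (?m * norm t) * (?m * norm t)"
    by (rule mult_mono) (use dev_le(2)[OF assms, of _ t] dev_nonneg in \<open>auto simp: mult_ac\<close>)
  ultimately have "dev j t * dev l t \<le> min 1 (?m\<^sup>2 * (norm t)\<^sup>2)"
    by (simp add: power2_eq_square mult_ac)
  also have "\<dots> \<le> (1 + ?m\<^sup>2) * min 1 ((norm t)\<^sup>2)"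
  proof (cases "(norm t)\<^sup>2 \<le> 1")
    case True
    then have "?m\<^sup>2 * (norm t)\<^sup>2 \<le> (1 + ?m\<^sup>2) * (norm t)\<^sup>2" by (intro mult_right_mono) auto
    then show ?thesis using True by (simp add: min_def)
  next
    case False
    then have "1 \<le> (1 + ?m\<^sup>2) * min 1 ((norm t)\<^sup>2)" by simp
    then show ?thesis by linarith
  qed
  finally show ?thesis by (simp add: dev_const_def trunc_sq_def)
qed

end

section \<open>Second moments of products of deviations\<close>

lemma sum_sum_mult:
  fixes f g :: "'i \<Rightarrow> 'i \<Rightarrow> complex"
  shows "(\<Sum>k\<in>A. \<Sum>k'\<in>A. f k k') * (\<Sum>r\<in>A. \<Sum>r'\<in>A. g r r')
    = (\<Sum>k\<in>A. \<Sum>k'\<in>A. \<Sum>r\<in>A. \<Sum>r'\<in>A. f k k' * g r r')"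
  by (simp only: sum_distrib_right, simp only: sum_distrib_left)

context independent_sample
begin

lemma norm_prod_le_power:
  fixes f :: "'i \<Rightarrow> complex"
  assumes "\<And>i. i \<in> I \<Longrightarrow> cmod (f i) \<le> C"
  shows "cmod (\<Prod>i\<in>I. f i) \<le> C ^ card I"
  unfolding prod_norm[symmetric] prod_constant[symmetric] by (rule prod_mono) (use assms in auto)

lemma expectation_prod_Xs_components:
  fixes f :: "nat \<Rightarrow> nat \<Rightarrow> real ^ 'n \<Rightarrow> complex"
  assumes K: "finite K" "\<And>m. m \<in> K \<Longrightarrow> m \<ge> 1"
    and f[measurable]: "\<And>j m. f j m \<in> borel_measurable borel" and bd: "\<And>j m x. cmod (f j m x) \<le> C"
    and comp: "\<And>j m. j \<in> {1..d} \<Longrightarrow> comp_fun j (f j m)"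
  shows "(\<integral>\<omega>. (\<Prod>m\<in>K. \<Prod>j=1..d. f j m (Xs m \<omega>)) \<partial>M) = (\<Prod>m\<in>K. \<Prod>j=1..d. \<integral>\<omega>. f j m (X \<omega>) \<partial>M)"
proof -
  have "(\<integral>\<omega>. (\<Prod>m\<in>K. \<Prod>j=1..d. f j m (Xs m \<omega>)) \<partial>M) = (\<Prod>m\<in>K. \<integral>\<omega>. (\<Prod>j=1..d. f j m (X \<omega>)) \<partial>M)"
    by (rule expectation_prod_Xs[where \<rho>="\<lambda>m. m" and C="\<lambda>_. C ^ card {1..d}"])
       (use K in \<open>auto intro!: norm_prod_le_power[of "{1..d}", simplified] bd\<close>)
  also have "\<dots> = (\<Prod>m\<in>K. \<Prod>j=1..d. \<integral>\<omega>. f j m (X \<omega>) \<partial>M)"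
    by (intro prod.cong refl expectation_prod_components[OF f bd comp])
  finally show ?thesis .
qed

text \<open>In the array of blocks, indexed by sample number and component, the columns j and l are
  independent. All columns other than these two receive the factor 1.\<close>

lemma expectation_columns:
  fixes p q :: "nat \<Rightarrow> real ^ 'n \<Rightarrow> complex"
  assumes K: "finite K" "\<And>m. m \<in> K \<Longrightarrow> m \<ge> 1" and jl: "j \<in> {1..d}" "l \<in> {1..d}" "j \<noteq> l"
    and p[measurable]: "\<And>m. p m \<in> borel_measurable borel" and q[measurable]: "\<And>m. q m \<in> borel_measurable borel"
    and pb: "\<And>m x. cmod (p m x) \<le> C" and qb: "\<And>m x. cmod (q m x) \<le> C" and C: "C \<ge> 1"
    and pc: "\<And>m. comp_fun j (p m)" and qc: "\<And>m. comp_fun l (q m)"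
  shows "(\<integral>\<omega>. (\<Prod>m\<in>K. p m (Xs m \<omega>)) * (\<Prod>m\<in>K. q m (Xs m \<omega>)) \<partial>M)
    = (\<integral>\<omega>. (\<Prod>m\<in>K. p m (Xs m \<omega>)) \<partial>M) * (\<integral>\<omega>. (\<Prod>m\<in>K. q m (Xs m \<omega>)) \<partial>M)"
proof -
  define f where "f i m x = (if i = j then p m x else if i = l then q m x else 1)" for i m x
  have f_m[measurable]: "f i m \<in> borel_measurable borel" for i m unfolding f_def by measurable
  have f_b: "cmod (f i m x) \<le> C" for i m x using pb qb C by (auto simp: f_def)
  have f_c: "comp_fun i (f i m)" for i m
    unfolding comp_fun_def
  proof (intro allI impI)
    fix x y assume e: "component b i x = component b i y"
    have "p m x = p m y" if "i = j" using pc[of m] e that unfolding comp_fun_def by blast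
    moreover have "q m x = q m y" if "i = l" using qc[of m] e that unfolding comp_fun_def by blast
    ultimately show "f i m x = f i m y" by (simp add: f_def)
  qed
  have split: "(\<Prod>i=1..d. if i = j then a else if i = l then b else 1) = a * b" for a b :: complex
  proof -
    have "(\<Prod>i=1..d. if i = j then a else if i = l then b else 1)
        = (\<Prod>i=1..d. (if i = j then a else 1) * (if i = l then b else 1))"
      by (rule prod.cong) (use jl in auto)
    then show ?thesis using jl by (simp add: prod.distrib)
  qed
  have "(\<integral>\<omega>. (\<Prod>m\<in>K. p m (Xs m \<omega>)) * (\<Prod>m\<in>K. q m (Xs m \<omega>)) \<partial>M)
      = (\<integral>\<omega>. (\<Prod>m\<in>K. \<Prod>i=1..d. f i m (Xs m \<omega>)) \<partial>M)"
    unfolding f_def split by (simp add: prod.distrib)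
  also have "\<dots> = (\<Prod>m\<in>K. \<Prod>i=1..d. \<integral>\<omega>. f i m (X \<omega>) \<partial>M)"
    by (rule expectation_prod_Xs_components[OF K f_m f_b f_c])
  also have "\<dots> = (\<Prod>m\<in>K. \<Prod>i=1..d. if i = j then (\<integral>\<omega>. p m (X \<omega>) \<partial>M) else if i = l then (\<integral>\<omega>. q m (X \<omega>) \<partial>M) else 1)"
    by (intro prod.cong refl) (auto simp: f_def prob_space)
  also have "\<dots> = (\<Prod>m\<in>K. \<integral>\<omega>. p m (X \<omega>) \<partial>M) * (\<Prod>m\<in>K. \<integral>\<omega>. q m (X \<omega>) \<partial>M)"
    unfolding split by (rule prod.distrib)
  also have "(\<Prod>m\<in>K. \<integral>\<omega>. p m (X \<omega>) \<partial>M) = (\<integral>\<omega>. (\<Prod>m\<in>K. p m (Xs m \<omega>)) \<partial>M)"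
    by (rule expectation_prod_Xs[where \<rho>="\<lambda>m. m" and C="\<lambda>_. C", symmetric]) (use K pb in auto)
  also have "(\<Prod>m\<in>K. \<integral>\<omega>. q m (X \<omega>) \<partial>M) = (\<integral>\<omega>. (\<Prod>m\<in>K. q m (Xs m \<omega>)) \<partial>M)"
    by (rule expectation_prod_Xs[where \<rho>="\<lambda>m. m" and C="\<lambda>_. C", symmetric]) (use K qb in auto)
  finally show ?thesis .
qed

definition ecf_comp :: "nat \<Rightarrow> nat \<Rightarrow> real ^ 'n \<Rightarrow> 'w \<Rightarrow> complex" where
  "ecf_comp j n t \<omega> = (1 / of_nat n) * (\<Sum>k=1..n. ch j t (Xs k \<omega>))"

lemma ecf_comp_measurable [measurable]: "ecf_comp j n t \<in> borel_measurable M"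
  unfolding ecf_comp_def[abs_def]
  by (intro borel_measurable_times borel_measurable_const borel_measurable_sum
      measurable_compose[OF Xs_measurable ch_measurable]) auto

lemma norm_ecf_comp: "cmod (ecf_comp j n t \<omega>) \<le> 1"
proof (cases "n = 0")
  case False
  have "cmod (\<Sum>k=1..n. ch j t (Xs k \<omega>)) \<le> (\<Sum>k=1..n. 1)"
    by (rule order_trans[OF norm_sum]) simp
  then show ?thesis using False by (simp add: ecf_comp_def norm_mult norm_divide field_simps)
qed (simp add: ecf_comp_def)

text \<open>The deviations of the component averages belong to different columns, so the expectation
  is the product of the two variances, each \<open>dev\<close> divided by n. Expanding both squared
  moduli into double sums reduces the claim to products over single entries of the array.\<close>

lemma ecf_comp_dev_mult:
  assumes jl: "j \<in> {1..d}" "l \<in> {1..d}" "j \<noteq> l" and n: "n > 0"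
  shows "(\<integral>\<omega>. (cmod (ecf_comp j n t \<omega> - \<phi> j t))\<^sup>2 * (cmod (ecf_comp l n t \<omega> - \<phi> l t))\<^sup>2 \<partial>M)
    = dev j t * dev l t / (real n)\<^sup>2"
proof -
  define \<epsilon> where "\<epsilon> j x = ch j t x - \<phi> j t" for j x
  have \<epsilon>_m[measurable]: "\<epsilon> j \<in> borel_measurable borel" for j unfolding \<epsilon>_def by measurable
  have \<epsilon>_b: "cmod (\<epsilon> j x) \<le> 2" for j x
    using norm_triangle_ineq4[of "ch j t x" "\<phi> j t"] norm_component_char[of j t] by (simp add: \<epsilon>_def)
  have \<epsilon>_c: "comp_fun j (\<epsilon> j)" for j
    using comp_fun_ch[of j t] unfolding comp_fun_def \<epsilon>_def by metis
  let ?K = "{1..n}"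
  \<comment> \<open>Writes the product of one deviation at k and a conjugate deviation at k' as a
    product over all sample numbers; for k = k' both factors fall on the same number. This is the
    form in which independence is applied.\<close>
  define p where "p j k k' m x = (if m = k then \<epsilon> j x else 1) * (if m = k' then cnj (\<epsilon> j x) else 1)"
    for j k k' m :: nat and x
  have p_m[measurable]: "p j k k' m \<in> borel_measurable borel" for j k k' m unfolding p_def by measurable
  have p_b: "cmod (p j k k' m x) \<le> 4" for j k k' m x
  proof -
    have "cmod (p j k k' m x) \<le> 2 * 2"
      unfolding p_def norm_mult by (rule mult_mono) (use \<epsilon>_b[of j x] in auto)
    then show ?thesis by simp
  qed
  have p_c: "comp_fun j (p j k k' m)" for j k k' m
    using \<epsilon>_c[of j] unfolding comp_fun_def p_def by metis
  have p_prod: "(\<Prod>m\<in>?K. p j k k' m (Xs m \<omega>)) = \<epsilon> j (Xs k \<omega>) * cnj (\<epsilon> j (Xs k' \<omega>))"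
    if "k \<in> ?K" "k' \<in> ?K" for j k k' \<omega>
    unfolding p_def prod.distrib using that by simp
  have mean0: "(\<integral>\<omega>. \<epsilon> j (X \<omega>) \<partial>M) = 0" for j
    unfolding \<epsilon>_def using integrable_ch by (simp add: component_char_eq prob_space)
  have rv[measurable]: "(\<lambda>\<omega>. \<epsilon> j (Xs k \<omega>)) \<in> borel_measurable M" if "k \<in> ?K" for j k
    using that by (intro measurable_compose[OF Xs_measurable \<epsilon>_m]) auto
  have cov: "(\<integral>\<omega>. \<epsilon> j (Xs k \<omega>) * cnj (\<epsilon> j (Xs k' \<omega>)) \<partial>M) = (if k = k' then complex_of_real (dev j t) else 0)"
    if k: "k \<in> ?K" "k' \<in> ?K" for j k k'
  proof -
    have "(\<integral>\<omega>. \<epsilon> j (Xs k \<omega>) * cnj (\<epsilon> j (Xs k' \<omega>)) \<partial>M) = (\<Prod>m\<in>?K. \<integral>\<omega>. p j k k' m (X \<omega>) \<partial>M)"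
      unfolding p_prod[OF k, symmetric]
      by (rule expectation_prod_Xs[where \<rho>="\<lambda>m. m" and C="\<lambda>_. 4"]) (use p_b in auto)
    also have "\<dots> = (if k = k' then complex_of_real (dev j t) else 0)"
    proof (cases "k = k'")
      case True
      have "(\<integral>\<omega>. p j k k' m (X \<omega>) \<partial>M) = (if m = k then complex_of_real (dev j t) else 1)" for m
      proof -
        have "(\<integral>\<omega>. \<epsilon> j (X \<omega>) * cnj (\<epsilon> j (X \<omega>)) \<partial>M) = complex_of_real (dev j t)"
          unfolding dev_def \<epsilon>_def complex_norm_square[symmetric] by (rule integral_complex_of_real)
        then show ?thesis using True by (simp add: p_def prob_space)
      qed
      then show ?thesis using True k by simp
    next
      case False
      have "(\<integral>\<omega>. p j k k' k (X \<omega>) \<partial>M) = 0" using False mean0 by (simp add: p_def)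
      then show ?thesis using False k by (auto intro: prod_zero)
    qed
    finally show ?thesis .
  qed
  have int: "complex_integrable M (\<lambda>\<omega>. \<epsilon> j (Xs k \<omega>) * cnj (\<epsilon> j (Xs k' \<omega>)))" if "k \<in> ?K" "k' \<in> ?K" for j k k'
  proof (rule integrable_bounded[OF finite_measure_axioms, where C="2 * 2"])
    show "cmod (\<epsilon> j (Xs k x) * cnj (\<epsilon> j (Xs k' x))) \<le> 2 * 2" for x
      unfolding norm_mult by (rule mult_mono) (use \<epsilon>_b in auto)
  qed (use that in measurable)
  have int4: "complex_integrable M (\<lambda>\<omega>. (\<epsilon> j (Xs k \<omega>) * cnj (\<epsilon> j (Xs k' \<omega>))) * (\<epsilon> l (Xs r \<omega>) * cnj (\<epsilon> l (Xs r' \<omega>))))"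
    if "k \<in> ?K" "k' \<in> ?K" "r \<in> ?K" "r' \<in> ?K" for k k' r r'
  proof (rule integrable_bounded[OF finite_measure_axioms, where C="(2 * 2) * (2 * 2)"])
    show "cmod ((\<epsilon> j (Xs k x) * cnj (\<epsilon> j (Xs k' x))) * (\<epsilon> l (Xs r x) * cnj (\<epsilon> l (Xs r' x)))) \<le> (2 * 2) * (2 * 2)" for x
      unfolding norm_mult by (intro mult_mono) (use \<epsilon>_b in auto)
  qed (use that in measurable)
  have sq: "complex_of_real ((cmod (ecf_comp j n t \<omega> - \<phi> j t))\<^sup>2)
      = (1 / (of_nat n)\<^sup>2) * (\<Sum>k\<in>?K. \<Sum>k'\<in>?K. \<epsilon> j (Xs k \<omega>) * cnj (\<epsilon> j (Xs k' \<omega>)))" for j \<omega>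
  proof -
    have "ecf_comp j n t \<omega> - \<phi> j t = (1 / of_nat n) * (\<Sum>k\<in>?K. \<epsilon> j (Xs k \<omega>))"
      using n by (simp add: ecf_comp_def \<epsilon>_def sum_subtractf right_diff_distrib)
    then show ?thesis
      unfolding complex_norm_square by (simp add: sum_product power2_eq_square mult_ac)
  qed
  have "complex_of_real (\<integral>\<omega>. (cmod (ecf_comp j n t \<omega> - \<phi> j t))\<^sup>2 * (cmod (ecf_comp l n t \<omega> - \<phi> l t))\<^sup>2 \<partial>M)
     = (\<integral>\<omega>. (1 / (of_nat n) ^ 4) * (\<Sum>k\<in>?K. \<Sum>k'\<in>?K. \<Sum>r\<in>?K. \<Sum>r'\<in>?K.
         (\<epsilon> j (Xs k \<omega>) * cnj (\<epsilon> j (Xs k' \<omega>))) * (\<epsilon> l (Xs r \<omega>) * cnj (\<epsilon> l (Xs r' \<omega>)))) \<partial>M)"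
    unfolding integral_complex_of_real[symmetric] of_real_mult sq
  proof (intro Bochner_Integration.integral_cong refl)
    fix \<omega>
    let ?A = "\<Sum>k\<in>?K. \<Sum>k'\<in>?K. \<epsilon> j (Xs k \<omega>) * cnj (\<epsilon> j (Xs k' \<omega>))"
    let ?B = "\<Sum>k\<in>?K. \<Sum>k'\<in>?K. \<epsilon> l (Xs k \<omega>) * cnj (\<epsilon> l (Xs k' \<omega>))"
    have "?A * ?B = (\<Sum>k\<in>?K. \<Sum>k'\<in>?K. \<Sum>r\<in>?K. \<Sum>r'\<in>?K.
         (\<epsilon> j (Xs k \<omega>) * cnj (\<epsilon> j (Xs k' \<omega>))) * (\<epsilon> l (Xs r \<omega>) * cnj (\<epsilon> l (Xs r' \<omega>))))"
      by (rule sum_sum_mult)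
    moreover have "(1 / (of_nat n)\<^sup>2 * ?A) * (1 / (of_nat n)\<^sup>2 * ?B) = 1 / (of_nat n) ^ 4 * (?A * ?B)"
      by (simp add: power4_eq_xxxx power2_eq_square)
    ultimately show "(1 / (of_nat n)\<^sup>2 * ?A) * (1 / (of_nat n)\<^sup>2 * ?B)
        = (1 / (of_nat n) ^ 4) * (\<Sum>k\<in>?K. \<Sum>k'\<in>?K. \<Sum>r\<in>?K. \<Sum>r'\<in>?K.
         (\<epsilon> j (Xs k \<omega>) * cnj (\<epsilon> j (Xs k' \<omega>))) * (\<epsilon> l (Xs r \<omega>) * cnj (\<epsilon> l (Xs r' \<omega>))))"
      by (simp only:)
  qed
  also have "\<dots> = (1 / (of_nat n) ^ 4) * (\<Sum>k\<in>?K. \<Sum>k'\<in>?K. \<Sum>r\<in>?K. \<Sum>r'\<in>?K.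
         \<integral>\<omega>. (\<epsilon> j (Xs k \<omega>) * cnj (\<epsilon> j (Xs k' \<omega>))) * (\<epsilon> l (Xs r \<omega>) * cnj (\<epsilon> l (Xs r' \<omega>))) \<partial>M)"
    using int4 by (simp only: integral_mult_right_zero Bochner_Integration.integral_sum Bochner_Integration.integrable_sum cong: sum.cong)
  also have "\<dots> = (1 / (of_nat n) ^ 4) * (\<Sum>k\<in>?K. \<Sum>k'\<in>?K. \<Sum>r\<in>?K. \<Sum>r'\<in>?K.
         (if k = k' then complex_of_real (dev j t) else 0) * (if r = r' then complex_of_real (dev l t) else 0))"
  proof (intro arg_cong2[where f="(*)"] sum.cong refl)
    fix k k' r r' assume k: "k \<in> ?K" "k' \<in> ?K" "r \<in> ?K" "r' \<in> ?K"
    have "(\<integral>\<omega>. (\<epsilon> j (Xs k \<omega>) * cnj (\<epsilon> j (Xs k' \<omega>))) * (\<epsilon> l (Xs r \<omega>) * cnj (\<epsilon> l (Xs r' \<omega>))) \<partial>M)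
       = (\<integral>\<omega>. \<epsilon> j (Xs k \<omega>) * cnj (\<epsilon> j (Xs k' \<omega>)) \<partial>M) * (\<integral>\<omega>. \<epsilon> l (Xs r \<omega>) * cnj (\<epsilon> l (Xs r' \<omega>)) \<partial>M)"
      using expectation_columns[of ?K j l "p j k k'" "p l r r'" 4] jl p_b p_c
      by (simp only: p_prod[OF k(1,2)] p_prod[OF k(3,4)]) simp
    then show "(\<integral>\<omega>. (\<epsilon> j (Xs k \<omega>) * cnj (\<epsilon> j (Xs k' \<omega>))) * (\<epsilon> l (Xs r \<omega>) * cnj (\<epsilon> l (Xs r' \<omega>))) \<partial>M)
       = (if k = k' then complex_of_real (dev j t) else 0) * (if r = r' then complex_of_real (dev l t) else 0)"
      by (simp only: cov[OF k(1,2)] cov[OF k(3,4)])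
  qed
  also have "\<dots> = (1 / (of_nat n) ^ 4) * ((\<Sum>k\<in>?K. \<Sum>k'\<in>?K. (if k = k' then complex_of_real (dev j t) else 0))
      * (\<Sum>r\<in>?K. \<Sum>r'\<in>?K. (if r = r' then complex_of_real (dev l t) else 0)))"
    by (simp only: sum_sum_mult)
  also have "\<dots> = complex_of_real (dev j t * dev l t / (real n)\<^sup>2)"
    using n by (simp add: power4_eq_xxxx power2_eq_square field_simps)
  finally show ?thesis by (simp only: of_real_eq_iff)
qed

text \<open>Both bounds are instances of \<open>gen\<close>: z is the character of a single vector
  with c = 1, or the empirical average with c = 1/n^2. Of the factor d^4, one d^2 comes from
  Cauchy-Schwarz over pairs and one from counting the pairs.\<close>

lemma feature_sq_norm:
  assumes X1: "integrable M (\<lambda>\<omega>. norm (X \<omega>))"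
  shows "sq_norm M (\<lambda>\<omega>. feature t (X \<omega>)) \<le> real d ^ 4 * dev_const * trunc_sq t"
    and "n > 0 \<Longrightarrow> sq_norm M (\<lambda>\<omega>. (\<Prod>j=1..d. ecf_comp j n t \<omega>) - (\<Prod>j=1..d. \<phi> j t)
      - (\<Sum>j=1..d. (ecf_comp j n t \<omega> - \<phi> j t) * (\<Prod>l\<in>{1..d} - {j}. \<phi> l t)))
     \<le> real d ^ 4 * dev_const * trunc_sq t / (real n)\<^sup>2"
proof -
  have gen: "sq_norm M (\<lambda>\<omega>. (\<Prod>j=1..d. z j \<omega>) - (\<Prod>j=1..d. \<phi> j t) - (\<Sum>j=1..d. (z j \<omega> - \<phi> j t) * (\<Prod>l\<in>{1..d} - {j}. \<phi> l t)))
      \<le> real d ^ 4 * (dev_const * trunc_sq t) * c"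
    if z[measurable]: "\<And>j. z j \<in> borel_measurable M" and z1: "\<And>j \<omega>. cmod (z j \<omega>) \<le> 1" and c: "c \<ge> 0"
      and zE: "\<And>j l. j \<in> {1..d} \<Longrightarrow> l \<in> {1..d} \<Longrightarrow> j \<noteq> l \<Longrightarrow>
         (\<integral>\<omega>. (cmod (z j \<omega> - \<phi> j t))\<^sup>2 * (cmod (z l \<omega> - \<phi> l t))\<^sup>2 \<partial>M) = dev j t * dev l t * c" for z c
  proof -
    let ?J = "{1..d}"
    let ?D = "\<lambda>\<omega>. (\<Prod>j=1..d. z j \<omega>) - (\<Prod>j=1..d. \<phi> j t) - (\<Sum>j=1..d. (z j \<omega> - \<phi> j t) * (\<Prod>l\<in>{1..d} - {j}. \<phi> l t))"
    have b2: "(cmod (z j \<omega> - \<phi> j t))\<^sup>2 \<le> 2\<^sup>2" for j \<omega>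
    proof (rule power_mono)
      show "cmod (z j \<omega> - \<phi> j t) \<le> 2"
        using norm_triangle_ineq4[of "z j \<omega>" "\<phi> j t"] z1[of j \<omega>] norm_component_char[of j t] by simp
    qed simp
    have int: "integrable M (\<lambda>\<omega>. (cmod (z j \<omega> - \<phi> j t))\<^sup>2 * (cmod (z l \<omega> - \<phi> l t))\<^sup>2)" for j l
    proof (rule integrable_bounded[OF finite_measure_axioms, where C="2\<^sup>2 * 2\<^sup>2"])
      show "norm ((cmod (z j x - \<phi> j t))\<^sup>2 * (cmod (z l x - \<phi> l t))\<^sup>2) \<le> 2\<^sup>2 * 2\<^sup>2" for x
        unfolding norm_mult using b2 by (intro mult_mono) auto
    qed measurable
    have pt: "(cmod (?D \<omega>))\<^sup>2 \<le> (real (card ?J))\<^sup>2 * (\<Sum>j\<in>?J. \<Sum>l\<in>?J - {j}. (cmod (z j \<omega> - \<phi> j t))\<^sup>2 * (cmod (z l \<omega> - \<phi> l t))\<^sup>2)" for \<omega>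
      by (rule norm_prod_linearization_sq) (use z1 norm_component_char in auto)
    have intR: "integrable M (\<lambda>\<omega>. (real (card ?J))\<^sup>2 * (\<Sum>j\<in>?J. \<Sum>l\<in>?J - {j}. (cmod (z j \<omega> - \<phi> j t))\<^sup>2 * (cmod (z l \<omega> - \<phi> l t))\<^sup>2))"
      by (intro integrable_mult_right Bochner_Integration.integrable_sum int)
    have intD: "integrable M (\<lambda>\<omega>. (cmod (?D \<omega>))\<^sup>2)"
      by (rule Bochner_Integration.integrable_bound[OF intR]) (use pt in \<open>auto intro: order_trans[OF _ abs_ge_self]\<close>)
    have "sq_norm M ?D \<le> (\<integral>\<omega>. (real (card ?J))\<^sup>2 * (\<Sum>j\<in>?J. \<Sum>l\<in>?J - {j}. (cmod (z j \<omega> - \<phi> j t))\<^sup>2 * (cmod (z l \<omega> - \<phi> l t))\<^sup>2) \<partial>M)"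
      unfolding sq_norm_def by (rule integral_mono[OF intD intR pt])
    also have "\<dots> = (real d)\<^sup>2 * (\<Sum>j\<in>?J. \<Sum>l\<in>?J - {j}. \<integral>\<omega>. (cmod (z j \<omega> - \<phi> j t))\<^sup>2 * (cmod (z l \<omega> - \<phi> l t))\<^sup>2 \<partial>M)"
      using int by (simp add: Bochner_Integration.integral_sum)
    also have "\<dots> = (real d)\<^sup>2 * (\<Sum>j\<in>?J. \<Sum>l\<in>?J - {j}. dev j t * dev l t * c)"
      by (intro arg_cong2[where f="(*)"] sum.cong refl zE) auto
    also have "\<dots> \<le> (real d)\<^sup>2 * (\<Sum>j\<in>?J. \<Sum>l\<in>?J. dev_const * trunc_sq t * c)"
    proof (intro mult_left_mono sum_mono)
      fix j
      have "(\<Sum>l\<in>?J - {j}. dev j t * dev l t * c) \<le> (\<Sum>l\<in>?J. dev j t * dev l t * c)"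
        using dev_nonneg c by (intro sum_mono2) auto
      also have "\<dots> \<le> (\<Sum>l\<in>?J. dev_const * trunc_sq t * c)"
        by (intro sum_mono mult_right_mono dev_mult_le X1 c)
      finally show "(\<Sum>l\<in>?J - {j}. dev j t * dev l t * c) \<le> (\<Sum>l\<in>?J. dev_const * trunc_sq t * c)" .
    qed simp
    also have "\<dots> = real d ^ 4 * (dev_const * trunc_sq t) * c"
      by (simp add: power4_eq_xxxx power2_eq_square)
    finally show ?thesis .
  qed
  show "sq_norm M (\<lambda>\<omega>. feature t (X \<omega>)) \<le> real d ^ 4 * dev_const * trunc_sq t"
  proof -
    have "(\<integral>\<omega>. (cmod (ch j t (X \<omega>) - \<phi> j t))\<^sup>2 * (cmod (ch l t (X \<omega>) - \<phi> l t))\<^sup>2 \<partial>M) = dev j t * dev l t * 1"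
      if jl: "j \<in> {1..d}" "l \<in> {1..d}" "j \<noteq> l" for j l
    proof -
      \<comment> \<open>An empirical average over one observation is the character itself, so the
        factorisation for a single vector is the case n = 1.\<close>
      have e: "ecf_comp j 1 t \<omega> = ch j t (Xs 1 \<omega>)" for j \<omega> by (simp add: ecf_comp_def)
      have "(\<integral>\<omega>. (cmod (ch j t (Xs 1 \<omega>) - \<phi> j t))\<^sup>2 * (cmod (ch l t (Xs 1 \<omega>) - \<phi> l t))\<^sup>2 \<partial>M) = dev j t * dev l t"
        using ecf_comp_dev_mult[OF jl, of 1 t] by (simp only: e) simp
      then show ?thesis
        using expectation_Xs[of 1 "\<lambda>x. (cmod (ch j t x - \<phi> j t))\<^sup>2 * (cmod (ch l t x - \<phi> l t))\<^sup>2"] by simp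
    qed
    from gen[of "\<lambda>j \<omega>. ch j t (X \<omega>)" 1, OF _ _ _ this]
    show ?thesis by (simp add: feature_def)
  qed
  show "sq_norm M (\<lambda>\<omega>. (\<Prod>j=1..d. ecf_comp j n t \<omega>) - (\<Prod>j=1..d. \<phi> j t)
      - (\<Sum>j=1..d. (ecf_comp j n t \<omega> - \<phi> j t) * (\<Prod>l\<in>{1..d} - {j}. \<phi> l t)))
     \<le> real d ^ 4 * dev_const * trunc_sq t / (real n)\<^sup>2" if n: "n > 0"
    using gen[of "\<lambda>j. ecf_comp j n t" "1 / (real n)\<^sup>2", OF ecf_comp_measurable norm_ecf_comp] ecf_comp_dev_mult[OF _ _ _ n, of _ _ t]
    by simp
qed

section \<open>Orthogonality and covariance of the features\<close>

lemma expectation_prod_update: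
  fixes h :: "nat \<Rightarrow> real ^ 'n \<Rightarrow> complex" and f :: "real ^ 'n \<Rightarrow> complex"
  assumes h[measurable]: "\<And>l. h l \<in> borel_measurable borel" and hb: "\<And>l x. cmod (h l x) \<le> 1"
    and hc: "\<And>l. comp_fun l (h l)" and j: "j \<in> {1..d}"
    and f[measurable]: "f \<in> borel_measurable borel" and fb: "\<And>x. cmod (f x) \<le> C" and fc: "comp_fun j f"
  shows "(\<integral>\<omega>. f (X \<omega>) * (\<Prod>l=1..d. h l (X \<omega>)) \<partial>M)
    = (\<integral>\<omega>. f (X \<omega>) * h j (X \<omega>) \<partial>M) * (\<Prod>l\<in>{1..d} - {j}. \<integral>\<omega>. h l (X \<omega>) \<partial>M)"
proof -
  define u where "u l x = (if l = j then f x else 1) * h l x" for l x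
  have [measurable]: "u l \<in> borel_measurable borel" for l unfolding u_def by measurable
  have ub: "cmod (u l x) \<le> max C 1" for l x
  proof -
    have "cmod (if l = j then f x else 1) * cmod (h l x) \<le> max C 1 * 1"
      by (rule mult_mono) (use fb[of x] hb[of l x] in auto)
    then show ?thesis by (simp add: u_def norm_mult)
  qed
  have uc: "comp_fun l (u l)" for l
    using hc[of l] fc unfolding u_def comp_fun_def by metis
  have "f x * (\<Prod>l=1..d. h l x) = (\<Prod>l=1..d. u l x)" for x
    using j by (simp add: u_def prod.distrib)
  then have "(\<integral>\<omega>. f (X \<omega>) * (\<Prod>l=1..d. h l (X \<omega>)) \<partial>M) = (\<Prod>l=1..d. \<integral>\<omega>. u l (X \<omega>) \<partial>M)"
    using expectation_prod_components[of u, OF _ ub uc] by simp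
  also have "\<dots> = (\<integral>\<omega>. u j (X \<omega>) \<partial>M) * (\<Prod>l\<in>{1..d} - {j}. \<integral>\<omega>. u l (X \<omega>) \<partial>M)"
    by (rule prod.remove) (use j in auto)
  also have "(\<Prod>l\<in>{1..d} - {j}. \<integral>\<omega>. u l (X \<omega>) \<partial>M) = (\<Prod>l\<in>{1..d} - {j}. \<integral>\<omega>. h l (X \<omega>) \<partial>M)"
    by (rule prod.cong) (auto simp: u_def)
  finally show ?thesis by (simp add: u_def)
qed


lemma ch_diff: "ch j t x * cnj (ch j s x) = ch j (t - s) x"
  unfolding ch_def by (simp add: component_inner_diff exp_cnj exp_add[symmetric] right_diff_distrib)

lemma expectation_mult_ch:
  assumes j: "j \<in> {1..d}" "l \<in> {1..d}" "l \<noteq> j"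
    and f: "f \<in> borel_measurable borel" and fb: "\<And>x. cmod (f x) \<le> C" and fc: "comp_fun j f"
  shows "(\<integral>\<omega>. f (X \<omega>) * ch l t (X \<omega>) \<partial>M) = (\<integral>\<omega>. f (X \<omega>) \<partial>M) * \<phi> l t"
proof -
  define h where "h i x = (if i = l then ch l t x else 1)" for i x
  have h: "h i \<in> borel_measurable borel" "cmod (h i x) \<le> 1" "comp_fun i (h i)" for i x
    using comp_fun_ch[of l t] by (cases "i = l"; simp add: h_def comp_fun_const h_def[abs_def])+
  have "(\<integral>\<omega>. f (X \<omega>) * (\<Prod>i=1..d. h i (X \<omega>)) \<partial>M)
    = (\<integral>\<omega>. f (X \<omega>) * h j (X \<omega>) \<partial>M) * (\<Prod>i\<in>{1..d} - {j}. \<integral>\<omega>. h i (X \<omega>) \<partial>M)"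
    by (rule expectation_prod_update[OF h j(1) f fb fc])
  moreover have "(\<integral>\<omega>. h i (X \<omega>) \<partial>M) = (if i = l then \<phi> l t else 1)" for i
    by (simp add: h_def component_char_eq prob_space)
  ultimately show ?thesis using j by (simp add: h_def)
qed

text \<open>Given component j, the mean of the full product is \<open>ch j\<close> times the
  remaining characteristic functions, which is exactly the constant plus the j-th linear term. The
  other linear terms are centred and independent of f.\<close>

lemma feature_orthogonal:
  assumes j: "j \<in> {1..d}"
    and f[measurable]: "f \<in> borel_measurable borel" and fb: "\<And>x. cmod (f x) \<le> C" and fc: "comp_fun j f"
  shows "(\<integral>\<omega>. f (X \<omega>) * feature t (X \<omega>) \<partial>M) = 0"
proof -
  let ?c = "\<lambda>j. \<Prod>l\<in>{1..d} - {j}. \<phi> l t"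
  have C0: "C \<ge> 0" using order_trans[OF norm_ge_zero fb] .
  have int: "complex_integrable M (\<lambda>\<omega>. f (X \<omega>) * u (X \<omega>))"
    if [measurable]: "u \<in> borel_measurable borel" and "\<And>x. cmod (u x) \<le> 1" for u
    by (rule integrable_bounded[OF finite_measure_axioms, where C="C * 1"])
       (use that fb C0 in \<open>auto simp: norm_mult intro!: mult_mono[of _ C _ 1, simplified]\<close>)
  have i1: "complex_integrable M (\<lambda>\<omega>. f (X \<omega>) * (\<Prod>l=1..d. ch l t (X \<omega>)))"
    by (rule int) (simp_all add: prod_norm[symmetric])
  have i2: "complex_integrable M (\<lambda>\<omega>. f (X \<omega>) * ch l t (X \<omega>))" for l
    by (rule int) simp_all
  have i3: "complex_integrable M (\<lambda>\<omega>. f (X \<omega>))" using int[of "\<lambda>_. 1"] by simp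
  let ?E = "\<integral>\<omega>. f (X \<omega>) \<partial>M" and ?F = "\<integral>\<omega>. f (X \<omega>) * ch j t (X \<omega>) \<partial>M"
  have P: "(\<integral>\<omega>. f (X \<omega>) * (\<Prod>l=1..d. ch l t (X \<omega>)) \<partial>M) = ?F * ?c j"
    unfolding component_char_eq
    by (rule expectation_prod_update[OF _ _ comp_fun_ch j f fb fc]) simp_all
  have prod_c: "(\<Prod>l=1..d. \<phi> l t) = \<phi> j t * ?c j"
    by (rule prod.remove) (use j in auto)
  have S: "(\<integral>\<omega>. f (X \<omega>) * (ch l t (X \<omega>) - \<phi> l t) \<partial>M) = (if l = j then ?F - ?E * \<phi> j t else 0)" if l: "l \<in> {1..d}" for l
  proof -
    have "(\<integral>\<omega>. f (X \<omega>) * (ch l t (X \<omega>) - \<phi> l t) \<partial>M) = (\<integral>\<omega>. f (X \<omega>) * ch l t (X \<omega>) \<partial>M) - ?E * \<phi> l t"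
      using i2 i3 by (simp add: right_diff_distrib)
    then show ?thesis using expectation_mult_ch[OF j l _ f fb fc] by auto
  qed
  have i4: "complex_integrable M (\<lambda>\<omega>. f (X \<omega>) * (ch l t (X \<omega>) - \<phi> l t) * ?c l)" for l
    using i2 i3 by (simp add: right_diff_distrib)
  have "(\<integral>\<omega>. f (X \<omega>) * feature t (X \<omega>) \<partial>M)
     = (\<integral>\<omega>. f (X \<omega>) * (\<Prod>l=1..d. ch l t (X \<omega>)) - f (X \<omega>) * (\<Prod>l=1..d. \<phi> l t)
         - (\<Sum>l=1..d. f (X \<omega>) * (ch l t (X \<omega>) - \<phi> l t) * ?c l) \<partial>M)"
    unfolding feature_def
    by (intro Bochner_Integration.integral_cong refl)
       (simp add: algebra_simps sum_distrib_left sum_distrib_right sum_subtractf)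
  also have "\<dots> = ?F * ?c j - ?E * (\<Prod>l=1..d. \<phi> l t)
       - (\<Sum>l=1..d. (\<integral>\<omega>. f (X \<omega>) * (ch l t (X \<omega>) - \<phi> l t) \<partial>M) * ?c l)"
    using i1 i3 i4 P by simp
  also have "(\<Sum>l=1..d. (\<integral>\<omega>. f (X \<omega>) * (ch l t (X \<omega>) - \<phi> l t) \<partial>M) * ?c l)
      = (\<Sum>l=1..d. if l = j then (?F - ?E * \<phi> j t) * ?c j else 0)"
    by (rule sum.cong) (auto simp: S)
  also have "\<dots> = (?F - ?E * \<phi> j t) * ?c j" using j by simp
  finally show ?thesis unfolding prod_c by (simp add: algebra_simps)
qed

lemma feature_degenerate:
  "degenerate (\<lambda>x. Re (feature t x))" "degenerate (\<lambda>x. Im (feature t x))"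
proof -
  have b: "bounded_rv borel (\<lambda>x. Re (feature t x))" "bounded_rv borel (\<lambda>x. Im (feature t x))"
    by (rule bounded_rvI[where C="2 + 2 * real d"];
        auto intro: order_trans[OF abs_Re_le_cmod feature_bound] order_trans[OF abs_Im_le_cmod feature_bound])+
  have "(\<integral>\<omega>. Re (feature t (X \<omega>)) * f (X \<omega>) \<partial>M) = 0 \<and> (\<integral>\<omega>. Im (feature t (X \<omega>)) * f (X \<omega>) \<partial>M) = 0"
    if j: "j \<in> {1..d}" and f: "bounded_rv borel f" and fc: "comp_fun j f" for j f
  proof -
    note [measurable] = bounded_rv_measurable[OF f]
    obtain C where C: "\<And>x. \<bar>f x\<bar> \<le> C" using f by (auto simp: bounded_rv_def)
    have C0: "C \<ge> 0" using order_trans[OF abs_ge_zero C] .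
    have fc': "comp_fun j (\<lambda>x. complex_of_real (f x))"
      using fc unfolding comp_fun_def by metis
    have z: "(\<integral>\<omega>. complex_of_real (f (X \<omega>)) * feature t (X \<omega>) \<partial>M) = 0"
      by (rule feature_orthogonal[OF j _ _ fc', where C=C]) (use C in simp_all)
    have int: "complex_integrable M (\<lambda>\<omega>. complex_of_real (f (X \<omega>)) * feature t (X \<omega>))"
    proof (rule integrable_bounded[OF finite_measure_axioms, where C="C * (2 + 2 * real d)"])
      show "cmod (complex_of_real (f (X x)) * feature t (X x)) \<le> C * (2 + 2 * real d)" for x
        unfolding norm_mult by (intro mult_mono feature_bound C0) (use C in auto)
    qed measurable
    have "(\<integral>\<omega>. Re (complex_of_real (f (X \<omega>)) * feature t (X \<omega>)) \<partial>M) = 0"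
        "(\<integral>\<omega>. Im (complex_of_real (f (X \<omega>)) * feature t (X \<omega>)) \<partial>M) = 0"
      using integral_Re[OF int] integral_Im[OF int] z by simp_all
    then show ?thesis by (simp add: mult.commute)
  qed
  then show "degenerate (\<lambda>x. Re (feature t x))" "degenerate (\<lambda>x. Im (feature t x))"
    using b by (auto simp: degenerate_def)
qed

text \<open>By orthogonality the constant and linear parts of the feature at s drop out, leaving the
  covariance of the feature at t with the conjugate product of characters at s. The d products
  arising from the linear terms at t, less the one from the mean, give the coefficient d - 1 of
  \<open>R_cov\<close>.\<close>

lemma feature_cov: "(\<integral>\<omega>. feature t (X \<omega>) * cnj (feature s (X \<omega>)) \<partial>M) = R_cov M b d X t s"
proof -
  let ?c = "\<lambda>t j. \<Prod>l\<in>{1..d} - {j}. \<phi> l t"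
  let ?P = "\<lambda>x. \<Prod>l=1..d. cnj (ch l s x)"
  have int: "complex_integrable M (\<lambda>\<omega>. u (X \<omega>))"
    if [measurable]: "u \<in> borel_measurable borel" and "\<And>x. cmod (u x) \<le> C" for u C
    by (rule integrable_bounded[OF finite_measure_axioms, where C=C]) (use that in auto)
  have int_f: "complex_integrable M (\<lambda>\<omega>. u (X \<omega>) * feature t (X \<omega>))"
    if [measurable]: "u \<in> borel_measurable borel" and b: "\<And>x. cmod (u x) \<le> 2" for u
  proof (rule int)
    show "cmod (u x * feature t x) \<le> 2 * (2 + 2 * real d)" for x
      unfolding norm_mult by (intro mult_mono feature_bound b) auto
  qed measurable
  have dev2: "cmod (ch l t x - \<phi> l t) \<le> 2" for l t x
    using norm_triangle_ineq4[of "ch l t x" "\<phi> l t"] norm_component_char[of l t] by simp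
  have o1: "(\<integral>\<omega>. feature t (X \<omega>) \<partial>M) = 0"
    using feature_orthogonal[of 1, OF _ _ order_refl comp_fun_const[of 1 1], of t] d_pos by simp
  have cdev: "comp_fun l (\<lambda>x. cnj (ch l s x - \<phi> l s))" "comp_fun l (\<lambda>x. ch l t x - \<phi> l t)" for l s t
    using comp_fun_ch[of l s] comp_fun_ch[of l t] unfolding comp_fun_def by metis+
  have o2: "(\<integral>\<omega>. cnj (ch l s (X \<omega>) - \<phi> l s) * feature t (X \<omega>) \<partial>M) = 0" if "l \<in> {1..d}" for l
    by (rule feature_orthogonal[OF that _ _ cdev(1), where C=2]) (measurable, simp only: complex_mod_cnj dev2)
  have i1: "complex_integrable M (\<lambda>\<omega>. ?P (X \<omega>) * feature t (X \<omega>))"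
    by (rule int_f) (simp_all add: prod_norm[symmetric])
  have i2: "complex_integrable M (\<lambda>\<omega>. cnj (ch l s (X \<omega>) - \<phi> l s) * feature t (X \<omega>))" for l
    by (rule int_f) (measurable, simp only: complex_mod_cnj dev2)
  have i3: "complex_integrable M (\<lambda>\<omega>. feature t (X \<omega>))" by (rule int[OF _ feature_bound]) measurable
  have "(\<integral>\<omega>. feature t (X \<omega>) * cnj (feature s (X \<omega>)) \<partial>M)
     = (\<integral>\<omega>. ?P (X \<omega>) * feature t (X \<omega>) - (\<Prod>l=1..d. cnj (\<phi> l s)) * feature t (X \<omega>)
         - (\<Sum>l=1..d. cnj (?c s l) * (cnj (ch l s (X \<omega>) - \<phi> l s) * feature t (X \<omega>))) \<partial>M)"
    by (intro Bochner_Integration.integral_cong refl)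
       (simp add: feature_def[of s] algebra_simps sum_distrib_left sum_distrib_right)
  also have "\<dots> = (\<integral>\<omega>. ?P (X \<omega>) * feature t (X \<omega>) \<partial>M) - 0 - (\<Sum>l=1..d. cnj (?c s l) * 0)"
    using i1 i2 i3
    by (subst Bochner_Integration.integral_diff, (intro Bochner_Integration.integrable_diff Bochner_Integration.integrable_sum integrable_mult_right i1 i2 i3)+,
        subst Bochner_Integration.integral_diff, (intro integrable_mult_right i1 i3)+,
        subst Bochner_Integration.integral_sum, (intro integrable_mult_right i2)+)
       (simp only: o1 integral_mult_right_zero o2 mult_zero_right cong: sum.cong)
  also have "\<dots> = (\<integral>\<omega>. ?P (X \<omega>) * feature t (X \<omega>) \<partial>M)" by simp
  also have "\<dots> = (\<integral>\<omega>. (\<Prod>l=1..d. ch l (t - s) (X \<omega>)) - (\<Prod>l=1..d. \<phi> l t) * ?P (X \<omega>)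
       - (\<Sum>j=1..d. ?c t j * ((ch j t (X \<omega>) - \<phi> j t) * ?P (X \<omega>))) \<partial>M)"
    by (intro Bochner_Integration.integral_cong refl)
       (simp add: feature_def[of t] ch_diff[symmetric] prod.distrib algebra_simps sum_distrib_left sum_distrib_right)
  also have "\<dots> = (\<integral>\<omega>. (\<Prod>l=1..d. ch l (t - s) (X \<omega>)) \<partial>M) - (\<Prod>l=1..d. \<phi> l t) * (\<integral>\<omega>. ?P (X \<omega>) \<partial>M)
       - (\<Sum>j=1..d. ?c t j * (\<integral>\<omega>. (ch j t (X \<omega>) - \<phi> j t) * ?P (X \<omega>) \<partial>M))"
  proof -
    have j1: "complex_integrable M (\<lambda>\<omega>. \<Prod>l=1..d. ch l (t - s) (X \<omega>))"
      by (rule int[of _ 1]) (simp_all add: prod_norm[symmetric])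
    have j2: "complex_integrable M (\<lambda>\<omega>. ?P (X \<omega>))"
      by (rule int[of _ 1]) (simp_all add: prod_norm[symmetric])
    have j3: "complex_integrable M (\<lambda>\<omega>. (ch j t (X \<omega>) - \<phi> j t) * ?P (X \<omega>))" for j
      by (rule int[of _ 2]) (use dev2 in \<open>simp_all add: norm_mult prod_norm[symmetric]\<close>)
    show ?thesis
      by (subst Bochner_Integration.integral_diff, (intro Bochner_Integration.integrable_diff Bochner_Integration.integrable_sum integrable_mult_right j1 j2 j3)+,
        subst Bochner_Integration.integral_diff, (intro integrable_mult_right j1 j2)+,
        subst Bochner_Integration.integral_sum, (intro integrable_mult_right j3)+)
       (simp only: integral_mult_right_zero)
  qed
  also have "(\<integral>\<omega>. (\<Prod>l=1..d. ch l (t - s) (X \<omega>)) \<partial>M) = (\<Prod>l=1..d. \<phi> l (t - s))"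
    unfolding component_char_eq by (rule expectation_prod_components[where C=1]) (auto simp: comp_fun_ch)
  also have "(\<integral>\<omega>. ?P (X \<omega>) \<partial>M) = (\<Prod>l=1..d. cnj (\<phi> l s))"
    unfolding ch_minus[symmetric] component_char_cnj[symmetric] component_char_eq[of _ "- s"]
    by (rule expectation_prod_components[where C=1]) (auto simp: comp_fun_ch)
  also have "(\<Sum>j=1..d. ?c t j * (\<integral>\<omega>. (ch j t (X \<omega>) - \<phi> j t) * ?P (X \<omega>) \<partial>M))
      = (\<Sum>j=1..d. \<phi> j (t - s) * (\<Prod>l\<in>{1..d} - {j}. \<phi> l t * cnj (\<phi> l s)) - (\<Prod>l=1..d. \<phi> l t * cnj (\<phi> l s)))"
  proof (rule sum.cong[OF refl])
    fix j assume j: "j \<in> {1..d}"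
    have "(\<integral>\<omega>. (ch j t (X \<omega>) - \<phi> j t) * ?P (X \<omega>) \<partial>M)
       = (\<integral>\<omega>. (ch j t (X \<omega>) - \<phi> j t) * cnj (ch j s (X \<omega>)) \<partial>M) * (\<Prod>l\<in>{1..d} - {j}. cnj (\<phi> l s))"
      unfolding ch_minus[symmetric] component_char_cnj[symmetric] component_char_eq[of _ "- s"]
      by (rule expectation_prod_update[OF _ _ comp_fun_ch j _ dev2 cdev(2)]) simp_all
    also have "(\<integral>\<omega>. (ch j t (X \<omega>) - \<phi> j t) * cnj (ch j s (X \<omega>)) \<partial>M) = \<phi> j (t - s) - \<phi> j t * cnj (\<phi> j s)"
    proof -
      have pt: "(ch j t x - \<phi> j t) * cnj (ch j s x) = ch j (t - s) x - \<phi> j t * ch j (- s) x" for x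
        by (simp only: left_diff_distrib ch_diff ch_minus)
      show ?thesis
        unfolding pt component_char_cnj[symmetric]
        by (subst Bochner_Integration.integral_diff)
           (simp_all only: integrable_ch integrable_mult_right integral_mult_right_zero component_char_eq)
    qed
    finally have e: "(\<integral>\<omega>. (ch j t (X \<omega>) - \<phi> j t) * ?P (X \<omega>) \<partial>M)
       = (\<phi> j (t - s) - \<phi> j t * cnj (\<phi> j s)) * (\<Prod>l\<in>{1..d} - {j}. cnj (\<phi> l s))" .
    have r: "(\<Prod>l=1..d. \<phi> l t * cnj (\<phi> l s)) = \<phi> j t * cnj (\<phi> j s) * (?c t j * (\<Prod>l\<in>{1..d} - {j}. cnj (\<phi> l s)))"
      unfolding prod.distrib[symmetric] by (rule prod.remove) (use j in auto)
    show "?c t j * (\<integral>\<omega>. (ch j t (X \<omega>) - \<phi> j t) * ?P (X \<omega>) \<partial>M)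
      = \<phi> j (t - s) * (\<Prod>l\<in>{1..d} - {j}. \<phi> l t * cnj (\<phi> l s)) - (\<Prod>l=1..d. \<phi> l t * cnj (\<phi> l s))"
      unfolding e r by (simp only: prod.distrib) (simp only: algebra_simps)
  qed
  finally show ?thesis
    unfolding R_cov_def Let_def by (simp add: sum_subtractf prod.distrib algebra_simps)
qed

end

subsection \<open>Laplace transforms and weak convergence\<close>

lemma continuous_on_cts_step: "a < b \<Longrightarrow> continuous_on S (cts_step a b)"
  using cts_step_uniformly_continuous[of a b] uniformly_continuous_imp_continuous
    continuous_on_subset by blast

text \<open>The substitution y = exp(-x) maps the half-line into [0, 1] and a continuous step
  function to a continuous function there. Weierstrass approximates it uniformly by polynomials in
  y, whose integrals are combinations of Laplace transforms at natural numbers.\<close>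

theorem laplace_imp_weak_conv:
  fixes \<mu> :: "nat \<Rightarrow> real measure" and \<nu> :: "real measure"
  assumes \<mu>: "\<And>n. real_distribution (\<mu> n)" and \<nu>: "real_distribution \<nu>"
    and \<mu>_pos: "\<And>n. AE x in \<mu> n. x \<ge> 0" and \<nu>_pos: "AE x in \<nu>. x \<ge> 0"
    and conv: "\<And>k::nat. (\<lambda>n. \<integral>x. exp (- (real k * x)) \<partial>\<mu> n) \<longlonglongrightarrow> (\<integral>x. exp (- (real k * x)) \<partial>\<nu>)"
  shows "weak_conv_m \<mu> \<nu>"
proof (rule integral_cts_step_conv_imp_weak_conv[OF \<mu> \<nu>])
  fix a b :: real assume ab: "a < b"
  \<comment> \<open>The cut-off at exp(-b) keeps the logarithm away from 0 and changes nothing,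
    because the step function is already 0 beyond b.\<close>
  define h where "h y = cts_step a b (- ln (max y (exp (- b))))" for y
  have h_exp: "h (exp (- x)) = cts_step a b x" for x
  proof (cases "x \<le> b")
    case True
    then have "max (exp (- x)) (exp (- b)) = exp (- x)" by (intro max_absorb1) auto
    then show ?thesis by (simp add: h_def)
  next
    case False
    then have "max (exp (- x)) (exp (- b)) = exp (- b)" by (intro max_absorb2) auto
    then show ?thesis using False ab by (simp add: h_def cts_step_def)
  qed
  have max_pos: "max y (exp (- b)) \<noteq> 0" for y
    using less_max_iff_disj[of 0 y "exp (- b)"] by auto
  have "continuous_on {0..1} (\<lambda>y. - ln (max y (exp (- b))))"
    by (intro continuous_on_minus continuous_on_ln continuous_on_max continuous_on_id
        continuous_on_const ballI max_pos)
  then have h_cont: "continuous_on {0..1} h"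
    unfolding h_def
    by (rule continuous_on_compose2[OF continuous_on_cts_step[OF ab, of UNIV]]) simp
  have approx: "\<bar>(\<integral>x. cts_step a b x \<partial>\<rho>) - (\<Sum>i\<le>N. c i * (\<integral>x. exp (- (real i * x)) \<partial>\<rho>))\<bar> \<le> e"
    if \<rho>: "real_distribution \<rho>" and pos: "AE x in \<rho>. x \<ge> 0"
      and c: "\<And>y. y \<in> {0..1} \<Longrightarrow> \<bar>h y - (\<Sum>i\<le>N. c i * y ^ i)\<bar> \<le> e"
    for \<rho> :: "real measure" and c :: "nat \<Rightarrow> real" and N e
  proof -
    interpret real_distribution \<rho> by fact
    have int_e: "integrable \<rho> (\<lambda>x. exp (- (real i * x)))" for i
      by (rule integrable_const_bound[of _ 1]) (use pos in auto)
    have "(\<integral>x. cts_step a b x \<partial>\<rho>) - (\<Sum>i\<le>N. c i * (\<integral>x. exp (- (real i * x)) \<partial>\<rho>))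
        = (\<integral>x. cts_step a b x - (\<Sum>i\<le>N. c i * exp (- (real i * x))) \<partial>\<rho>)"
      using int_e integrable_cts_step[OF ab] by simp
    also have "\<bar>\<dots>\<bar> \<le> (\<integral>x. \<bar>cts_step a b x - (\<Sum>i\<le>N. c i * exp (- (real i * x)))\<bar> \<partial>\<rho>)"
      by (rule integral_abs_bound)
    also have "\<dots> \<le> (\<integral>x. e \<partial>\<rho>)"
    proof (rule integral_mono_AE)
      show "AE x in \<rho>. \<bar>cts_step a b x - (\<Sum>i\<le>N. c i * exp (- (real i * x)))\<bar> \<le> e"
        using pos
      proof eventually_elim
        case (elim x)
        then have "exp (- x) \<in> {0..1}" by auto
        from c[OF this] show ?case
          by (simp only: h_exp exp_of_nat_mult[symmetric] mult_minus_right)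
      qed
    qed (intro integrable_abs Bochner_Integration.integrable_diff integrable_cts_step ab
        Bochner_Integration.integrable_sum integrable_mult_right int_e integrable_const)+
    also have "\<dots> = e" using prob_space by simp
    finally show ?thesis .
  qed
  show "(\<lambda>n. integral\<^sup>L (\<mu> n) (cts_step a b)) \<longlonglongrightarrow> integral\<^sup>L \<nu> (cts_step a b)"
  proof (rule LIMSEQ_I)
    fix r :: real assume r: "0 < r"
    obtain g where g: "real_polynomial_function g" "\<And>y. y \<in> {0..1} \<Longrightarrow> \<bar>h y - g y\<bar> < r / 4"
      using Stone_Weierstrass_real_polynomial_function[OF compact_Icc h_cont, of "r / 4"] r by auto
    obtain c :: "nat \<Rightarrow> real" and N where gc: "g = (\<lambda>y. \<Sum>i\<le>N. c i * y ^ i)"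
      using g(1) real_polynomial_function_iff_sum by auto
    let ?L = "\<lambda>\<rho>. (\<Sum>i\<le>N. c i * (\<integral>x. exp (- (real i * x)) \<partial>\<rho>))"
    have A: "\<bar>(\<integral>x. cts_step a b x \<partial>\<rho>) - ?L \<rho>\<bar> \<le> r / 4"
      if "real_distribution \<rho>" "AE x in \<rho>. x \<ge> 0" for \<rho> :: "real measure"
      by (rule approx[OF that]) (use g(2) gc in \<open>auto intro: less_imp_le\<close>)
    have "(\<lambda>n. ?L (\<mu> n)) \<longlonglongrightarrow> ?L \<nu>"
      by (intro tendsto_intros conv)
    then obtain n0 where n0: "\<And>n. n \<ge> n0 \<Longrightarrow> norm (?L (\<mu> n) - ?L \<nu>) < r / 4"
      using LIMSEQ_D[of _ _ "r / 4"] r by fastforce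
    have "norm (integral\<^sup>L (\<mu> n) (cts_step a b) - integral\<^sup>L \<nu> (cts_step a b)) < r" if "n \<ge> n0" for n
      using A[OF \<mu> \<mu>_pos, of n] A[OF \<nu> \<nu>_pos] n0[OF that] r unfolding real_norm_def by linarith
    then show "\<exists>no. \<forall>n\<ge>no. norm (integral\<^sup>L (\<mu> n) (cts_step a b) - integral\<^sup>L \<nu> (cts_step a b)) < r"
      by blast
  qed
qed

subsection \<open>Limit laws under independence\<close>

lemma countable_dense_sequence:
  "\<exists>q :: nat \<Rightarrow> 'a::{second_countable_topology, metric_space}. \<forall>t. \<forall>e>0. \<exists>k. dist (q k) t < e"
proof -
  obtain D :: "'a set" where D: "countable D" "\<And>U. open U \<Longrightarrow> U \<noteq> {} \<Longrightarrow> \<exists>x\<in>D. x \<in> U"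
    by (erule countable_dense_setE)
  have "\<exists>k. dist (from_nat_into D k) t < e" if "e > 0" for t e
  proof -
    have "t \<in> ball t e" using that by simp
    then have "ball t e \<noteq> {}" by blast
    then obtain x where "x \<in> D" "x \<in> ball t e" using D(2)[OF open_ball] by blast
    then show ?thesis
      using from_nat_into_surj[OF D(1)] by (auto simp: dist_commute)
  qed
  then show ?thesis by blast
qed

lemma w1_norm_sq_eq: "w1_norm_sq = weighted_norm w1"
  by (simp add: fun_eq_iff w1_norm_sq_def weighted_norm_def)

context independent_sample
begin

lemma feature_X_measurable: "(\<lambda>(t, \<omega>). feature t (X \<omega>)) \<in> borel_measurable (lborel \<Otimes>\<^sub>M M)"
  unfolding case_prod_unfold by measurable

lemma feature_continuous:
  assumes r: "r \<longlonglongrightarrow> t"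
  shows "(\<lambda>i. sq_norm M (\<lambda>\<omega>. feature t (X \<omega>) - feature (r i) (X \<omega>))) \<longlonglongrightarrow> 0"
proof -
  have le: "cmod (feature t x - feature s x) \<le> 4 + 4 * real d" for s x
    using norm_triangle_ineq4[of "feature t x" "feature s x"] feature_bound[of t x] feature_bound[of s x] by simp
  have "(\<lambda>i. \<integral>\<omega>. (cmod (feature t (X \<omega>) - feature (r i) (X \<omega>)))\<^sup>2 \<partial>M) \<longlonglongrightarrow> (\<integral>\<omega>. 0 \<partial>M)"
  proof (rule integral_dominated_convergence[where w="\<lambda>_. (4 + 4 * real d)\<^sup>2"])
    show "AE \<omega> in M. (\<lambda>i. (cmod (feature t (X \<omega>) - feature (r i) (X \<omega>)))\<^sup>2) \<longlonglongrightarrow> 0"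
    proof (rule AE_I2)
      fix \<omega>
      have "(\<lambda>i. (cmod (feature t (X \<omega>) - feature (r i) (X \<omega>)))\<^sup>2) \<longlonglongrightarrow> (cmod (feature t (X \<omega>) - feature t (X \<omega>)))\<^sup>2"
        by (intro tendsto_intros feature_tendsto r)
      then show "(\<lambda>i. (cmod (feature t (X \<omega>) - feature (r i) (X \<omega>)))\<^sup>2) \<longlonglongrightarrow> 0" by simp
    qed
    show "AE \<omega> in M. norm ((cmod (feature t (X \<omega>) - feature (r i) (X \<omega>)))\<^sup>2) \<le> (4 + 4 * real d)\<^sup>2" for i
      using le by (auto intro!: power_mono)
  qed simp_all
  then show ?thesis by (simp add: sq_norm_def)
qed

lemma feature_process_exists: "\<exists>q. feature_process M lborel (\<lambda>t \<omega>. feature t (X \<omega>)) q (2 + 2 * real d)"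
proof -
  obtain q :: "nat \<Rightarrow> real ^ 'n" where q: "\<And>t e. e > 0 \<Longrightarrow> \<exists>k. dist (q k) t < e"
    using countable_dense_sequence[where 'a="real ^ 'n"] by blast
  have "feature_process M lborel (\<lambda>t \<omega>. feature t (X \<omega>)) q (2 + 2 * real d)"
  proof (unfold_locales)
    show "(\<lambda>(t, \<omega>). feature t (X \<omega>)) \<in> borel_measurable (lborel \<Otimes>\<^sub>M M)" by (rule feature_X_measurable)
    show "cmod (feature t (X \<omega>)) \<le> 2 + 2 * real d" for t \<omega> by (rule feature_bound)
    fix t :: "real ^ 'n" and e :: real assume e: "e > 0"
    have "\<exists>k. dist (q k) t < 1 / real (Suc i)" for i by (rule q) simp
    then have "\<forall>i. \<exists>k. dist (q k) t < 1 / real (Suc i)" by blast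
    then obtain k where "\<forall>i. dist (q (k i)) t < 1 / real (Suc i)" by (rule choice[THEN exE])
    then have k: "dist (q (k i)) t < 1 / real (Suc i)" for i by (rule spec)
    have "(\<lambda>i. q (k i)) \<longlonglongrightarrow> t"
      by (subst tendsto_dist_iff, rule tendsto_sandwich[OF always_eventually always_eventually tendsto_const LIMSEQ_Suc[OF lim_1_over_n]])
         (intro allI zero_le_dist less_imp_le k)+
    from order_tendstoD(2)[OF feature_continuous[OF this] e]
    show "\<exists>k. sq_norm M (\<lambda>\<omega>. feature t (X \<omega>) - feature (q k) (X \<omega>)) < e"
      by (auto simp: eventually_sequentially)
  qed simp_all
  then show ?thesis by blast
qed

text \<open>For \<open>c = 1\<close> this is exactly the empirical process behind \<open>Q_star\<close>, for \<open>c = 0\<close> the linearised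
  one behind \<open>Q\<close>. The limits have covariances \<open>(1 + c\<^sup>2) R\<close>, whence the factor 2.\<close>

definition partial_process :: "real \<Rightarrow> nat \<Rightarrow> real ^ 'n \<Rightarrow> 'w \<Rightarrow> complex" where
  "partial_process c n t \<omega> = complex_of_real (1 / sqrt (real n)) *
     (\<Sum>k=1..n. feature t (Xs k \<omega>) - complex_of_real c * feature t (star n k \<omega>))"

lemma partial_process_measurable:
  "(\<lambda>(t, \<omega>). partial_process c n t \<omega>) \<in> borel_measurable (lborel \<Otimes>\<^sub>M M)"
  unfolding partial_process_def case_prod_unfold
proof (intro borel_measurable_times borel_measurable_const borel_measurable_sum borel_measurable_diff)
  fix k assume "k \<in> {1..n}"
  then have [measurable]: "Xs k \<in> borel_measurable M" by auto
  show "(\<lambda>x. feature (fst x) (Xs k (snd x))) \<in> borel_measurable (lborel \<Otimes>\<^sub>M M)"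
    "(\<lambda>x. feature (fst x) (star n k (snd x))) \<in> borel_measurable (lborel \<Otimes>\<^sub>M M)" by measurable
qed

text \<open>An exact identity for every n \<ge> d, since increments are uncorrelated. It is stated
  for general H so that it also yields the L2 distance between two values of t, with no dependence
  on n.\<close>

lemma sq_norm_sum_increments:
  assumes Re: "degenerate (\<lambda>x. Re (H x))" and Im: "degenerate (\<lambda>x. Im (H x))" and n: "n \<ge> d"
  shows "sq_integrable M (\<lambda>\<omega>. complex_of_real (1 / sqrt (real n)) *
      (\<Sum>k=1..n. H (Xs k \<omega>) - complex_of_real c * H (star n k \<omega>)))" (is "sq_integrable M ?Z")
    and "sq_norm M (\<lambda>\<omega>. complex_of_real (1 / sqrt (real n)) *
      (\<Sum>k=1..n. H (Xs k \<omega>) - complex_of_real c * H (star n k \<omega>))) = (1 + c\<^sup>2) * sq_norm M (\<lambda>\<omega>. H (X \<omega>))"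
proof -
  have n0: "n > 0" using n d_pos by linarith
  let ?S = "\<lambda>g \<omega>. \<Sum>k=1..n. increment c g n k \<omega>"
  let ?Re = "\<lambda>x. Re (H x)" and ?Im = "\<lambda>x. Im (H x)"
  have sumRe: "Re (\<Sum>k=1..n. H (Xs k \<omega>) - complex_of_real c * H (star n k \<omega>)) = ?S ?Re \<omega>"
    and sumIm: "Im (\<Sum>k=1..n. H (Xs k \<omega>) - complex_of_real c * H (star n k \<omega>)) = ?S ?Im \<omega>" for \<omega>
    by (simp_all add: increment_def)
  have sq: "(cmod (?Z \<omega>))\<^sup>2 = (1 / real n) * ((?S ?Re \<omega>)\<^sup>2 + (?S ?Im \<omega>)\<^sup>2)" for \<omega>
    unfolding norm_mult power_mult_distrib cmod_power2[of "sum _ _"] sumRe sumIm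
    by (simp add: power_divide norm_divide)
  have Sb: "bounded_rv M (?S ?Re)" "bounded_rv M (?S ?Im)"
    by (rule sum_increment_bounded[OF Re order_refl], rule sum_increment_bounded[OF Im order_refl])
  have int: "integrable M (\<lambda>\<omega>. (?S ?Re \<omega>)\<^sup>2)" "integrable M (\<lambda>\<omega>. (?S ?Im \<omega>)\<^sup>2)"
    unfolding power2_eq_square by (intro integrable_bounded_rv bounded_rv_mult Sb)+
  have H_m: "H \<in> borel_measurable borel"
  proof -
    note [measurable] = bounded_rv_measurable[OF degenerate_bounded[OF Re]] bounded_rv_measurable[OF degenerate_bounded[OF Im]]
    have "(\<lambda>x. complex_of_real (Re (H x)) + \<i> * complex_of_real (Im (H x))) \<in> borel_measurable borel" by measurable
    then show ?thesis by (simp flip: complex_eq)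
  qed
  have Zm: "?Z \<in> borel_measurable M"
    by (intro borel_measurable_times borel_measurable_const borel_measurable_sum borel_measurable_diff
        measurable_compose[OF _ H_m] star_measurable Xs_measurable) auto
  show "sq_integrable M ?Z"
    unfolding sq_integrable_def sq using Zm int by simp
  have v: "(\<integral>\<omega>. (?S g \<omega>)\<^sup>2 \<partial>M) = real n * ((1 + c\<^sup>2) * var g)" if "degenerate g" for g
    using sum_increment_sq[OF that n order_refl, of c] by simp
  have i2: "integrable M (\<lambda>\<omega>. (g (X \<omega>))\<^sup>2)" if "degenerate g" for g
    unfolding power2_eq_square by (rule integrable_bounded_rv, rule bounded_rv_mult; rule bounded_rv_X[OF degenerate_bounded[OF that]])
  have "sq_norm M ?Z = (1 / real n) * (real n * ((1 + c\<^sup>2) * var ?Re) + real n * ((1 + c\<^sup>2) * var ?Im))"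
    unfolding sq_norm_def sq using int v[OF Re] v[OF Im] by simp
  also have "\<dots> = (1 + c\<^sup>2) * (var ?Re + var ?Im)" using n0 by (simp add: field_simps)
  also have "var ?Re + var ?Im = sq_norm M (\<lambda>\<omega>. H (X \<omega>))"
    unfolding var_def sq_norm_def cmod_power2 using i2[OF Re] i2[OF Im] by simp
  finally show "sq_norm M ?Z = (1 + c\<^sup>2) * sq_norm M (\<lambda>\<omega>. H (X \<omega>))" .
qed

lemma feature_diff_degenerate:
  "degenerate (\<lambda>x. Re (feature t x - feature s x))" "degenerate (\<lambda>x. Im (feature t x - feature s x))"
  using degenerate_add[OF feature_degenerate(1)[of t] degenerate_cmult[OF feature_degenerate(1)[of s], of "-1"]]
    degenerate_add[OF feature_degenerate(2)[of t] degenerate_cmult[OF feature_degenerate(2)[of s], of "-1"]]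
  by simp_all

lemma partial_process_sq:
  assumes n: "n \<ge> d"
  shows "sq_integrable M (partial_process c n t)"
    and "sq_norm M (partial_process c n t) = (1 + c\<^sup>2) * sq_norm M (\<lambda>\<omega>. feature t (X \<omega>))"
    and "sq_norm M (\<lambda>\<omega>. partial_process c n t \<omega> - partial_process c n s \<omega>)
      = (1 + c\<^sup>2) * sq_norm M (\<lambda>\<omega>. feature t (X \<omega>) - feature s (X \<omega>))"
proof -
  show "sq_integrable M (partial_process c n t)"
    "sq_norm M (partial_process c n t) = (1 + c\<^sup>2) * sq_norm M (\<lambda>\<omega>. feature t (X \<omega>))"
    unfolding partial_process_def[abs_def] by (rule sq_norm_sum_increments[OF feature_degenerate n])+
  have eq: "partial_process c n t \<omega> - partial_process c n s \<omega>
     = complex_of_real (1 / sqrt (real n)) *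
      (\<Sum>k=1..n. (feature t (Xs k \<omega>) - feature s (Xs k \<omega>)) - complex_of_real c * (feature t (star n k \<omega>) - feature s (star n k \<omega>)))" for \<omega>
    unfolding partial_process_def right_diff_distrib[symmetric] sum_subtractf[symmetric]
    by (intro arg_cong2[where f="(*)"] sum.cong refl) (simp add: algebra_simps)
  show "sq_norm M (\<lambda>\<omega>. partial_process c n t \<omega> - partial_process c n s \<omega>)
      = (1 + c\<^sup>2) * sq_norm M (\<lambda>\<omega>. feature t (X \<omega>) - feature s (X \<omega>))"
    unfolding eq by (rule sq_norm_sum_increments(2)[OF feature_diff_degenerate n])
qed

text \<open>A real combination of process values is the normalised increment sum of a single
  degenerate function, to which the univariate limit theorem applies.\<close>

lemma partial_process_char:
  assumes F: "finite F"
  shows "(\<lambda>n. \<integral>\<omega>. iexp (rcomb F \<alpha> \<beta> (partial_process c n) \<omega>) \<partial>M)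
    \<longlonglongrightarrow> complex_of_real (exp (- ((1 + c\<^sup>2) * (\<integral>\<omega>. (rcomb F \<alpha> \<beta> (\<lambda>t \<omega>. feature t (X \<omega>)) \<omega>)\<^sup>2 \<partial>M)) / 2))"
proof -
  define g where "g = rcomb F \<alpha> \<beta> feature"
  have g: "degenerate g"
    unfolding g_def rcomb_def[abs_def]
    by (intro degenerate_sum degenerate_add degenerate_cmult feature_degenerate)
  have inc: "increment c g n k \<omega> = (\<Sum>t\<in>F. \<alpha> t * Re (feature t (Xs k \<omega>) - complex_of_real c * feature t (star n k \<omega>))
      + \<beta> t * Im (feature t (Xs k \<omega>) - complex_of_real c * feature t (star n k \<omega>)))" for n k \<omega>
    unfolding increment_def g_def rcomb_def sum_distrib_left sum_subtractf[symmetric]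
    by (intro sum.cong refl) (simp add: algebra_simps)
  have eq: "rcomb F \<alpha> \<beta> (partial_process c n) \<omega> = (\<Sum>k=1..n. increment c g n k \<omega>) / sqrt (real n)" for n \<omega>
  proof -
    have e1: "(\<Sum>k=1..n. increment c g n k \<omega>) = (\<Sum>t\<in>F. \<Sum>k=1..n. \<alpha> t * Re (feature t (Xs k \<omega>) - complex_of_real c * feature t (star n k \<omega>))
      + \<beta> t * Im (feature t (Xs k \<omega>) - complex_of_real c * feature t (star n k \<omega>)))"
      unfolding inc by (rule sum.swap)
    have e2: "(\<Sum>t\<in>F. \<Sum>k=1..n. \<alpha> t * Re (feature t (Xs k \<omega>) - complex_of_real c * feature t (star n k \<omega>))
      + \<beta> t * Im (feature t (Xs k \<omega>) - complex_of_real c * feature t (star n k \<omega>))) / sqrt (real n)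
      = rcomb F \<alpha> \<beta> (partial_process c n) \<omega>"
      unfolding rcomb_def partial_process_def sum_divide_distrib
    proof (intro sum.cong refl)
      fix t
      let ?z = "\<lambda>k. feature t (Xs k \<omega>) - complex_of_real c * feature t (star n k \<omega>)"
      let ?S = "\<Sum>k=1..n. ?z k" and ?s = "sqrt (real n)"
      have scale: "Re (complex_of_real (1 / ?s) * z) = Re z / ?s" "Im (complex_of_real (1 / ?s) * z) = Im z / ?s" for z
        by simp_all
      have "(\<Sum>k=1..n. (\<alpha> t * Re (?z k) + \<beta> t * Im (?z k)) / ?s)
          = (\<Sum>k=1..n. \<alpha> t * Re (?z k) + \<beta> t * Im (?z k)) / ?s"
        by (rule sum_divide_distrib[symmetric])
      also have "(\<Sum>k=1..n. \<alpha> t * Re (?z k) + \<beta> t * Im (?z k)) = \<alpha> t * Re ?S + \<beta> t * Im ?S"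
        unfolding sum.distrib Re_sum Im_sum sum_distrib_left ..
      also have "(\<alpha> t * Re ?S + \<beta> t * Im ?S) / ?s = \<alpha> t * (Re ?S / ?s) + \<beta> t * (Im ?S / ?s)"
        by (rule trans[OF add_divide_distrib]) (simp only: times_divide_eq_right)
      finally show "(\<Sum>k=1..n. (\<alpha> t * Re (?z k) + \<beta> t * Im (?z k)) / ?s)
        = \<alpha> t * Re (complex_of_real (1 / ?s) * ?S) + \<beta> t * Im (complex_of_real (1 / ?s) * ?S)"
        by (subst scale, subst scale)
    qed
    show ?thesis unfolding e1 e2 ..
  qed
  have "var g = (\<integral>\<omega>. (rcomb F \<alpha> \<beta> (\<lambda>t \<omega>. feature t (X \<omega>)) \<omega>)\<^sup>2 \<partial>M)"
    by (simp add: var_def g_def rcomb_def)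
  then show ?thesis using increment_clt[OF g, of c] by (simp only: eq)
qed

end

section \<open>The statistics as weighted norms of processes\<close>

lemma sum_cyclic:
  assumes "n > 0" "j \<ge> 1"
  shows "(\<Sum>k=1..n. h (cyclic n (k + j - 1))) = (\<Sum>k=1..n. h k)"
proof (rule sum.reindex_bij_betw)
  have inj: "inj_on (\<lambda>k. cyclic n (k + j - 1)) {1..n}"
  proof (rule inj_onI)
    fix k l assume k: "k \<in> {1..n}" "l \<in> {1..n}" and eq: "cyclic n (k + j - 1) = cyclic n (l + j - 1)"
    from eq have "k + j - 1 = l + j - 1" by (rule cyclic_inj) (use k assms in auto)
    then show "k = l" using assms by simp
  qed
  have "(\<lambda>k. cyclic n (k + j - 1)) ` {1..n} \<subseteq> {1..n}"
    using assms by (auto simp: cyclic_def Suc_le_eq)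
  then show "bij_betw (\<lambda>k. cyclic n (k + j - 1)) {1..n} {1..n}"
    using inj by (simp add: bij_betw_def endo_inj_surj)
qed

context sample
begin

lemma ecf_eq: "ecf n x t = (1 / of_nat n) * (\<Sum>k=1..n. \<Prod>j=1..d. ch j t (x k))"
  unfolding ecf_def prod_ch ..

lemma ecf_prod_eq: "ecf_prod b d n x t = (\<Prod>j=1..d. (1 / of_nat n) * (\<Sum>k=1..n. ch j t (x k)))"
  unfolding ecf_prod_def ch_def ..

lemma ecf_star_eq: "ecf_star b d n x t = (1 / of_nat n) * (\<Sum>k=1..n. \<Prod>j=1..d. ch j t (x (cyclic n (k + j - 1))))"
proof -
  have "(\<Sum>j=1..d. component_inner b j t (x (cyclic n (k + j - 1)))) = t \<bullet> mix b (\<lambda>j. cyclic n (k + j - 1)) x" for k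
    unfolding sum_component_inner[OF range_b, symmetric] component_inner_mix ..
  then show ?thesis unfolding ecf_star_def by (simp only: prod_ch_mix)
qed

lemma ch_Xs_measurable [measurable]:
  "k \<in> {1..n} \<Longrightarrow> (\<lambda>z. ch j (fst z) (Xs k (snd z))) \<in> borel_measurable (lborel \<Otimes>\<^sub>M M)"
proof -
  assume "k \<in> {1..n}"
  then have [measurable]: "Xs k \<in> borel_measurable M" by auto
  show ?thesis by measurable
qed

lemma ch_Xs_cyclic_measurable [measurable]:
  "(\<lambda>z. ch j (fst z) (Xs (cyclic n k) (snd z))) \<in> borel_measurable (lborel \<Otimes>\<^sub>M M)"
proof -
  have [measurable]: "Xs (cyclic n k) \<in> borel_measurable M"
    by (rule Xs_measurable) (simp add: cyclic_def)
  show ?thesis by measurable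
qed

lemma Q_integrand_measurable:
  "(\<lambda>(t, \<omega>). ecf n (\<lambda>k. Xs k \<omega>) t - ecf_prod b d n (\<lambda>k. Xs k \<omega>) t) \<in> borel_measurable (lborel \<Otimes>\<^sub>M M)"
  "(\<lambda>(t, \<omega>). ecf n (\<lambda>k. Xs k \<omega>) t - ecf_star b d n (\<lambda>k. Xs k \<omega>) t) \<in> borel_measurable (lborel \<Otimes>\<^sub>M M)"
  unfolding ecf_eq ecf_prod_eq ecf_star_eq case_prod_unfold
  by (intro borel_measurable_diff borel_measurable_times borel_measurable_const borel_measurable_sum
      borel_measurable_prod ch_Xs_measurable ch_Xs_cyclic_measurable; assumption)+

lemma Q_measurable:
  "(\<lambda>\<omega>. real n * Q b d n (\<lambda>k. Xs k \<omega>)) \<in> borel_measurable M"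
  "(\<lambda>\<omega>. real n * Q_star b d n (\<lambda>k. Xs k \<omega>)) \<in> borel_measurable M"
  unfolding Q_def Q_star_def w1_norm_sq_eq
  by (intro borel_measurable_times borel_measurable_const weighted_norm_measurable sigma_finite_measure_axioms
      Q_integrand_measurable w1_measurable)+

lemma Q_nonneg: "Q b d n x \<ge> 0" "Q_star b d n x \<ge> 0"
  unfolding Q_def Q_star_def w1_norm_sq_eq by (rule weighted_norm_nonneg, simp)+

lemma scaled_weighted_norm:
  "real n * weighted_norm w f = weighted_norm w (\<lambda>t. complex_of_real (sqrt (real n)) * f t)"
  unfolding weighted_norm_def integral_mult_right_zero[symmetric]
  by (simp add: norm_mult power_mult_distrib mult_ac)

end

context independent_sample
begin

lemma inverse_sqrt: "n > 0 \<Longrightarrow> complex_of_real (1 / sqrt (real n)) = complex_of_real (sqrt (real n)) * (1 / of_nat n)"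
proof -
  assume "n > 0"
  then have "1 / sqrt (real n) = sqrt (real n) * (1 / real n)"
    by (simp add: field_simps)
  then show ?thesis by (metis of_real_1 of_real_divide of_real_mult of_real_of_nat_eq)
qed

text \<open>A cyclic shift permutes the sample within each component, so the linear terms have equal
  sums over the original and the shifted vectors, and the constants cancel as well. Centring thus
  changes nothing and the representation is exact.\<close>

lemma partial_process_star:
  assumes n: "n > 0"
  shows "complex_of_real (sqrt (real n)) * (ecf n (\<lambda>k. Xs k \<omega>) t - ecf_star b d n (\<lambda>k. Xs k \<omega>) t) = partial_process 1 n t \<omega>"
proof -
  let ?c = "\<lambda>j. \<Prod>l\<in>{1..d} - {j}. \<phi> l t"
  have ch_star: "ch j t (star n k \<omega>) = ch j t (Xs (cyclic n (k + j - 1)) \<omega>)" for j k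
    unfolding star_def ch_def component_inner_mix ..
  have lin: "(\<Sum>k=1..n. \<Sum>j=1..d. (ch j t (star n k \<omega>) - \<phi> j t) * ?c j) = (\<Sum>k=1..n. \<Sum>j=1..d. (ch j t (Xs k \<omega>) - \<phi> j t) * ?c j)"
  proof (subst (1 2) sum.swap, rule sum.cong[OF refl])
    fix j assume "j \<in> {1..d}"
    then show "(\<Sum>k=1..n. (ch j t (star n k \<omega>) - \<phi> j t) * ?c j) = (\<Sum>k=1..n. (ch j t (Xs k \<omega>) - \<phi> j t) * ?c j)"
      unfolding ch_star by (intro sum_cyclic[OF n]) simp
  qed
  have "(\<Sum>k=1..n. feature t (Xs k \<omega>) - complex_of_real 1 * feature t (star n k \<omega>))
      = (\<Sum>k=1..n. \<Prod>j=1..d. ch j t (Xs k \<omega>)) - (\<Sum>k=1..n. \<Prod>j=1..d. ch j t (star n k \<omega>))"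
    unfolding feature_def sum_subtractf sum_distrib_left[symmetric] using lin by simp
  then show ?thesis
    unfolding partial_process_def inverse_sqrt[OF n] ecf_eq ecf_star_eq ch_star
    by (simp only: mult.assoc right_diff_distrib)
qed

definition linearization_error :: "nat \<Rightarrow> real ^ 'n \<Rightarrow> 'w \<Rightarrow> complex" where
  "linearization_error n t \<omega> = (\<Prod>j=1..d. ecf_comp j n t \<omega>) - (\<Prod>j=1..d. \<phi> j t)
      - (\<Sum>j=1..d. (ecf_comp j n t \<omega> - \<phi> j t) * (\<Prod>l\<in>{1..d} - {j}. \<phi> l t))"

text \<open>Averaging the features over the sample subtracts from \<open>ecf\<close> the first-order
  expansion of the product of component averages around the \<open>\<phi> j t\<close>. What
  separates this from \<open>ecf_prod\<close> is the remainder of that expansion.\<close>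

lemma partial_process_linearized:
  assumes n: "n > 0"
  shows "complex_of_real (sqrt (real n)) * (ecf n (\<lambda>k. Xs k \<omega>) t - ecf_prod b d n (\<lambda>k. Xs k \<omega>) t)
     = partial_process 0 n t \<omega> - complex_of_real (sqrt (real n)) * linearization_error n t \<omega>"
proof -
  let ?c = "\<lambda>j. \<Prod>l\<in>{1..d} - {j}. \<phi> l t"
  let ?n = "of_nat n :: complex"
  have nn: "?n \<noteq> 0" using n by simp
  have comp: "(1 / ?n) * (\<Sum>k=1..n. (ch j t (Xs k \<omega>) - \<phi> j t) * ?c j) = (ecf_comp j n t \<omega> - \<phi> j t) * ?c j" for j
    unfolding ecf_comp_def sum_distrib_right[symmetric] sum_subtractf using nn by (simp add: field_simps)
  have "(1 / ?n) * (\<Sum>k=1..n. feature t (Xs k \<omega>))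
     = (1 / ?n) * (\<Sum>k=1..n. \<Prod>j=1..d. ch j t (Xs k \<omega>)) - (1 / ?n) * (\<Sum>k=1..n. \<Prod>j=1..d. \<phi> j t)
       - (1 / ?n) * (\<Sum>k=1..n. \<Sum>j=1..d. (ch j t (Xs k \<omega>) - \<phi> j t) * ?c j)"
    unfolding feature_def sum_subtractf by (simp only: right_diff_distrib)
  also have "(1 / ?n) * (\<Sum>k=1..n. \<Prod>j=1..d. \<phi> j t) = (\<Prod>j=1..d. \<phi> j t)"
    using nn by simp
  also have "(1 / ?n) * (\<Sum>k=1..n. \<Sum>j=1..d. (ch j t (Xs k \<omega>) - \<phi> j t) * ?c j)
     = (\<Sum>j=1..d. (ecf_comp j n t \<omega> - \<phi> j t) * ?c j)"
    by (subst sum.swap) (simp only: sum_distrib_left[of "1 / ?n" _ "{1..d}"] comp)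
  finally have e: "(1 / ?n) * (\<Sum>k=1..n. feature t (Xs k \<omega>))
     = ecf n (\<lambda>k. Xs k \<omega>) t - ecf_prod b d n (\<lambda>k. Xs k \<omega>) t + linearization_error n t \<omega>"
    unfolding ecf_eq ecf_prod_eq linearization_error_def ecf_comp_def by simp
  have "(\<Sum>k=1..n. feature t (Xs k \<omega>) - complex_of_real 0 * feature t (star n k \<omega>)) = (\<Sum>k=1..n. feature t (Xs k \<omega>))"
    by simp
  then have "partial_process 0 n t \<omega> = complex_of_real (sqrt (real n)) * ((1 / ?n) * (\<Sum>k=1..n. feature t (Xs k \<omega>)))"
    unfolding partial_process_def inverse_sqrt[OF n] mult.assoc by (simp only:)
  then show ?thesis unfolding e by (simp only: distrib_left right_diff_distrib) simp
qed

text \<open>One Gaussian process Z over the features serves every c, since the prelimit covariances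
  depend on c only through the factor 1 + c^2. For n \<ge> d the second moments and distances agree
  with those of the limit, so \<kappa> can be their common value.\<close>

theorem limit_process:
  assumes X1: "integrable M (\<lambda>\<omega>. norm (X \<omega>))"
  shows "\<exists>Z. \<forall>c::real.
      centered_gaussian_with_cov gauss_seq (\<lambda>t w. complex_of_real (sqrt (1 + c\<^sup>2)) * Z t w)
        (\<lambda>t s. complex_of_real (1 + c\<^sup>2) * R_cov M b d X t s) \<and>
      (\<lambda>t_w. complex_of_real (sqrt (1 + c\<^sup>2)) * Z (fst t_w) (snd t_w)) \<in> borel_measurable (lborel \<Otimes>\<^sub>M gauss_seq) \<and>
      (\<forall>s\<ge>0. (\<lambda>n. \<integral>\<omega>. exp (- (s * weighted_norm w1 (\<lambda>t. partial_process c n t \<omega>))) \<partial>M)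
        \<longlonglongrightarrow> (\<integral>w. exp (- (s * weighted_norm w1 (\<lambda>t. complex_of_real (sqrt (1 + c\<^sup>2)) * Z t w))) \<partial>gauss_seq))"
proof -
  obtain q where "feature_process M lborel (\<lambda>t \<omega>. feature t (X \<omega>)) q (2 + 2 * real d)"
    using feature_process_exists by blast
  then interpret FP: feature_process M lborel "\<lambda>t \<omega>. feature t (X \<omega>)" q "2 + 2 * real d" .
  interpret N: prob_space gauss_seq by (rule prob_space_gauss_seq)
  define CG where "CG = real d ^ 4 * dev_const"
  have feat_V: "sq_norm M (\<lambda>\<omega>. feature t (X \<omega>)) \<le> CG * trunc_sq t" for t
    using feature_sq_norm(1)[OF X1, of t] by (simp add: CG_def)
  \<comment> \<open>The limit must vanish at the origin surely, because simple approximations may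
    send a set of infinite \<open>w1\<close>-mass to 0. The feature at 0 vanishes, hence so do all
    its coefficients.\<close>
  have gp0: "FP.gp 0 w = 0" for w
  proof -
    have "FP.coef 0 i = 0" for i
      unfolding FP.coef_def ip_def by (simp add: complex_eq_iff)
    then have "FP.coef 0 = (\<lambda>_. 0)" by (rule ext)
    then show ?thesis by (simp add: FP.gp_def gseries_def gsum_def limI)
  qed
  have main: "centered_gaussian_with_cov gauss_seq (\<lambda>t w. complex_of_real (sqrt (1 + c\<^sup>2)) * FP.gp t w)
        (\<lambda>t s. complex_of_real (1 + c\<^sup>2) * R_cov M b d X t s)"
      "(\<lambda>t_w. complex_of_real (sqrt (1 + c\<^sup>2)) * FP.gp (fst t_w) (snd t_w)) \<in> borel_measurable (lborel \<Otimes>\<^sub>M gauss_seq)"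
      "\<And>s. s \<ge> 0 \<Longrightarrow> (\<lambda>n. \<integral>\<omega>. exp (- (s * weighted_norm w1 (\<lambda>t. partial_process c n t \<omega>))) \<partial>M)
        \<longlonglongrightarrow> (\<integral>w. exp (- (s * weighted_norm w1 (\<lambda>t. complex_of_real (sqrt (1 + c\<^sup>2)) * FP.gp t w))) \<partial>gauss_seq)"
    for c :: real
  proof -
    define a where "a = sqrt (1 + c\<^sup>2)"
    have a2: "a\<^sup>2 = 1 + c\<^sup>2" by (simp add: a_def add_nonneg_nonneg)
    let ?Z = "\<lambda>t w. complex_of_real a * FP.gp t w"
    have joint: "(\<lambda>z. ?Z (fst z) (snd z)) \<in> borel_measurable (lborel \<Otimes>\<^sub>M gauss_seq)"
      using FP.gp_joint_measurable unfolding case_prod_unfold by (rule borel_measurable_times[OF borel_measurable_const])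
    then show "(\<lambda>z. complex_of_real (sqrt (1 + c\<^sup>2)) * FP.gp (fst z) (snd z)) \<in> borel_measurable (lborel \<Otimes>\<^sub>M gauss_seq)"
      by (simp only: a_def)
    have joint': "(\<lambda>(t, w). ?Z t w) \<in> borel_measurable (lborel \<Otimes>\<^sub>M gauss_seq)"
      using joint by (simp only: case_prod_unfold)
    have Zi: "sq_integrable gauss_seq (?Z t)" for t
      by (rule sq_integrable_cmult(1)[OF FP.gp_sq_integrable])
    have Zn: "sq_norm gauss_seq (?Z t) = (1 + c\<^sup>2) * sq_norm M (\<lambda>\<omega>. feature t (X \<omega>))" for t
      unfolding sq_integrable_cmult(2)[OF FP.gp_sq_integrable] FP.gp_sq_norm by (simp add: a2)
    have ZV: "sq_norm gauss_seq (?Z t) \<le> ((1 + c\<^sup>2) * CG) * trunc_sq t" for t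
      unfolding Zn mult.assoc by (intro mult_left_mono feat_V) simp
    have intV: "integrable lborel (\<lambda>t. ((1 + c\<^sup>2) * CG) * trunc_sq t * w1 (t :: real ^ 'n))"
      unfolding mult.assoc[of _ "trunc_sq _"] by (rule integrable_mult_right[OF integrable_trunc_sq_w1])
    show "centered_gaussian_with_cov gauss_seq (\<lambda>t w. complex_of_real (sqrt (1 + c\<^sup>2)) * FP.gp t w)
        (\<lambda>t s. complex_of_real (1 + c\<^sup>2) * R_cov M b d X t s)"
      unfolding centered_gaussian_with_cov_def a_def[symmetric]
    proof (intro conjI allI)
      show "complex_gaussian_process gauss_seq ?Z" by (rule FP.gp_gaussian)
      show "(\<integral>w. ?Z t w \<partial>gauss_seq) = 0" for t by (simp add: FP.gp_mean)
      show "(\<integral>w. ?Z t w * cnj (?Z s w) \<partial>gauss_seq) = complex_of_real (1 + c\<^sup>2) * R_cov M b d X t s" for t s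
      proof -
        have "?Z t w * cnj (?Z s w) = complex_of_real (a\<^sup>2) * (FP.gp t w * cnj (FP.gp s w))" for w
          by (simp add: power2_eq_square mult_ac)
        then show ?thesis by (simp only: integral_mult_right_zero FP.gp_cov feature_cov a2)
      qed
      show "(\<lambda>(t, w). ?Z t w) \<in> borel_measurable (lborel \<Otimes>\<^sub>M gauss_seq)" by (rule joint')
      show "AE w in gauss_seq. w1_integrable (\<lambda>t. ?Z t w)"
        unfolding w1_integrable_def
        by (rule weighted_norm_AE_finite[OF prob_space_gauss_seq joint' w1_measurable w1_nonneg Zi ZV intV])
    qed
    fix s :: real assume s: "s \<ge> 0"
    define \<kappa> where "\<kappa> t r = (1 + c\<^sup>2) * sq_norm M (\<lambda>\<omega>. feature t (X \<omega>) - feature r (X \<omega>))" for t r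
    \<comment> \<open>Shifted by d because the second-moment identities hold from n = d on.\<close>
    have "(\<lambda>n. \<integral>\<omega>. exp (- (s * weighted_norm w1 (\<lambda>t. partial_process c (n + d) t \<omega>))) \<partial>M)
        \<longlonglongrightarrow> (\<integral>w. exp (- (s * weighted_norm w1 (\<lambda>t. ?Z t w))) \<partial>gauss_seq)"
    proof (rule laplace_weighted_norm_tendsto[where C="(1 + c\<^sup>2) * CG" and \<kappa>=\<kappa>])
      show "prob_space M" by (rule prob_space_axioms)
      show "prob_space gauss_seq" by (rule prob_space_gauss_seq)
      show "(\<lambda>(t, \<omega>). partial_process c (n + d) t \<omega>) \<in> borel_measurable (lborel \<Otimes>\<^sub>M M)" for n
        by (rule partial_process_measurable)
      show "(\<lambda>(t, w). ?Z t w) \<in> borel_measurable (lborel \<Otimes>\<^sub>M gauss_seq)" by (rule joint')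
      show "sq_integrable M (partial_process c (n + d) t)" for n t by (rule partial_process_sq(1)) simp
      show "sq_integrable gauss_seq (?Z t)" for t by (rule Zi)
      show "sq_norm M (partial_process c (n + d) t) \<le> (1 + c\<^sup>2) * CG * trunc_sq t" for n t
        unfolding partial_process_sq(2)[OF le_add2] mult.assoc by (intro mult_left_mono feat_V) simp
      show "sq_norm gauss_seq (?Z t) \<le> (1 + c\<^sup>2) * CG * trunc_sq t" for t by (rule ZV)
      show "sq_norm M (\<lambda>\<omega>. partial_process c (n + d) t \<omega> - partial_process c (n + d) r \<omega>) \<le> \<kappa> t r" for n r t
        unfolding \<kappa>_def by (rule eq_refl, rule partial_process_sq(3)) simp
      show "sq_norm gauss_seq (\<lambda>w. ?Z t w - ?Z r w) \<le> \<kappa> t r" for r t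
      proof -
        have "sq_norm gauss_seq (\<lambda>w. ?Z t w - ?Z r w) = sq_norm gauss_seq (\<lambda>w. complex_of_real a * (FP.gp t w - FP.gp r w))"
          by (simp only: right_diff_distrib)
        also have "\<dots> = \<kappa> t r"
          unfolding sq_integrable_cmult(2)[OF sq_integrable_diff(1)[OF FP.gp_sq_integrable FP.gp_sq_integrable]]
            FP.gp_sq_norm_diff \<kappa>_def by (simp add: a2)
        finally show ?thesis by simp
      qed
      have "(\<lambda>(z, \<omega>). (cmod (feature (fst z) (X \<omega>) - feature (snd z) (X \<omega>)))\<^sup>2) \<in> borel_measurable ((borel \<Otimes>\<^sub>M borel) \<Otimes>\<^sub>M M)"
        unfolding case_prod_unfold by measurable
      from borel_measurable_lebesgue_integral[OF this]
      show "(\<lambda>(t, r). \<kappa> t r) \<in> borel_measurable (borel \<Otimes>\<^sub>M borel)"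
        unfolding \<kappa>_def sq_norm_def case_prod_unfold by (rule borel_measurable_times[OF borel_measurable_const])
      show "(\<lambda>i. \<kappa> t (r i)) \<longlonglongrightarrow> 0" if "r \<longlonglongrightarrow> t" for t r
        unfolding \<kappa>_def using tendsto_mult_right_zero[OF feature_continuous[OF that]] .
      show "partial_process c (n + d) 0 \<omega> = 0" for n \<omega> by (simp add: partial_process_def)
      show "?Z 0 w = 0" for w by (simp add: gp0)
      show "(\<lambda>n. \<integral>x. iexp (rcomb F \<alpha> \<beta> (partial_process c (n + d)) x) \<partial>M) \<longlonglongrightarrow> (\<integral>w. iexp (rcomb F \<alpha> \<beta> ?Z w) \<partial>gauss_seq)"
        if F: "finite F" for F \<alpha> \<beta>
      proof -
        have rc: "rcomb F \<alpha> \<beta> ?Z w = rcomb F (\<lambda>t. a * \<alpha> t) (\<lambda>t. a * \<beta> t) FP.gp w" for w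
          unfolding rcomb_def by (intro sum.cong refl) (simp add: algebra_simps)
        have "(\<integral>w. iexp (rcomb F \<alpha> \<beta> ?Z w) \<partial>gauss_seq)
           = complex_of_real (exp (- ((1 + c\<^sup>2) * (\<integral>\<omega>. (rcomb F \<alpha> \<beta> (\<lambda>t \<omega>. feature t (X \<omega>)) \<omega>)\<^sup>2 \<partial>M)) / 2))"
          unfolding rc
          by (subst FP.gp_char[OF F])
             (simp only: FP.rcomb_scale power_mult_distrib integral_mult_right_zero a2)
        then show ?thesis
          using LIMSEQ_ignore_initial_segment[OF partial_process_char[OF F], of \<alpha> \<beta> c d] by simp
      qed
    qed (simp_all add: s integrable_trunc_sq_w1 w1_measurable)
    then show "(\<lambda>n. \<integral>\<omega>. exp (- (s * weighted_norm w1 (\<lambda>t. partial_process c n t \<omega>))) \<partial>M)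
        \<longlonglongrightarrow> (\<integral>w. exp (- (s * weighted_norm w1 (\<lambda>t. complex_of_real (sqrt (1 + c\<^sup>2)) * FP.gp t w))) \<partial>gauss_seq)"
      unfolding a_def by (rule LIMSEQ_offset)
  qed
  show ?thesis using main by (intro exI[of _ FP.gp] allI conjI impI)
qed

end

lemma converges_in_distributionI:
  assumes M: "prob_space M" and N: "prob_space N"
    and Y[measurable]: "\<And>n. Y n \<in> borel_measurable M" and Y0: "\<And>n \<omega>. Y n \<omega> \<ge> 0"
    and Z[measurable]: "Z \<in> borel_measurable N" and Z0: "\<And>w. Z w \<ge> 0"
    and conv: "\<And>k::nat. (\<lambda>n. \<integral>\<omega>. exp (- (real k * Y n \<omega>)) \<partial>M) \<longlonglongrightarrow> (\<integral>w. exp (- (real k * Z w)) \<partial>N)"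
  shows "converges_in_distribution M Y N Z"
  unfolding converges_in_distribution_def
proof (rule laplace_imp_weak_conv)
  interpret M: prob_space M by fact
  interpret N: prob_space N by fact
  show "real_distribution (distr M borel (Y n))" for n by simp
  show "real_distribution (distr N borel Z)" by simp
  show "AE x in distr M borel (Y n). 0 \<le> x" for n by (subst AE_distr_iff) (auto simp: Y0)
  show "AE x in distr N borel Z. 0 \<le> x" by (subst AE_distr_iff) (auto simp: Z0)
  show "(\<lambda>n. \<integral>x. exp (- (real k * x)) \<partial>distr M borel (Y n)) \<longlonglongrightarrow> (\<integral>x. exp (- (real k * x)) \<partial>distr N borel Z)" for k
    using conv[of k] by (simp add: integral_distr)
qed

context independent_sample
begin

lemma Q_star_partial_process:
  "n > 0 \<Longrightarrow> real n * Q_star b d n (\<lambda>k. Xs k \<omega>) = weighted_norm w1 (\<lambda>t. partial_process 1 n t \<omega>)"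
  unfolding Q_star_def w1_norm_sq_eq scaled_weighted_norm by (simp add: partial_process_star)

text \<open>The remainder has second moment of order 1/n^2, so after multiplication by sqrt n its
  second moment is of order 1/n, uniformly against \<open>trunc_sq\<close>. The comparison of
  Laplace transforms takes a square root, whence the rate 1/sqrt n.\<close>

lemma Q_linearization:
  assumes X1: "integrable M (\<lambda>\<omega>. norm (X \<omega>))" and s: "s \<ge> 0"
  shows "(\<lambda>n. (\<integral>\<omega>. exp (- (s * (real n * Q b d n (\<lambda>k. Xs k \<omega>)))) \<partial>M)
      - (\<integral>\<omega>. exp (- (s * weighted_norm w1 (\<lambda>t. partial_process 0 n t \<omega>))) \<partial>M)) \<longlonglongrightarrow> 0"
proof (rule Lim_null_comparison)
  define CG where "CG = real d ^ 4 * dev_const"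
  define I where "I = (\<integral>t. trunc_sq t * w1 t \<partial>(lborel :: (real ^ 'n) measure))"
  have CG0: "CG \<ge> 0" unfolding CG_def using dev_const_pos by (intro mult_nonneg_nonneg) auto
  show "(\<lambda>n. s * (CG * sqrt 10 * I / sqrt (real n))) \<longlonglongrightarrow> 0"
  proof -
    have "(\<lambda>n. s * (CG * sqrt 10 * I) * inverse (sqrt (real n))) \<longlonglongrightarrow> s * (CG * sqrt 10 * I) * 0"
      by (intro tendsto_mult tendsto_const tendsto_inverse_0_at_top
          filterlim_compose[OF sqrt_at_top filterlim_real_sequentially])
    then show ?thesis by (simp add: field_simps)
  qed
  have bound: "norm ((\<integral>\<omega>. exp (- (s * (real n * Q b d n (\<lambda>k. Xs k \<omega>)))) \<partial>M)
      - (\<integral>\<omega>. exp (- (s * weighted_norm w1 (\<lambda>t. partial_process 0 n t \<omega>))) \<partial>M)) \<le> s * (CG * sqrt 10 * I / sqrt (real n))"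
    if n: "n \<ge> d" for n
  proof -
    have n0: "n > 0" using n d_pos by linarith
    let ?Z = "\<lambda>t \<omega>. complex_of_real (sqrt (real n)) * (ecf n (\<lambda>k. Xs k \<omega>) t - ecf_prod b d n (\<lambda>k. Xs k \<omega>) t)"
    let ?Z' = "partial_process 0 n"
    let ?E = "\<lambda>t \<omega>. complex_of_real (sqrt (real n)) * linearization_error n t \<omega>"
    have Z_eq: "?Z t = (\<lambda>\<omega>. ?Z' t \<omega> - ?E t \<omega>)" for t
      by (rule ext) (rule partial_process_linearized[OF n0])
    have lin_m: "linearization_error n t \<in> borel_measurable M" for t
      unfolding linearization_error_def[abs_def] by measurable
    have lin_b: "cmod (linearization_error n t \<omega>) \<le> 2 + 2 * real d" for t \<omega>
    proof -
      have "cmod (\<Sum>j=1..d. (ecf_comp j n t \<omega> - \<phi> j t) * (\<Prod>l\<in>{1..d} - {j}. \<phi> l t)) \<le> (\<Sum>j=1..d. 2 * 1)"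
      proof (rule order_trans[OF norm_sum sum_mono])
        fix j
        have "cmod (ecf_comp j n t \<omega> - \<phi> j t) \<le> 2"
          using norm_triangle_ineq4[of "ecf_comp j n t \<omega>" "\<phi> j t"] norm_component_char[of j t] norm_ecf_comp[of j n t \<omega>] by simp
        then show "cmod ((ecf_comp j n t \<omega> - \<phi> j t) * (\<Prod>l\<in>{1..d} - {j}. \<phi> l t)) \<le> 2 * 1"
          unfolding norm_mult by (intro mult_mono norm_prod_component_char) auto
      qed
      moreover have "cmod (\<Prod>j=1..d. ecf_comp j n t \<omega>) \<le> 1"
        unfolding prod_norm[symmetric] by (rule prod_le_1) (simp add: norm_ecf_comp)
      ultimately show ?thesis
        using norm_triangle_ineq4[of "(\<Prod>j=1..d. ecf_comp j n t \<omega>) - (\<Prod>j=1..d. \<phi> j t)" "\<Sum>j=1..d. (ecf_comp j n t \<omega> - \<phi> j t) * (\<Prod>l\<in>{1..d} - {j}. \<phi> l t)"]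
          norm_triangle_ineq4[of "\<Prod>j=1..d. ecf_comp j n t \<omega>" "\<Prod>j=1..d. \<phi> j t"] norm_prod_component_char[of t "{1..d}"]
        unfolding linearization_error_def by simp
    qed
    have lin_i: "sq_integrable M (linearization_error n t)" for t
      by (rule sq_integrable_bounded[OF lin_m lin_b])
    have E_i: "sq_integrable M (?E t)" for t by (rule sq_integrable_cmult(1)[OF lin_i])
    have E_n: "sq_norm M (?E t) \<le> CG * trunc_sq t / real n" for t
    proof -
      have "sq_norm M (?E t) = real n * sq_norm M (linearization_error n t)"
        unfolding sq_integrable_cmult(2)[OF lin_i] by simp
      also have "\<dots> \<le> real n * (CG * trunc_sq t / (real n)\<^sup>2)"
        using feature_sq_norm(2)[OF X1 n0, of t] unfolding linearization_error_def[abs_def] CG_def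
        by (intro mult_left_mono) auto
      also have "\<dots> = CG * trunc_sq t / real n" using n0 by (simp add: power2_eq_square)
      finally show ?thesis .
    qed
    have Z'_n: "sq_norm M (?Z' t) \<le> CG * trunc_sq t" for t
      using feature_sq_norm(1)[OF X1, of t] partial_process_sq(2)[OF n, of 0 t] by (simp add: CG_def)
    have Z'_i: "sq_integrable M (?Z' t)" for t by (rule partial_process_sq(1)[OF n])
    have Z_i: "sq_integrable M (?Z t)" for t
      unfolding Z_eq by (rule sq_integrable_diff(1)[OF Z'_i E_i])
    \<comment> \<open>The 4 is 2 + 2 from the estimate for a difference, both parts being at most
      \<open>CG * trunc_sq t\<close>. Together with the bound for \<open>?Z'\<close> it produces 2 *
      4 + 2 = 10 under the square root.\<close>
    have Z_n: "sq_norm M (?Z t) \<le> 4 * (CG * trunc_sq t)" for t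
    proof -
      have "CG * trunc_sq t / real n \<le> CG * trunc_sq t / 1"
        using n0 CG0 by (intro divide_left_mono) auto
      then show ?thesis
        unfolding Z_eq using sq_integrable_diff(2)[OF Z'_i[of t] E_i[of t]] Z'_n[of t] E_n[of t] by linarith
    qed
    have D: "sq_norm M (\<lambda>\<omega>. ?Z t \<omega> - ?Z' t \<omega>) \<le> CG * trunc_sq t / real n" for t
    proof -
      have "(\<lambda>\<omega>. ?Z t \<omega> - ?Z' t \<omega>) = (\<lambda>\<omega>. (- 1) * ?E t \<omega>)"
        using fun_cong[OF Z_eq[of t]] by (intro ext) simp
      then have "sq_norm M (\<lambda>\<omega>. ?Z t \<omega> - ?Z' t \<omega>) = sq_norm M (?E t)"
        using sq_integrable_cmult(2)[OF E_i[of t], of "-1"] by simp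
      then show ?thesis using E_n[of t] by simp
    qed
    have \<delta>: "sqrt (CG * trunc_sq t / real n) * sqrt (2 * (4 * (CG * trunc_sq t)) + 2 * (CG * trunc_sq t)) * w1 t
        = (CG * sqrt 10 / sqrt (real n)) * (trunc_sq t * w1 t)" for t :: "real ^ 'n"
    proof -
      have "2 * (4 * (CG * trunc_sq t)) + 2 * (CG * trunc_sq t) = 10 * (CG * trunc_sq t)" by simp
      moreover have "sqrt (CG * trunc_sq t) * sqrt (CG * trunc_sq t) = CG * trunc_sq t"
        using CG0 by simp
      ultimately show ?thesis
        by (simp only: real_sqrt_divide real_sqrt_mult[of 10]) (simp add: field_simps)
    qed
    have "\<bar>(\<integral>\<omega>. exp (- (s * weighted_norm w1 (\<lambda>t. ?Z t \<omega>))) \<partial>M) - (\<integral>\<omega>. exp (- (s * weighted_norm w1 (\<lambda>t. ?Z' t \<omega>))) \<partial>M)\<bar>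
      \<le> s * (\<integral>t. sqrt (CG * trunc_sq (t :: real ^ 'n) / real n) * sqrt (2 * (4 * (CG * trunc_sq t)) + 2 * (CG * trunc_sq t)) * w1 t \<partial>lborel)"
    proof (rule laplace_weighted_norm_compare[where Z="?Z" and Z'="?Z'" and V="\<lambda>t. 4 * (CG * trunc_sq t)"
          and V'="\<lambda>t. CG * trunc_sq t" and D="\<lambda>t. CG * trunc_sq t / real n"])
      show "prob_space M" by (rule prob_space_axioms)
      show "(\<lambda>(t, \<omega>). ?Z' t \<omega>) \<in> borel_measurable (lborel \<Otimes>\<^sub>M M)" by (rule partial_process_measurable)
      show "(w1 :: real ^ 'n \<Rightarrow> real) \<in> borel_measurable borel" by (rule w1_measurable)
      show "w1 t \<ge> 0" for t :: "real ^ 'n" by (rule w1_nonneg)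
      show "sq_integrable M (?Z t)" for t by (rule Z_i)
      show "sq_norm M (?Z t) \<le> 4 * (CG * trunc_sq t)" for t by (rule Z_n)
      show "sq_integrable M (?Z' t)" for t by (rule Z'_i)
      show "sq_norm M (?Z' t) \<le> CG * trunc_sq t" for t by (rule Z'_n)
      show "sq_norm M (\<lambda>\<omega>. ?Z t \<omega> - ?Z' t \<omega>) \<le> CG * trunc_sq t / real n" for t by (rule D)
      show "s \<ge> 0" by (rule s)
      have "(\<lambda>z. complex_of_real (sqrt (real n)) * (case z of (t, \<omega>) \<Rightarrow> ecf n (\<lambda>k. Xs k \<omega>) t - ecf_prod b d n (\<lambda>k. Xs k \<omega>) t))
          \<in> borel_measurable (lborel \<Otimes>\<^sub>M M)"
        by (intro borel_measurable_times borel_measurable_const Q_integrand_measurable)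
      then show "(\<lambda>(t, \<omega>). ?Z t \<omega>) \<in> borel_measurable (lborel \<Otimes>\<^sub>M M)" by (simp only: case_prod_unfold)
      show "integrable lborel (\<lambda>t::real ^ 'n. 4 * (CG * trunc_sq t) * w1 t)" "integrable lborel (\<lambda>t::real ^ 'n. CG * trunc_sq t * w1 t)"
        using integrable_mult_right[OF integrable_trunc_sq_w1, of "4 * CG"] integrable_mult_right[OF integrable_trunc_sq_w1, of CG]
        by (simp_all add: mult.assoc)
      show "integrable lborel (\<lambda>t::real ^ 'n. sqrt (CG * trunc_sq t / real n) * sqrt (2 * (4 * (CG * trunc_sq t)) + 2 * (CG * trunc_sq t)) * w1 t)"
        unfolding \<delta> by (rule integrable_mult_right[OF integrable_trunc_sq_w1])
    qed
    then show ?thesis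
      unfolding \<delta> integral_mult_right_zero I_def[symmetric] real_norm_def Q_def w1_norm_sq_eq scaled_weighted_norm
      by simp
  qed
  show "\<forall>\<^sub>F n in sequentially. norm ((\<integral>\<omega>. exp (- (s * (real n * Q b d n (\<lambda>k. Xs k \<omega>)))) \<partial>M)
      - (\<integral>\<omega>. exp (- (s * weighted_norm w1 (\<lambda>t. partial_process 0 n t \<omega>))) \<partial>M)) \<le> s * (CG * sqrt 10 * I / sqrt (real n))"
    using eventually_ge_at_top[of d] by eventually_elim (rule bound)
qed

theorem limit_laws:
  assumes X1: "integrable M (\<lambda>\<omega>. norm (X \<omega>))"
  shows "\<exists>(N :: (nat \<Rightarrow> real) measure) \<zeta> \<zeta>_star.
          prob_space N \<and>
          centered_gaussian_with_cov N \<zeta> (R_cov M b d X) \<and>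
          centered_gaussian_with_cov N \<zeta>_star (\<lambda>t t0. 2 * R_cov M b d X t t0) \<and>
          converges_in_distribution M (\<lambda>n \<omega>. real n * Q b d n (\<lambda>k. Xs k \<omega>))
            N (\<lambda>\<omega>. w1_norm_sq (\<lambda>t. \<zeta> t \<omega>)) \<and>
          converges_in_distribution M (\<lambda>n \<omega>. real n * Q_star b d n (\<lambda>k. Xs k \<omega>))
            N (\<lambda>\<omega>. w1_norm_sq (\<lambda>t. \<zeta>_star t \<omega>))"
proof -
  obtain Z where Z: "\<And>c::real. centered_gaussian_with_cov gauss_seq (\<lambda>t w. complex_of_real (sqrt (1 + c\<^sup>2)) * Z t w)
        (\<lambda>t s. complex_of_real (1 + c\<^sup>2) * R_cov M b d X t s)"
      and Zm: "\<And>c::real. (\<lambda>t_w. complex_of_real (sqrt (1 + c\<^sup>2)) * Z (fst t_w) (snd t_w)) \<in> borel_measurable (lborel \<Otimes>\<^sub>M gauss_seq)"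
      and Zl: "\<And>(c::real) s. s \<ge> 0 \<Longrightarrow> (\<lambda>n. \<integral>\<omega>. exp (- (s * weighted_norm w1 (\<lambda>t. partial_process c n t \<omega>))) \<partial>M)
        \<longlonglongrightarrow> (\<integral>w. exp (- (s * weighted_norm w1 (\<lambda>t. complex_of_real (sqrt (1 + c\<^sup>2)) * Z t w))) \<partial>gauss_seq)"
    using limit_process[OF X1] by blast
  interpret N: prob_space gauss_seq by (rule prob_space_gauss_seq)
  define \<zeta> where "\<zeta> c t w = complex_of_real (sqrt (1 + c\<^sup>2)) * Z t w" for c :: real and t w
  have norm_m: "(\<lambda>w. weighted_norm w1 (\<lambda>t. \<zeta> c t w)) \<in> borel_measurable gauss_seq" for c
    using Zm[of c] unfolding \<zeta>_def
    by (intro weighted_norm_measurable N.sigma_finite_measure_axioms w1_measurable) (simp only: case_prod_unfold)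
  have cov: "centered_gaussian_with_cov gauss_seq (\<zeta> 0) (R_cov M b d X)"
      "centered_gaussian_with_cov gauss_seq (\<zeta> 1) (\<lambda>t t0. 2 * R_cov M b d X t t0)"
    using Z[of 0] Z[of 1] unfolding \<zeta>_def[abs_def] by simp_all
  have lim: "(\<lambda>n. \<integral>\<omega>. exp (- (s * weighted_norm w1 (\<lambda>t. partial_process c n t \<omega>))) \<partial>M)
        \<longlonglongrightarrow> (\<integral>w. exp (- (s * weighted_norm w1 (\<lambda>t. \<zeta> c t w))) \<partial>gauss_seq)" if "s \<ge> 0" for s c
    using Zl[OF that, of c] by (simp only: \<zeta>_def)
  have 1: "converges_in_distribution M (\<lambda>n \<omega>. real n * Q b d n (\<lambda>k. Xs k \<omega>))
            gauss_seq (\<lambda>\<omega>. w1_norm_sq (\<lambda>t. \<zeta> 0 t \<omega>))"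
    unfolding w1_norm_sq_eq
  proof (rule converges_in_distributionI[OF prob_space_axioms prob_space_gauss_seq Q_measurable(1) _ norm_m])
    fix k :: nat
    from tendsto_add[OF Q_linearization[OF X1, of "real k"] lim[of "real k" 0]]
    show "(\<lambda>n. \<integral>\<omega>. exp (- (real k * (real n * Q b d n (\<lambda>k. Xs k \<omega>)))) \<partial>M)
        \<longlonglongrightarrow> (\<integral>w. exp (- (real k * weighted_norm w1 (\<lambda>t. \<zeta> 0 t w))) \<partial>gauss_seq)" by simp
  qed (simp_all add: Q_nonneg weighted_norm_nonneg)
  have 2: "converges_in_distribution M (\<lambda>n \<omega>. real n * Q_star b d n (\<lambda>k. Xs k \<omega>))
            gauss_seq (\<lambda>\<omega>. w1_norm_sq (\<lambda>t. \<zeta> 1 t \<omega>))"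
    unfolding w1_norm_sq_eq
  proof (rule converges_in_distributionI[OF prob_space_axioms prob_space_gauss_seq Q_measurable(2) _ norm_m])
    fix k :: nat
    show "(\<lambda>n. \<integral>\<omega>. exp (- (real k * (real n * Q_star b d n (\<lambda>k. Xs k \<omega>)))) \<partial>M)
        \<longlonglongrightarrow> (\<integral>w. exp (- (real k * weighted_norm w1 (\<lambda>t. \<zeta> 1 t w))) \<partial>gauss_seq)"
    proof (rule Lim_transform_eventually[OF lim[of "real k" 1]])
      show "\<forall>\<^sub>F n in sequentially. (\<integral>\<omega>. exp (- (real k * weighted_norm w1 (\<lambda>t. partial_process 1 n t \<omega>))) \<partial>M)
         = (\<integral>\<omega>. exp (- (real k * (real n * Q_star b d n (\<lambda>k. Xs k \<omega>)))) \<partial>M)"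
        using eventually_gt_at_top[of 0] by eventually_elim (simp only: Q_star_partial_process)
    qed simp
  qed (simp_all add: Q_nonneg weighted_norm_nonneg)
  show ?thesis
    by (rule exI[of _ gauss_seq], rule exI[of _ "\<zeta> 0"], rule exI[of _ "\<zeta> 1"])
       (intro conjI prob_space_gauss_seq cov 1 2)
qed

end

subsection \<open>Divergence without independence\<close>

text \<open>In the expanded double sum only pairs at distance less than p survive, at most 2p in
  each row, and each is bounded by the square of B.\<close>

lemma (in prob_space) decorrelated_second_moment:
  fixes Y :: "nat \<Rightarrow> 'a \<Rightarrow> complex"
  assumes Y[measurable]: "\<And>k. Y k \<in> borel_measurable M" and B: "\<And>k \<omega>. cmod (Y k \<omega>) \<le> B"
    and orth: "\<And>k l. k + p \<le> l \<Longrightarrow> (\<integral>\<omega>. Y k \<omega> * cnj (Y l \<omega>) \<partial>M) = 0"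
  shows "(\<integral>\<omega>. (cmod (\<Sum>k<n. Y k \<omega>))\<^sup>2 \<partial>M) \<le> real n * (2 * real p * B\<^sup>2)"
proof -
  let ?c = "\<lambda>k l. \<integral>\<omega>. Y k \<omega> * cnj (Y l \<omega>) \<partial>M"
  have B0: "B \<ge> 0" using order_trans[OF norm_ge_zero B] .
  have nb: "cmod (Y k \<omega> * cnj (Y l \<omega>)) \<le> B\<^sup>2" for k l \<omega>
    unfolding norm_mult power2_eq_square complex_mod_cnj by (intro mult_mono B B0 norm_ge_zero)
  have i: "complex_integrable M (\<lambda>\<omega>. Y k \<omega> * cnj (Y l \<omega>))" for k l
    by (rule integrable_bounded[OF finite_measure_axioms _ nb]) measurable
  have le: "Re (?c k l) \<le> (if k < l + p \<and> l < k + p then B\<^sup>2 else 0)" for k l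
  proof -
    have "Re (?c k l) \<le> cmod (?c k l)" by (rule complex_Re_le_cmod)
    also have "\<dots> \<le> (\<integral>\<omega>. cmod (Y k \<omega> * cnj (Y l \<omega>)) \<partial>M)" by (rule integral_norm_bound)
    also have "\<dots> \<le> (\<integral>\<omega>. B\<^sup>2 \<partial>M)" by (intro integral_mono integrable_norm i nb) simp
    finally have "Re (?c k l) \<le> B\<^sup>2" by (simp add: prob_space)
    moreover have "?c k l = 0" if "k + p \<le> l" by (rule orth[OF that])
    moreover have "?c k l = 0" if "l + p \<le> k"
    proof -
      have "?c k l = (\<integral>\<omega>. cnj (Y l \<omega> * cnj (Y k \<omega>)) \<partial>M)" by (simp add: mult.commute)
      also have "\<dots> = cnj (?c l k)" by (rule Bochner_Integration.integral_cnj)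
      finally show ?thesis using orth[OF that] by simp
    qed
    ultimately show ?thesis by (cases "k + p \<le> l"; cases "l + p \<le> k") auto
  qed
  have "(\<integral>\<omega>. (cmod (\<Sum>k<n. Y k \<omega>))\<^sup>2 \<partial>M) = (\<integral>\<omega>. Re (\<Sum>k<n. \<Sum>l<n. Y k \<omega> * cnj (Y l \<omega>)) \<partial>M)"
  proof -
    have "(cmod z)\<^sup>2 = Re (z * cnj z)" for z by (metis Re_complex_of_real complex_norm_square)
    then show ?thesis by (simp only: cnj_sum sum_product)
  qed
  also have "\<dots> = Re (\<integral>\<omega>. (\<Sum>k<n. \<Sum>l<n. Y k \<omega> * cnj (Y l \<omega>)) \<partial>M)"
    by (rule integral_Re) (intro Bochner_Integration.integrable_sum i)
  also have "\<dots> = (\<Sum>k<n. \<Sum>l<n. Re (?c k l))"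
    by (subst Bochner_Integration.integral_sum, intro Bochner_Integration.integrable_sum i,
        subst Bochner_Integration.integral_sum, rule i) simp
  also have "\<dots> \<le> (\<Sum>k<n. 2 * real p * B\<^sup>2)"
  proof (rule sum_mono)
    fix k
    have "(\<Sum>l<n. Re (?c k l)) \<le> (\<Sum>l<n. if k < l + p \<and> l < k + p then B\<^sup>2 else 0)"
      by (rule sum_mono[OF le])
    also have "\<dots> = real (card {l. l < n \<and> k < l + p \<and> l < k + p}) * B\<^sup>2"
      by (simp add: sum.If_cases Int_def)
    also have "\<dots> \<le> (2 * real p) * B\<^sup>2"
    proof (rule mult_right_mono)
      have "card {l. l < n \<and> k < l + p \<and> l < k + p} \<le> card {k - p..<k + p}"
        by (rule card_mono) auto
      then show "real (card {l. l < n \<and> k < l + p \<and> l < k + p}) \<le> 2 * real p" by simp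
    qed simp
    finally show "(\<Sum>l<n. Re (?c k l)) \<le> 2 * real p * B\<^sup>2" .
  qed
  finally show ?thesis by simp
qed

text \<open>For n between m^2 and (m + 1)^2 the partial sum moves by at most 2mB from its value at
  m^2, which is negligible against n \<ge> m^2.\<close>

lemma averages_tendsto_0_along_squares:
  fixes S :: "nat \<Rightarrow> complex"
  assumes sq: "(\<lambda>m. cmod (S (m\<^sup>2)) / (real m)\<^sup>2) \<longlonglongrightarrow> 0"
    and lip: "\<And>m n. m \<le> n \<Longrightarrow> cmod (S n - S m) \<le> real (n - m) * B"
  shows "(\<lambda>n. S n / of_nat n) \<longlonglongrightarrow> 0"
proof -
  have B0: "B \<ge> 0" using order_trans[OF norm_ge_zero lip[of 0 1]] by simp
  have lim: "filterlim floor_sqrt sequentially sequentially"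
    unfolding filterlim_at_top
  proof
    fix Z :: nat
    show "\<forall>\<^sub>F n in sequentially. Z \<le> floor_sqrt n"
      using eventually_ge_at_top[of "Z\<^sup>2"] by eventually_elim (metis floor_sqrt_inverse_power2 monoD mono_floor_sqrt)
  qed
  have "(\<lambda>m. cmod (S (m\<^sup>2)) / (real m)\<^sup>2 + 2 * B * (1 / real m)) \<longlonglongrightarrow> 0 + 2 * B * 0"
    by (intro tendsto_intros sq lim_1_over_n)
  then have "(\<lambda>m. cmod (S (m\<^sup>2)) / (real m)\<^sup>2 + 2 * B * (1 / real m)) \<longlonglongrightarrow> 0" by simp
  from filterlim_compose[OF this lim] show ?thesis
  proof (rule Lim_null_comparison[rotated])
    show "\<forall>\<^sub>F n in sequentially. cmod (S n / of_nat n)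
        \<le> cmod (S ((floor_sqrt n)\<^sup>2)) / (real (floor_sqrt n))\<^sup>2 + 2 * B * (1 / real (floor_sqrt n))"
      using eventually_gt_at_top[of 0]
    proof eventually_elim
      fix n :: nat assume n: "n > 0"
      define m where "m = floor_sqrt n"
      have m0: "real m > 0" using n by (simp add: m_def)
      have le: "m\<^sup>2 \<le> n" unfolding m_def by (rule floor_sqrt_power2_le)
      have "n < (Suc m)\<^sup>2" unfolding m_def by (rule Suc_floor_sqrt_power2_gt)
      then have d: "n - m\<^sup>2 \<le> 2 * m" by (simp add: power2_eq_square)
      have r: "(real m)\<^sup>2 \<le> real n" using le by (metis of_nat_le_iff of_nat_power)
      have "cmod (S n) \<le> cmod (S (m\<^sup>2)) + real (n - m\<^sup>2) * B"
        using norm_triangle_sub[of "S n" "S (m\<^sup>2)"] lip[OF le] by linarith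
      also have "\<dots> \<le> cmod (S (m\<^sup>2)) + real (2 * m) * B"
        using d B0 by (intro add_left_mono mult_right_mono) auto
      finally have "cmod (S n) / real n \<le> (cmod (S (m\<^sup>2)) + real (2 * m) * B) / (real m)\<^sup>2"
        using r m0 B0 by (intro frac_le) auto
      also have "\<dots> = cmod (S (m\<^sup>2)) / (real m)\<^sup>2 + 2 * B * (1 / real m)"
        using m0 by (simp add: add_divide_distrib power2_eq_square)
      finally show "cmod (S n / of_nat n)
        \<le> cmod (S ((floor_sqrt n)\<^sup>2)) / (real (floor_sqrt n))\<^sup>2 + 2 * B * (1 / real (floor_sqrt n))"
        by (simp add: m_def norm_divide)
    qed
  qed
qed

text \<open>The second moments of partial sums grow linearly, so the squared averages at sizes m^2
  have summable means and tend to 0 almost surely; boundedness fills the gaps between squares. Only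
  vanishing covariances at distance p enter, so independent and d-dependent summands are handled
  alike.\<close>

lemma (in prob_space) strong_law_decorrelated:
  fixes Y :: "nat \<Rightarrow> 'a \<Rightarrow> complex"
  assumes Y[measurable]: "\<And>k. Y k \<in> borel_measurable M" and B: "\<And>k \<omega>. cmod (Y k \<omega>) \<le> B"
    and orth: "\<And>k l. k + p \<le> l \<Longrightarrow> (\<integral>\<omega>. Y k \<omega> * cnj (Y l \<omega>) \<partial>M) = 0"
  shows "AE \<omega> in M. (\<lambda>n. (\<Sum>k<n. Y k \<omega>) / of_nat n) \<longlonglongrightarrow> 0"
proof -
  define S where "S n \<omega> = (\<Sum>k<n. Y k \<omega>)" for n \<omega>
  define C where "C = 2 * real p * B\<^sup>2"
  \<comment> \<open>The squared modulus of the average of the first m^2 summands; its mean is at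
    most C/m^2.\<close>
  define T where "T m \<omega> = (cmod (S (m\<^sup>2) \<omega>) / (real m)\<^sup>2)\<^sup>2" for m \<omega>
  have [measurable]: "S n \<in> borel_measurable M" for n unfolding S_def by measurable
  have [measurable]: "T m \<in> borel_measurable M" for m unfolding T_def by measurable
  have lip: "cmod (S n \<omega> - S m \<omega>) \<le> real (n - m) * B" if "m \<le> n" for m n \<omega>
  proof -
    have "S n \<omega> - S m \<omega> = (\<Sum>k\<in>{m..<n}. Y k \<omega>)"
      unfolding S_def using that by (metis lessThan_atLeast0 sum_diff_nat_ivl zero_le)
    also have "cmod \<dots> \<le> (\<Sum>k\<in>{m..<n}. B)" by (rule order_trans[OF norm_sum sum_mono[OF B]])
    finally show ?thesis by simp
  qed
  have Sb: "cmod (S n \<omega>) \<le> real n * B" for n \<omega>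
    using lip[of 0 n \<omega>] by (simp add: S_def)
  have T_le: "(\<integral>\<^sup>+\<omega>. ennreal (T m \<omega>) \<partial>M) \<le> ennreal (C * inverse (real m ^ 2))" for m
  proof (cases "m = 0")
    case False
    then have m0: "real m > 0" by simp
    have i: "integrable M (\<lambda>\<omega>. (cmod (S (m\<^sup>2) \<omega>))\<^sup>2)"
      by (rule integrable_bounded[OF finite_measure_axioms, where C="(real (m\<^sup>2) * B)\<^sup>2"])
         (auto intro!: power_mono Sb simp del: of_nat_power)
    have "(\<integral>\<^sup>+\<omega>. ennreal (T m \<omega>) \<partial>M) = ennreal (\<integral>\<omega>. T m \<omega> \<partial>M)"
      by (rule nn_integral_eq_integral) (use i in \<open>auto simp: T_def power_divide\<close>)
    also have "(\<integral>\<omega>. T m \<omega> \<partial>M) = (\<integral>\<omega>. (cmod (S (m\<^sup>2) \<omega>))\<^sup>2 \<partial>M) / ((real m)\<^sup>2)\<^sup>2"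
      by (simp add: T_def power_divide)
    also have "\<dots> \<le> real (m\<^sup>2) * C / ((real m)\<^sup>2)\<^sup>2"
      unfolding S_def C_def by (intro divide_right_mono decorrelated_second_moment[OF Y B orth]) auto
    also have "\<dots> = C * inverse (real m ^ 2)"
      using m0 by (simp add: field_simps power2_eq_square)
    finally show ?thesis by (simp add: ennreal_leI)
  qed (simp add: T_def)
  have sm: "summable (\<lambda>m. C * inverse (real m ^ 2))"
    by (intro summable_mult inverse_power_summable) simp
  have C0: "C * inverse (real m ^ 2) \<ge> 0" for m unfolding C_def by simp
  have "(\<integral>\<^sup>+\<omega>. (\<Sum>m. ennreal (T m \<omega>)) \<partial>M) = (\<Sum>m. \<integral>\<^sup>+\<omega>. ennreal (T m \<omega>) \<partial>M)"
    by (rule nn_integral_suminf) measurable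
  also have "\<dots> \<le> (\<Sum>m. ennreal (C * inverse (real m ^ 2)))"
    by (intro suminf_le T_le) auto
  also have "\<dots> = ennreal (\<Sum>m. C * inverse (real m ^ 2))"
    by (rule suminf_ennreal_eq[OF C0 summable_sums[OF sm]])
  finally have "(\<integral>\<^sup>+\<omega>. (\<Sum>m. ennreal (T m \<omega>)) \<partial>M) \<noteq> \<infinity>" by (auto simp: top_unique)
  then have "AE \<omega> in M. (\<Sum>m. ennreal (T m \<omega>)) \<noteq> \<infinity>"
    by (intro nn_integral_PInf_AE) auto
  then show ?thesis
  proof eventually_elim
    case (elim \<omega>)
    have "summable (\<lambda>m. T m \<omega>)"
      by (rule summable_suminf_not_top) (use elim in \<open>auto simp: T_def\<close>)
    then have "(\<lambda>m. T m \<omega>) \<longlonglongrightarrow> 0" by (rule summable_LIMSEQ_zero)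
    then have "(\<lambda>m. sqrt (T m \<omega>)) \<longlonglongrightarrow> sqrt 0" by (rule tendsto_real_sqrt)
    then have "(\<lambda>m. cmod (S (m\<^sup>2) \<omega>) / (real m)\<^sup>2) \<longlonglongrightarrow> 0" by (simp add: T_def)
    from averages_tendsto_0_along_squares[of "\<lambda>n. S n \<omega>", OF this lip] show ?case by (simp add: S_def)
  qed
qed

section \<open>Almost sure limits of the empirical characteristic functions\<close>

context sample
begin

definition char_gap :: "real ^ 'n \<Rightarrow> complex" where
  "char_gap t = (\<integral>\<omega>. iexp (t \<bullet> X \<omega>) \<partial>M) - (\<Prod>j=1..d. \<phi> j t)"

lemma average_Xs_tendsto:
  assumes g[measurable]: "g \<in> borel_measurable borel" and 1: "\<And>x. cmod (g x) \<le> 1"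
  shows "AE \<omega> in M. (\<lambda>n. (1 / of_nat n) * (\<Sum>k=1..n. g (Xs k \<omega>))) \<longlonglongrightarrow> (\<integral>\<omega>. g (X \<omega>) \<partial>M)"
proof -
  define c where "c = (\<integral>\<omega>. g (X \<omega>) \<partial>M)"
  define g' where "g' x = g x - c" for x
  have [measurable]: "g' \<in> borel_measurable borel" unfolding g'_def by measurable
  have [measurable]: "Xs (Suc k) \<in> borel_measurable M" for k by (rule Xs_measurable) simp
  have gi: "complex_integrable M (\<lambda>\<omega>. g (X \<omega>))"
    by (rule integrable_bounded[OF finite_measure_axioms _ 1]) measurable
  have g'0: "(\<integral>\<omega>. g' (X \<omega>) \<partial>M) = 0"
    using gi by (simp add: g'_def c_def prob_space)
  have g'b: "cmod (g' x) \<le> 1 + cmod c" for x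
    unfolding g'_def using norm_triangle_ineq4[of "g x" c] 1[of x] by linarith
  have "AE \<omega> in M. (\<lambda>n. (\<Sum>k<n. g' (Xs (Suc k) \<omega>)) / of_nat n) \<longlonglongrightarrow> 0"
  proof (rule strong_law_decorrelated[where p=1 and B="1 + cmod c"])
    fix k l :: nat assume kl: "k + 1 \<le> l"
    have "(\<integral>\<omega>. (\<Prod>i\<in>{Suc k, Suc l}. (if i = Suc k then g' (Xs i \<omega>) else cnj (g' (Xs i \<omega>)))) \<partial>M)
      = (\<Prod>i\<in>{Suc k, Suc l}. \<integral>\<omega>. (if i = Suc k then g' (X \<omega>) else cnj (g' (X \<omega>))) \<partial>M)"
      by (rule expectation_prod_Xs[where \<rho>="\<lambda>i. i" and g="\<lambda>i x. if i = Suc k then g' x else cnj (g' x)" and C="\<lambda>_. 1 + cmod c"])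
         (use g'b in \<open>simp_all, auto\<close>)
    then show "(\<integral>\<omega>. g' (Xs (Suc k) \<omega>) * cnj (g' (Xs (Suc l) \<omega>)) \<partial>M) = 0"
      using kl by (simp add: g'0)
  qed (use g'b in auto)
  then show ?thesis
  proof eventually_elim
    case (elim \<omega>)
    have "(\<lambda>n. (\<Sum>k<n. g' (Xs (Suc k) \<omega>)) / of_nat n + c) \<longlonglongrightarrow> 0 + c"
      by (intro tendsto_add elim tendsto_const)
    then have "(\<lambda>n. (\<Sum>k<n. g' (Xs (Suc k) \<omega>)) / of_nat n + c) \<longlonglongrightarrow> c" by simp
    then show ?case unfolding c_def[symmetric]
    proof (rule Lim_transform_eventually)
      show "\<forall>\<^sub>F n in sequentially. (\<Sum>k<n. g' (Xs (Suc k) \<omega>)) / of_nat n + c = (1 / of_nat n) * (\<Sum>k=1..n. g (Xs k \<omega>))"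
        using eventually_gt_at_top[of 0]
      proof eventually_elim
        case (elim n)
        have "(\<Sum>k=1..n. g (Xs k \<omega>)) = (\<Sum>k<n. g' (Xs (Suc k) \<omega>)) + of_nat n * c"
          unfolding g'_def sum_subtractf by (simp add: sum.atLeast1_atMost_eq)
        then show ?case using elim by (simp add: field_simps)
      qed
    qed
  qed
qed

lemma ecf_tendsto: "AE \<omega> in M. (\<lambda>n. ecf n (\<lambda>k. Xs k \<omega>) t) \<longlonglongrightarrow> (\<integral>\<omega>. iexp (t \<bullet> X \<omega>) \<partial>M)"
  unfolding ecf_def by (rule average_Xs_tendsto) simp_all

lemma ecf_prod_tendsto: "AE \<omega> in M. (\<lambda>n. ecf_prod b d n (\<lambda>k. Xs k \<omega>) t) \<longlonglongrightarrow> (\<Prod>j=1..d. \<phi> j t)"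
proof -
  have "AE \<omega> in M. \<forall>j. (\<lambda>n. (1 / of_nat n) * (\<Sum>k=1..n. ch j t (Xs k \<omega>))) \<longlonglongrightarrow> \<phi> j t"
    unfolding AE_all_countable component_char_eq by (intro allI average_Xs_tendsto) simp_all
  then show ?thesis
    unfolding ecf_prod_eq by eventually_elim (intro tendsto_prod, blast)
qed

text \<open>Away from the last \<open>d\<close> indices no wrap-around takes place, and the summands of the star
  version form a \<open>d\<close>-dependent sequence.\<close>

lemma ecf_star_tendsto: "AE \<omega> in M. (\<lambda>n. ecf_star b d n (\<lambda>k. Xs k \<omega>) t) \<longlonglongrightarrow> (\<Prod>j=1..d. \<phi> j t)"
proof -
  define c where "c = (\<Prod>j=1..d. \<phi> j t)"
  define V where "V k \<omega> = (\<Prod>j=1..d. ch j t (Xs (k + j) \<omega>))" for k \<omega>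
  have V1: "cmod (V k \<omega>) = 1" for k \<omega> unfolding V_def by (simp add: prod_norm[symmetric])
  have [measurable]: "V k \<in> borel_measurable M" for k
  proof -
    have [measurable]: "Xs (k + j) \<in> borel_measurable M" if "j \<in> {1..d}" for j
      using that by (intro Xs_measurable) auto
    show ?thesis unfolding V_def by measurable
  qed
  have Vi: "complex_integrable M (V k)" for k
    by (rule integrable_bounded[OF finite_measure_axioms, where C=1]) (simp_all add: V1)
  have Vm: "(\<integral>\<omega>. V k \<omega> \<partial>M) = c" for k
    using char_mix[of "\<lambda>j. k + j" t] unfolding prod_ch_mix V_def c_def by (simp add: inj_on_def)
  have c1: "cmod c \<le> 1" unfolding c_def by (rule norm_prod_component_char)
  have "AE \<omega> in M. (\<lambda>n. (\<Sum>k<n. V k \<omega> - c) / of_nat n) \<longlonglongrightarrow> 0"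
  proof (rule strong_law_decorrelated[where p=d and B=2])
    show "cmod (V k \<omega> - c) \<le> 2" for k \<omega>
      using norm_triangle_ineq4[of "V k \<omega>" c] c1 V1[of k \<omega>] by linarith
    fix k l :: nat assume kl: "k + d \<le> l"
    have "(\<integral>\<omega>. V k \<omega> * cnj (V l \<omega>) \<partial>M) = c * cnj c"
    proof -
      \<comment> \<open>The boolean marks whether a factor belongs to \<open>V k\<close> or to the
        conjugate of \<open>V l\<close>. Since k + d \<le> l, the windows k + 1, ..., k + d and l +
        1, ..., l + d are disjoint, so all indices are distinct.\<close>
      let ?P = "{1..d} \<times> (UNIV :: bool set)"
      let ?\<rho> = "\<lambda>(j, e). (if e then k else l) + j"
      let ?g = "\<lambda>(j, e) x. ch j (if e then t else - t) x"
      have inj: "inj_on ?\<rho> ?P"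
        using kl by (auto simp: inj_on_def split: if_splits)
      have split_prod: "(\<Prod>p\<in>?P. h p) = (\<Prod>j=1..d. h (j, True) * h (j, False))" for h :: "nat \<times> bool \<Rightarrow> complex"
        using prod.cartesian_product[of "\<lambda>j e. h (j, e)" "UNIV :: bool set" "{1..d}"]
        by (simp add: UNIV_bool mult.commute)
      have "V k \<omega> * cnj (V l \<omega>) = (\<Prod>p\<in>?P. ?g p (Xs (?\<rho> p) \<omega>))" for \<omega>
        unfolding V_def cnj_prod ch_minus[symmetric] prod.distrib[symmetric] split_prod by simp
      then have "(\<integral>\<omega>. V k \<omega> * cnj (V l \<omega>) \<partial>M) = (\<integral>\<omega>. (\<Prod>p\<in>?P. ?g p (Xs (?\<rho> p) \<omega>)) \<partial>M)"
        by (simp only:)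
      also have "\<dots> = (\<Prod>p\<in>?P. \<integral>\<omega>. ?g p (X \<omega>) \<partial>M)"
        by (rule expectation_prod_Xs[OF _ inj, where C="\<lambda>_. 1"]) (auto split: prod.splits)
      also have "\<dots> = (\<Prod>j=1..d. \<phi> j t * cnj (\<phi> j t))"
        unfolding split_prod by (simp add: component_char_eq[symmetric] component_char_cnj)
      finally show ?thesis by (simp add: c_def prod.distrib)
    qed
    moreover have "complex_integrable M (\<lambda>\<omega>. V k \<omega> * cnj (V l \<omega>))"
      by (rule integrable_bounded[OF finite_measure_axioms, where C=1]) (simp_all add: V1 norm_mult)
    moreover have "(V k \<omega> - c) * cnj (V l \<omega> - c) = V k \<omega> * cnj (V l \<omega>) - V k \<omega> * cnj c - c * cnj (V l \<omega>) + c * cnj c" for \<omega>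
      by (simp add: algebra_simps)
    ultimately show "(\<integral>\<omega>. (V k \<omega> - c) * cnj (V l \<omega> - c) \<partial>M) = 0"
      using Vi by (simp add: Vm prob_space)
  qed simp
  then show ?thesis
  proof eventually_elim
    case (elim \<omega>)
    have "(\<lambda>n. (\<Sum>k<n. V k \<omega> - c) / of_nat n + c) \<longlonglongrightarrow> 0 + c"
      by (intro tendsto_add elim tendsto_const)
    moreover have "(\<lambda>n. ecf_star b d n (\<lambda>k. Xs k \<omega>) t - ((\<Sum>k<n. V k \<omega> - c) / of_nat n + c)) \<longlonglongrightarrow> 0"
    proof (rule Lim_null_comparison)
      show "(\<lambda>n. (2 * real d) * (1 / real n)) \<longlonglongrightarrow> 0"
        using tendsto_mult[OF tendsto_const lim_1_over_n, of "2 * real d"] by simp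
      show "\<forall>\<^sub>F n in sequentially. cmod (ecf_star b d n (\<lambda>k. Xs k \<omega>) t - ((\<Sum>k<n. V k \<omega> - c) / of_nat n + c)) \<le> (2 * real d) * (1 / real n)"
        using eventually_gt_at_top[of 0]
      proof eventually_elim
        case (elim n)
        \<comment> \<open>The summand of the star version with number \<open>Suc k\<close>, matched
          with \<open>V k\<close>: the two agree as long as k + d \<le> n, so at most d summands
          differ, each by at most 2.\<close>
        let ?U = "\<lambda>k. \<Prod>j=1..d. ch j t (Xs (cyclic n (Suc k + j - 1)) \<omega>)"
        have "(\<Sum>k<n. V k \<omega> - c) / of_nat n + c = (1 / of_nat n) * (\<Sum>k<n. V k \<omega>)"
          unfolding sum_subtractf using elim by (simp add: field_simps)
        then have "ecf_star b d n (\<lambda>k. Xs k \<omega>) t - ((\<Sum>k<n. V k \<omega> - c) / of_nat n + c) = (1 / of_nat n) * (\<Sum>k<n. ?U k - V k \<omega>)"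
          unfolding ecf_star_eq sum_subtractf by (simp add: sum.atLeast1_atMost_eq right_diff_distrib)
        moreover have "cmod (\<Sum>k<n. ?U k - V k \<omega>) \<le> 2 * real d"
        proof -
          have eq: "?U k = V k \<omega>" if "k + d \<le> n" for k
            unfolding V_def using that by (intro prod.cong refl arg_cong[of _ _ "\<lambda>i. ch _ t (Xs i \<omega>)"]) (simp add: cyclic_id)
          have "cmod (\<Sum>k<n. ?U k - V k \<omega>) \<le> (\<Sum>k<n. if n < k + d then 2 else 0)"
          proof (rule order_trans[OF norm_sum sum_mono])
            fix k
            have "cmod (?U k) = 1" by (simp add: prod_norm[symmetric])
            then show "cmod (?U k - V k \<omega>) \<le> (if n < k + d then 2 else 0)"
              using norm_triangle_ineq4[of "?U k" "V k \<omega>"] V1[of k \<omega>] eq[of k] by auto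
          qed
          also have "\<dots> = 2 * real (card {k. k < n \<and> n < k + d})"
            by (simp add: sum.If_cases Int_def)
          also have "\<dots> \<le> 2 * real (card {n - d..<n})"
            by (intro mult_left_mono of_nat_mono card_mono) auto
          also have "\<dots> \<le> 2 * real d" by simp
          finally show ?thesis .
        qed
        ultimately show ?case
          by (simp add: norm_mult norm_divide divide_right_mono)
      qed
    qed
    ultimately have "(\<lambda>n. ((\<Sum>k<n. V k \<omega> - c) / of_nat n + c)
        + (ecf_star b d n (\<lambda>k. Xs k \<omega>) t - ((\<Sum>k<n. V k \<omega> - c) / of_nat n + c))) \<longlonglongrightarrow> (0 + c) + 0"
      by (rule tendsto_add)
    then show ?case by (simp add: c_def)
  qed
qed

end

section \<open>Integrability for a fixed sample and divergence\<close>

lemma cmod_sq_le_trunc_sq: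
  assumes "cmod z \<le> 2" "cmod z \<le> L * norm t" "L \<ge> 0"
  shows "(cmod z)\<^sup>2 \<le> (2 + L)\<^sup>2 * trunc_sq t"
proof (cases "norm t \<le> 1")
  case True
  then have "trunc_sq t = (norm t)\<^sup>2" by (simp add: trunc_sq_def power_le_one)
  moreover have "cmod z \<le> (2 + L) * norm t"
    using assms(2) by (simp add: distrib_right add_increasing)
  then have "(cmod z)\<^sup>2 \<le> ((2 + L) * norm t)\<^sup>2" by (rule power_mono) simp
  ultimately show ?thesis by (simp add: power_mult_distrib)
next
  case False
  then have "trunc_sq t = 1" by (simp add: trunc_sq_def)
  moreover have "(cmod z)\<^sup>2 \<le> (2 + L)\<^sup>2" by (rule power_mono) (use assms in auto)
  ultimately show ?thesis by simp
qed

lemma norm_average_minus_1: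
  fixes u :: "nat \<Rightarrow> complex"
  assumes n: "n > 0" and le: "\<And>k. k \<in> {1..n} \<Longrightarrow> cmod (u k - 1) \<le> C"
  shows "cmod ((1 / of_nat n) * (\<Sum>k=1..n. u k) - 1) \<le> C"
proof -
  have "(1 / of_nat n) * (\<Sum>k=1..n. u k) - 1 = (1 / of_nat n) * (\<Sum>k=1..n. u k - 1)"
    unfolding sum_subtractf using n by (simp add: field_simps)
  also have "cmod \<dots> = (1 / real n) * cmod (\<Sum>k=1..n. u k - 1)"
    by (simp add: norm_mult norm_divide)
  also have "\<dots> \<le> (1 / real n) * (\<Sum>k=1..n. C)"
    by (intro mult_left_mono order_trans[OF norm_sum sum_mono] le) auto
  finally show ?thesis using n by simp
qed

text \<open>Fatou bounds nonnegative integrals from below, whereas the statistics are Bochner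
  integrals that default to 0. The domination by \<open>trunc_sq\<close> shows that the two
  agree.\<close>

lemma weighted_norm_w1_eq_nn_integral:
  fixes f :: "real ^ 'n::finite \<Rightarrow> complex"
  assumes [measurable]: "f \<in> borel_measurable borel" and le: "\<And>t. (cmod (f t))\<^sup>2 \<le> C * trunc_sq t"
  shows "(\<integral>\<^sup>+t. ennreal ((cmod (f t))\<^sup>2 * w1 t) \<partial>lborel) = ennreal (weighted_norm w1 f)"
  unfolding weighted_norm_def
proof (rule nn_integral_eq_integral)
  show "integrable lborel (\<lambda>t. (cmod (f t))\<^sup>2 * w1 t)"
  proof (rule Bochner_Integration.integrable_bound[OF integrable_mult_right[OF integrable_trunc_sq_w1, of C]])
    show "AE t in lborel. norm ((cmod (f t))\<^sup>2 * w1 t) \<le> norm (C * (trunc_sq t * w1 t))"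
    proof (rule AE_I2)
      fix t
      have "(cmod (f t))\<^sup>2 * w1 t \<le> C * trunc_sq t * w1 t" by (intro mult_right_mono le) simp
      then show "norm ((cmod (f t))\<^sup>2 * w1 t) \<le> norm (C * (trunc_sq t * w1 t))"
        by (simp add: mult.assoc abs_of_nonneg)
    qed
  qed measurable
qed simp

context sample
begin

text \<open>All three functions equal 1 at the origin and satisfy a linear estimate there. The
  constant depends on the sample, which is harmless: integrability is wanted for each sample
  separately.\<close>

lemma ecf_minus_1:
  fixes x :: "nat \<Rightarrow> real ^ 'n"
  assumes n: "n > 0"
  defines "R \<equiv> \<Sum>k=1..n. norm (x k)"
  shows "cmod (ecf n x t - 1) \<le> real d * R * norm t" (is ?A)
    and "cmod (ecf_prod b d n x t - 1) \<le> real d * R * norm t" (is ?B)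
    and "cmod (ecf_star b d n x t - 1) \<le> real d * R * norm t" (is ?C)
proof -
  have R: "norm (x k) \<le> R" if "k \<in> {1..n}" for k
    unfolding R_def using that by (intro member_le_sum) auto
  have R0: "R \<ge> 0" unfolding R_def by (rule sum_nonneg) simp
  have ch1: "cmod (ch j t (x k) - 1) \<le> R * norm t" if "k \<in> {1..n}" for j k
  proof -
    have "cmod (ch j t (x k) - 1) \<le> \<bar>component_inner b j t (x k)\<bar>"
      using norm_iexp_diff_le[of "component_inner b j t (x k)" 0] by (simp add: ch_def)
    also have "\<dots> \<le> norm t * norm (x k)" by (rule abs_component_inner_le)
    also have "\<dots> \<le> norm t * R" by (intro mult_left_mono R that) simp
    finally show ?thesis by (simp add: mult.commute)
  qed
  have prod1: "cmod ((\<Prod>j=1..d. z j) - 1) \<le> real d * R * norm t"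
    if "\<And>j. cmod (z j) \<le> 1" "\<And>j. j \<in> {1..d} \<Longrightarrow> cmod (z j - 1) \<le> R * norm t" for z
  proof -
    have "cmod ((\<Prod>j=1..d. z j) - (\<Prod>j=1..d. 1)) \<le> (\<Sum>j=1..d. cmod (z j - 1))"
      by (rule norm_prod_diff) (use that in auto)
    also have "\<dots> \<le> (\<Sum>j=1..d. R * norm t)" by (intro sum_mono that)
    finally show ?thesis by (simp add: mult.assoc)
  qed
  have "cyclic n k \<in> {1..n}" for k using n by (auto simp: cyclic_def Suc_le_eq)
  then show ?A ?C
    unfolding ecf_eq ecf_star_eq by (intro norm_average_minus_1[OF n] prod1 ch1; simp)+
  have "cmod ((1 / of_nat n) * (\<Sum>k=1..n. ch j t (x k))) \<le> 1" for j
  proof -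
    have "cmod (\<Sum>k=1..n. ch j t (x k)) \<le> (\<Sum>k=1..n. 1)"
      by (rule order_trans[OF norm_sum]) simp
    then show ?thesis using n by (simp add: norm_mult norm_divide field_simps)
  qed
  then show ?B unfolding ecf_prod_eq by (intro prod1 norm_average_minus_1[OF n] ch1)
qed

lemma norm_ecf_le_1: "cmod (ecf n x t) \<le> 1" "cmod (ecf_prod b d n x t) \<le> 1" "cmod (ecf_star b d n x t) \<le> 1"
proof -
  have avg: "cmod ((1 / of_nat n) * (\<Sum>k=1..n. u k)) \<le> 1" if "\<And>k. cmod (u k) = 1" for u :: "nat \<Rightarrow> complex"
  proof -
    have "cmod (\<Sum>k=1..n. u k) \<le> (\<Sum>k=1..n. 1)"
      by (rule order_trans[OF norm_sum]) (simp add: that)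
    then show ?thesis by (cases "n = 0") (simp_all add: norm_mult norm_divide field_simps)
  qed
  show "cmod (ecf n x t) \<le> 1" "cmod (ecf_star b d n x t) \<le> 1"
    unfolding ecf_def ecf_star_def by (rule avg, simp)+
  show "cmod (ecf_prod b d n x t) \<le> 1"
    unfolding ecf_prod_def prod_norm[symmetric] by (intro prod_le_1 conjI avg norm_ge_zero) simp
qed

lemma ecf_gap_bound:
  "\<exists>C. \<forall>t. (cmod (ecf n x t - ecf_prod b d n x t))\<^sup>2 \<le> C * trunc_sq t"
  "\<exists>C. \<forall>t. (cmod (ecf n x t - ecf_star b d n x t))\<^sup>2 \<le> C * trunc_sq t"
proof -
  let ?L = "2 * (real d * (\<Sum>k=1..n. norm (x k)))"
  have L: "?L \<ge> 0" by (intro mult_nonneg_nonneg sum_nonneg) auto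
  have pos: "\<exists>C. \<forall>t. (cmod (ecf n x t - e t))\<^sup>2 \<le> C * trunc_sq t"
    if "n > 0" "\<And>t. cmod (e t) \<le> 1" "\<And>t. cmod (e t - 1) \<le> real d * (\<Sum>k=1..n. norm (x k)) * norm t" for e
  proof (intro exI allI, rule cmod_sq_le_trunc_sq[OF _ _ L])
    fix t
    show "cmod (ecf n x t - e t) \<le> 2"
      using norm_triangle_ineq4[of "ecf n x t" "e t"] norm_ecf_le_1(1)[of n x t] that(2)[of t] by linarith
    show "cmod (ecf n x t - e t) \<le> ?L * norm t"
      using norm_triangle_ineq4[of "ecf n x t - 1" "e t - 1"] ecf_minus_1(1)[OF that(1), of x t] that(3)[of t]
      by (simp add: mult.assoc)
  qed
  show "\<exists>C. \<forall>t. (cmod (ecf n x t - ecf_prod b d n x t))\<^sup>2 \<le> C * trunc_sq t"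
  proof (cases "n = 0")
    \<comment> \<open>For n = 0 the averages are 0 because 1 / 0 = 0, and so is their product over
      the nonempty range of components.\<close>
    case True
    then have "ecf n x t - ecf_prod b d n x t = 0" for t
      using d_pos by (simp add: ecf_prod_def ecf_def)
    then show ?thesis by (intro exI[of _ 0]) simp
  qed (intro pos norm_ecf_le_1 ecf_minus_1; simp)
  show "\<exists>C. \<forall>t. (cmod (ecf n x t - ecf_star b d n x t))\<^sup>2 \<le> C * trunc_sq t"
  proof (cases "n = 0")
    case True
    then have "ecf n x t - ecf_star b d n x t = 0" for t by (simp add: ecf_star_def ecf_def)
    then show ?thesis by (intro exI[of _ 0]) simp
  qed (intro pos norm_ecf_le_1 ecf_minus_1; simp)
qed

lemma char_gap_tendsto: "r \<longlonglongrightarrow> t \<Longrightarrow> (\<lambda>i. char_gap (r i)) \<longlonglongrightarrow> char_gap t"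
  unfolding char_gap_def
  by (intro tendsto_intros component_char_tendsto integral_dominated_convergence[where w="\<lambda>_. 1"])
     (auto intro!: tendsto_intros)

lemma continuous_on_char_gap: "continuous_on UNIV char_gap"
  unfolding continuous_on_sequentially by (auto simp: o_def char_gap_tendsto)

lemma char_gap_measurable [measurable]: "char_gap \<in> borel_measurable borel"
  by (rule borel_measurable_continuous_onI[OF continuous_on_char_gap])

text \<open>A continuous function vanishing almost everywhere has a closed zero set of full measure,
  hence vanishes everywhere; the characteristic function then factorises and the components are
  independent.\<close>

lemma weighted_char_gap_pos:
  assumes "\<not> components_independent M b d X"
  shows "(\<integral>\<^sup>+t. ennreal ((cmod (char_gap t))\<^sup>2 * w1 t) \<partial>lborel) > 0"
proof (rule ccontr)
  assume "\<not> ?thesis"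
  then have "AE t in lborel. ennreal ((cmod (char_gap t))\<^sup>2 * w1 t) = 0"
    by (subst nn_integral_0_iff_AE[symmetric]) auto
  \<comment> \<open>The origin is removed because \<open>w1 0\<close> is 0 by the convention for
    division by 0; elsewhere the weight is positive.\<close>
  then have "AE t in lborel. char_gap t = 0"
    using AE_lborel_singleton[of 0]
  proof eventually_elim
    case (elim t)
    have "w1 t > 0" unfolding w1_def using elim(2) K_const_pos[of "CARD('n)"] by simp
    then show ?case using elim(1) by (simp add: ennreal_eq_0_iff mult_le_0_iff)
  qed
  then have "AE t in lebesgue. t \<in> {t. char_gap t = 0}" by (simp add: AE_completion)
  moreover have "closed {t. char_gap t = 0}"
    by (rule closed_Collect_eq[OF continuous_on_char_gap continuous_on_const])
  ultimately have "char_gap t = 0" for t using mem_closed_if_AE_lebesgue by blast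
  then have "components_independent M b d X"
    by (intro char_factorizes_imp_independent) (simp add: char_gap_def)
  with assms show False ..
qed

text \<open>Fatou in t, for almost every sample: the norms are eventually above a positive constant,
  so multiplication by n drives them to infinity. No rate of convergence of \<open>D n\<close> is
  involved.\<close>

lemma weighted_norm_diverges:
  assumes m: "\<And>n. (\<lambda>(t, \<omega>). D n t \<omega>) \<in> borel_measurable (lborel \<Otimes>\<^sub>M M)"
    and lim: "\<And>t. AE \<omega> in M. (\<lambda>n. D n t \<omega>) \<longlonglongrightarrow> char_gap t"
    and bd: "\<And>n \<omega>. \<exists>C. \<forall>t. (cmod (D n t \<omega>))\<^sup>2 \<le> C * trunc_sq t"
    and dep: "\<not> components_independent M b d X"
  shows "AE \<omega> in M. filterlim (\<lambda>n. real n * weighted_norm w1 (\<lambda>t. D n t \<omega>)) at_top sequentially"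
proof -
  interpret PS: pair_sigma_finite "lborel :: (real ^ 'n) measure" M ..
  have m1[measurable]: "(\<lambda>z. D n (fst z) (snd z)) \<in> borel_measurable (lborel \<Otimes>\<^sub>M M)" for n
    using m[of n] by (simp add: case_prod_unfold)
  let ?h = "\<lambda>n t \<omega>. ennreal ((cmod (D n t \<omega>))\<^sup>2 * w1 t)"
  let ?g = "\<lambda>t. ennreal ((cmod (char_gap t))\<^sup>2 * w1 t)"
  let ?P = "\<lambda>t \<omega>. ?g t \<le> liminf (\<lambda>n. ?h n t \<omega>)"
  \<comment> \<open>The integral may be infinite here, so a finite level strictly below it is
    chosen.\<close>
  obtain e where e: "0 < e" "e < (\<integral>\<^sup>+t. ?g t \<partial>lborel)"
    using dense[OF weighted_char_gap_pos[OF dep]] by blast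
  define c where "c = enn2real e"
  have e_top: "e < top" using e(2) by (rule less_le_trans) simp
  have e_c: "e = ennreal c" and c0: "c > 0"
    using e(1) e_top by (simp_all add: c_def enn2real_positive_iff)
  have "AE t in lborel. AE \<omega> in M. ?P t \<omega>"
  proof (rule AE_I2)
    fix t :: "real ^ 'n"
    show "AE \<omega> in M. ?P t \<omega>" using lim[of t]
    proof eventually_elim
      case (elim \<omega>)
      have "(\<lambda>n. ?h n t \<omega>) \<longlonglongrightarrow> ?g t"
        by (intro tendsto_ennrealI tendsto_intros elim)
      then show ?case using lim_imp_Liminf[OF sequentially_bot] by (metis order_refl)
    qed
  qed
  \<comment> \<open>The exceptional samples depend on t, and there are uncountably many t.
    Exchanging the quantifiers by Fubini gives, for almost every sample, the bound at almost every
    t, which is all that integration over t sees.\<close>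
  also have "?this \<longleftrightarrow> (AE \<omega> in M. AE t in lborel. ?P t \<omega>)"
    by (rule PS.AE_commute) measurable
  finally show ?thesis using AE_space
  proof eventually_elim
    case (elim \<omega>)
    have [measurable]: "(\<lambda>t. D n t \<omega>) \<in> borel_measurable borel" for n
      using measurable_compose[OF measurable_Pair2'[OF elim(2)] m1[of n]] by simp
    have "(\<integral>\<^sup>+t. ?g t \<partial>lborel) \<le> (\<integral>\<^sup>+t. liminf (\<lambda>n. ?h n t \<omega>) \<partial>lborel)"
      by (rule nn_integral_mono_AE[OF elim(1)])
    also have "\<dots> \<le> liminf (\<lambda>n. \<integral>\<^sup>+t. ?h n t \<omega> \<partial>lborel)"
      by (rule nn_integral_liminf) measurable
    also have "(\<lambda>n. \<integral>\<^sup>+t. ?h n t \<omega> \<partial>lborel) = (\<lambda>n. ennreal (weighted_norm w1 (\<lambda>t. D n t \<omega>)))"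
    proof
      fix n
      obtain C where "\<forall>t. (cmod (D n t \<omega>))\<^sup>2 \<le> C * trunc_sq t" using bd by blast
      then show "(\<integral>\<^sup>+t. ?h n t \<omega> \<partial>lborel) = ennreal (weighted_norm w1 (\<lambda>t. D n t \<omega>))"
        by (intro weighted_norm_w1_eq_nn_integral[where C=C]) auto
    qed
    finally have "ennreal c < liminf (\<lambda>n. ennreal (weighted_norm w1 (\<lambda>t. D n t \<omega>)))"
      using e(2) unfolding e_c by (rule less_le_trans[rotated])
    then have "\<forall>\<^sub>F n in sequentially. ennreal c < ennreal (weighted_norm w1 (\<lambda>t. D n t \<omega>))"
      by (rule less_LiminfD)
    then have ev: "\<forall>\<^sub>F n in sequentially. real n * c \<le> real n * weighted_norm w1 (\<lambda>t. D n t \<omega>)"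
      by eventually_elim (use c0 in \<open>auto simp: ennreal_less_iff intro!: mult_left_mono\<close>)
    have "filterlim (\<lambda>n. real n * c) at_top sequentially"
      using filterlim_tendsto_pos_mult_at_top[OF tendsto_const c0 filterlim_real_sequentially]
      by (simp add: mult.commute)
    from filterlim_at_top_mono[OF this ev] show ?case .
  qed
qed

theorem divergence:
  assumes "\<not> components_independent M b d X"
  shows "AE \<omega> in M. filterlim (\<lambda>n. real n * Q b d n (\<lambda>k. Xs k \<omega>)) at_top sequentially \<and>
    filterlim (\<lambda>n. real n * Q_star b d n (\<lambda>k. Xs k \<omega>)) at_top sequentially"
proof (rule AE_conjI)
  show "AE \<omega> in M. filterlim (\<lambda>n. real n * Q b d n (\<lambda>k. Xs k \<omega>)) at_top sequentially"
    unfolding Q_def w1_norm_sq_eq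
  proof (rule weighted_norm_diverges[OF Q_integrand_measurable(1) _ ecf_gap_bound(1) assms])
    show "AE \<omega> in M. (\<lambda>n. ecf n (\<lambda>k. Xs k \<omega>) t - ecf_prod b d n (\<lambda>k. Xs k \<omega>) t) \<longlonglongrightarrow> char_gap t" for t
      using ecf_tendsto ecf_prod_tendsto unfolding char_gap_def by eventually_elim (rule tendsto_diff)
  qed
  show "AE \<omega> in M. filterlim (\<lambda>n. real n * Q_star b d n (\<lambda>k. Xs k \<omega>)) at_top sequentially"
    unfolding Q_star_def w1_norm_sq_eq
  proof (rule weighted_norm_diverges[OF Q_integrand_measurable(2) _ ecf_gap_bound(2) assms])
    show "AE \<omega> in M. (\<lambda>n. ecf n (\<lambda>k. Xs k \<omega>) t - ecf_star b d n (\<lambda>k. Xs k \<omega>) t) \<longlonglongrightarrow> char_gap t" for t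
      using ecf_tendsto ecf_star_tendsto unfolding char_gap_def by eventually_elim (rule tendsto_diff)
  qed
qed

end

theorem theorem3:
  fixes M :: "'w measure" and X :: "'w \<Rightarrow> real ^ 'n::finite"
    and Xs :: "nat \<Rightarrow> 'w \<Rightarrow> real ^ 'n"
    and b :: "'n \<Rightarrow> nat" and d :: nat
  assumes "prob_space M"
    and "d \<ge> 2"
    and "range b = {1..d}"
    and "X \<in> borel_measurable M"
    and "\<And>j. j \<in> {1..d} \<Longrightarrow>
           absolutely_continuous (component_lebesgue b j)
             (distr M (component_lebesgue b j) (\<lambda>\<omega>. component b j (X \<omega>)))"
    and "prob_space.indep_vars M (\<lambda>_. borel) Xs {1..}"
    and "\<And>k. k \<ge> 1 \<Longrightarrow> distr M borel (Xs k) = distr M borel X"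
    and "integrable M (\<lambda>\<omega>. norm (X \<omega>))"
  shows
    "(components_independent M b d X \<longrightarrow>
       (\<exists>(N :: (nat \<Rightarrow> real) measure) \<zeta> \<zeta>_star.
          prob_space N \<and>
          centered_gaussian_with_cov N \<zeta> (R_cov M b d X) \<and>
          centered_gaussian_with_cov N \<zeta>_star (\<lambda>t t0. 2 * R_cov M b d X t t0) \<and>
          converges_in_distribution M (\<lambda>n \<omega>. real n * Q b d n (\<lambda>k. Xs k \<omega>))
            N (\<lambda>\<omega>. w1_norm_sq (\<lambda>t. \<zeta> t \<omega>)) \<and>
          converges_in_distribution M (\<lambda>n \<omega>. real n * Q_star b d n (\<lambda>k. Xs k \<omega>))
            N (\<lambda>\<omega>. w1_norm_sq (\<lambda>t. \<zeta>_star t \<omega>)))) \<and>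
     (\<not> components_independent M b d X \<longrightarrow>
       (AE \<omega> in M.
          filterlim (\<lambda>n. real n * Q b d n (\<lambda>k. Xs k \<omega>)) at_top sequentially \<and>
          filterlim (\<lambda>n. real n * Q_star b d n (\<lambda>k. Xs k \<omega>)) at_top sequentially))"
proof -
  interpret prob_space M by fact
  interpret S: sample M X Xs b d by unfold_locales (use assms in auto)
  show ?thesis
  proof (intro conjI impI)
    assume "components_independent M b d X"
    then interpret I: independent_sample M X Xs b d by unfold_locales
    show "\<exists>(N :: (nat \<Rightarrow> real) measure) \<zeta> \<zeta>_star.
          prob_space N \<and>
          centered_gaussian_with_cov N \<zeta> (R_cov M b d X) \<and>
          centered_gaussian_with_cov N \<zeta>_star (\<lambda>t t0. 2 * R_cov M b d X t t0) \<and>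
          converges_in_distribution M (\<lambda>n \<omega>. real n * Q b d n (\<lambda>k. Xs k \<omega>))
            N (\<lambda>\<omega>. w1_norm_sq (\<lambda>t. \<zeta> t \<omega>)) \<and>
          converges_in_distribution M (\<lambda>n \<omega>. real n * Q_star b d n (\<lambda>k. Xs k \<omega>))
            N (\<lambda>\<omega>. w1_norm_sq (\<lambda>t. \<zeta>_star t \<omega>))"
      by (rule I.limit_laws[OF assms(8)])
  qed (rule S.divergence)
qed

end
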